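(* Let $X$ be the $m$-symmetric Hunt process on $S$ described in the context (regular Dirichlet form, absolute continuity condition (AC), transition density $p$). Let $A=(A_t)_{t\ge 0}$ be a PCAF in the strict sense of $X$ and let $\mu$ be the Revuz measure of $A$. Let $F\colon (0,\infty)\times\Omega\to[0,\infty]$ be $\mathcal{B}((0,\infty))\otimes\mathscr{F}_\infty$-measurable, set $F_t(\omega):=F(t,\omega)$ for $(t,\omega)\in(0,\infty)\times\Omega$, and assume that the following conditions are satisfied: (i) there exists $\Lambda\in\mathscr{F}_\infty$ with $P_x(\Lambda)=1$ for all $x\in S$ such that the function $(0,\infty)\times\Omega\ni(t,\omega)\mapsto 1_\Lambda(\omega)\,F_t\circ\theta_t(\omega)=1_\Lambda(\omega)F_t(\theta_t\omega)$ is $\mathcal{B}((0,\infty))\otimes\mathscr{F}_\infty$-measurable; (ii) the function $(0,\infty)\times S\ni(t,x)\mapsto E_x[F_t]$ is Borel measurable. Then, for any $t\in(0,\infty]$ and $x\in S$, $$E_x\biggl[\int_0^t F_s\circ\theta_s\,dA_s\biggr]=\int_0^t\int_S p_s(x,y)\,E_y[F_s]\,\mu(dy)\,ds.$$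
   Context: Setting. $S$ is a locally compact separable metrizable topological space, and $S_\Delta=S\cup\{\Delta\}$ is its one-point compactification ($\Delta$ is added as an isolated point if $S$ is compact). $\mathcal{B}(E)$ denotes the Borel $\sigma$-algebra of a topological space $E$, and $1_E$ an indicator function. $m$ is a Radon measure on $S$ with full support, $(\mathcal{E},\mathcal{F})$ is a regular symmetric Dirichlet form on $L^2(S,m)$, and $X=(\Omega,\mathscr{M},(X_t)_{t\in[0,\infty]},(P_x)_{x\in S_\Delta},(\theta_t)_{t\in[0,\infty]})$ is an $m$-symmetric Hunt process on $S$ with cemetery $\Delta$ (and $X_\infty=\Delta$) whose Dirichlet form is $(\mathcal{E},\mathcal{F})$. Here $\theta_t\colon\Omega\to\Omega$ is the shift operator, satisfying $X_s\circ\theta_t=X_{s+t}$ for all $s\in[0,\infty]$. $E_x$ is expectation under $P_x$. The life time $\zeta\colon\Omega\to[0,\infty]$ satisfies $\{X_t=\Delta\}=\{\zeta\le t\}$ for each $t\in[0,\infty]$. $\mathscr{F}_*=(\mathscr{F}_t)_{t\in[0,\infty]}$ is the minimum augmented admissible filtration of $X$: with $\mathscr{F}^0_t:=\sigma(X_s: s\le t)$, for each probability measure $\nu$ on $S_\Delta$ let $\mathscr{F}^\nu_\infty$ be the $P_\nu$-completion of $\mathscr{F}^0_\infty$ and $\mathscr{F}^\nu_t$ the $\sigma$-algebra generated by $\mathscr{F}^0_t$ and the $P_\nu$-null sets of $\mathscr{F}^\nu_\infty$; then $\mathscr{F}_t:=\bigcap_\nu\mathscr{F}^\nu_t$. Absolute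 continuity condition (AC) (assumed): for all $x\in S$ and $t\in(0,\infty)$, the Borel measure $P_x(X_t\in dy)$ on $S$ is absolutely continuous with respect to $m(dy)$. Transition density. Under these assumptions there is a unique Borel measurable $p\colon(0,\infty)\times S\times S\to[0,\infty]$ such that, for all $s,t\in(0,\infty)$ and $x,y\in S$, $P_x(X_t\in dz)=p_t(x,z)\,m(dz)$ on $S$, $p_t(x,y)=p_t(y,x)$ and $p_{t+s}(x,y)=\int_S p_t(x,z)p_s(z,y)\,m(dz)$. PCAF in the strict sense. An $\mathscr{F}_*$-adapted $[0,\infty]$-valued process $A=(A_t)_{t\ge0}$ on $\Omega$ is a positive continuous additive functional (PCAF) in the strict sense of $X$ if there is a set $\Lambda\in\mathscr{F}_\infty$ (a defining set of $A$) such that $P_x(\Lambda)=1$ for all $x\in S$, $\theta_t(\Lambda)\subseteq\Lambda$ for all $t\in[0,\infty)$, and for every $\omega\in\Lambda$ the map $[0,\infty)\ni t\mapsto A_t(\omega)\in[0,\infty]$ is continuous with $A_0(\omega)=0$ and, for all $s,t\in[0,\infty)$, $A_t(\omega)<\infty$ if $t<\zeta(\omega)$, $A_t(\omega)=A_{\zeta(\omega)}(\omega)$ if $t\ge\zeta(\omega)$, and $A_{t+s}(\omega)=A_t(\omega)+A_s(\theta_t(\omega))$. Set $A_\infty:=\sup_{t\in[0,\infty)\cap\mathbb{Q}}A_t$. Standing convention: every PCAF in the strict sense with defining set $\Lambda$ satisfies $A_t(\omega)=0$ for all $t\in[0,\infty)$, $\omega\in\Omega\setminus\Lambda$, and $\{\zeta=0\}\subseteq\Lambda$.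 Integrals $\int_0^t\cdots dA_s$ are Lebesgue--Stieltjes integrals (the measure $dA_s$ has no atoms and is carried by $(0,\zeta)$). Revuz measure. The Revuz measure of $A$ is the Borel measure $\mu$ on $S$ given, for $E\in\mathcal{B}(S)$, by $$\mu(E):=\sup_{t\in(0,\infty)}\frac1t\int_S E_x\Bigl[\int_0^t1_E(X_s)\,dA_s\Bigr]m(dx)=\lim_{t\downarrow0}\frac1t\int_S E_x\Bigl[\int_0^t1_E(X_s)\,dA_s\Bigr]m(dx).$$ *)

theory Defs
  imports "HOL-Probability.Probability"
begin

text \<open>
  The state space is a type \<open>'s\<close> of class \<open>{metric_space, second_countable_topology}\<close>; only its
  topology is used.  Points of the one-point compactification are of type \<open>'s option\<close>, with \<open>None\<close>
  as the cemetery.  The sample space is the whole type \<open>'w\<close>.  Times in \<open>[0,\<infinity>]\<close> are of type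
  \<^typ>\<open>ennreal\<close>; times in \<open>[0,\<infinity>)\<close> or \<open>(0,\<infinity>)\<close> are of type \<^typ>\<open>real\<close>, with explicit bounds.
\<close>

section \<open>Regular symmetric Dirichlet forms\<close>

definition radon_full_support :: "'s::topological_space measure \<Rightarrow> bool" where
  "radon_full_support m \<longleftrightarrow>
     sets m = sets borel \<and>
     (\<forall>K. compact K \<longrightarrow> emeasure m K < \<infinity>) \<and>
     (\<forall>U. open U \<longrightarrow> U \<noteq> {} \<longrightarrow> 0 < emeasure m U)"

text \<open>Elements of \<open>L\<^sup>2(S,m)\<close> are handled through their Borel representatives.\<close>

definition L2 :: "'s::topological_space measure \<Rightarrow> ('s \<Rightarrow> real) set" where
  "L2 m = {u \<in> borel_measurable borel. integrable m (\<lambda>x. (u x)\<^sup>2)}"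

definition form1 ::
  "'s measure \<Rightarrow> (('s \<Rightarrow> real) \<Rightarrow> ('s \<Rightarrow> real) \<Rightarrow> real) \<Rightarrow> ('s \<Rightarrow> real) \<Rightarrow> ('s \<Rightarrow> real) \<Rightarrow> real" where
  "form1 m \<E> u v = \<E> u v + (\<integral>x. u x * v x \<partial>m)"

text \<open>\<open>D\<close> is the domain of the form, a union of \<open>m\<close>-equivalence classes of functions; \<open>ae_domain\<close>
  and \<open>ae_form\<close> say that the domain and the form live on the quotient \<open>L\<^sup>2(S,m)\<close>.\<close>

locale dirichlet_form =
  fixes m :: "'s::topological_space measure"
    and D :: "('s \<Rightarrow> real) set"
    and \<E> :: "('s \<Rightarrow> real) \<Rightarrow> ('s \<Rightarrow> real) \<Rightarrow> real"
  assumes domain_L2: "D \<subseteq> L2 m"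
    and ae_domain: "\<And>u v. u \<in> D \<Longrightarrow> v \<in> L2 m \<Longrightarrow> (AE x in m. u x = v x) \<Longrightarrow> v \<in> D"
    and ae_form: "\<And>u v w. u \<in> D \<Longrightarrow> v \<in> D \<Longrightarrow> w \<in> D \<Longrightarrow> (AE x in m. u x = v x) \<Longrightarrow> \<E> u w = \<E> v w"
    and domain_zero: "(\<lambda>x. 0) \<in> D"
    and domain_add: "\<And>u v. u \<in> D \<Longrightarrow> v \<in> D \<Longrightarrow> (\<lambda>x. u x + v x) \<in> D"
    and domain_scale: "\<And>c u. u \<in> D \<Longrightarrow> (\<lambda>x. c * u x) \<in> D"
    and domain_dense: "\<And>u \<epsilon>. u \<in> L2 m \<Longrightarrow> 0 < \<epsilon> \<Longrightarrow> \<exists>v\<in>D. (\<integral>x. (u x - v x)\<^sup>2 \<partial>m) < \<epsilon>"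
    and form_sym: "\<And>u v. u \<in> D \<Longrightarrow> v \<in> D \<Longrightarrow> \<E> u v = \<E> v u"
    and form_add: "\<And>u v w. u \<in> D \<Longrightarrow> v \<in> D \<Longrightarrow> w \<in> D \<Longrightarrow> \<E> (\<lambda>x. u x + v x) w = \<E> u w + \<E> v w"
    and form_scale: "\<And>c u w. u \<in> D \<Longrightarrow> w \<in> D \<Longrightarrow> \<E> (\<lambda>x. c * u x) w = c * \<E> u w"
    and form_nonneg: "\<And>u. u \<in> D \<Longrightarrow> 0 \<le> \<E> u u"
    and form_closed:
      "\<And>f. (\<forall>n::nat. f n \<in> D) \<Longrightarrow>
        (\<forall>\<epsilon>>0. \<exists>N. \<forall>n\<ge>N. \<forall>k\<ge>N. form1 m \<E> (\<lambda>x. f n x - f k x) (\<lambda>x. f n x - f k x) < \<epsilon>) \<Longrightarrow>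
        \<exists>g\<in>D. (\<lambda>n. form1 m \<E> (\<lambda>x. f n x - g x) (\<lambda>x. f n x - g x)) \<longlonglongrightarrow> 0"
    and markovian_domain: "\<And>u. u \<in> D \<Longrightarrow> (\<lambda>x. min 1 (max 0 (u x))) \<in> D"
    and markovian_form:
      "\<And>u. u \<in> D \<Longrightarrow> \<E> (\<lambda>x. min 1 (max 0 (u x))) (\<lambda>x. min 1 (max 0 (u x))) \<le> \<E> u u"

definition Cc :: "('s::topological_space \<Rightarrow> real) set" where
  "Cc = {f. continuous_on UNIV f \<and> compact (closure {x. f x \<noteq> 0})}"

locale regular_dirichlet_form = dirichlet_form +
  assumes core_form_dense:
      "\<And>u \<epsilon>. u \<in> D \<Longrightarrow> 0 < \<epsilon> \<Longrightarrow>
        \<exists>v\<in>D \<inter> Cc. form1 m \<E> (\<lambda>x. u x - v x) (\<lambda>x. u x - v x) < \<epsilon>"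
    and core_uniformly_dense:
      "\<And>f \<epsilon>. f \<in> Cc \<Longrightarrow> 0 < \<epsilon> \<Longrightarrow> \<exists>v\<in>D \<inter> Cc. \<forall>x. \<bar>f x - v x\<bar> < \<epsilon>"

section \<open>Hunt processes\<close>

abbreviation one_point :: "'s::topological_space option topology" where
  "one_point \<equiv> Alexandroff_compactification euclidean"

definition borel_pt :: "'s::topological_space option measure" where
  "borel_pt = sigma UNIV {U. openin one_point U}"

definition life_time :: "(ennreal \<Rightarrow> 'w \<Rightarrow> 's option) \<Rightarrow> 'w \<Rightarrow> ennreal" where
  "life_time X \<omega> = Inf {t. X t \<omega> = None}"

definition nat_filt :: "(ennreal \<Rightarrow> 'w \<Rightarrow> 's::topological_space option) \<Rightarrow> ennreal \<Rightarrow> 'w measure" where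
  "nat_filt X t = sigma UNIV {X s -` B | s B. s \<le> t \<and> B \<in> sets borel_pt}"

definition init_laws :: "'s::topological_space option measure set" where
  "init_laws = {\<nu>. prob_space \<nu> \<and> sets \<nu> = sets borel_pt}"

text \<open>The completion of \<open>P\<^sub>\<nu> = \<integral> P\<^sub>x(\<cdot>) \<nu>(dx)\<close> on \<open>\<sigma>(X\<^sub>s : s \<in> [0,\<infinity>])\<close>.\<close>

definition law_from ::
  "(ennreal \<Rightarrow> 'w \<Rightarrow> 's::topological_space option) \<Rightarrow> ('s option \<Rightarrow> 'w measure) \<Rightarrow>
    's option measure \<Rightarrow> 'w measure" where
  "law_from X P \<nu> =
     completion (measure_of UNIV (sets (nat_filt X \<infinity>)) (\<lambda>B. \<integral>\<^sup>+x. emeasure (P x) B \<partial>\<nu>))"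

text \<open>The minimum augmented admissible filtration.  At \<open>t = \<infinity>\<close> the \<open>\<sigma>\<close>-algebra generated by
  \<open>\<sigma>(X\<^sub>s : s \<in> [0,\<infinity>])\<close> and the null sets is the \<open>P\<^sub>\<nu>\<close>-completion itself.\<close>

definition aug_filt ::
  "(ennreal \<Rightarrow> 'w \<Rightarrow> 's::topological_space option) \<Rightarrow> ('s option \<Rightarrow> 'w measure) \<Rightarrow> ennreal \<Rightarrow> 'w measure" where
  "aug_filt X P t = sigma UNIV
     (\<Inter>\<nu>\<in>init_laws. sigma_sets UNIV (sets (nat_filt X t) \<union> null_sets (law_from X P \<nu>)))"

text \<open>\<open>P\<^sub>x\<close>, \<open>x \<in> S\<close>, extended to the \<open>P\<^sub>x\<close>-completion of \<open>\<sigma>(X\<^sub>s : s \<in> [0,\<infinity>])\<close>, hence to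
  \<open>aug_filt X P \<infinity>\<close>, and the corresponding expectation.\<close>

definition Pc ::
  "(ennreal \<Rightarrow> 'w \<Rightarrow> 's::topological_space option) \<Rightarrow> ('s option \<Rightarrow> 'w measure) \<Rightarrow> 's \<Rightarrow> 'w measure" where
  "Pc X P x = completion (restr_to_subalg (P (Some x)) (nat_filt X \<infinity>))"

definition expect ::
  "(ennreal \<Rightarrow> 'w \<Rightarrow> 's::topological_space option) \<Rightarrow> ('s option \<Rightarrow> 'w measure) \<Rightarrow> 's \<Rightarrow>
    ('w \<Rightarrow> ennreal) \<Rightarrow> ennreal" where
  "expect X P x f = (\<integral>\<^sup>+\<omega>. f \<omega> \<partial>Pc X P x)"

text \<open>\<open>M\<close> carries the \<open>\<sigma>\<close>-algebra on which all the \<open>P\<^sub>x\<close> are given.  The simple Markov property is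
  \<open>strong_markov\<close> for constant stopping times.\<close>

locale hunt_process =
  fixes M :: "'w measure"
    and X :: "ennreal \<Rightarrow> 'w \<Rightarrow> 's::topological_space option"
    and P :: "'s option \<Rightarrow> 'w measure"
    and \<theta> :: "ennreal \<Rightarrow> 'w \<Rightarrow> 'w"
  assumes space_M: "space M = UNIV"
    and prob_P: "\<And>x. prob_space (P x)"
    and sets_P: "\<And>x. sets (P x) = sets M"
    and X_measurable: "\<And>t. X t \<in> M \<rightarrow>\<^sub>M borel_pt"
    and kernel_measurable:
      "\<And>t B. t < \<infinity> \<Longrightarrow> B \<in> sets borel \<Longrightarrow>
        (\<lambda>x. emeasure (P (Some x)) {\<omega>. X t \<omega> \<in> Some ` B}) \<in> borel_measurable borel"
    and cemetery: "\<And>t. emeasure (P None) {\<omega>. X t \<omega> = None} = 1"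
    and normal: "\<And>x. emeasure (P (Some x)) {\<omega>. X 0 \<omega> = Some x} = 1"
    and absorbed: "\<And>t \<omega>. X t \<omega> = None \<longleftrightarrow> life_time X \<omega> \<le> t"
    and X_infinity: "\<And>\<omega>. X \<infinity> \<omega> = None"
    and shift: "\<And>s t \<omega>. X s (\<theta> t \<omega>) = X (s + t) \<omega>"
    and right_cont: "\<And>t \<omega>. t < \<infinity> \<Longrightarrow> limitin one_point (\<lambda>s. X s \<omega>) (X t \<omega>) (at_right t)"
    and left_lim:
      "\<And>t \<omega>. 0 < t \<Longrightarrow> t < \<infinity> \<Longrightarrow> \<exists>l. limitin one_point (\<lambda>s. X s \<omega>) l (at_left t)"
    and filt_right_cont:
      "\<And>t. t < \<infinity> \<Longrightarrow> sets (aug_filt X P t) = (\<Inter>s\<in>{t<..}. sets (aug_filt X P s))"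
    and strong_markov:
      "\<And>\<nu> \<sigma> s B. \<nu> \<in> init_laws \<Longrightarrow> stopping_time (aug_filt X P) \<sigma> \<Longrightarrow> s < \<infinity> \<Longrightarrow>
        B \<in> sets borel_pt \<Longrightarrow>
        AE \<omega> in law_from X P \<nu>.
          real_cond_exp (law_from X P \<nu>) (filtration.pre_sigma UNIV (aug_filt X P) \<sigma>)
            (indicator {\<omega>. X (\<sigma> \<omega> + s) \<omega> \<in> B}) \<omega>
          = measure (P (X (\<sigma> \<omega>) \<omega>)) {\<omega>'. X s \<omega>' \<in> B}"
    and quasi_left_cont:
      "\<And>\<nu> \<sigma>n \<sigma>. \<nu> \<in> init_laws \<Longrightarrow> (\<forall>n::nat. stopping_time (aug_filt X P) (\<sigma>n n)) \<Longrightarrow>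
        (\<forall>\<omega>. incseq (\<lambda>n. \<sigma>n n \<omega>)) \<Longrightarrow> (\<forall>\<omega>. \<sigma> \<omega> = (SUP n. \<sigma>n n \<omega>)) \<Longrightarrow>
        AE \<omega> in law_from X P \<nu>.
          \<sigma> \<omega> < \<infinity> \<longrightarrow> limitin one_point (\<lambda>n. X (\<sigma>n n \<omega>) \<omega>) (X (\<sigma> \<omega>) \<omega>) sequentially"

text \<open>\<open>P\<^sub>x(X\<^sub>t \<in> dy)\<close> as a (sub-probability) measure on \<open>S\<close>.\<close>

definition trans_law ::
  "(ennreal \<Rightarrow> 'w \<Rightarrow> 's::topological_space option) \<Rightarrow> ('s option \<Rightarrow> 'w measure) \<Rightarrow> real \<Rightarrow> 's \<Rightarrow> 's measure" where
  "trans_law X P t x =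
     distr (restrict_space (P (Some x)) {\<omega>. X (ennreal t) \<omega> \<noteq> None}) borel (\<lambda>\<omega>. the (X (ennreal t) \<omega>))"

definition m_symmetric ::
  "'s::topological_space measure \<Rightarrow> (ennreal \<Rightarrow> 'w \<Rightarrow> 's option) \<Rightarrow> ('s option \<Rightarrow> 'w measure) \<Rightarrow> bool" where
  "m_symmetric m X P \<longleftrightarrow>
     (\<forall>t>0. \<forall>f\<in>borel_measurable borel. \<forall>g\<in>borel_measurable borel.
        (\<integral>\<^sup>+x. (\<integral>\<^sup>+y. f y \<partial>trans_law X P t x) * g x \<partial>m) =
        (\<integral>\<^sup>+x. f x * (\<integral>\<^sup>+y. g y \<partial>trans_law X P t x) \<partial>m))"

text \<open>\<open>t\<^sup>-\<^sup>1 \<langle>u - P\<^sub>t u, v\<rangle>\<close> in \<open>L\<^sup>2(S,m)\<close>, and the Dirichlet form of the process as its limit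
  for \<open>t \<down> 0\<close>.\<close>

definition approx_form ::
  "'s::topological_space measure \<Rightarrow> (ennreal \<Rightarrow> 'w \<Rightarrow> 's option) \<Rightarrow> ('s option \<Rightarrow> 'w measure) \<Rightarrow>
    real \<Rightarrow> ('s \<Rightarrow> real) \<Rightarrow> ('s \<Rightarrow> real) \<Rightarrow> real" where
  "approx_form m X P t u v = (\<integral>x. (u x - (\<integral>y. u y \<partial>trans_law X P t x)) * v x \<partial>m) / t"

definition has_dirichlet_form ::
  "'s::topological_space measure \<Rightarrow> (ennreal \<Rightarrow> 'w \<Rightarrow> 's option) \<Rightarrow> ('s option \<Rightarrow> 'w measure) \<Rightarrow>
    ('s \<Rightarrow> real) set \<Rightarrow> (('s \<Rightarrow> real) \<Rightarrow> ('s \<Rightarrow> real) \<Rightarrow> real) \<Rightarrow> bool" where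
  "has_dirichlet_form m X P D \<E> \<longleftrightarrow>
     D = {u \<in> L2 m. \<exists>l. ((\<lambda>t. approx_form m X P t u u) \<longlongrightarrow> l) (at_right 0)} \<and>
     (\<forall>u\<in>D. \<forall>v\<in>D. ((\<lambda>t. approx_form m X P t u v) \<longlongrightarrow> \<E> u v) (at_right 0))"

definition AC_cond ::
  "'s::topological_space measure \<Rightarrow> (ennreal \<Rightarrow> 'w \<Rightarrow> 's option) \<Rightarrow> ('s option \<Rightarrow> 'w measure) \<Rightarrow> bool" where
  "AC_cond m X P \<longleftrightarrow> (\<forall>x. \<forall>t>0. absolutely_continuous m (trans_law X P t x))"

definition transition_density ::
  "'s::topological_space measure \<Rightarrow> (ennreal \<Rightarrow> 'w \<Rightarrow> 's option) \<Rightarrow> ('s option \<Rightarrow> 'w measure) \<Rightarrow>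
    (real \<Rightarrow> 's \<Rightarrow> 's \<Rightarrow> ennreal) \<Rightarrow> bool" where
  "transition_density m X P p \<longleftrightarrow>
     (\<lambda>(t, x, y). p t x y) \<in>
       borel_measurable (restrict_space borel {0<..} \<Otimes>\<^sub>M borel \<Otimes>\<^sub>M borel) \<and>
     (\<forall>t>0. \<forall>x. trans_law X P t x = density m (p t x)) \<and>
     (\<forall>t>0. \<forall>x y. p t x y = p t y x) \<and>
     (\<forall>s>0. \<forall>t>0. \<forall>x y. p (t + s) x y = (\<integral>\<^sup>+z. p t x z * p s z y \<partial>m))"

section \<open>Positive continuous additive functionals and Revuz measures\<close>

definition defining_set ::
  "(ennreal \<Rightarrow> 'w \<Rightarrow> 's::topological_space option) \<Rightarrow> ('s option \<Rightarrow> 'w measure) \<Rightarrow> (ennreal \<Rightarrow> 'w \<Rightarrow> 'w) \<Rightarrow>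
    (real \<Rightarrow> 'w \<Rightarrow> ennreal) \<Rightarrow> 'w set \<Rightarrow> bool" where
  "defining_set X P \<theta> A \<Lambda> \<longleftrightarrow>
     \<Lambda> \<in> sets (aug_filt X P \<infinity>) \<and>
     (\<forall>x. emeasure (Pc X P x) \<Lambda> = 1) \<and>
     (\<forall>t::real\<ge>0. \<theta> (ennreal t) ` \<Lambda> \<subseteq> \<Lambda>) \<and>
     (\<forall>\<omega>\<in>\<Lambda>.
        continuous_on {0..} (\<lambda>t. A t \<omega>) \<and> A 0 \<omega> = 0 \<and>
        (\<forall>s\<ge>0. \<forall>t\<ge>0.
           (ennreal t < life_time X \<omega> \<longrightarrow> A t \<omega> < \<infinity>) \<and>
           (life_time X \<omega> \<le> ennreal t \<longrightarrow> A t \<omega> = A (enn2real (life_time X \<omega>)) \<omega>) \<and>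
           A (t + s) \<omega> = A t \<omega> + A s (\<theta> (ennreal t) \<omega>)))"

text \<open>The last two conjuncts are the convention that \<open>A\<close> vanishes off its defining set and that the
  defining set contains \<open>{\<zeta> = 0}\<close>.  Only the values \<open>A t\<close> with \<open>t \<ge> 0\<close> matter.\<close>

definition pcaf_strict ::
  "(ennreal \<Rightarrow> 'w \<Rightarrow> 's::topological_space option) \<Rightarrow> ('s option \<Rightarrow> 'w measure) \<Rightarrow> (ennreal \<Rightarrow> 'w \<Rightarrow> 'w) \<Rightarrow>
    (real \<Rightarrow> 'w \<Rightarrow> ennreal) \<Rightarrow> bool" where
  "pcaf_strict X P \<theta> A \<longleftrightarrow>
     (\<forall>t\<ge>0. A t \<in> borel_measurable (aug_filt X P (ennreal t))) \<and>
     (\<exists>\<Lambda>. defining_set X P \<theta> A \<Lambda> \<and>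
        (\<forall>t\<ge>0. \<forall>\<omega>. \<omega> \<notin> \<Lambda> \<longrightarrow> A t \<omega> = 0) \<and>
        {\<omega>. life_time X \<omega> = 0} \<subseteq> \<Lambda>)"

text \<open>The Stieltjes measure \<open>dA(\<omega>)\<close>, carried by \<open>(0,\<zeta>(\<omega>))\<close>.  Since \<open>A\<close> is finite only before the
  life time and may explode there, the measure is the increasing limit over \<open>r < \<zeta>(\<omega>)\<close> of the
  Lebesgue-Stieltjes measures of \<open>A\<close> stopped at \<open>r\<close>.\<close>

definition dA_measure ::
  "(ennreal \<Rightarrow> 'w \<Rightarrow> 's option) \<Rightarrow> (real \<Rightarrow> 'w \<Rightarrow> ennreal) \<Rightarrow> 'w \<Rightarrow> real measure" where
  "dA_measure X A \<omega> = measure_of UNIV (sets borel)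
     (\<lambda>B. SUP r\<in>{r. 0 \<le> r \<and> ennreal r < life_time X \<omega>}.
        emeasure (interval_measure (\<lambda>s. enn2real (A (min r (max 0 s)) \<omega>))) B)"

definition dA_integral ::
  "(ennreal \<Rightarrow> 'w \<Rightarrow> 's option) \<Rightarrow> (real \<Rightarrow> 'w \<Rightarrow> ennreal) \<Rightarrow> 'w \<Rightarrow> ennreal \<Rightarrow> (real \<Rightarrow> ennreal) \<Rightarrow> ennreal" where
  "dA_integral X A \<omega> t f = (\<integral>\<^sup>+s\<in>{s. 0 < s \<and> ennreal s \<le> t}. f s \<partial>dA_measure X A \<omega>)"

definition revuz_measure ::
  "'s::topological_space measure \<Rightarrow> (ennreal \<Rightarrow> 'w \<Rightarrow> 's option) \<Rightarrow> ('s option \<Rightarrow> 'w measure) \<Rightarrow>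
    (real \<Rightarrow> 'w \<Rightarrow> ennreal) \<Rightarrow> 's measure \<Rightarrow> bool" where
  "revuz_measure m X P A \<mu> \<longleftrightarrow>
     sets \<mu> = sets borel \<and>
     (\<forall>B\<in>sets borel. emeasure \<mu> B =
        (SUP t\<in>{0<..}. ennreal (1 / t) *
           (\<integral>\<^sup>+x. expect X P x (\<lambda>\<omega>. dA_integral X A \<omega> (ennreal t)
              (\<lambda>s. indicator (Some ` B) (X (ennreal s) \<omega>))) \<partial>m)))"

end

theory Submission
  imports Defs
begin

text \<open>
  The formula splits into two statements, one about the paths and one about the Revuz measure.

  Projection (\<open>dA_projection\<close>): under the integral \<open>E\<^sub>x[\<integral> \<dots> dA\<^sub>s]\<close> the functional \<open>F\<^sub>s \<circ> \<theta>\<^sub>s\<close> of the future may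
  be replaced by \<open>E\<^sub>y[F\<^sub>s]\<close> at \<open>y = X\<^sub>s\<close>.  If \<open>A\<close> were the Lebesgue clock, this would be the Markov
  property at each time \<open>s\<close>.  In general the right inverse \<open>\<tau>\<^sub>u\<close> of \<open>A\<close> turns an integral
  against \<open>dA\<^sub>s\<close> into a Lebesgue integral over the levels \<open>u\<close>.  Each \<open>\<tau>\<^sub>u\<close> is a stopping time,
  so that the strong Markov property applies level by level (\<open>strong_markov_path\<close>).

  Occupation formula (\<open>occupation_formula\<close>):
  \<open>E\<^sub>x[\<integral>\<^sub>0\<^sup>t \<psi>(s, X\<^sub>s) dA\<^sub>s] = \<integral>\<^sub>0\<^sup>t \<integral> p\<^sub>s(x,y) \<psi>(s,y) \<mu>(dy) ds\<close> for every starting point \<open>x\<close>.  The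
  definition of \<open>\<mu>\<close> only concerns small times and the starting measure \<open>m\<close>.  Write
  \<open>c\<^sub>t(x) = E\<^sub>x[\<integral>\<^sub>0\<^sup>t f(X\<^sub>s) dA\<^sub>s]\<close> and \<open>R\<^sub>a h = \<integral>\<^sub>0\<^sup>a P\<^sub>r h dr\<close>.  The passage to a single \<open>x\<close> goes through the
  identity \<open>\<integral> h c\<^sub>a dm = \<integral> f R\<^sub>a h d\<mu>\<close> (\<open>energy_identity\<close>): choosing \<open>h = p\<^sub>\<epsilon>(x, \<cdot>)\<close>, the left-hand
  side becomes \<open>E\<^sub>x[\<integral> f(X\<^sub>s) dA\<^sub>s]\<close> over \<open>(\<epsilon>, \<epsilon> + a]\<close> and the right-hand side becomes
  \<open>\<integral> f(y) \<integral> p\<^sub>r(x,y) dr \<mu>(dy)\<close> with \<open>r\<close> in the same window, and \<open>\<epsilon> \<rightarrow> 0\<close> is monotone convergence.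

  The energy identity itself holds for the following reason.  Put \<open>g = R\<^sub>a h\<close> and \<open>B\<^sub>s = \<integral>\<^sub>0\<^sup>s f(X\<^sub>r) dA\<^sub>r\<close>.  By the semigroup
  property and symmetry, \<open>\<integral> g c\<^sub>s dm / s \<rightarrow> \<integral> h c\<^sub>a dm\<close> as \<open>s \<rightarrow> 0\<close> (\<open>energy_sandwich\<close>), and by the definition of \<open>\<mu>\<close>,
  \<open>E\<^sub>m[\<integral>\<^sub>0\<^sup>s (f g)(X\<^sub>r) dA\<^sub>r] / s \<rightarrow> \<integral> f g d\<mu>\<close>.  Now \<open>\<integral> g c\<^sub>s dm = E\<^sub>m[g(X\<^sub>0) B\<^sub>s]\<close>, and replacing
  \<open>g(X\<^sub>0)\<close> by \<open>g(X\<^sub>r)\<close> inside \<open>B\<^sub>s\<close> changes it by \<open>o(s)\<close>: symmetry gives \<open>E\<^sub>m[(g(X\<^sub>0) - g(X\<^sub>s))\<^sup>2] = O(s)\<close>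
  (\<open>quadratic_variation_bound\<close>), projection gives \<open>E\<^sub>m[B\<^sub>s\<^sup>2] \<le> 2 s \<integral> f c\<^sub>s d\<mu> = o(s)\<close>
  (\<open>E_Bi_square\<close>), and the product is controlled by the inequality of the arithmetic and geometric means
  (\<open>energy_error\<close>).

  These estimates need finite quantities, although \<open>\<mu>\<close> is an arbitrary Borel measure to begin with.  They are first proved for \<open>f \<le> \<phi>\<close>,
  where \<open>\<phi>(x) = E\<^sub>x[\<integral>\<^sub>0\<^sup>1 w(X\<^sub>r) exp(-A\<^sub>r) dr]\<close> with a strictly positive \<open>m\<close>-integrable
  weight \<open>w \<le> 1\<close>.  The discount \<open>exp(-A)\<close> forces \<open>E\<^sub>x[\<integral>\<^sub>0\<^sup>t \<phi>(X\<^sub>s) dA\<^sub>s] \<le> 1 + t\<close> and \<open>\<integral> \<phi> d\<mu> < \<infinity>\<close>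
  (\<open>localizer_inequality\<close>), and \<open>\<phi> > 0\<close> makes this class of functions rich enough.

  Path functionals such as \<open>A\<close> are measurable only for the completed \<open>\<sigma>\<close>-algebras, so that their expectations
  need not be Borel in the starting point.  Shifted by a positive time they are (\<open>measurable_E_shift\<close>), because the law of
  the path at that time has a density with respect to \<open>m\<close>; additivity and continuity of \<open>A\<close> then allow the shift to tend to \<open>0\<close>.
\<close>

section \<open>The Borel sets of the one-point compactification\<close>

lemma space_borel_pt [simp]: "space borel_pt = UNIV"
  by (simp add: borel_pt_def space_measure_of_conv)

lemma measurable_Some_borel_pt [measurable]:
  "Some \<in> (borel :: 's::t2_space measure) \<rightarrow>\<^sub>M borel_pt"
  unfolding borel_pt_def
proof (rule measurable_measure_of)
  fix V :: "'s option set"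
  assume "V \<in> {U. openin one_point U}"
  then have "open (Some -` V)"
    by (auto simp: openin_Alexandroff_compactification vimage_def image_iff Compl_eq_Diff_UNIV[symmetric] open_closed
      simp flip: Compl_eq)
  then show "Some -` V \<inter> space borel \<in> sets borel" by simp
qed auto

lemma image_Some_borel_pt:
  assumes "B \<in> sets (borel :: 's::t2_space measure)"
  shows "Some ` B \<in> sets borel_pt"
proof -
  have open_in: "Some ` U \<in> sets borel_pt" if "open U" for U :: "'s set"
    using that by (auto simp: borel_pt_def)
  have "B \<in> sigma_sets UNIV {S. open S}" using assms by (simp add: borel_def)
  then show ?thesis
  proof induct
    case (Compl a)
    have "Some ` (UNIV - a) = Some ` UNIV - Some ` a" by auto
    then show ?case using Compl open_in[of UNIV] by simp
  next
    case (Union a)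
    then show ?case by (auto simp: image_UN)
  qed (use open_in in auto)
qed

lemma None_borel_pt: "{None} \<in> sets (borel_pt :: 's::t2_space option measure)"
proof -
  have "{None} = UNIV - Some ` (UNIV :: 's set)" by (auto simp: UNIV_option_conv)
  then show ?thesis using image_Some_borel_pt[of "UNIV :: 's set"]
    by (metis sets.compl_sets space_borel space_borel_pt sets.top)
qed

lemma borel_pt_Int_Some: "B \<in> sets borel_pt \<Longrightarrow> Some -` B \<in> sets (borel :: 's::t2_space measure)"
  using measurable_sets[OF measurable_Some_borel_pt] by simp

lemma measurable_borel_ptI:
  fixes f :: "'s::t2_space option \<Rightarrow> 'b"
  assumes f: "(\<lambda>x. f (Some x)) \<in> borel \<rightarrow>\<^sub>M L" and "f None \<in> space L"
  shows "f \<in> borel_pt \<rightarrow>\<^sub>M L"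
proof (rule measurableI)
  show "f y \<in> space L" for y
    using assms(2) measurable_space[OF f] by (cases y) auto
  fix A assume A: "A \<in> sets L"
  have "f -` A \<inter> space borel_pt = Some ` ((\<lambda>x. f (Some x)) -` A \<inter> space borel) \<union> (if f None \<in> A then {None} else {})"
    (is "?l = ?r")
  proof (rule set_eqI)
    show "y \<in> ?l \<longleftrightarrow> y \<in> ?r" for y by (cases y) auto
  qed
  also have "\<dots> \<in> sets borel_pt"
    using image_Some_borel_pt[OF measurable_sets[OF f A]] None_borel_pt by (intro sets.Un) auto
  finally show "f -` A \<inter> space borel_pt \<in> sets borel_pt" .
qed

lemma singleton_borel_pt: "{y} \<in> sets (borel_pt :: 's::t2_space option measure)"
  using None_borel_pt image_Some_borel_pt[of "{the y}"] by (cases y) auto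

section \<open>The completed path laws\<close>

locale hunt = hunt_process M X P \<theta>
  for M :: "'w measure"
    and X :: "ennreal \<Rightarrow> 'w \<Rightarrow> 's::{metric_space, second_countable_topology} option"
    and P :: "'s option \<Rightarrow> 'w measure"
    and \<theta> :: "ennreal \<Rightarrow> 'w \<Rightarrow> 'w" +
  assumes locally_compact: "locally_compact_space (euclidean :: 's topology)"
begin

text \<open>The path laws are needed for every starting point of the compactification, the cemetery
  included, because the strong Markov property evaluates them at the position of the path.
  On the state space, \<open>Q\<close> is the completed law \<^const>\<open>Pc\<close>.\<close>

definition N where "N = nat_filt X \<infinity>"
definition Finf where "Finf = aug_filt X P \<infinity>"
definition P0 where "P0 y = restr_to_subalg (P y) N"
definition Q where "Q y = completion (P0 y)"

lemma Q_Some: "Pc X P x = Q (Some x)"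
  by (simp add: Pc_def Q_def P0_def N_def)

lemma expect_Q: "expect X P x f = (\<integral>\<^sup>+\<omega>. f \<omega> \<partial>Q (Some x))"
  by (simp add: expect_def Q_Some)

lemma sets_nat_filt: "sets (nat_filt X t) = sigma_sets UNIV {X s -` B | s B. s \<le> t \<and> B \<in> sets borel_pt}"
  unfolding nat_filt_def by (rule sets_measure_of) auto

lemma space_nat_filt [simp]: "space (nat_filt X t) = UNIV"
  by (simp add: nat_filt_def space_measure_of_conv)

lemma measurable_X_nat_filt: "s \<le> t \<Longrightarrow> X s \<in> nat_filt X t \<rightarrow>\<^sub>M borel_pt"
  by (rule measurableI) (auto simp: sets_nat_filt intro!: sigma_sets.Basic)

lemma space_N [simp]: "space N = UNIV"
  by (simp add: N_def)

lemma measurable_X [measurable]: "X s \<in> N \<rightarrow>\<^sub>M borel_pt"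
  unfolding N_def by (rule measurable_X_nat_filt) simp

lemma space_P: "space (P y) = UNIV"
  using sets_eq_imp_space_eq[OF sets_P[of y]] space_M by simp

lemma nat_filt_le_M: "sets (nat_filt X t) \<subseteq> sets M"
  unfolding sets_nat_filt
proof (rule sets.sigma_sets_subset'[of _ M, unfolded space_M])
  show "{X s -` B |s B. s \<le> t \<and> B \<in> sets borel_pt} \<subseteq> sets M"
    using measurable_sets[OF X_measurable] by (auto simp: space_M)
qed (use sets.top[of M] space_M in auto)

lemma nat_filt_mono: "s \<le> t \<Longrightarrow> sets (nat_filt X s) \<subseteq> sets (nat_filt X t)"
  unfolding sets_nat_filt by (rule sigma_sets_mono') (blast dest: order_trans)

lemma subalgebra_N: "subalgebra (P y) N"
  using nat_filt_le_M by (auto simp: subalgebra_def space_P sets_P N_def)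

lemma sets_P0 [simp, measurable_cong]: "sets (P0 y) = sets N"
  by (simp add: P0_def sets_restr_to_subalg[OF subalgebra_N])

lemma space_P0 [simp]: "space (P0 y) = UNIV"
  by (simp add: P0_def space_restr_to_subalg space_P)

lemma space_Q [simp]: "space (Q y) = UNIV"
  by (simp add: Q_def)

lemma emeasure_P0: "A \<in> sets N \<Longrightarrow> emeasure (P0 y) A = emeasure (P y) A"
  by (simp add: P0_def emeasure_restr_to_subalg[OF subalgebra_N])

lemma emeasure_Q: "A \<in> sets N \<Longrightarrow> emeasure (Q y) A = emeasure (P y) A"
  by (simp add: Q_def emeasure_P0)

lemma prob_P0: "prob_space (P0 y)"
  unfolding P0_def by (rule prob_space_restr_to_subalg[OF subalgebra_N prob_P])

lemma prob_Q: "prob_space (Q y)"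
  unfolding Q_def by (rule prob_space.prob_space_completion[OF prob_P0])

lemma nn_integral_Q: "(\<integral>\<^sup>+\<omega>. f \<omega> \<partial>Q y) = (\<integral>\<^sup>+\<omega>. f \<omega> \<partial>P0 y)"
  by (simp add: Q_def nn_integral_completion)

lemma complete_Q: "complete_measure (Q y)"
  unfolding Q_def by standard

lemma measurable_X_Q [measurable]: "X s \<in> Q y \<rightarrow>\<^sub>M borel_pt"
  unfolding Q_def by (rule measurable_completion) simp

subsection \<open>The augmented filtration\<close>

lemma sets_aug_filt:
  "sets (aug_filt X P t) = (\<Inter>\<nu>\<in>init_laws. sigma_sets UNIV (sets (nat_filt X t) \<union> null_sets (law_from X P \<nu>)))"
    (is "_ = ?R")
proof -
  have "sigma_sets UNIV ?R \<subseteq> ?R"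
  proof (intro INT_greatest)
    fix \<nu> :: "'s option measure" assume "\<nu> \<in> init_laws"
    then have "sigma_sets UNIV ?R \<subseteq> sigma_sets UNIV (sigma_sets UNIV (sets (nat_filt X t) \<union> null_sets (law_from X P \<nu>)))"
      by (intro sigma_sets_mono') auto
    then show "sigma_sets UNIV ?R \<subseteq> sigma_sets UNIV (sets (nat_filt X t) \<union> null_sets (law_from X P \<nu>))"
      by (simp add: sigma_sets_sigma_sets_eq)
  qed
  then show ?thesis unfolding aug_filt_def by (subst sets_measure_of) auto
qed

lemma space_aug_filt [simp]: "space (aug_filt X P t) = UNIV"
  by (simp add: aug_filt_def space_measure_of_conv)

lemma nat_filt_le_aug: "sets (nat_filt X t) \<subseteq> sets (aug_filt X P t)"
  unfolding sets_aug_filt by (auto intro: sigma_sets.Basic)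

sublocale filt: filtration UNIV "aug_filt X P"
proof
  show "sets (aug_filt X P i) \<le> sets (aug_filt X P j)" if "i \<le> j" for i j
    unfolding sets_aug_filt using nat_filt_mono[OF that]
    by (intro INF_mono' sigma_sets_mono' Un_mono subset_refl)
qed simp

lemma space_Finf [simp]: "space Finf = UNIV"
  by (simp add: Finf_def)

lemma sets_law_from: "sets N \<subseteq> sets (law_from X P \<nu>)" "space (law_from X P \<nu>) = UNIV"
proof -
  show "space (law_from X P \<nu>) = UNIV" by (simp add: law_from_def space_measure_of_conv)
  have "sets (measure_of UNIV (sets N) (\<lambda>B. \<integral>\<^sup>+x. emeasure (P x) B \<partial>\<nu>)) = sets N"
    using sets.sets_measure_of_eq[of N] by simp
  then show "sets N \<subseteq> sets (law_from X P \<nu>)"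
    unfolding law_from_def N_def by (metis sets_completionI_sets subsetI)
qed

lemma aug_le_law_from:
  assumes "\<nu> \<in> init_laws"
  shows "sets (aug_filt X P t) \<subseteq> sets (law_from X P \<nu>)"
proof -
  have "sets (aug_filt X P t) \<subseteq> sigma_sets UNIV (sets (nat_filt X t) \<union> null_sets (law_from X P \<nu>))"
    unfolding sets_aug_filt using assms by auto
  also have "\<dots> \<subseteq> sets (law_from X P \<nu>)"
    using sets_law_from[of \<nu>, unfolded N_def] nat_filt_mono[of t \<infinity>]
    by (intro sets.sigma_sets_subset'[of _ "law_from X P \<nu>", unfolded sets_law_from(2)])
       (auto intro: subset_trans sets.top[of "law_from X P \<nu>", unfolded sets_law_from(2)])
  finally show ?thesis .
qed

lemma return_init_laws: "return borel_pt y \<in> init_laws"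
  by (auto simp: init_laws_def intro!: prob_space_return)

text \<open>Every statement about all initial laws specializes to the completed laws \<open>Q y\<close>.\<close>

lemma law_from_return: "law_from X P (return borel_pt y) = Q y"
proof -
  have "(\<integral>\<^sup>+x. emeasure (P x) B \<partial>return borel_pt y) = emeasure (P y) B" for B
  proof -
    have "AE x in return borel_pt y. x = y"
      using singleton_borel_pt[of y] by (subst AE_return) (auto simp: Measurable.pred_def)
    then have "(\<integral>\<^sup>+x. emeasure (P x) B \<partial>return borel_pt y) = (\<integral>\<^sup>+x. emeasure (P y) B \<partial>return borel_pt y)"
      by (intro nn_integral_cong_AE) auto
    then show ?thesis
      using prob_space.emeasure_space_1[OF prob_space_return[of y borel_pt]] by simp
  qed
  then have "(\<lambda>B. \<integral>\<^sup>+x. emeasure (P x) B \<partial>return borel_pt y) = emeasure (P y)"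
    by (rule ext)
  then show ?thesis unfolding law_from_def Q_def P0_def restr_to_subalg_def space_P N_def by (rule arg_cong)
qed

lemma aug_le_Q: "sets (aug_filt X P t) \<subseteq> sets (Q y)"
  using aug_le_law_from[OF return_init_laws, of t y] by (simp add: law_from_return)

lemma measurable_aug_Q: "f \<in> aug_filt X P t \<rightarrow>\<^sub>M L \<Longrightarrow> f \<in> Q y \<rightarrow>\<^sub>M L"
  using aug_le_Q[of t y] by (auto simp: measurable_def)

lemma N_le_Finf: "sets N \<subseteq> sets Finf"
  unfolding N_def Finf_def by (rule nat_filt_le_aug)

lemma pre_sigma_le_Finf:
  assumes "stopping_time (aug_filt X P) \<sigma>"
  shows "sets (filt.pre_sigma \<sigma>) \<subseteq> sets Finf"
proof
  fix C assume "C \<in> sets (filt.pre_sigma \<sigma>)"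
  from filt.sets_pre_sigmaD[OF assms this, of \<infinity>] show "C \<in> sets Finf"
    by (simp add: Finf_def)
qed

lemma subalgebra_pre_sigma:
  assumes "stopping_time (aug_filt X P) \<sigma>"
  shows "subalgebra (Q y) (filt.pre_sigma \<sigma>)"
  using pre_sigma_le_Finf[OF assms] aug_le_Q[of \<infinity> y, folded Finf_def] by (auto simp: subalgebra_def filt.space_pre_sigma)

section \<open>The strong Markov property for path functionals\<close>

lemma X_0_AE: "AE \<omega> in P y. X 0 \<omega> = y"
proof -
  interpret prob_space "P y" by (rule prob_P)
  have "{\<omega>. X 0 \<omega> = y} \<in> sets (P y)"
    using measurable_sets[OF X_measurable[of 0] singleton_borel_pt[of y]] by (simp add: sets_P space_M vimage_def)
  moreover have "emeasure (P y) {\<omega>. X 0 \<omega> = y} = 1"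
    using normal cemetery[of 0] by (cases y) auto
  ultimately show ?thesis using AE_prob_1[of "{\<omega>. X 0 \<omega> = y}"] by (simp add: measure_def)
qed

lemma measure_X_0: "B \<in> sets borel_pt \<Longrightarrow> measure (P y) {\<omega>. X 0 \<omega> \<in> B} = indicator B y"
proof -
  assume B: "B \<in> sets borel_pt"
  interpret prob_space "P y" by (rule prob_P)
  have ev: "{\<omega>. X 0 \<omega> \<in> B} \<in> sets (P y)"
    using measurable_sets[OF X_measurable[of 0] B] by (simp add: sets_P space_M vimage_def)
  have "measure (P y) {\<omega>. X 0 \<omega> \<in> B} = measure (P y) (if y \<in> B then space (P y) else {})"
    by (rule finite_measure_eq_AE) (use X_0_AE[of y] ev in auto)
  then show ?thesis by (auto simp: prob_space)
qed

lemma stopping_time_add: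
  assumes "stopping_time (aug_filt X P) \<sigma>" "s < \<infinity>"
  shows "stopping_time (aug_filt X P) (\<lambda>\<omega>. \<sigma> \<omega> + s)"
proof
  fix t :: ennreal
  have "\<sigma> \<omega> + s \<le> t \<longleftrightarrow> s \<le> t \<and> \<sigma> \<omega> \<le> t - s" for \<omega>
  proof (cases "s \<le> t")
    case True
    then have "\<sigma> \<omega> + s \<le> t \<longleftrightarrow> s + \<sigma> \<omega> \<le> s + (t - s)"
      by (simp add: add_diff_inverse_ennreal add.commute)
    also have "\<dots> \<longleftrightarrow> \<sigma> \<omega> \<le> t - s"
      using assms(2) by (subst ennreal_add_left_cancel_le) auto
    finally show ?thesis using True by simp
  next
    case False
    then show ?thesis by (meson add_increasing order_refl order_trans zero_le)
  qed
  moreover have "Measurable.pred (aug_filt X P t) (\<lambda>\<omega>. \<sigma> \<omega> \<le> t - s)"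
    by (rule filt.stopping_time_le_const[OF assms(1)]) simp
  ultimately show "Measurable.pred (aug_filt X P t) (\<lambda>\<omega>. \<sigma> \<omega> + s \<le> t)"
    by simp
qed

lemma sigma_finite_subalgebra_pre_sigma:
  assumes "stopping_time (aug_filt X P) \<sigma>"
  shows "sigma_finite_subalgebra (Q y) (filt.pre_sigma \<sigma>)"
  by (rule finite_measure_subalgebra_is_sigma_finite)
     (simp add: finite_measure_subalgebra_def finite_measure_subalgebra_axioms_def subalgebra_pre_sigma[OF assms]
       prob_space.finite_measure[OF prob_Q])

lemma cond_exp_at:
  assumes "stopping_time (aug_filt X P) \<sigma>" "s < \<infinity>" "B \<in> sets borel_pt"
  shows "AE \<omega> in Q y. real_cond_exp (Q y) (filt.pre_sigma \<sigma>) (indicator {\<omega>. X (\<sigma> \<omega> + s) \<omega> \<in> B}) \<omega>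
    = measure (P (X (\<sigma> \<omega>) \<omega>)) {\<omega>'. X s \<omega>' \<in> B}"
  using strong_markov[OF return_init_laws assms(1,2,3), of y] unfolding law_from_return .

text \<open>The strong Markov property with time lag \<open>0\<close>, together with \<open>X\<^sub>0 = y\<close> under \<open>P\<^sub>y\<close>, says that
  the conditional probability of \<open>{X\<^sub>\<sigma> \<in> B}\<close> given the past of \<open>\<sigma>\<close> is the indicator of this
  event.  So the event belongs to the past up to a null set, and completeness makes it measurable.\<close>

lemma hitting_event:
  assumes \<sigma>: "stopping_time (aug_filt X P) \<sigma>" and B: "B \<in> sets borel_pt"
  shows "\<exists>C\<in>sets (filt.pre_sigma \<sigma>). AE \<omega> in Q y. X (\<sigma> \<omega>) \<omega> \<in> B \<longleftrightarrow> \<omega> \<in> C"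
    and "{\<omega>. X (\<sigma> \<omega>) \<omega> \<in> B} \<in> sets (Q y)"
proof -
  interpret Q: complete_measure "Q y" by (rule complete_Q)
  let ?Z = "real_cond_exp (Q y) (filt.pre_sigma \<sigma>) (indicator {\<omega>. X (\<sigma> \<omega>) \<omega> \<in> B})"
  let ?C = "{\<omega>\<in>space (filt.pre_sigma \<sigma>). ?Z \<omega> = 1}"
  have AE: "AE \<omega> in Q y. ?Z \<omega> = indicator B (X (\<sigma> \<omega>) \<omega>)"
    using cond_exp_at[OF \<sigma> _ B, of 0 y] by (simp add: measure_X_0[OF B])
  have C: "?C \<in> sets (filt.pre_sigma \<sigma>)" by measurable
  have AE': "AE \<omega> in Q y. X (\<sigma> \<omega>) \<omega> \<in> B \<longleftrightarrow> \<omega> \<in> ?C"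
    using AE by eventually_elim (auto simp: filt.space_pre_sigma indicator_def split: if_splits)
  show "\<exists>C\<in>sets (filt.pre_sigma \<sigma>). AE \<omega> in Q y. X (\<sigma> \<omega>) \<omega> \<in> B \<longleftrightarrow> \<omega> \<in> C"
    using C AE' by blast
  have "?C \<in> sets (Q y)" using C subalgebra_pre_sigma[OF \<sigma>, of y] unfolding subalgebra_def by blast
  then show "{\<omega>. X (\<sigma> \<omega>) \<omega> \<in> B} \<in> sets (Q y)"
    by (rule Q.in_sets_AE[rotated]) (use AE' in \<open>auto elim: eventually_mono\<close>)
qed

lemma measurable_X_stopped:
  "stopping_time (aug_filt X P) \<sigma> \<Longrightarrow> (\<lambda>\<omega>. X (\<sigma> \<omega>) \<omega>) \<in> Q y \<rightarrow>\<^sub>M borel_pt"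
  using hitting_event(2) by (auto simp: measurable_def vimage_def)

lemma measurable_X_ev: "B \<in> sets borel_pt \<Longrightarrow> {\<omega>. X s \<omega> \<in> B} \<in> sets N"
  using measurable_sets[OF measurable_X, of B s] by (simp add: vimage_def)

text \<open>The transition kernel is given as Borel on the state space; the mass at the cemetery is what is missing.\<close>

lemma measurable_prob_X:
  assumes t: "t < \<infinity>" and B: "B \<in> sets borel_pt"
  shows "(\<lambda>y. emeasure (P y) {\<omega>. X t \<omega> \<in> B}) \<in> borel_measurable borel_pt"
proof -
  have split: "emeasure (P y) {\<omega>. X t \<omega> \<in> B} = emeasure (P y) {\<omega>. X t \<omega> \<in> Some ` (Some -` B)} +
     (if None \<in> B then 1 - emeasure (P y) {\<omega>. X t \<omega> \<in> Some ` UNIV} else 0)" for y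
  proof -
    interpret prob_space "P y" by (rule prob_P)
    have ev [simp]: "{\<omega>. X t \<omega> \<in> C} \<in> sets (P y)" if "C \<in> sets borel_pt" for C
      using measurable_sets[OF X_measurable[of t] that] by (simp add: sets_P space_M vimage_def)
    have "B = Some ` (Some -` B) \<union> (B \<inter> {None})"
    proof (rule set_eqI)
      show "z \<in> B \<longleftrightarrow> z \<in> Some ` (Some -` B) \<union> (B \<inter> {None})" for z by (cases z) auto
    qed
    then have 1: "{\<omega>. X t \<omega> \<in> B} = {\<omega>. X t \<omega> \<in> Some ` (Some -` B)} \<union> {\<omega>. X t \<omega> \<in> B \<inter> {None}}"
      by blast
    have "emeasure (P y) {\<omega>. X t \<omega> \<in> B} = emeasure (P y) {\<omega>. X t \<omega> \<in> Some ` (Some -` B)}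
        + emeasure (P y) {\<omega>. X t \<omega> \<in> B \<inter> {None}}"
      using B image_Some_borel_pt[OF borel_pt_Int_Some[OF B]] None_borel_pt
      by (subst 1, intro plus_emeasure[symmetric] ev sets.Int) auto
    moreover have "emeasure (P y) {\<omega>. X t \<omega> = None} = 1 - emeasure (P y) {\<omega>. X t \<omega> \<in> Some ` UNIV}"
    proof -
      have "{\<omega>. X t \<omega> = None} = space (P y) - {\<omega>. X t \<omega> \<in> Some ` UNIV}"
        by (simp add: space_P set_eq_iff image_iff)
      then show ?thesis
        using emeasure_compl[OF ev[OF image_Some_borel_pt[of UNIV]]] by (simp add: emeasure_space_1)
    qed
    moreover have "{\<omega>. X t \<omega> \<in> B \<inter> {None}} = (if None \<in> B then {\<omega>. X t \<omega> = None} else {})"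
      by (cases "None \<in> B") (auto simp del: not_None_eq)
    ultimately show ?thesis by (simp only: if_distrib[of "emeasure (P y)"] emeasure_empty)
  qed
  show ?thesis
  proof (rule measurable_borel_ptI)
    show "(\<lambda>x. emeasure (P (Some x)) {\<omega>. X t \<omega> \<in> B}) \<in> borel_measurable borel"
      using kernel_measurable[OF t borel_pt_Int_Some[OF B]] kernel_measurable[OF t, of UNIV]
      by (subst split) auto
  qed simp
qed

lemma measurable_law_X:
  assumes t: "t < \<infinity>"
  shows "(\<lambda>y. distr (P0 y) borel_pt (X t)) \<in> borel_pt \<rightarrow>\<^sub>M prob_algebra borel_pt"
proof (rule measurable_prob_algebraI)
  show "(\<lambda>y. distr (P0 y) borel_pt (X t)) \<in> borel_pt \<rightarrow>\<^sub>M subprob_algebra borel_pt"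
  proof (rule measurable_subprob_algebra)
    show "subprob_space (distr (P0 y) borel_pt (X t))" for y
      by (intro prob_space_imp_subprob_space prob_space.prob_space_distr prob_P0) simp
    fix B assume B: "B \<in> sets (borel_pt :: 's option measure)"
    show "(\<lambda>y. emeasure (distr (P0 y) borel_pt (X t)) B) \<in> borel_measurable borel_pt"
      using measurable_prob_X[OF t B] measurable_X_ev[OF B]
      by (simp add: emeasure_distr B vimage_def emeasure_P0)
  qed simp
qed (intro prob_space.prob_space_distr prob_P0, simp)

text \<open>Testing the conditional expectation against an event of the past gives the Markov property at
  one later time.\<close>

lemma markov_one_set:
  assumes \<sigma>: "stopping_time (aug_filt X P) \<sigma>" and s: "s < \<infinity>" and B: "B \<in> sets borel_pt"
    and C: "C \<in> sets (filt.pre_sigma \<sigma>)"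
  shows "emeasure (Q y) (C \<inter> {\<omega>. X (\<sigma> \<omega> + s) \<omega> \<in> B}) =
    (\<integral>\<^sup>+\<omega>. indicator C \<omega> * emeasure (P (X (\<sigma> \<omega>) \<omega>)) {\<omega>'. X s \<omega>' \<in> B} \<partial>Q y)"
proof -
  interpret prob_space "Q y" by (rule prob_Q)
  interpret S: sigma_finite_subalgebra "Q y" "filt.pre_sigma \<sigma>"
    by (rule sigma_finite_subalgebra_pre_sigma[OF \<sigma>])
  let ?E = "{\<omega>. X (\<sigma> \<omega> + s) \<omega> \<in> B}"
  let ?Z = "real_cond_exp (Q y) (filt.pre_sigma \<sigma>) (indicator ?E)"
  have E[measurable]: "?E \<in> sets (Q y)" by (rule hitting_event(2)[OF stopping_time_add[OF \<sigma> s] B])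
  have C'[measurable]: "C \<in> sets (Q y)" using C S.subalg unfolding subalgebra_def by blast
  have iE: "integrable (Q y) (indicator ?E :: 'w \<Rightarrow> real)" by (simp add: emeasure_eq_measure)
  have AE: "AE \<omega> in Q y. ?Z \<omega> = measure (P (X (\<sigma> \<omega>) \<omega>)) {\<omega>'. X s \<omega>' \<in> B}"
    by (rule cond_exp_at[OF \<sigma> s B])
  have "(\<integral>\<^sup>+\<omega>. indicator C \<omega> * emeasure (P (X (\<sigma> \<omega>) \<omega>)) {\<omega>'. X s \<omega>' \<in> B} \<partial>Q y)
    = (\<integral>\<^sup>+\<omega>. ennreal (indicator C \<omega> * ?Z \<omega>) \<partial>Q y)"
  proof (rule nn_integral_cong_AE, use AE in eventually_elim)
    fix \<omega> assume *: "?Z \<omega> = measure (P (X (\<sigma> \<omega>) \<omega>)) {\<omega>'. X s \<omega>' \<in> B}"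
    interpret F: finite_measure "P (X (\<sigma> \<omega>) \<omega>)" by (rule prob_space.finite_measure[OF prob_P])
    show "indicator C \<omega> * emeasure (P (X (\<sigma> \<omega>) \<omega>)) {\<omega>'. X s \<omega>' \<in> B} = ennreal (indicator C \<omega> * ?Z \<omega>)"
      by (simp add: * F.emeasure_eq_measure indicator_def)
  qed
  also have "\<dots> = ennreal (\<integral>\<omega>. indicator C \<omega> * ?Z \<omega> \<partial>Q y)"
  proof (rule nn_integral_eq_integral)
    show "integrable (Q y) (\<lambda>\<omega>. indicator C \<omega> * ?Z \<omega>)"
      using integrable_mult_indicator[OF C' S.real_cond_exp_int(1)[OF iE]] by simp
    show "AE \<omega> in Q y. 0 \<le> indicator C \<omega> * ?Z \<omega>" using AE by eventually_elim simp
  qed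
  also have "(\<integral>\<omega>. indicator C \<omega> * ?Z \<omega> \<partial>Q y) = (\<integral>\<omega>. indicator C \<omega> * indicator ?E \<omega> \<partial>Q y)"
    using S.real_cond_exp_intA[OF iE C] by (simp add: set_lebesgue_integral_def)
  also have "\<dots> = measure (Q y) (C \<inter> ?E)"
    by (simp flip: indicator_inter_arith)
  finally show ?thesis by (simp add: emeasure_eq_measure)
qed

text \<open>The sets \<open>B\<close> of \<open>markov_one_set\<close> determine the law of \<open>X\<close> at time \<open>\<sigma> + s\<close> on \<open>C\<close> as a mixture of transition laws.\<close>

lemma markov_one:
  assumes \<sigma>: "stopping_time (aug_filt X P) \<sigma>" and s: "s < \<infinity>" and v: "v \<in> borel_measurable borel_pt"
    and C: "C \<in> sets (filt.pre_sigma \<sigma>)"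
  shows "(\<integral>\<^sup>+\<omega>. indicator C \<omega> * v (X (\<sigma> \<omega> + s) \<omega>) \<partial>Q y) =
    (\<integral>\<^sup>+\<omega>. indicator C \<omega> * (\<integral>\<^sup>+\<omega>'. v (X s \<omega>') \<partial>Q (X (\<sigma> \<omega>) \<omega>)) \<partial>Q y)"
proof -
  let ?R = "density (Q y) (indicator C)"
  let ?k = "\<lambda>\<omega>. distr (P0 (X (\<sigma> \<omega>) \<omega>)) borel_pt (X s)"
  have C'[measurable]: "C \<in> sets (Q y)"
    using C subalgebra_pre_sigma[OF \<sigma>, of y] unfolding subalgebra_def by blast
  note m1[measurable] = measurable_X_stopped[OF \<sigma>, of y]
    and m2[measurable] = measurable_X_stopped[OF stopping_time_add[OF \<sigma> s], of y]
  have k: "?k \<in> ?R \<rightarrow>\<^sub>M subprob_algebra borel_pt"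
    using measurable_compose[OF m1 measurable_law_X[OF s, THEN measurable_prob_algebraD]] by simp
  have eq: "distr ?R borel_pt (\<lambda>\<omega>. X (\<sigma> \<omega> + s) \<omega>) = ?R \<bind> ?k"
  proof (rule measure_eqI)
    show "sets (distr ?R borel_pt (\<lambda>\<omega>. X (\<sigma> \<omega> + s) \<omega>)) = sets (?R \<bind> ?k)"
      using sets_bind[OF sets_kernel[OF k]] by simp
    fix B assume "B \<in> sets (distr ?R borel_pt (\<lambda>\<omega>. X (\<sigma> \<omega> + s) \<omega>))"
    then have B: "B \<in> sets borel_pt" by simp
    have E: "{\<omega>. X (\<sigma> \<omega> + s) \<omega> \<in> B} \<in> sets (Q y)"
      by (rule hitting_event(2)[OF stopping_time_add[OF \<sigma> s] B])
    have "emeasure (distr ?R borel_pt (\<lambda>\<omega>. X (\<sigma> \<omega> + s) \<omega>)) B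
        = emeasure (Q y) (C \<inter> {\<omega>. X (\<sigma> \<omega> + s) \<omega> \<in> B})"
      using E B by (simp add: emeasure_distr vimage_def emeasure_restricted)
    also have "\<dots> = (\<integral>\<^sup>+\<omega>. indicator C \<omega> * emeasure (?k \<omega>) B \<partial>Q y)"
      unfolding markov_one_set[OF \<sigma> s B C]
      using measurable_X_ev[OF B] by (simp add: emeasure_distr B vimage_def emeasure_P0)
    also have "\<dots> = (\<integral>\<^sup>+\<omega>. emeasure (?k \<omega>) B \<partial>?R)"
      by (subst nn_integral_density)
         (use measurable_compose[OF k measurable_emeasure_subprob_algebra[OF B]] in simp_all)
    also have "\<dots> = emeasure (?R \<bind> ?k) B"
      by (rule emeasure_bind[symmetric, OF _ k B]) simp
    finally show "emeasure (distr ?R borel_pt (\<lambda>\<omega>. X (\<sigma> \<omega> + s) \<omega>)) B = emeasure (?R \<bind> ?k) B" .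
  qed
  have "(\<integral>\<^sup>+\<omega>. indicator C \<omega> * v (X (\<sigma> \<omega> + s) \<omega>) \<partial>Q y) = (\<integral>\<^sup>+z. v z \<partial>distr ?R borel_pt (\<lambda>\<omega>. X (\<sigma> \<omega> + s) \<omega>))"
    using v by (simp add: nn_integral_distr nn_integral_density)
  also have "\<dots> = (\<integral>\<^sup>+\<omega>. (\<integral>\<^sup>+z. v z \<partial>?k \<omega>) \<partial>?R)"
    unfolding eq by (rule nn_integral_bind[OF v k])
  also have "\<dots> = (\<integral>\<^sup>+\<omega>. indicator C \<omega> * (\<integral>\<^sup>+z. v z \<partial>?k \<omega>) \<partial>Q y)"
    using measurable_compose[OF k nn_integral_measurable_subprob_algebra[OF v]]
    by (subst nn_integral_density) simp_all
  also have "\<dots> = (\<integral>\<^sup>+\<omega>. indicator C \<omega> * (\<integral>\<^sup>+\<omega>'. v (X s \<omega>') \<partial>Q (X (\<sigma> \<omega>) \<omega>)) \<partial>Q y)"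
    using v by (simp add: nn_integral_distr nn_integral_Q)
  finally show ?thesis .
qed

lemma UNIV_N [simp]: "UNIV \<in> sets N"
  using sets.top[of N] by simp

lemma UNIV_Q [simp]: "UNIV \<in> sets (Q y)"
  using sets.top[of "Q y"] by simp

text \<open>Cylinder events are described by lists of observation times and sets; concatenation of
  lists is intersection of events, and sorting the list by time prepares the induction below.\<close>

definition cyl :: "(ennreal \<times> 's option set) list \<Rightarrow> 'w set" where
  "cyl l = {\<omega>. \<forall>(s, B)\<in>set l. X s \<omega> \<in> B}"

definition admissible :: "(ennreal \<times> 's option set) list \<Rightarrow> bool" where
  "admissible l \<longleftrightarrow> (\<forall>(s, B)\<in>set l. s < \<infinity> \<and> B \<in> sets borel_pt)"

lemma cyl_in_N: "admissible l \<Longrightarrow> cyl l \<in> sets N"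
proof -
  assume l: "admissible l"
  have "cyl l = (\<Inter>b\<in>set l. {\<omega>. X (fst b) \<omega> \<in> snd b}) \<inter> space N"
    by (auto simp: cyl_def split_beta)
  also have "\<dots> \<in> sets N"
  proof (cases "set l = {}")
    case False
    then show ?thesis
      using l measurable_X_ev by (intro sets.Int sets.finite_INT sets.top) (auto simp: admissible_def split_beta)
  qed simp
  finally show ?thesis .
qed

lemma shift_X: "X s (\<theta> t \<omega>) = X (t + s) \<omega>"
  using shift by (simp add: add.commute)

lemma cyl_Cons_shift:
  assumes "sorted (map fst ((s, B) # l))" "admissible ((s, B) # l)"
  shows "\<theta> t \<omega> \<in> cyl ((s, B) # l) \<longleftrightarrow>
    X (t + s) \<omega> \<in> B \<and> \<theta> (t + s) \<omega> \<in> cyl (map (\<lambda>(r, B). (r - s, B)) l)"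
proof -
  have key: "s + (fst b - s) = fst b" if "b \<in> set l" for b
    using assms(1) that by (auto simp: add_diff_inverse_ennreal)
  then have "(\<forall>b\<in>set l. X (t + (s + (fst b - s))) \<omega> \<in> snd b) \<longleftrightarrow> (\<forall>b\<in>set l. X (t + fst b) \<omega> \<in> snd b)"
    by (intro ball_cong refl) (simp add: key)
  then show ?thesis
    by (simp add: cyl_def shift_X add.assoc split_beta)
qed

lemma measurable_stopped_cyl:
  assumes \<sigma>: "stopping_time (aug_filt X P) \<sigma>" and l: "admissible l"
  shows "{\<omega>. \<theta> (\<sigma> \<omega>) \<omega> \<in> cyl l} \<in> sets (Q y)"
proof -
  have "{\<omega>. \<theta> (\<sigma> \<omega>) \<omega> \<in> cyl l} = (\<Inter>b\<in>set l. {\<omega>. X (\<sigma> \<omega> + fst b) \<omega> \<in> snd b}) \<inter> space (Q y)"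
    by (auto simp: cyl_def shift_X split_beta)
  also have "\<dots> \<in> sets (Q y)"
  proof (cases "set l = {}")
    case False
    then show ?thesis
      using l hitting_event(2)[OF stopping_time_add[OF \<sigma>]]
      by (intro sets.Int sets.finite_INT sets.top) (auto simp: admissible_def split_beta)
  qed simp
  finally show ?thesis .
qed

text \<open>Induction on the number of observation times.  The earliest observation splits off by the
  Markov property at one time, applied to the stopping time itself and, to identify the resulting
  kernel, to a constant time; the remaining observations are seen from the later stopping time.\<close>

lemma markov_cyl_sorted:
  assumes "sorted (map fst l)" "admissible l"
  shows "(\<lambda>y. emeasure (P y) (cyl l)) \<in> borel_measurable borel_pt \<and>
    (\<forall>y \<sigma> C. stopping_time (aug_filt X P) \<sigma> \<longrightarrow> C \<in> sets (filt.pre_sigma \<sigma>) \<longrightarrow>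
      emeasure (Q y) (C \<inter> {\<omega>. \<theta> (\<sigma> \<omega>) \<omega> \<in> cyl l}) =
      (\<integral>\<^sup>+\<omega>. indicator C \<omega> * emeasure (P (X (\<sigma> \<omega>) \<omega>)) (cyl l) \<partial>Q y))"
  using assms
proof (induction "length l" arbitrary: l)
  case 0
  have "emeasure (P y) UNIV = 1" for y
    using prob_space.emeasure_space_1[OF prob_P[of y]] by (simp add: space_P)
  moreover have "C \<in> sets (Q y)"
    if "stopping_time (aug_filt X P) \<sigma>" "C \<in> sets (filt.pre_sigma \<sigma>)" for y \<sigma> C
    using subalgebra_pre_sigma[OF that(1), of y] that(2) unfolding subalgebra_def by blast
  ultimately show ?case using 0 by (simp add: cyl_def)
next
  case (Suc n)
  then obtain s B l' where l: "l = (s, B) # l'" by (cases l) auto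
  define r where "r = map (\<lambda>(r, B). (r - s, B)) l'"
  have s: "s < \<infinity>" and B: "B \<in> sets borel_pt" using Suc.prems(2) by (auto simp: l admissible_def)
  have "sorted (map fst r)"
  proof -
    have "map fst r = map (\<lambda>t. t - s) (map fst l')" by (simp add: r_def split_beta)
    moreover have "sorted (map fst l')" using Suc.prems(1) by (simp add: l)
    then have "sorted_wrt (\<lambda>a b. a - s \<le> b - s) (map fst l')"
      by (rule sorted_wrt_mono_rel[rotated]) (simp add: ennreal_minus_mono)
    ultimately show ?thesis by (simp only: sorted_map)
  qed
  moreover have r_adm: "admissible r"
    using Suc.prems(2) by (auto simp: admissible_def r_def l intro: le_less_trans[OF diff_le_self_ennreal])
  moreover have "n = length r" using Suc.hyps(2) by (simp add: r_def l)
  moreover define q where "q = (\<lambda>y. emeasure (P y) (cyl r))"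
  ultimately have q: "q \<in> borel_measurable borel_pt"
    and IH: "\<And>y \<sigma> C. stopping_time (aug_filt X P) \<sigma> \<Longrightarrow> C \<in> sets (filt.pre_sigma \<sigma>) \<Longrightarrow>
      emeasure (Q y) (C \<inter> {\<omega>. \<theta> (\<sigma> \<omega>) \<omega> \<in> cyl r}) = (\<integral>\<^sup>+\<omega>. indicator C \<omega> * q (X (\<sigma> \<omega>) \<omega>) \<partial>Q y)"
    using Suc.hyps(1)[of r] by auto
  define v where "v = (\<lambda>z. indicator B z * q z)"
  have v: "v \<in> borel_measurable borel_pt" using q B by (simp add: v_def)
  \<comment> \<open>the event at the earliest time is absorbed into the past of the stopping time \<open>\<sigma> + s\<close>\<close>
  have step: "emeasure (Q y) (C \<inter> {\<omega>. \<theta> (\<sigma> \<omega>) \<omega> \<in> cyl l}) = (\<integral>\<^sup>+\<omega>. indicator C \<omega> * v (X (\<sigma> \<omega> + s) \<omega>) \<partial>Q y)"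
    if \<sigma>: "stopping_time (aug_filt X P) \<sigma>" and C: "C \<in> sets (filt.pre_sigma \<sigma>)" for y \<sigma> C
  proof -
    let ?\<tau> = "\<lambda>\<omega>. \<sigma> \<omega> + s"
    have \<tau>: "stopping_time (aug_filt X P) ?\<tau>" by (rule stopping_time_add[OF \<sigma> s])
    obtain E where E: "E \<in> sets (filt.pre_sigma ?\<tau>)" and AE: "AE \<omega> in Q y. X (\<sigma> \<omega> + s) \<omega> \<in> B \<longleftrightarrow> \<omega> \<in> E"
      using hitting_event(1)[OF \<tau> B, of y] by blast
    have C\<tau>: "C \<in> sets (filt.pre_sigma ?\<tau>)"
      using filt.mono_pre_sigma[OF \<sigma> \<tau>] C by (auto simp: add_increasing2)
    have CE: "C \<inter> E \<in> sets (filt.pre_sigma ?\<tau>)" using C\<tau> E by auto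
    have sub: "sets (filt.pre_sigma ?\<tau>) \<subseteq> sets (Q y)"
      using subalgebra_pre_sigma[OF \<tau>, of y] unfolding subalgebra_def by blast
    have "emeasure (Q y) (C \<inter> {\<omega>. \<theta> (\<sigma> \<omega>) \<omega> \<in> cyl l}) = emeasure (Q y) ((C \<inter> E) \<inter> {\<omega>. \<theta> (?\<tau> \<omega>) \<omega> \<in> cyl r})"
    proof (rule emeasure_eq_AE)
      show "AE \<omega> in Q y. \<omega> \<in> C \<inter> {\<omega>. \<theta> (\<sigma> \<omega>) \<omega> \<in> cyl l} \<longleftrightarrow> \<omega> \<in> (C \<inter> E) \<inter> {\<omega>. \<theta> (?\<tau> \<omega>) \<omega> \<in> cyl r}"
        using AE by eventually_elim (use cyl_Cons_shift[of s B l'] Suc.prems in \<open>auto simp: l r_def\<close>)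
      show "C \<inter> {\<omega>. \<theta> (\<sigma> \<omega>) \<omega> \<in> cyl l} \<in> sets (Q y)"
        using measurable_stopped_cyl[OF \<sigma> Suc.prems(2)] C\<tau> sub by blast
      show "(C \<inter> E) \<inter> {\<omega>. \<theta> (?\<tau> \<omega>) \<omega> \<in> cyl r} \<in> sets (Q y)"
        using measurable_stopped_cyl[OF \<tau> r_adm] CE sub by blast
    qed
    also have "\<dots> = (\<integral>\<^sup>+\<omega>. indicator (C \<inter> E) \<omega> * q (X (?\<tau> \<omega>) \<omega>) \<partial>Q y)"
      by (rule IH[OF \<tau> CE])
    also have "\<dots> = (\<integral>\<^sup>+\<omega>. indicator C \<omega> * v (X (\<sigma> \<omega> + s) \<omega>) \<partial>Q y)"
      by (rule nn_integral_cong_AE, use AE in eventually_elim) (auto simp: v_def indicator_def)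
    finally show ?thesis .
  qed
  have kernel: "(\<integral>\<^sup>+\<omega>. v (X s \<omega>) \<partial>Q z) = emeasure (P z) (cyl l)" for z
  proof -
    have [simp]: "stopping_time (aug_filt X P) (\<lambda>_. 0)" by (rule stopping_time_const)
    have "UNIV \<in> sets (filt.pre_sigma (\<lambda>_. 0))"
      using sets.top[of "filt.pre_sigma (\<lambda>_. 0)"] by (simp add: filt.space_pre_sigma)
    then have "emeasure (Q z) {\<omega>. \<theta> 0 \<omega> \<in> cyl l} = (\<integral>\<^sup>+\<omega>. v (X s \<omega>) \<partial>Q z)"
      using step[of "\<lambda>_. 0" UNIV z] by simp
    moreover have "{\<omega>. \<theta> 0 \<omega> \<in> cyl l} = cyl l" by (simp add: cyl_def shift_X)
    ultimately show ?thesis using emeasure_Q[OF cyl_in_N[OF Suc.prems(2)]] by simp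
  qed
  have "(\<lambda>y. \<integral>\<^sup>+z. v z \<partial>distr (P0 y) borel_pt (X s)) \<in> borel_measurable borel_pt"
    by (rule measurable_compose[OF measurable_law_X[OF s, THEN measurable_prob_algebraD]
          nn_integral_measurable_subprob_algebra[OF v]])
  moreover have "(\<integral>\<^sup>+z. v z \<partial>distr (P0 y) borel_pt (X s)) = emeasure (P y) (cyl l)" for y
    using v by (simp add: nn_integral_distr nn_integral_Q flip: kernel)
  ultimately show ?case
    using step markov_one[OF _ s v] by (simp add: kernel)
qed

lemma cyl_sort: "cyl (sort_key fst l) = cyl l" "admissible (sort_key fst l) = admissible l"
  by (auto simp: cyl_def admissible_def)

lemma measurable_prob_cyl: "admissible l \<Longrightarrow> (\<lambda>y. emeasure (P y) (cyl l)) \<in> borel_measurable borel_pt"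
  using markov_cyl_sorted[of "sort_key fst l"] by (simp add: cyl_sort)

lemma markov_cyl:
  assumes "stopping_time (aug_filt X P) \<sigma>" "C \<in> sets (filt.pre_sigma \<sigma>)" "admissible l"
  shows "emeasure (Q y) (C \<inter> {\<omega>. \<theta> (\<sigma> \<omega>) \<omega> \<in> cyl l}) =
    (\<integral>\<^sup>+\<omega>. indicator C \<omega> * emeasure (P (X (\<sigma> \<omega>) \<omega>)) (cyl l) \<partial>Q y)"
  using markov_cyl_sorted[of "sort_key fst l"] assms by (simp add: cyl_sort)

lemma sets_N_cyl: "sets N = sigma_sets UNIV {cyl l | l. admissible l}"
proof
  show "sets N \<subseteq> sigma_sets UNIV {cyl l | l. admissible l}"
    unfolding N_def sets_nat_filt
  proof (rule sigma_sets_mono, safe)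
    fix s B assume B: "B \<in> sets (borel_pt :: 's option measure)"
    show "X s -` B \<in> sigma_sets UNIV {cyl l | l. admissible l}"
    proof (cases "s < \<infinity>")
      case True
      then have "X s -` B = cyl [(s, B)]" "admissible [(s, B)]" using B by (auto simp: cyl_def admissible_def)
      then show ?thesis by auto
    next
      case False
      then have "X s -` B = (if None \<in> B then UNIV else {})"
        using X_infinity by (auto simp: not_less top_unique)
      then show ?thesis by (auto intro: sigma_sets_top sigma_sets.Empty)
    qed
  qed
  show "sigma_sets UNIV {cyl l | l. admissible l} \<subseteq> sets N"
    using sets.sigma_sets_subset[of "{cyl l | l. admissible l}" N] cyl_in_N by auto
qed

lemma Int_stable_cyl: "Int_stable {cyl l | l. admissible l}"
proof (rule Int_stableI, safe)
  fix k l assume "admissible k" "admissible l"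
  then show "\<exists>j. cyl k \<inter> cyl l = cyl j \<and> admissible j"
    by (intro exI[of _ "k @ l"]) (auto simp: cyl_def admissible_def)
qed

lemma P0_kernel: "P0 \<in> borel_pt \<rightarrow>\<^sub>M prob_algebra N"
proof (rule measurable_prob_algebra_generated[OF sets_N_cyl Int_stable_cyl])
  fix A assume "A \<in> {cyl l | l. admissible l}"
  then show "(\<lambda>a. emeasure (P0 a) A) \<in> borel_measurable borel_pt"
    using measurable_prob_cyl cyl_in_N by (auto simp: emeasure_P0)
qed (auto simp: prob_P0)

lemma measurable_theta_stopped:
  assumes "stopping_time (aug_filt X P) \<sigma>"
  shows "(\<lambda>\<omega>. \<theta> (\<sigma> \<omega>) \<omega>) \<in> Q y \<rightarrow>\<^sub>M N"
proof (rule measurable_sigma_sets[OF sets_N_cyl])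
  show "(\<lambda>\<omega>. \<theta> (\<sigma> \<omega>) \<omega>) -` A \<inter> space (Q y) \<in> sets (Q y)" if "A \<in> {cyl l | l. admissible l}" for A
    using that measurable_stopped_cyl[OF assms] by (auto simp: vimage_def)
qed auto

text \<open>This form makes the calculus of Markov kernels available for an arbitrary initial law.\<close>

lemma law_from_bind:
  assumes "\<nu> \<in> init_laws"
  shows "law_from X P \<nu> = completion (\<nu> \<bind> P0)"
proof -
  have \<nu>: "sets \<nu> = sets borel_pt" "space \<nu> \<noteq> {}"
    using assms prob_space.not_empty by (auto simp: init_laws_def)
  have k: "P0 \<in> \<nu> \<rightarrow>\<^sub>M subprob_algebra N"
    using measurable_prob_algebraD[OF P0_kernel] \<nu> by (simp cong: measurable_cong_sets)
  have [simp]: "sets (\<nu> \<bind> P0) = sets N"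
    using sets_bind[OF sets_kernel[OF k] \<nu>(2)] by simp
  have [simp]: "space (\<nu> \<bind> P0) = UNIV"
    using sets_eq_imp_space_eq[of "\<nu> \<bind> P0" N] by simp
  have "measure_of UNIV (sets N) (\<lambda>B. \<integral>\<^sup>+x. emeasure (P x) B \<partial>\<nu>) = measure_of UNIV (sets N) (emeasure (\<nu> \<bind> P0))"
  proof (rule measure_of_eq)
    fix A assume "A \<in> sigma_sets UNIV (sets N)"
    then have A: "A \<in> sets N" using sets.sigma_sets_eq[of N] by simp
    show "(\<integral>\<^sup>+x. emeasure (P x) A \<partial>\<nu>) = emeasure (\<nu> \<bind> P0) A"
      using A by (simp add: emeasure_bind[OF \<nu>(2) k A] emeasure_P0)
  qed simp
  also have "\<dots> = \<nu> \<bind> P0"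
    using measure_of_of_measure[of "\<nu> \<bind> P0"] by simp
  finally show ?thesis unfolding law_from_def N_def[symmetric] by simp
qed

text \<open>Membership in \<open>\<F>\<^sub>\<infinity>\<close> gives measurability for the completion of \<open>P\<^sub>\<nu>\<close>, which leaves an error inside a raw \<open>P\<^sub>\<nu>\<close>-null
  set \<open>Z\<close>; since \<open>P\<^sub>\<nu>\<close> is a mixture, \<open>Z\<close> is null for \<open>\<nu>\<close>-almost every starting point.\<close>

lemma Finf_sandwich:
  assumes H: "H \<in> sets Finf" and \<nu>: "\<nu> \<in> init_laws"
  shows "\<exists>S\<in>sets N. \<exists>Z\<in>sets N. S \<subseteq> H \<and> H \<subseteq> S \<union> Z \<and> (\<integral>\<^sup>+y. emeasure (P y) Z \<partial>\<nu>) = 0"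
proof -
  have \<nu>': "sets \<nu> = sets borel_pt" "space \<nu> \<noteq> {}"
    using \<nu> prob_space.not_empty by (auto simp: init_laws_def)
  have k: "P0 \<in> \<nu> \<rightarrow>\<^sub>M subprob_algebra N"
    using measurable_prob_algebraD[OF P0_kernel] \<nu>' by (simp cong: measurable_cong_sets)
  have sets_b: "sets (\<nu> \<bind> P0) = sets N"
    using sets_bind[OF sets_kernel[OF k] \<nu>'(2)] by auto
  have "H \<in> sets (completion (\<nu> \<bind> P0))"
    using H aug_le_law_from[OF \<nu>, of \<infinity>] by (auto simp: law_from_bind[OF \<nu>] Finf_def)
  then obtain S Z' Z where *: "H = S \<union> Z'" "Z' \<subseteq> Z" "Z \<in> null_sets (\<nu> \<bind> P0)" "S \<in> sets (\<nu> \<bind> P0)"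
    by (auto elim: sets_completionE)
  then have Z: "Z \<in> sets N" by (auto simp: sets_b)
  have "(\<integral>\<^sup>+y. emeasure (P y) Z \<partial>\<nu>) = emeasure (\<nu> \<bind> P0) Z"
    using Z by (simp add: emeasure_bind[OF \<nu>'(2) k Z] emeasure_P0)
  then show ?thesis using * Z by (intro bexI[of _ S] bexI[of _ Z]) (auto simp: sets_b)
qed

lemma measurable_stopping_time_Q:
  "stopping_time (aug_filt X P) \<sigma> \<Longrightarrow> \<sigma> \<in> borel_measurable (Q y)"
  by (rule measurable_stopping_time) (use aug_le_Q in auto)

text \<open>Cylinders determine the joint law of \<open>(\<sigma>, \<theta>\<^sub>\<sigma>)\<close> on the raw product \<open>\<sigma>\<close>-algebra: it is the mixture of the laws
  started at \<open>X\<^sub>\<sigma>\<close>.  A functional that is measurable only for the completed \<open>\<sigma>\<close>-algebra agrees with a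
  raw one up to a null set of this joint law, because by \<open>Finf_sandwich\<close>, used with the law of
  \<open>X\<^sub>\<sigma>\<close> as initial law, completed events differ from raw ones by a set that is null for almost every \<open>P\<close>
  at \<open>X\<^sub>\<sigma>\<close>.\<close>

lemma strong_markov_path:
  fixes F :: "real \<Rightarrow> 'w \<Rightarrow> ennreal"
  assumes \<sigma>: "stopping_time (aug_filt X P) \<sigma>"
    and F: "(\<lambda>(s, \<omega>). F s \<omega>) \<in> borel_measurable (borel \<Otimes>\<^sub>M Finf)"
  shows "(\<integral>\<^sup>+\<omega>. F (enn2real (\<sigma> \<omega>)) (\<theta> (\<sigma> \<omega>) \<omega>) * indicator {\<omega>. \<sigma> \<omega> < \<infinity>} \<omega> \<partial>Q y) =
    (\<integral>\<^sup>+\<omega>. (\<integral>\<^sup>+\<omega>'. F (enn2real (\<sigma> \<omega>)) \<omega>' \<partial>Q (X (\<sigma> \<omega>) \<omega>)) * indicator {\<omega>. \<sigma> \<omega> < \<infinity>} \<omega> \<partial>Q y)"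
proof -
  let ?A = "{\<omega>. \<sigma> \<omega> < \<infinity>}" and ?T = "\<lambda>\<omega>. enn2real (\<sigma> \<omega>)" and ?J = "borel \<Otimes>\<^sub>M N :: (real \<times> 'w) measure"
  let ?R = "density (Q y) (indicator ?A)"
  let ?f = "\<lambda>\<omega>. (?T \<omega>, \<theta> (\<sigma> \<omega>) \<omega>)"
  let ?k = "\<lambda>\<omega>. distr (P0 (X (\<sigma> \<omega>) \<omega>)) ?J (Pair (?T \<omega>))"
  have [measurable]: "\<sigma> \<in> borel_measurable (Q y)" by (rule measurable_stopping_time_Q[OF \<sigma>])
  have A[measurable]: "?A \<in> sets (Q y)"
  proof -
    have "{\<omega>\<in>space (Q y). \<sigma> \<omega> < \<infinity>} \<in> sets (Q y)" by measurable
    then show ?thesis by simp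
  qed
  note X\<sigma>[measurable] = measurable_X_stopped[OF \<sigma>, of y]
    and \<theta>\<sigma>[measurable] = measurable_theta_stopped[OF \<sigma>, of y]
  have f[measurable]: "?f \<in> Q y \<rightarrow>\<^sub>M ?J" by measurable
  have g: "(\<lambda>\<omega>. P0 (X (\<sigma> \<omega>) \<omega>)) \<in> ?R \<rightarrow>\<^sub>M subprob_algebra N"
    using measurable_compose[OF X\<sigma> measurable_prob_algebraD[OF P0_kernel]] by simp
  have k: "?k \<in> ?R \<rightarrow>\<^sub>M subprob_algebra ?J"
    by (rule measurable_distr2[OF _ g]) simp
  let ?E = "{a \<times> b | a b. a \<in> sets (borel :: real measure) \<and> b \<in> {cyl l | l. admissible l}}"
  have UNIV_cyl: "UNIV = cyl []" "admissible []" by (auto simp: cyl_def admissible_def)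
  have sJ: "sets ?J = sigma_sets UNIV ?E"
  proof -
    have "sets ?J = sets (sigma (space (borel :: real measure) \<times> space N) ?E)"
    proof (rule sets_pair_eq[where Ca = "{UNIV}" and Cb = "{UNIV}"])
      show "sets (borel :: real measure) = sigma_sets (space borel) (sets borel)"
        by (rule sets.sigma_sets_eq[symmetric])
    qed (use sets_N_cyl UNIV_cyl in auto)
    then show ?thesis by (simp add: sets_measure_of)
  qed
  have sk: "sets (?R \<bind> ?k) = sets ?J"
    using sets_bind[OF sets_kernel[OF k]] by simp
  have emk: "emeasure (?R \<bind> ?k) B = (\<integral>\<^sup>+\<omega>. emeasure (?k \<omega>) B * indicator ?A \<omega> \<partial>Q y)" if "B \<in> sets ?J" for B
  proof -
    have "emeasure (?R \<bind> ?k) B = (\<integral>\<^sup>+\<omega>. emeasure (?k \<omega>) B \<partial>?R)"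
      by (rule emeasure_bind[OF _ k that]) simp
    also have "\<dots> = (\<integral>\<^sup>+\<omega>. indicator ?A \<omega> * emeasure (?k \<omega>) B \<partial>Q y)"
      using measurable_compose[OF k measurable_emeasure_subprob_algebra[OF that]]
      by (subst nn_integral_density) auto
    finally show ?thesis by (simp add: mult.commute)
  qed
  \<comment> \<open>the joint law of the stopping time and the shifted path\<close>
  have eq: "distr ?R ?J ?f = ?R \<bind> ?k"
  proof (rule measure_eqI_generator_eq[where E = ?E and \<Omega> = UNIV and A = "\<lambda>_. UNIV \<times> UNIV"])
    show "Int_stable ?E"
    proof (rule Int_stableI, safe)
      fix a a' :: "real set" and j l assume *: "a \<in> sets borel" "a' \<in> sets borel" "admissible j" "admissible l"
      then have "(a \<times> cyl j) \<inter> (a' \<times> cyl l) = (a \<inter> a') \<times> cyl (j @ l)" "admissible (j @ l)"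
        by (auto simp: cyl_def admissible_def)
      then show "\<exists>b c. (a \<times> cyl j) \<inter> (a' \<times> cyl l) = b \<times> c \<and> b \<in> sets borel \<and> c \<in> {cyl l |l. admissible l}"
        using *(1,2) by blast
    qed
    show "sets (distr ?R ?J ?f) = sigma_sets UNIV ?E" "sets (?R \<bind> ?k) = sigma_sets UNIV ?E"
      using sJ sk by auto
    have "(UNIV :: real set) \<in> sets borel" "(UNIV :: 'w set) \<in> {cyl l | l. admissible l}"
      using UNIV_cyl by auto
    then have "(UNIV :: real set) \<times> (UNIV :: 'w set) \<in> ?E"
      by blast
    then show "range (\<lambda>_. UNIV \<times> UNIV) \<subseteq> ?E" by (rule image_subsetI)
    show "emeasure (distr ?R ?J ?f) (UNIV \<times> UNIV) \<noteq> \<infinity>" for i :: nat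
    proof -
      interpret prob_space "Q y" by (rule prob_Q)
      have "emeasure (distr ?R ?J ?f) (space ?J) = emeasure (Q y) ?A"
        using A sets.top[of ?J] by (subst emeasure_distr) (auto simp: space_pair_measure emeasure_restricted Int_absorb1)
      then show ?thesis by (simp add: space_pair_measure)
    qed
    fix B assume "B \<in> ?E"
    then obtain I l where B: "B = I \<times> cyl l" and I[measurable]: "I \<in> sets borel" and l: "admissible l" by auto
    have [measurable]: "cyl l \<in> sets N" by (rule cyl_in_N[OF l])
    let ?C = "{\<omega>. \<sigma> \<omega> < \<infinity> \<and> ?T \<omega> \<in> I}"
    have C: "?C \<in> sets (filt.pre_sigma \<sigma>)"
    proof -
      have [measurable]: "\<sigma> \<in> borel_measurable (filt.pre_sigma \<sigma>)"
        by (rule filt.measurable_stopping_time_pre_sigma[OF \<sigma>])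
      have "{\<omega>\<in>space (filt.pre_sigma \<sigma>). \<sigma> \<omega> < \<infinity> \<and> ?T \<omega> \<in> I} \<in> sets (filt.pre_sigma \<sigma>)" by measurable
      then show ?thesis by (simp add: filt.space_pre_sigma)
    qed
    have BJ: "B \<in> sets ?J" unfolding B by measurable
    have "emeasure (distr ?R ?J ?f) B = emeasure (Q y) (?A \<inter> (?f -` B \<inter> space (Q y)))"
      using A BJ measurable_sets[OF f BJ] by (simp add: emeasure_distr emeasure_restricted)
    also have "?A \<inter> (?f -` B \<inter> space (Q y)) = ?C \<inter> {\<omega>. \<theta> (\<sigma> \<omega>) \<omega> \<in> cyl l}"
      by (auto simp: B)
    also have "emeasure (Q y) \<dots> = (\<integral>\<^sup>+\<omega>. indicator ?C \<omega> * emeasure (P (X (\<sigma> \<omega>) \<omega>)) (cyl l) \<partial>Q y)"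
      by (rule markov_cyl[OF \<sigma> C l])
    also have "\<dots> = (\<integral>\<^sup>+\<omega>. emeasure (?k \<omega>) B * indicator ?A \<omega> \<partial>Q y)"
    proof (rule nn_integral_cong)
      fix \<omega>
      have "Pair (?T \<omega>) -` B = (if ?T \<omega> \<in> I then cyl l else {})" by (auto simp: B)
      then show "indicator ?C \<omega> * emeasure (P (X (\<sigma> \<omega>) \<omega>)) (cyl l) = emeasure (?k \<omega>) B * indicator ?A \<omega>"
        using BJ by (simp add: emeasure_distr emeasure_P0 indicator_def)
    qed
    also have "\<dots> = emeasure (?R \<bind> ?k) B" by (rule emk[OF BJ, symmetric])
    finally show "emeasure (distr ?R ?J ?f) B = emeasure (?R \<bind> ?k) B" .
  qed auto
  \<comment> \<open>the completion of the joint law sees all events of \<open>\<F>\<^sub>\<infinity>\<close>\<close>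
  define K where "K = distr ?R ?J ?f"
  have sK: "sets K = sets ?J" by (simp add: K_def)
  have Fc: "(\<lambda>(s, \<omega>). F s \<omega>) \<in> borel_measurable (completion K)"
  proof -
    define \<nu> where "\<nu> = distr (Q y) borel_pt (\<lambda>\<omega>. X (\<sigma> \<omega>) \<omega>)"
    have \<nu>: "\<nu> \<in> init_laws"
      unfolding init_laws_def \<nu>_def using prob_space.prob_space_distr[OF prob_Q X\<sigma>] by simp
    have rect: "I \<times> H \<in> sets (completion K)" if I: "I \<in> sets (borel :: real measure)" and H: "H \<in> sets Finf" for I H
    proof -
      obtain S Z where S: "S \<in> sets N" and Z[measurable]: "Z \<in> sets N" and sub: "S \<subseteq> H" "H \<subseteq> S \<union> Z"
        and null: "(\<integral>\<^sup>+x. emeasure (P x) Z \<partial>\<nu>) = 0"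
        using Finf_sandwich[OF H \<nu>] by blast
      have UZ: "UNIV \<times> Z \<in> sets ?J" by measurable
      have "emeasure K (UNIV \<times> Z) = (\<integral>\<^sup>+\<omega>. emeasure (?k \<omega>) (UNIV \<times> Z) * indicator ?A \<omega> \<partial>Q y)"
        unfolding K_def eq by (rule emk[OF UZ])
      also have "\<dots> \<le> (\<integral>\<^sup>+\<omega>. emeasure (P0 (X (\<sigma> \<omega>) \<omega>)) Z \<partial>Q y)"
        by (rule nn_integral_mono) (use UZ in \<open>auto simp: emeasure_distr indicator_def vimage_Times comp_def\<close>)
      also have "\<dots> = (\<integral>\<^sup>+x. emeasure (P0 x) Z \<partial>\<nu>)"
        unfolding \<nu>_def
        by (subst nn_integral_distr[OF X\<sigma>])
           (use measurable_compose[OF measurable_prob_algebraD[OF P0_kernel] measurable_emeasure_subprob_algebra[OF Z]] in simp_all)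
      also have "\<dots> = 0" using null by (simp add: emeasure_P0)
      finally have "UNIV \<times> Z \<in> null_sets K" using UZ by (auto simp: sK)
      moreover have "I \<times> S \<in> sets K" using I S by (simp add: sK)
      moreover have "I \<times> H = I \<times> S \<union> (I \<times> (H - S))" using sub by auto
      moreover have "I \<times> (H - S) \<subseteq> UNIV \<times> Z" using sub by auto
      ultimately show ?thesis by (intro sets_completionI[of _ "I \<times> S" "I \<times> (H - S)" "UNIV \<times> Z"]) auto
    qed
    have "space K = UNIV" by (simp add: K_def space_pair_measure)
    moreover have "sets (borel \<Otimes>\<^sub>M Finf :: (real \<times> 'w) measure) \<subseteq> sets (completion K)"
      unfolding sets_pair_measure
      by (rule sets.sigma_sets_subset') (use rect \<open>space K = UNIV\<close> sets.top[of "completion K"] in auto)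
    ultimately show ?thesis
      using F by (auto simp: measurable_def space_pair_measure)
  qed
  obtain F1 where F1K: "F1 \<in> borel_measurable K" and AE: "AE z in K. (\<lambda>(s, \<omega>). F s \<omega>) z = F1 z"
    using completion_ex_borel_measurable[OF Fc] by auto
  have F1[measurable]: "F1 \<in> borel_measurable ?J" using F1K sK by (simp cong: measurable_cong_sets)
  obtain Z where Z: "Z \<in> null_sets K" and ZF: "\<And>z. z \<notin> Z \<Longrightarrow> (\<lambda>(s, \<omega>). F s \<omega>) z = F1 z"
  proof -
    obtain Z where "Z \<in> null_sets K" "{z\<in>space K. (\<lambda>(s, \<omega>). F s \<omega>) z \<noteq> F1 z} \<subseteq> Z"
      using AE by (auto simp: eventually_ae_filter)
    moreover have "space K = UNIV" by (simp add: K_def space_pair_measure)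
    ultimately show ?thesis by (intro that[of Z]) blast+
  qed
  have [measurable]: "Z \<in> sets ?J" using Z sK by auto
  have AEZ: "AE z in K. z \<notin> Z" using Z by (rule AE_not_in)
  have 1: "AE \<omega> in Q y. \<omega> \<in> ?A \<longrightarrow> ?f \<omega> \<notin> Z"
  proof -
    have "AE z in distr ?R ?J ?f. z \<notin> Z" using AEZ by (simp only: K_def)
    then have "AE \<omega> in ?R. ?f \<omega> \<notin> Z" by (rule AE_distrD[rotated]) (use f in simp)
    then show ?thesis by (subst (asm) AE_density) (auto simp: indicator_def elim!: eventually_mono split: if_splits)
  qed
  have 2: "AE \<omega> in Q y. \<omega> \<in> ?A \<longrightarrow> (AE \<omega>' in P0 (X (\<sigma> \<omega>) \<omega>). (?T \<omega>, \<omega>') \<notin> Z)"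
  proof -
    have "AE z in ?R \<bind> ?k. z \<notin> Z" using AEZ by (simp only: K_def eq)
    then have "AE \<omega> in ?R. AE z in ?k \<omega>. z \<notin> Z"
      by (subst (asm) AE_bind[OF k]) auto
    then have "AE \<omega> in ?R. AE \<omega>' in P0 (X (\<sigma> \<omega>) \<omega>). (?T \<omega>, \<omega>') \<notin> Z"
      by (rule eventually_mono) (rule AE_distrD[of _ _ ?J], auto)
    then show ?thesis by (subst (asm) AE_density) (auto simp: indicator_def elim!: eventually_mono split: if_splits)
  qed
  have "(\<integral>\<^sup>+\<omega>. F (?T \<omega>) (\<theta> (\<sigma> \<omega>) \<omega>) * indicator ?A \<omega> \<partial>Q y) = (\<integral>\<^sup>+\<omega>. indicator ?A \<omega> * F1 (?f \<omega>) \<partial>Q y)"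
    by (rule nn_integral_cong_AE, use 1 in eventually_elim) (use ZF in \<open>auto simp: indicator_def\<close>)
  also have "\<dots> = (\<integral>\<^sup>+z. F1 z \<partial>K)"
    by (simp add: K_def nn_integral_distr nn_integral_density)
  also have "\<dots> = (\<integral>\<^sup>+\<omega>. (\<integral>\<^sup>+z. F1 z \<partial>?k \<omega>) \<partial>?R)"
    unfolding K_def eq by (rule nn_integral_bind[OF F1 k])
  also have "\<dots> = (\<integral>\<^sup>+\<omega>. indicator ?A \<omega> * (\<integral>\<^sup>+z. F1 z \<partial>?k \<omega>) \<partial>Q y)"
    using measurable_compose[OF k nn_integral_measurable_subprob_algebra[OF F1]]
    by (subst nn_integral_density) simp_all
  also have "\<dots> = (\<integral>\<^sup>+\<omega>. (\<integral>\<^sup>+\<omega>'. F (?T \<omega>) \<omega>' \<partial>Q (X (\<sigma> \<omega>) \<omega>)) * indicator ?A \<omega> \<partial>Q y)"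
  proof (rule nn_integral_cong_AE, use 2 in eventually_elim)
    fix \<omega> assume *: "\<omega> \<in> ?A \<longrightarrow> (AE \<omega>' in P0 (X (\<sigma> \<omega>) \<omega>). (?T \<omega>, \<omega>') \<notin> Z)"
    have "(\<integral>\<^sup>+\<omega>'. F1 (?T \<omega>, \<omega>') \<partial>P0 (X (\<sigma> \<omega>) \<omega>)) = (\<integral>\<^sup>+\<omega>'. F (?T \<omega>) \<omega>' \<partial>P0 (X (\<sigma> \<omega>) \<omega>))" if "\<omega> \<in> ?A"
      by (rule nn_integral_cong_AE, use *[rule_format, OF that] in eventually_elim) (use ZF in force)
    then show "indicator ?A \<omega> * (\<integral>\<^sup>+z. F1 z \<partial>?k \<omega>) = (\<integral>\<^sup>+\<omega>'. F (?T \<omega>) \<omega>' \<partial>Q (X (\<sigma> \<omega>) \<omega>)) * indicator ?A \<omega>"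
      by (auto simp: indicator_def nn_integral_distr nn_integral_Q)
  qed
  finally show ?thesis .
qed

lemma markov_path:
  assumes H: "H \<in> borel_measurable Finf" and t: "t < \<infinity>"
  shows "(\<integral>\<^sup>+\<omega>. H (\<theta> t \<omega>) \<partial>Q y) = (\<integral>\<^sup>+\<omega>. (\<integral>\<^sup>+\<omega>'. H \<omega>' \<partial>Q (X t \<omega>)) \<partial>Q y)"
proof -
  have "(\<lambda>(s :: real, \<omega>). H \<omega>) \<in> borel_measurable (borel \<Otimes>\<^sub>M Finf)" using H by simp
  from strong_markov_path[OF stopping_time_const[of _ t] this, of y] t show ?thesis by simp
qed

section \<open>Joint measurability of the paths\<close>

lemma measurable_into_borel_pt:
  fixes f :: "'b \<Rightarrow> 's option"
  assumes "\<And>U. open U \<Longrightarrow> f -` (Some ` U) \<inter> space L \<in> sets L"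
  shows "f \<in> L \<rightarrow>\<^sub>M borel_pt"
  unfolding borel_pt_def
proof (rule measurable_measure_of)
  fix V :: "'s option set" assume "V \<in> {U. openin one_point U}"
  then consider U where "open U" "V = Some ` U" | C where "closed C" "V = insert None (Some ` (UNIV - C))"
    by (auto simp: openin_Alexandroff_compactification)
  then show "f -` V \<inter> space L \<in> sets L"
  proof cases
    case 2
    have "f -` V \<inter> space L = (f -` (Some ` (UNIV - C)) \<inter> space L) \<union> (space L - (f -` (Some ` UNIV) \<inter> space L))"
      using 2 by (auto simp: image_iff)
    then show ?thesis using assms[of "UNIV - C"] assms[of UNIV] 2 by auto
  qed (use assms in auto)
qed auto

lemma open_union_relatively_compact:
  fixes U :: "'s set"
  assumes "open U"
  obtains \<V> where "countable \<V>" "\<Union>\<V> = U" "\<And>V. V \<in> \<V> \<Longrightarrow> open V \<and> compact (closure V)"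
proof -
  let ?V = "{V. open V \<and> V \<subseteq> U \<and> compact (closure V)}"
  have "U \<subseteq> \<Union>?V"
  proof
    fix x assume x: "x \<in> U"
    have "\<exists>W. open W \<and> (\<exists>K. compact K \<and> x \<in> W \<and> W \<subseteq> K)"
      using locally_compact by (simp add: locally_compact_space_def)
    then obtain W K where W: "open W" "x \<in> W" "W \<subseteq> K" "compact K" by blast
    have "closure (U \<inter> W) \<subseteq> K"
      using W by (intro closure_minimal) (auto intro: compact_imp_closed)
    then have "compact (closure (U \<inter> W))"
      using W(4) by (metis closed_closure compact_Int_closed inf.absorb_iff2)
    then show "x \<in> \<Union>?V" using W x assms by (intro UnionI[of "U \<inter> W"]) auto
  qed
  then have "\<Union>?V = U" by auto
  moreover obtain \<V> where "\<V> \<subseteq> ?V" "countable \<V>" "\<Union>\<V> = \<Union>?V"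
    by (rule Lindelof[of ?V]) auto
  ultimately show ?thesis by (intro that[of \<V>]) auto
qed

text \<open>These points tend to \<open>s\<close> strictly from the right, and for each \<open>n\<close> there are countably many of them.\<close>

definition grid :: "nat \<Rightarrow> real \<Rightarrow> real" where
  "grid n s = (real_of_int \<lfloor>s * real (Suc n)\<rfloor> + 1) / real (Suc n)"

lemma grid_gt: "s < grid n s"
  by (simp add: grid_def field_simps) linarith

lemma grid_tendsto: "(\<lambda>n. grid n s) \<longlonglongrightarrow> s"
proof (rule real_tendsto_sandwich[of "\<lambda>_. s" _ _ "\<lambda>n. s + inverse (real (Suc n))"])
  have "grid n s \<le> s + inverse (real (Suc n))" for n
  proof -
    have "grid n s \<le> (s * real (Suc n) + 1) / real (Suc n)"
      unfolding grid_def by (intro divide_right_mono) auto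
    then show ?thesis by (simp add: add_divide_distrib inverse_eq_divide)
  qed
  then show "\<forall>\<^sub>F n in sequentially. grid n s \<le> s + inverse (real (Suc n))" by simp
  show "(\<lambda>n. s + inverse (real (Suc n))) \<longlonglongrightarrow> s"
    using tendsto_add[OF tendsto_const LIMSEQ_inverse_real_of_nat, of s] by simp
qed (simp_all add: less_imp_le[OF grid_gt])

lemma grid_at_right: "0 \<le> s \<Longrightarrow> filterlim (\<lambda>n. ennreal (grid n s)) (at_right (ennreal s)) sequentially"
proof -
  assume "0 \<le> s"
  then have "ennreal s < ennreal (grid n s)" for n using grid_gt[of s n] by (simp add: ennreal_less_iff)
  then have "ennreal (grid n s) \<in> {ennreal s<..}" "ennreal (grid n s) \<noteq> ennreal s" for n
    using less_imp_neq by (metis greaterThan_iff)+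
  then show ?thesis
    unfolding filterlim_at by (intro conjI always_eventually allI tendsto_ennrealI grid_tendsto)
qed

text \<open>The sets of points whose ball of radius \<open>1 / (k + 1)\<close> stays in \<open>V\<close> are compact and exhaust \<open>V\<close>.  If the
  path eventually stays in one of them along times tending to \<open>s\<close> from the right, then by right continuity in
  the compactification compactness keeps the limit \<open>X\<^sub>s\<close> in it.  Conversely, a path that is in \<open>V\<close> at time \<open>s\<close> has a whole
  ball to move in.\<close>

lemma X_in_relatively_compact_iff:
  fixes V :: "'s set"
  assumes V: "open V" "compact (closure V)" and s: "0 \<le> s"
  shows "X (ennreal s) \<omega> \<in> Some ` V \<longleftrightarrow>
    (\<exists>k. \<exists>n0. \<forall>n\<ge>n0. X (ennreal (grid n s)) \<omega> \<in> Some ` {x. ball x (inverse (real (Suc k))) \<subseteq> V})"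
proof -
  let ?C = "\<lambda>k. {x. ball x (inverse (real (Suc k))) \<subseteq> V}"
  have lim: "limitin one_point (\<lambda>n. X (ennreal (grid n s)) \<omega>) (X (ennreal s) \<omega>) sequentially"
  proof -
    have "limitin one_point (\<lambda>s. X s \<omega>) (X (ennreal s) \<omega>) (at_right (ennreal s))"
      by (rule right_cont) simp
    then show ?thesis
      unfolding limitin_def using grid_at_right[OF s] by (auto simp: filterlim_iff)
  qed
  have C_closed: "closed (?C k)" for k
  proof -
    have "?C k = - (\<Union>y\<in>-V. ball y (inverse (real (Suc k))))"
      by (auto simp: dist_commute subset_eq)
    then show ?thesis by (simp only:) (intro closed_Compl open_UN ballI open_ball)
  qed
  have C_sub: "?C k \<subseteq> V" for k by (auto simp: subset_eq)
  have C_compact: "compact (?C k)" for k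
  proof -
    have "?C k \<subseteq> closure V" using C_sub closure_subset by blast
    then show ?thesis using V(2) C_closed by (metis compact_Int_closed inf.absorb_iff2)
  qed
  show ?thesis
  proof
    assume "X (ennreal s) \<omega> \<in> Some ` V"
    then obtain x where x: "X (ennreal s) \<omega> = Some x" "x \<in> V" by auto
    obtain e where e: "e > 0" "ball x e \<subseteq> V" using V(1) x(2) open_contains_ball by blast
    obtain k where k: "inverse (real (Suc k)) < e / 2" using reals_Archimedean[of "e / 2"] e by auto
    have sub: "ball x (e / 2) \<subseteq> ?C k"
    proof safe
      fix z w assume z: "z \<in> ball x (e / 2)" and w: "w \<in> ball z (inverse (real (Suc k)))"
      have "dist x w \<le> dist x z + dist z w" by (rule dist_triangle)
      also have "\<dots> < e" using z w k by simp
      finally show "w \<in> V" using e by auto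
    qed
    have "openin one_point (Some ` ball x (e / 2))" by simp
    moreover have "X (ennreal s) \<omega> \<in> Some ` ball x (e / 2)" using x e by auto
    ultimately have "\<forall>\<^sub>F n in sequentially. X (ennreal (grid n s)) \<omega> \<in> Some ` ball x (e / 2)"
      using lim unfolding limitin_def by blast
    then have "\<forall>\<^sub>F n in sequentially. X (ennreal (grid n s)) \<omega> \<in> Some ` ?C k"
      by (rule eventually_mono) (use sub in blast)
    then show "\<exists>k n0. \<forall>n\<ge>n0. X (ennreal (grid n s)) \<omega> \<in> Some ` ?C k"
      by (auto simp: eventually_sequentially)
  next
    assume "\<exists>k n0. \<forall>n\<ge>n0. X (ennreal (grid n s)) \<omega> \<in> Some ` ?C k"
    then obtain k n0 where kn: "\<And>n. n \<ge> n0 \<Longrightarrow> X (ennreal (grid n s)) \<omega> \<in> Some ` ?C k" by auto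
    show "X (ennreal s) \<omega> \<in> Some ` V"
    proof (rule ccontr)
      assume "X (ennreal s) \<omega> \<notin> Some ` V"
      then have "X (ennreal s) \<omega> \<notin> Some ` ?C k" using C_sub[of k] by blast
      moreover have "z \<in> insert None (Some ` (topspace euclidean - C))" if "z \<notin> Some ` C" for z and C :: "'s set"
        using that by (cases z) auto
      ultimately have "X (ennreal s) \<omega> \<in> insert None (Some ` (topspace euclidean - ?C k))" by blast
      moreover have "openin one_point (insert None (Some ` (topspace euclidean - ?C k)))"
        unfolding openin_Alexandroff_compactification using C_compact[of k] C_closed[of k]
        by (intro disjI2 exI[of _ "?C k"]) auto
      ultimately have "\<forall>\<^sub>F n in sequentially. X (ennreal (grid n s)) \<omega> \<in> insert None (Some ` (topspace euclidean - ?C k))"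
        using lim unfolding limitin_def by blast
      then obtain n1 where "\<And>n. n \<ge> n1 \<Longrightarrow> X (ennreal (grid n s)) \<omega> \<in> insert None (Some ` (topspace euclidean - ?C k))"
        by (auto simp: eventually_sequentially)
      from this[of "max n0 n1"] kn[of "max n0 n1"] show False by auto
    qed
  qed
qed

text \<open>The criterion of \<open>X_in_relatively_compact_iff\<close> involves countably many times only; a countable cover by relatively
  compact open sets reduces every open set to it.\<close>

lemma measurable_X_joint:
  "(\<lambda>(s, \<omega>). X (ennreal s) \<omega>) \<in> borel \<Otimes>\<^sub>M N \<rightarrow>\<^sub>M borel_pt"
proof (rule measurable_into_borel_pt)
  fix U :: "'s set" assume "open U"
  then obtain \<V> where \<V>: "countable \<V>" "\<Union>\<V> = U" "\<And>V. V \<in> \<V> \<Longrightarrow> open V \<and> compact (closure V)"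
    by (rule open_union_relatively_compact) auto
  let ?C = "\<lambda>V k. {x. ball x (inverse (real (Suc k))) \<subseteq> V}"
  have C: "Some ` ?C V k \<in> sets borel_pt" for k and V :: "'s set"
  proof -
    have "?C V k = - (\<Union>y\<in>-V. ball y (inverse (real (Suc k))))"
      by (auto simp: dist_commute subset_eq)
    then have "closed (?C V k)" by (simp only:) (intro closed_Compl open_UN ballI open_ball)
    then show ?thesis by (intro image_Some_borel_pt) auto
  qed
  have g[measurable]: "(\<lambda>(s, \<omega>). X (ennreal (grid n (max 0 s))) \<omega>) \<in> borel \<Otimes>\<^sub>M N \<rightarrow>\<^sub>M borel_pt" for n
  proof -
    have "(\<lambda>z. X (ennreal ((real_of_int i + 1) / real (Suc n))) (snd z)) \<in> (borel :: real measure) \<Otimes>\<^sub>M N \<rightarrow>\<^sub>M borel_pt" for i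
      by measurable
    moreover have "(\<lambda>z. \<lfloor>max 0 (fst z) * real (Suc n)\<rfloor>) \<in> (borel :: real measure) \<Otimes>\<^sub>M N \<rightarrow>\<^sub>M count_space UNIV"
      by measurable
    ultimately show ?thesis
      unfolding grid_def split_beta by (rule measurable_compose_countable)
  qed
  let ?L = "borel \<Otimes>\<^sub>M N :: (real \<times> 'w) measure"
  define G where "G V k n = (\<lambda>(s, \<omega>). X (ennreal (grid n (max 0 s))) \<omega>) -` (Some ` ?C V k) \<inter> space ?L" for V k n
  have GS: "G V k n \<in> sets ?L" for V k n
    unfolding G_def by (rule measurable_sets[OF g C])
  have "(\<lambda>(s, \<omega>). X (ennreal s) \<omega>) -` (Some ` U) \<inter> space ?L = (\<Union>V\<in>\<V>. \<Union>k. \<Union>n0. \<Inter>n\<in>{n0..}. G V k n)"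
    (is "?l = ?r")
  proof (rule set_eqI)
    fix z :: "real \<times> 'w"
    obtain s \<omega> where z: "z = (s, \<omega>)" by (cases z)
    have "X (ennreal s) \<omega> \<in> Some ` U \<longleftrightarrow> (\<exists>V\<in>\<V>. X (ennreal (max 0 s)) \<omega> \<in> Some ` V)"
      using \<V>(2) by (auto simp: max_def ennreal_neg not_le)
    also have "\<dots> \<longleftrightarrow> (\<exists>V\<in>\<V>. \<exists>k. \<exists>n0. \<forall>n\<ge>n0. X (ennreal (grid n (max 0 s))) \<omega> \<in> Some ` ?C V k)"
      using \<V>(3) by (intro bex_cong refl X_in_relatively_compact_iff) auto
    also have "\<dots> \<longleftrightarrow> (\<exists>V\<in>\<V>. \<exists>k. \<exists>n0. \<forall>n\<ge>n0. z \<in> G V k n)"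
      by (simp add: G_def z space_pair_measure)
    finally show "z \<in> ?l \<longleftrightarrow> z \<in> ?r"
      by (simp add: z space_pair_measure, simp add: Ball_def)
  qed
  also have "\<dots> \<in> sets ?L"
  proof (rule sets.countable_UN''[OF \<V>(1)])
    have "(\<Inter>n\<in>{n0..}. G V k n) \<in> sets ?L" for V k n0
      by (rule sets.countable_INT') (use GS in auto)
    then show "(\<Union>k. \<Union>n0. \<Inter>n\<in>{n0..}. G V k n) \<in> sets ?L" for V
      by (intro sets.countable_UN image_subsetI)
  qed
  finally show "(\<lambda>(s, \<omega>). X (ennreal s) \<omega>) -` (Some ` U) \<inter> space ?L \<in> sets ?L" .
qed

end

section \<open>Time change of a continuous increasing path\<close>

lemma borel_measurable_ennrealI:
  fixes f :: "'b \<Rightarrow> ennreal"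
  assumes "\<And>s. 0 \<le> s \<Longrightarrow> {x\<in>space L. f x < ennreal s} \<in> sets L"
  shows "f \<in> borel_measurable L"
proof (rule borel_measurableI_less)
  fix y :: ennreal
  show "{x\<in>space L. f x < y} \<in> sets L"
  proof (cases y)
    case (real r)
    then show ?thesis using assms[of r] by simp
  next
    case top
    have "{x\<in>space L. f x < y} = (\<Union>n::nat. {x\<in>space L. f x < ennreal (real n)})"
    proof (safe, simp_all)
      fix x assume "f x < y"
      then obtain r where "f x = ennreal r" "0 \<le> r" by (cases "f x") (auto simp: top)
      moreover obtain n where "r < real n" using reals_Archimedean2 by blast
      ultimately show "\<exists>n. f x < ennreal (real n)" by (auto simp: ennreal_less_iff)
    next
      fix x n assume "f x < ennreal (real n)"
      then show "f x < y" using less_top order_less_trans top by fastforce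
    qed
    then show ?thesis using assms by auto
  qed
qed

text \<open>The right-continuous inverse of the clock: the time at which the level \<open>u\<close> is exceeded.\<close>

definition inv_clock :: "(real \<Rightarrow> ennreal) \<Rightarrow> real \<Rightarrow> ennreal" where
  "inv_clock a u = Inf {ennreal s | s. 0 \<le> s \<and> ennreal u < a s}"

definition clock_measure :: "(real \<Rightarrow> ennreal) \<Rightarrow> ennreal \<Rightarrow> real measure" where
  "clock_measure a z = measure_of UNIV (sets borel)
     (\<lambda>B. SUP r\<in>{r. 0 \<le> r \<and> ennreal r < z}.
        emeasure (interval_measure (\<lambda>s. enn2real (a (min r (max 0 s))))) B)"

text \<open>A path of a positive continuous additive functional up to and after its life time \<open>z\<close>, at
  which it may explode.\<close>

locale clock =
  fixes a :: "real \<Rightarrow> ennreal" and z :: ennreal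
  assumes zero: "a 0 = 0"
    and mono: "0 \<le> s \<Longrightarrow> s \<le> t \<Longrightarrow> a s \<le> a t"
    and cont: "continuous_on {0..} a"
    and fin: "0 \<le> t \<Longrightarrow> ennreal t < z \<Longrightarrow> a t < \<infinity>"
    and stop: "0 \<le> t \<Longrightarrow> z \<le> ennreal t \<Longrightarrow> a t = a (enn2real z)"
begin

text \<open>Continuity of the clock turns the infimum into an exact equivalence, through which
  measurability questions and the stopping time property of the inverse reduce to the clock itself.\<close>

lemma inv_clock_less_iff:
  assumes s: "0 \<le> s"
  shows "inv_clock a u < ennreal s \<longleftrightarrow> ennreal u < a s"
proof
  assume "inv_clock a u < ennreal s"
  then obtain r where "0 \<le> r" "ennreal u < a r" "ennreal r < ennreal s"
    by (auto simp: inv_clock_def Inf_less_iff)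
  then show "ennreal u < a s" using mono[of r s] by (auto simp: ennreal_less_iff)
next
  assume u: "ennreal u < a s"
  then have "s \<noteq> 0" using zero by auto
  then have s': "s > 0" using s by simp
  have "(a \<longlongrightarrow> a s) (at s within {0..})" using cont s by (auto simp: continuous_on)
  then have "\<forall>\<^sub>F r in at s within {0..}. ennreal u < a r" using u by (rule order_tendstoD)
  then obtain d where d: "d > 0" "\<And>r. r \<ge> 0 \<Longrightarrow> r \<noteq> s \<Longrightarrow> dist r s < d \<Longrightarrow> ennreal u < a r"
    by (auto simp: eventually_at)
  let ?r = "max 0 (s - d / 2)"
  have "ennreal u < a ?r" using d s' by (intro d(2)) (auto simp: dist_real_def)
  then have "inv_clock a u \<le> ennreal ?r" unfolding inv_clock_def by (intro Inf_lower CollectI exI[of _ ?r]) auto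
  also have "\<dots> < ennreal s" using s' d by (intro ennreal_lessI) auto
  finally show "inv_clock a u < ennreal s" .
qed

text \<open>The clock stands still from \<open>z\<close> on, so a level that is exceeded at all is exceeded before \<open>z\<close>.\<close>

lemma inv_clock_less_life:
  assumes "inv_clock a u < \<infinity>"
  shows "inv_clock a u < z"
proof -
  obtain r where r: "0 \<le> r" "ennreal u < a r"
    using assms by (auto simp: inv_clock_def Inf_less_iff)
  show ?thesis
  proof (cases "ennreal r < z")
    case True
    then show ?thesis using r inv_clock_less_iff[of r u] by auto
  next
    case False
    then have le: "z \<le> ennreal r" by simp
    then have "z < \<infinity>" by (auto simp: le_less_trans)
    then have "ennreal (enn2real z) = z" by simp
    then show ?thesis
      using inv_clock_less_iff[of "enn2real z" u] r stop[OF r(1) le] by simp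
  qed
qed

lemma clock_inverse:
  assumes "inv_clock a u < \<infinity>"
  shows "a (enn2real (inv_clock a u)) = ennreal u"
proof (rule antisym)
  let ?T = "enn2real (inv_clock a u)"
  have T: "ennreal ?T = inv_clock a u" using assms by simp
  show "a ?T \<le> ennreal u"
    using inv_clock_less_iff[of "enn2real (inv_clock a u)" u, OF enn2real_nonneg] T by (simp add: not_less[symmetric])
  show "ennreal u \<le> a ?T"
  proof (rule ccontr)
    assume "\<not> ennreal u \<le> a ?T"
    then have "a ?T < ennreal u" by simp
    moreover have "(a \<longlongrightarrow> a ?T) (at ?T within {0..})" using cont by (auto simp: continuous_on)
    ultimately have "\<forall>\<^sub>F r in at ?T within {0..}. a r < ennreal u" by (metis order_tendstoD(2))
    then obtain d where d: "d > 0" "\<And>r. r \<ge> 0 \<Longrightarrow> r \<noteq> ?T \<Longrightarrow> dist r ?T < d \<Longrightarrow> a r < ennreal u"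
      by (auto simp: eventually_at)
    have "a (?T + d / 2) < ennreal u"
      using d(1) by (intro d(2)) (auto simp: dist_real_def)
    moreover have "inv_clock a u < ennreal (?T + d / 2)"
      using d(1) by (subst T[symmetric]) (simp add: ennreal_less_iff del: ennreal_enn2real)
    then have "ennreal u < a (?T + d / 2)" by (subst (asm) inv_clock_less_iff) (use d(1) in auto)
    ultimately show False by simp
  qed
qed

lemma inv_clock_measurable [measurable]: "inv_clock a \<in> borel_measurable borel"
proof (rule borel_measurable_ennrealI)
  fix s :: real assume "0 \<le> s"
  have "{u\<in>space borel. ennreal u < a s} \<in> sets borel" by measurable
  then show "{u\<in>space borel. inv_clock a u < ennreal s} \<in> sets borel"
    using inv_clock_less_iff[OF \<open>0 \<le> s\<close>] by simp
qed

text \<open>An interval \<open>(\<alpha>, \<beta>]\<close> has Stieltjes mass \<open>G \<beta> - G \<alpha>\<close>, which is the Lebesgue measure of the levels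
  passed in it: the inverse lies in \<open>(\<alpha>, \<beta>]\<close> for the levels in \<open>[G \<alpha>, G \<beta>)\<close>, apart from at most the two end points.\<close>

lemma interval_measure_stopped:
  assumes r: "0 \<le> r" "ennreal r < z" and B: "B \<in> sets borel"
  shows "emeasure (interval_measure (\<lambda>s. enn2real (a (min r (max 0 s))))) B =
    emeasure lborel {u. 0 \<le> u \<and> inv_clock a u < ennreal r \<and> enn2real (inv_clock a u) \<in> B}"
proof -
  define G where "G s = enn2real (a (min r (max 0 s)))" for s
  have ar: "a r < \<infinity>" by (rule fin[OF r])
  have af: "a (min r (max 0 s)) < \<infinity>" for s
    using mono[of "min r (max 0 s)" r] r ar by (auto intro: le_less_trans)
  have G: "ennreal (G s) = a (min r (max 0 s))" for s
    using af[of s] by (simp add: G_def)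
  have G_mono: "G s \<le> G t" if "s \<le> t" for s t
    unfolding G_def using that r af[of t]
    by (intro enn2real_mono mono) (auto simp: min_def max_def)
  have G_nonneg: "0 \<le> G s" for s by (simp add: G_def)
  have G_cont: "continuous_on UNIV G"
  proof -
    have "continuous_on UNIV (\<lambda>s. a (min r (max 0 s)))"
      by (rule continuous_on_compose2[OF cont]) (use r in \<open>auto intro!: continuous_intros\<close>)
    then show ?thesis
      unfolding continuous_on_def G_def using af by (auto intro!: tendsto_enn2real simp: less_top)
  qed
  let ?U = "{u. 0 \<le> u \<and> inv_clock a u < ennreal r}"
  have U: "?U \<in> sets borel"
  proof -
    have "{u\<in>space borel. 0 \<le> u \<and> inv_clock a u < ennreal r} \<in> sets borel" by measurable
    then show ?thesis by simp
  qed
  have less: "enn2real (inv_clock a u) < s \<longleftrightarrow> u < G s" if "u \<in> ?U" for u s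
  proof -
    have u: "0 \<le> u" "inv_clock a u < ennreal r" using that by auto
    have fin: "inv_clock a u < \<infinity>" using u(2) by (simp add: order_less_trans)
    have T: "ennreal (enn2real (inv_clock a u)) = inv_clock a u" using fin by simp
    show ?thesis
    proof (cases "0 \<le> s")
      case True
      have "enn2real (inv_clock a u) < s \<longleftrightarrow> inv_clock a u < ennreal s"
        by (subst T[symmetric]) (simp add: ennreal_less_iff del: ennreal_enn2real)
      also have "\<dots> \<longleftrightarrow> inv_clock a u < ennreal (min r s)"
        using u(2) by (auto simp: min_def) (meson ennreal_leI not_le order_less_le_trans)
      also have "\<dots> \<longleftrightarrow> ennreal u < a (min r (max 0 s))"
        using True r by (subst inv_clock_less_iff) auto
      also have "\<dots> \<longleftrightarrow> u < G s"
        unfolding G[symmetric] using u(1) by (simp add: ennreal_less_iff)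
      finally show ?thesis .
    next
      case False
      then have "G s = 0" using r(1) zero by (cases "r = 0") (auto simp: G_def min_def max_def)
      moreover have "\<not> enn2real (inv_clock a u) < s" using False enn2real_nonneg[of "inv_clock a u"] by linarith
      ultimately show ?thesis using u by simp
    qed
  qed
  have le1: "u \<le> G s" if "u \<in> ?U" "enn2real (inv_clock a u) \<le> s" for u s
  proof (rule ccontr)
    assume "\<not> u \<le> G s"
    then have "G s < u" by simp
    moreover have "(G \<longlongrightarrow> G s) (at s)" using G_cont by (simp add: continuous_on_def)
    ultimately have "\<forall>\<^sub>F q in at s. G q < u" by (metis order_tendstoD(2))
    then obtain d where d: "d > 0" "\<And>q. q \<noteq> s \<Longrightarrow> dist q s < d \<Longrightarrow> G q < u"
      by (auto simp: eventually_at)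
    have "G (s + d / 2) < u" using d(1) by (intro d(2)) (auto simp: dist_real_def)
    moreover have "u < G (s + d / 2)" using less[OF that(1), of "s + d / 2"] that(2) d(1) by linarith
    ultimately show False by simp
  qed
  let ?m2 = "distr (restrict_space lborel ?U) borel (\<lambda>u. enn2real (inv_clock a u))"
  have T_meas: "(\<lambda>u. enn2real (inv_clock a u)) \<in> restrict_space lborel ?U \<rightarrow>\<^sub>M borel"
    by (rule measurable_restrict_space1) simp
  have m2: "emeasure ?m2 C = emeasure lborel {u. 0 \<le> u \<and> inv_clock a u < ennreal r \<and> enn2real (inv_clock a u) \<in> C}" if "C \<in> sets borel" for C
  proof -
    have "emeasure ?m2 C = emeasure (restrict_space lborel ?U) ((\<lambda>u. enn2real (inv_clock a u)) -` C \<inter> ?U)"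
      using that U by (subst emeasure_distr[OF T_meas]) (auto simp: space_restrict_space)
    also have "\<dots> = emeasure lborel ((\<lambda>u. enn2real (inv_clock a u)) -` C \<inter> ?U)"
      using U by (intro emeasure_restrict_space) auto
    also have "(\<lambda>u. enn2real (inv_clock a u)) -` C \<inter> ?U = {u. 0 \<le> u \<and> inv_clock a u < ennreal r \<and> enn2real (inv_clock a u) \<in> C}" by auto
    finally show ?thesis .
  qed
  let ?E = "range (\<lambda>(\<alpha>, \<beta>). {\<alpha> <.. \<beta> :: real})"
  have "interval_measure G = ?m2"
  proof (rule measure_eqI_generator_eq[where E = ?E and \<Omega> = UNIV and A = "\<lambda>i::nat. {- real i <.. real i}"])
    show "Int_stable ?E"
    proof (rule Int_stableI)
      fix A B assume "A \<in> ?E" "B \<in> ?E"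
      then obtain \<alpha> \<beta> \<gamma> \<delta> where "A = {\<alpha> <.. \<beta>}" "B = {\<gamma> <.. \<delta>}" by auto
      then have "A \<inter> B = (\<lambda>(\<alpha>, \<beta>). {\<alpha> <.. \<beta>}) (max \<alpha> \<gamma>, min \<beta> \<delta>)" by auto
      then show "A \<inter> B \<in> ?E" by (simp only: rangeI)
    qed
    show "sets (interval_measure G) = sigma_sets UNIV ?E" "sets ?m2 = sigma_sets UNIV ?E"
      by (simp_all add: borel_sigma_sets_Ioc)
    show "(\<Union>i::nat. {- real i <.. real i}) = UNIV"
    proof (safe, simp_all)
      fix x :: real
      obtain n :: nat where "\<bar>x\<bar> < real n" using reals_Archimedean2 by blast
      then show "\<exists>i. - real i < x \<and> x \<le> real i" by (intro exI[of _ n]) auto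
    qed
    have Gr: "continuous (at_right s) G" for s
      using G_cont by (simp add: continuous_on_eq_continuous_within continuous_within_subset[of s UNIV])
    show "emeasure (interval_measure G) {- real i <.. real i} \<noteq> \<infinity>" for i :: nat
      by (subst emeasure_interval_measure_Ioc) (use G_mono Gr in auto)
    fix C assume "C \<in> ?E"
    then obtain \<alpha> \<beta> where C: "C = {\<alpha> <.. \<beta>}" by auto
    show "emeasure (interval_measure G) C = emeasure ?m2 C"
    proof (cases "\<alpha> \<le> \<beta>")
      case True
      have "emeasure ?m2 C = emeasure lborel {u. 0 \<le> u \<and> inv_clock a u < ennreal r \<and> enn2real (inv_clock a u) \<in> C}"
        by (rule m2) (simp add: C)
      also have "\<dots> = emeasure lborel {G \<alpha> ..< G \<beta>}"
      proof (rule emeasure_eq_AE)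
        have "AE u in lborel. u \<noteq> G \<alpha> \<and> u \<noteq> G \<beta>"
          using AE_lborel_singleton[of "G \<alpha>"] AE_lborel_singleton[of "G \<beta>"] by eventually_elim simp
        then show "AE u in lborel. u \<in> {u. 0 \<le> u \<and> inv_clock a u < ennreal r \<and> enn2real (inv_clock a u) \<in> C} \<longleftrightarrow> u \<in> {G \<alpha> ..< G \<beta>}"
        proof eventually_elim
          fix u assume ne: "u \<noteq> G \<alpha> \<and> u \<noteq> G \<beta>"
          have in_U: "u \<in> ?U" if "0 \<le> u" "u < G \<beta>"
          proof -
            have "ennreal u < a (min r (max 0 \<beta>))" using that by (simp add: G[symmetric] ennreal_less_iff)
            also have "\<dots> \<le> a r" using r by (intro mono) auto
            finally show ?thesis using that r by (simp add: inv_clock_less_iff)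
          qed
          show "u \<in> {u. 0 \<le> u \<and> inv_clock a u < ennreal r \<and> enn2real (inv_clock a u) \<in> C} \<longleftrightarrow> u \<in> {G \<alpha> ..< G \<beta>}"
          proof
            assume "u \<in> {u. 0 \<le> u \<and> inv_clock a u < ennreal r \<and> enn2real (inv_clock a u) \<in> C}"
            then have "u \<in> ?U" "\<alpha> < enn2real (inv_clock a u)" "enn2real (inv_clock a u) \<le> \<beta>" by (auto simp: C)
            then show "u \<in> {G \<alpha> ..< G \<beta>}" using le1[of u \<beta>] less[of u \<alpha>] ne by auto
          next
            assume u: "u \<in> {G \<alpha> ..< G \<beta>}"
            then have "u \<in> ?U" using G_nonneg[of \<alpha>] by (intro in_U) auto
            then show "u \<in> {u. 0 \<le> u \<and> inv_clock a u < ennreal r \<and> enn2real (inv_clock a u) \<in> C}"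
              using le1[of u \<alpha>] less[of u \<beta>] ne u by (force simp: C)
          qed
        qed
        have "{u\<in>space borel. 0 \<le> u \<and> inv_clock a u < ennreal r \<and> enn2real (inv_clock a u) \<in> {\<alpha> <.. \<beta>}} \<in> sets borel" by measurable
        then show "{u. 0 \<le> u \<and> inv_clock a u < ennreal r \<and> enn2real (inv_clock a u) \<in> C} \<in> sets lborel" by (simp add: C)
      qed simp
      also have "\<dots> = ennreal (G \<beta> - G \<alpha>)" using G_mono[OF True] by simp
      finally show ?thesis
        unfolding C by (subst emeasure_interval_measure_Ioc) (use True G_mono Gr in auto)
    qed (simp add: C)
  qed auto
  then show ?thesis using m2[OF B] unfolding G_def[abs_def] by simp
qed

definition "D = clock_measure a z"

text \<open>Stopping at \<open>r < z\<close> cuts off the levels passed at or after \<open>r\<close>.  As \<open>r\<close> increases to \<open>z\<close>, all levels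
  with a finite passage time are reached, by \<open>inv_clock_less_life\<close>.\<close>

lemma clock_measure_eq: "D = distr (restrict_space lborel {u. 0 \<le> u \<and> inv_clock a u < \<infinity>}) borel (\<lambda>u. enn2real (inv_clock a u))"
proof -
  let ?U = "{u. 0 \<le> u \<and> inv_clock a u < \<infinity>}"
  let ?m = "distr (restrict_space lborel ?U) borel (\<lambda>u. enn2real (inv_clock a u))"
  have U: "?U \<in> sets borel"
  proof -
    have "{u\<in>space borel. 0 \<le> u \<and> inv_clock a u < \<infinity>} \<in> sets borel" by measurable
    then show ?thesis by simp
  qed
  have T_meas: "(\<lambda>u. enn2real (inv_clock a u)) \<in> restrict_space lborel ?U \<rightarrow>\<^sub>M borel"
    by (rule measurable_restrict_space1) simp
  have m: "emeasure ?m C = emeasure lborel {u. 0 \<le> u \<and> inv_clock a u < \<infinity> \<and> enn2real (inv_clock a u) \<in> C}" if "C \<in> sets borel" for C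
  proof -
    have "emeasure ?m C = emeasure (restrict_space lborel ?U) ((\<lambda>u. enn2real (inv_clock a u)) -` C \<inter> ?U)"
      using that U by (subst emeasure_distr[OF T_meas]) (auto simp: space_restrict_space)
    also have "\<dots> = emeasure lborel ((\<lambda>u. enn2real (inv_clock a u)) -` C \<inter> ?U)"
      using U by (intro emeasure_restrict_space) auto
    also have "(\<lambda>u. enn2real (inv_clock a u)) -` C \<inter> ?U = {u. 0 \<le> u \<and> inv_clock a u < \<infinity> \<and> enn2real (inv_clock a u) \<in> C}" by auto
    finally show ?thesis .
  qed
  have "clock_measure a z = measure_of UNIV (sets borel) (emeasure ?m)"
    unfolding clock_measure_def
  proof (rule measure_of_eq)
    fix B :: "real set" assume "B \<in> sigma_sets UNIV (sets borel)"
    then have B[measurable]: "B \<in> sets borel" using sets.sigma_sets_eq[of "borel :: real measure"] by simp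
    define S where "S r = {u. 0 \<le> u \<and> inv_clock a u < ennreal r \<and> enn2real (inv_clock a u) \<in> B}" for r
    have S: "S r \<in> sets lborel" for r
    proof -
      have "{u\<in>space borel. 0 \<le> u \<and> inv_clock a u < ennreal r \<and> enn2real (inv_clock a u) \<in> B} \<in> sets borel" by measurable
      then show ?thesis by (simp add: S_def)
    qed
    let ?R = "{r. 0 \<le> r \<and> ennreal r < z}" and ?W = "{u. 0 \<le> u \<and> inv_clock a u < \<infinity> \<and> enn2real (inv_clock a u) \<in> B}"
    have W: "?W \<in> sets lborel"
    proof -
      have "{u\<in>space borel. 0 \<le> u \<and> inv_clock a u < \<infinity> \<and> enn2real (inv_clock a u) \<in> B} \<in> sets borel" by measurable
      then show ?thesis by simp
    qed
    have "(SUP r\<in>?R. emeasure (interval_measure (\<lambda>s. enn2real (a (min r (max 0 s))))) B) = (SUP r\<in>?R. emeasure lborel (S r))"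
      by (intro SUP_cong refl) (simp add: interval_measure_stopped S_def)
    also have "\<dots> = emeasure lborel ?W"
    proof (rule antisym)
      show "(SUP r\<in>?R. emeasure lborel (S r)) \<le> emeasure lborel ?W"
        by (intro SUP_least emeasure_mono W) (auto simp: S_def intro: order_less_trans)
      show "emeasure lborel ?W \<le> (SUP r\<in>?R. emeasure lborel (S r))"
      proof (cases "z = 0")
        case True
        then have "?W = {}" using inv_clock_less_life by auto
        then show ?thesis by (simp only: emeasure_empty zero_le)
      next
        case False
        \<comment> \<open>a sequence in \<open>[0, z)\<close> that increases to \<open>z\<close>, finite or not\<close>
        define \<rho> where "\<rho> n = (if z = \<infinity> then real n else enn2real z * (real n / real (Suc n)))" for n
        have \<rho>R: "\<rho> n \<in> ?R" for n
        proof (cases z)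
          case (real q)
          then have "q > 0" using False by (cases "q = 0") auto
          then have "q * (real n / real (Suc n)) < q * 1" by (intro mult_strict_left_mono) auto
          then show ?thesis using real by (auto simp: \<rho>_def ennreal_less_iff)
        qed (simp add: \<rho>_def)
        have \<rho>_mono: "\<rho> m \<le> \<rho> n" if "m \<le> n" for m n
          unfolding \<rho>_def using that by (auto intro!: mult_left_mono simp: field_simps)
        have inc: "incseq (\<lambda>n. S (\<rho> n))"
          unfolding incseq_def S_def using ennreal_leI[OF \<rho>_mono] by (auto intro: order_less_le_trans)
        have "?W \<subseteq> (\<Union>n. S (\<rho> n))"
        proof safe
          fix u assume u: "0 \<le> u" "inv_clock a u < \<infinity>" "enn2real (inv_clock a u) \<in> B"
          have "\<exists>n. inv_clock a u < ennreal (\<rho> n)"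
          proof (cases z)
            case (real q)
            have "(\<lambda>n. ennreal (q * (real n / real (Suc n)))) \<longlonglongrightarrow> ennreal (q * 1)"
              by (intro tendsto_ennrealI tendsto_mult tendsto_const LIMSEQ_n_over_Suc_n)
            moreover have "inv_clock a u < ennreal (q * 1)" using inv_clock_less_life[OF u(2)] real by simp
            ultimately have "\<forall>\<^sub>F n in sequentially. inv_clock a u < ennreal (q * (real n / real (Suc n)))"
              by (rule order_tendstoD)
            then show ?thesis using real by (auto simp: \<rho>_def eventually_sequentially)
          next
            case top
            obtain n where "enn2real (inv_clock a u) < real n" using reals_Archimedean2 by blast
            moreover have "ennreal (enn2real (inv_clock a u)) = inv_clock a u" using u(2) by simp
            ultimately have "inv_clock a u < ennreal (real n)" by (metis enn2real_nonneg ennreal_less_iff)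
            then show ?thesis using top by (auto simp: \<rho>_def)
          qed
          then show "u \<in> (\<Union>n. S (\<rho> n))" using u by (auto simp: S_def)
        qed
        then have "emeasure lborel ?W \<le> emeasure lborel (\<Union>n. S (\<rho> n))"
          using S by (intro emeasure_mono) auto
        also have "\<dots> = (SUP n. emeasure lborel (S (\<rho> n)))"
          using S inc by (intro SUP_emeasure_incseq[symmetric]) auto
        also have "\<dots> \<le> (SUP r\<in>?R. emeasure lborel (S r))"
          using \<rho>R by (intro SUP_mono) auto
        finally show ?thesis .
      qed
    qed
    also have "\<dots> = emeasure ?m B" by (rule m[OF B, symmetric])
    finally show "(SUP r\<in>?R. emeasure (interval_measure (\<lambda>s. enn2real (a (min r (max 0 s))))) B) = emeasure ?m B" .
  qed simp
  also have "\<dots> = ?m" using measure_of_of_measure[of ?m] by simp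
  finally show ?thesis by (simp add: D_def)
qed

lemma nn_integral_clock:
  assumes [measurable]: "f \<in> borel_measurable borel"
  shows "(\<integral>\<^sup>+s. f s \<partial>D) = (\<integral>\<^sup>+u. f (enn2real (inv_clock a u)) * indicator {u. 0 \<le> u \<and> inv_clock a u < \<infinity>} u \<partial>lborel)"
proof -
  have U: "{u. 0 \<le> u \<and> inv_clock a u < \<infinity>} \<in> sets borel"
  proof -
    have "{u\<in>space borel. 0 \<le> u \<and> inv_clock a u < \<infinity>} \<in> sets borel" by measurable
    then show ?thesis by simp
  qed
  show ?thesis
    unfolding clock_measure_eq
    by (subst nn_integral_distr) (use U in \<open>auto intro!: measurable_restrict_space1 simp: nn_integral_restrict_space\<close>)
qed

end

section \<open>Additive functionals and their time change\<close>

text \<open>Data given for positive times are extended by zero, so that the whole real line can serve as time axis.\<close>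

lemma measurable_extend_pos:
  assumes f: "(\<lambda>(s, y). f s y) \<in> borel_measurable (restrict_space borel {0<..} \<Otimes>\<^sub>M L)"
  shows "(\<lambda>(s :: real, y). if 0 < s then f s y else (0 :: ennreal)) \<in> borel_measurable (borel \<Otimes>\<^sub>M L)"
proof -
  have "(\<lambda>z. (if 0 < fst z then fst z else 1, snd z)) \<in> borel \<Otimes>\<^sub>M L \<rightarrow>\<^sub>M restrict_space borel {0 :: real<..} \<Otimes>\<^sub>M L"
    by (intro measurable_Pair measurable_restrict_space2) auto
  from measurable_compose[OF this f]
  have [measurable]: "(\<lambda>z. f (if 0 < fst z then fst z else 1) (snd z)) \<in> borel_measurable (borel \<Otimes>\<^sub>M L)" by simp
  have "(\<lambda>z. if 0 < fst z then f (if 0 < fst z then fst z else 1) (snd z) else 0) \<in> borel_measurable (borel \<Otimes>\<^sub>M L)"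
    by measurable
  then show ?thesis
    by (rule measurable_cong[THEN iffD1, rotated]) auto
qed

text \<open>Functions on the state space vanish at the cemetery.\<close>

definition lift :: "('s \<Rightarrow> ennreal) \<Rightarrow> 's option \<Rightarrow> ennreal" where
  "lift f y = (case y of None \<Rightarrow> 0 | Some x \<Rightarrow> f x)"

lemma lift_simps [simp]: "lift f None = 0" "lift f (Some x) = f x"
  by (simp_all add: lift_def)

lemma measurable_lift2:
  assumes f: "(\<lambda>(l, x). f l x) \<in> borel_measurable (L \<Otimes>\<^sub>M (borel :: 's::t2_space measure))"
  shows "(\<lambda>(l, y). lift (f l) y) \<in> borel_measurable (L \<Otimes>\<^sub>M borel_pt)"
proof -
  have [measurable]: "case_option undefined (\<lambda>x. x) \<in> borel_pt \<rightarrow>\<^sub>M (borel :: 's measure)"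
    by (rule measurable_borel_ptI) simp_all
  have [measurable]: "range Some \<in> sets (borel_pt :: 's option measure)"
    by (rule image_Some_borel_pt) simp
  note f[measurable]
  have "(\<lambda>z. indicator (range Some) (snd z) * (\<lambda>(l, x). f l x) (fst z, case_option undefined (\<lambda>x. x) (snd z)))
      \<in> borel_measurable (L \<Otimes>\<^sub>M borel_pt)"
    by measurable
  moreover have "(\<lambda>z. indicator (range Some) (snd z) * (\<lambda>(l, x). f l x) (fst z, case_option undefined (\<lambda>x. x) (snd z)))
    = (\<lambda>(l, y). lift (f l) y)"
  proof
    fix z :: "'a \<times> 's option"
    show "indicator (range Some) (snd z) * (\<lambda>(l, x). f l x) (fst z, case_option undefined (\<lambda>x. x) (snd z))
      = (\<lambda>(l, y). lift (f l) y) z"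
      by (cases z; cases "snd z") auto
  qed
  ultimately show ?thesis by (simp only:)
qed

lemma measurable_lift [measurable (raw)]:
  assumes "f \<in> borel_measurable (borel :: 's::t2_space measure)"
  shows "lift f \<in> borel_measurable borel_pt"
  by (rule measurable_borel_ptI) (use assms in simp_all)

lemma lift_mono: "(\<And>x. f x \<le> g x) \<Longrightarrow> lift f y \<le> lift g y"
  by (cases y) auto

locale pcaf = hunt M X P \<theta>
  for M :: "'w measure"
    and X :: "ennreal \<Rightarrow> 'w \<Rightarrow> 's::{metric_space, second_countable_topology} option"
    and P :: "'s option \<Rightarrow> 'w measure"
    and \<theta> :: "ennreal \<Rightarrow> 'w \<Rightarrow> 'w" +
  fixes A :: "real \<Rightarrow> 'w \<Rightarrow> ennreal" and \<Lambda> :: "'w set"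
  assumes adapted: "0 \<le> t \<Longrightarrow> A t \<in> borel_measurable (aug_filt X P (ennreal t))"
    and defining: "defining_set X P \<theta> A \<Lambda>"
    and A_outside: "0 \<le> t \<Longrightarrow> \<omega> \<notin> \<Lambda> \<Longrightarrow> A t \<omega> = 0"
begin

abbreviation "\<zeta> \<equiv> life_time X"

lemma \<Lambda>_Finf: "\<Lambda> \<in> sets Finf"
  using defining by (simp add: defining_set_def Finf_def)

lemma A_add: "\<omega> \<in> \<Lambda> \<Longrightarrow> 0 \<le> s \<Longrightarrow> 0 \<le> t \<Longrightarrow> A (t + s) \<omega> = A t \<omega> + A s (\<theta> (ennreal t) \<omega>)"
  using defining by (simp add: defining_set_def)

lemma AE_Q_iff: "{\<omega>. R \<omega>} \<in> sets Finf \<Longrightarrow> (AE \<omega> in Q y. R \<omega>) \<longleftrightarrow> emeasure (Q y) {\<omega>. R \<omega>} = 1"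
proof -
  assume "{\<omega>. R \<omega>} \<in> sets Finf"
  then have R: "{\<omega>. R \<omega>} \<in> sets (Q y)" using aug_le_Q[of \<infinity> y] by (auto simp: Finf_def)
  interpret prob_space "Q y" by (rule prob_Q)
  show ?thesis using AE_in_set_eq_1[OF R] by (simp add: emeasure_eq_measure)
qed

lemma AE_\<Lambda>: "AE \<omega> in Q (Some x). \<omega> \<in> \<Lambda>"
  using AE_Q_iff[of "\<lambda>\<omega>. \<omega> \<in> \<Lambda>" "Some x"] \<Lambda>_Finf defining by (simp add: defining_set_def Q_Some)

text \<open>Off the defining set the functional vanishes, so every path is a clock.\<close>

lemma clock: "clock (\<lambda>t. A t \<omega>) (\<zeta> \<omega>)"
proof (cases "\<omega> \<in> \<Lambda>")
  case True
  show ?thesis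
  proof
    show "A s \<omega> \<le> A t \<omega>" if "0 \<le> s" "s \<le> t" for s t
      using A_add[OF True, of "t - s" s] that by simp
  qed (use True defining in \<open>auto simp: defining_set_def\<close>)
next
  case False
  then have eq: "A t \<omega> = 0" if "0 \<le> t" for t using A_outside that by simp
  show ?thesis
  proof
    show "continuous_on {0..} (\<lambda>t. A t \<omega>)"
      by (rule continuous_on_eq[OF continuous_on_const[of _ 0]]) (simp add: eq)
  qed (simp_all add: eq)
qed

definition \<tau> :: "real \<Rightarrow> 'w \<Rightarrow> ennreal" where
  "\<tau> u \<omega> = inv_clock (\<lambda>t. A t \<omega>) u"

lemma \<tau>_less_iff: "0 \<le> s \<Longrightarrow> \<tau> u \<omega> < ennreal s \<longleftrightarrow> ennreal u < A s \<omega>"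
  unfolding \<tau>_def by (rule clock.inv_clock_less_iff[OF clock])

lemma \<tau>_less_life: "\<tau> u \<omega> < \<infinity> \<Longrightarrow> \<tau> u \<omega> < \<zeta> \<omega>"
  unfolding \<tau>_def by (rule clock.inv_clock_less_life[OF clock])

lemma A_\<tau>: "\<tau> u \<omega> < \<infinity> \<Longrightarrow> A (enn2real (\<tau> u \<omega>)) \<omega> = ennreal u"
  unfolding \<tau>_def by (rule clock.clock_inverse[OF clock])

lemma A_mono: "0 \<le> s \<Longrightarrow> s \<le> t \<Longrightarrow> A s \<omega> \<le> A t \<omega>"
  by (rule clock.mono[OF clock])

lemma A_finite: "0 \<le> t \<Longrightarrow> ennreal t < \<zeta> \<omega> \<Longrightarrow> A t \<omega> < \<infinity>"
  by (rule clock.fin[OF clock])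

lemma A_0: "A 0 \<omega> = 0"
  by (rule clock.zero[OF clock])

lemma measurable_A: "0 \<le> t \<Longrightarrow> A t \<in> borel_measurable Finf"
  using adapted[of t] filt.sets_F_mono[of "ennreal t" \<infinity>] by (auto simp: measurable_def Finf_def)

text \<open>The event \<open>{\<tau>\<^sub>u < s}\<close> is \<open>{u < A\<^sub>s}\<close> and so belongs to \<open>\<F>\<^sub>s\<close>; right continuity of the filtration
  gives \<open>{\<tau>\<^sub>u \<le> t}\<close>.\<close>

lemma stopping_\<tau>: "stopping_time (aug_filt X P) (\<tau> u)"
proof
  have less: "{\<omega>. \<tau> u \<omega> < ennreal s} \<in> sets (aug_filt X P (ennreal s))" if "0 \<le> s" for s
  proof -
    have "{\<omega>\<in>space (aug_filt X P (ennreal s)). ennreal u < A s \<omega>} \<in> sets (aug_filt X P (ennreal s))"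
      using adapted[OF that] by measurable
    then show ?thesis by (simp add: \<tau>_less_iff that)
  qed
  fix t :: ennreal
  show "Measurable.pred (aug_filt X P t) (\<lambda>\<omega>. \<tau> u \<omega> \<le> t)"
  proof (cases t)
    case (real r)
    have "{\<omega>. \<tau> u \<omega> \<le> t} \<in> sets (aug_filt X P s)" if s: "s \<in> {t<..}" for s
    proof -
      obtain N where N: "ennreal (r + inverse (real (Suc N))) \<le> s"
      proof -
        have "(\<lambda>n. ennreal (r + inverse (real (Suc n)))) \<longlonglongrightarrow> ennreal (r + 0)"
          by (intro tendsto_ennrealI tendsto_add tendsto_const LIMSEQ_inverse_real_of_nat)
        moreover have "ennreal (r + 0) < s" using s real by (simp only: add_0_right greaterThan_iff)
        ultimately have "\<forall>\<^sub>F n in sequentially. ennreal (r + inverse (real (Suc n))) < s"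
          by (rule order_tendstoD)
        then show ?thesis using that by (auto simp: eventually_sequentially intro: less_imp_le)
      qed
      have "{\<omega>. \<tau> u \<omega> \<le> t} = (\<Inter>n\<in>{N..}. {\<omega>. \<tau> u \<omega> < ennreal (r + inverse (real (Suc n)))})"
      proof (intro set_eqI iffI)
        fix \<omega> assume "\<omega> \<in> {\<omega>. \<tau> u \<omega> \<le> t}"
        then have "\<tau> u \<omega> \<le> ennreal r" using real by simp
        moreover have "ennreal r < ennreal (r + inverse (real (Suc n)))" for n
          using real by (intro ennreal_lessI) (auto intro: add_nonneg_pos)
        ultimately show "\<omega> \<in> (\<Inter>n\<in>{N..}. {\<omega>. \<tau> u \<omega> < ennreal (r + inverse (real (Suc n)))})"
          by (auto intro: le_less_trans)
      next
        fix \<omega> assume *: "\<omega> \<in> (\<Inter>n\<in>{N..}. {\<omega>. \<tau> u \<omega> < ennreal (r + inverse (real (Suc n)))})"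
        have "(\<lambda>n. ennreal (r + inverse (real (Suc n)))) \<longlonglongrightarrow> ennreal (r + 0)"
          by (intro tendsto_ennrealI tendsto_add tendsto_const LIMSEQ_inverse_real_of_nat)
        then have "\<tau> u \<omega> \<le> ennreal (r + 0)"
          by (rule tendsto_lowerbound) (use * in \<open>auto simp: eventually_sequentially intro!: exI[of _ N] less_imp_le\<close>)
        then show "\<omega> \<in> {\<omega>. \<tau> u \<omega> \<le> t}" using real by simp
      qed
      also have "\<dots> \<in> sets (aug_filt X P s)"
      proof (rule sets.countable_INT')
        show "(\<lambda>n. {\<omega>. \<tau> u \<omega> < ennreal (r + inverse (real (Suc n)))}) ` {N..} \<subseteq> sets (aug_filt X P s)"
        proof (rule image_subsetI)
          fix n assume "n \<in> {N..}"
          then have "inverse (real (Suc n)) \<le> inverse (real (Suc N))" by (intro le_imp_inverse_le) auto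
          then have "ennreal (r + inverse (real (Suc n))) \<le> s"
            by (intro order_trans[OF ennreal_leI N]) linarith
          from filt.sets_F_mono[OF this] less[of "r + inverse (real (Suc n))"]
          show "{\<omega>. \<tau> u \<omega> < ennreal (r + inverse (real (Suc n)))} \<in> sets (aug_filt X P s)"
            using real by (auto simp: add_nonneg_nonneg)
        qed
      qed auto
      finally show ?thesis .
    qed
    then have "{\<omega>. \<tau> u \<omega> \<le> t} \<in> sets (aug_filt X P t)"
      using filt_right_cont[of t] real by auto
    then show ?thesis by (simp add: pred_def)
  qed simp
qed

lemma measurable_\<tau>_joint: "(\<lambda>(u, \<omega>). \<tau> u \<omega>) \<in> borel_measurable (borel \<Otimes>\<^sub>M Finf)"
proof (rule borel_measurable_ennrealI)
  fix s :: real assume s: "0 \<le> s"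
  note measurable_A[OF s, measurable]
  have "{z\<in>space (borel \<Otimes>\<^sub>M Finf). ennreal (fst z) < A s (snd z)} \<in> sets (borel \<Otimes>\<^sub>M Finf)"
    by measurable
  then show "{z\<in>space (borel \<Otimes>\<^sub>M Finf). (\<lambda>(u, \<omega>). \<tau> u \<omega>) z < ennreal s} \<in> sets (borel \<Otimes>\<^sub>M Finf)"
    by (simp add: \<tau>_less_iff[OF s] split_beta)
qed

lemma measurable_\<tau>2 [measurable (raw)]:
  "f \<in> borel_measurable L \<Longrightarrow> g \<in> L \<rightarrow>\<^sub>M Finf \<Longrightarrow> (\<lambda>z. \<tau> (f z) (g z)) \<in> borel_measurable L"
  using measurable_compose[OF measurable_Pair measurable_\<tau>_joint, of f L g] by simp

text \<open>By \<open>\<tau>_less_iff\<close>, superlevel sets of \<open>A\<close> are comparisons of \<open>\<tau>\<close> with the time coordinate.\<close>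

lemma measurable_A_joint: "(\<lambda>(s, \<omega>). A (max 0 s) \<omega>) \<in> borel_measurable (borel \<Otimes>\<^sub>M Finf)"
proof (rule borel_measurableI_greater)
  fix y :: ennreal
  show "{z\<in>space (borel \<Otimes>\<^sub>M Finf). y < (\<lambda>(s, \<omega>). A (max 0 s) \<omega>) z} \<in> sets (borel \<Otimes>\<^sub>M Finf)"
  proof (cases y)
    case (real u)
    have "{z\<in>space (borel \<Otimes>\<^sub>M Finf). \<tau> u (snd z) < ennreal (max 0 (fst z))} \<in> sets (borel \<Otimes>\<^sub>M Finf)"
      by measurable
    then show ?thesis by (simp add: \<tau>_less_iff real split_beta del: ennreal_max_0 ennreal_max_0')
  qed simp
qed

lemma measurable_A2:
  "f \<in> borel_measurable L \<Longrightarrow> g \<in> L \<rightarrow>\<^sub>M Finf \<Longrightarrow> (\<lambda>z. A (max 0 (f z)) (g z)) \<in> borel_measurable L"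
  using measurable_compose[OF measurable_Pair measurable_A_joint, of f L g] by simp

lemma measurable_X2 [measurable (raw)]:
  assumes "f \<in> borel_measurable L" "g \<in> L \<rightarrow>\<^sub>M Finf"
  shows "(\<lambda>z. X (ennreal (f z)) (g z)) \<in> L \<rightarrow>\<^sub>M borel_pt"
proof -
  have g: "g \<in> L \<rightarrow>\<^sub>M N" using assms(2) N_le_Finf by (auto simp: measurable_def)
  show ?thesis using measurable_compose[OF measurable_Pair[OF assms(1) g] measurable_X_joint] by simp
qed

lemma X_\<tau>_Some: "\<tau> u \<omega> < \<infinity> \<Longrightarrow> X (\<tau> u \<omega>) \<omega> \<noteq> None"
  using \<tau>_less_life[of u \<omega>] by (simp add: absorbed)

section \<open>Integrals against an additive functional\<close>

text \<open>The levels \<open>u\<close> of the clock that are passed during \<open>(0, t]\<close>.\<close>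

definition levels :: "'w \<Rightarrow> ennreal \<Rightarrow> real set" where
  "levels \<omega> t = {u. 0 \<le> u \<and> 0 < \<tau> u \<omega> \<and> \<tau> u \<omega> \<le> t \<and> \<tau> u \<omega> < \<infinity>}"

lemma dA_measure_clock: "dA_measure X A \<omega> = clock_measure (\<lambda>t. A t \<omega>) (\<zeta> \<omega>)"
  by (simp add: dA_measure_def clock_measure_def)

text \<open>Change of variables \<open>s = \<tau>\<^sub>u\<close>: the Stieltjes measure is the image of Lebesgue measure on the levels.\<close>

lemma dA_integral_eq:
  assumes f: "(\<lambda>s. f s * indicator {s. 0 < s \<and> ennreal s \<le> t} s) \<in> borel_measurable borel"
  shows "dA_integral X A \<omega> t f = (\<integral>\<^sup>+u. f (enn2real (\<tau> u \<omega>)) * indicator (levels \<omega> t) u \<partial>lborel)"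
proof -
  have "dA_integral X A \<omega> t f = (\<integral>\<^sup>+s. f s * indicator {s. 0 < s \<and> ennreal s \<le> t} s \<partial>clock.D (\<lambda>t. A t \<omega>) (\<zeta> \<omega>))"
    by (simp add: dA_integral_def dA_measure_clock clock.D_def[OF clock])
  also have "\<dots> = (\<integral>\<^sup>+u. f (enn2real (\<tau> u \<omega>)) * indicator {s. 0 < s \<and> ennreal s \<le> t} (enn2real (\<tau> u \<omega>))
      * indicator {u. 0 \<le> u \<and> \<tau> u \<omega> < \<infinity>} u \<partial>lborel)"
    unfolding \<tau>_def by (rule clock.nn_integral_clock[OF clock f])
  also have "\<dots> = (\<integral>\<^sup>+u. f (enn2real (\<tau> u \<omega>)) * indicator (levels \<omega> t) u \<partial>lborel)"
    by (intro nn_integral_cong)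
       (auto simp: levels_def indicator_def enn2real_positive_iff less_top)
  finally show ?thesis .
qed

lemma sets_levels: "{z\<in>space (borel \<Otimes>\<^sub>M Finf). fst z \<in> levels (snd z) t} \<in> sets (borel \<Otimes>\<^sub>M Finf)"
  unfolding levels_def by measurable

lemma borel_section:
  assumes "(\<lambda>(s, \<omega>). g s \<omega>) \<in> borel_measurable (borel \<Otimes>\<^sub>M Finf)"
  shows "(\<lambda>s. g s \<omega>) \<in> borel_measurable (borel :: real measure)"
  using measurable_compose[OF measurable_Pair2'[of \<omega> Finf borel] assms] by simp

lemma dA_integral_joint:
  assumes g: "(\<lambda>(s, \<omega>). g s \<omega>) \<in> borel_measurable (borel \<Otimes>\<^sub>M Finf)"
  shows "dA_integral X A \<omega> t (\<lambda>s. g s \<omega>) = (\<integral>\<^sup>+u. g (enn2real (\<tau> u \<omega>)) \<omega> * indicator (levels \<omega> t) u \<partial>lborel)"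
proof (rule dA_integral_eq)
  note borel_section[OF g, measurable]
  have "{s\<in>space borel. 0 < s \<and> ennreal s \<le> t} \<in> sets borel" by measurable
  then show "(\<lambda>s. g s \<omega> * indicator {s. 0 < s \<and> ennreal s \<le> t} s) \<in> borel_measurable borel"
    by (intro borel_measurable_times_ennreal borel_measurable_indicator) simp_all
qed

lemma measurable_time_changed:
  fixes g :: "real \<Rightarrow> 'w \<Rightarrow> ennreal"
  assumes g: "(\<lambda>(s, \<omega>). g s \<omega>) \<in> borel_measurable (borel \<Otimes>\<^sub>M Finf)"
  shows "(\<lambda>(u, \<omega>). g (enn2real (\<tau> u \<omega>)) \<omega> * indicator (levels \<omega> t) u) \<in> borel_measurable (borel \<Otimes>\<^sub>M Finf)"
proof -
  have "(\<lambda>z. (enn2real (\<tau> (fst z) (snd z)), snd z)) \<in> borel \<Otimes>\<^sub>M Finf \<rightarrow>\<^sub>M borel \<Otimes>\<^sub>M Finf"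
    by measurable
  from measurable_compose[OF this g]
  have "(\<lambda>z. g (enn2real (\<tau> (fst z) (snd z))) (snd z)) \<in> borel_measurable (borel \<Otimes>\<^sub>M Finf)" by simp
  note borel_measurable_times_ennreal[OF this borel_measurable_indicator[OF sets_levels[of t]]]
  then have "(\<lambda>z. g (enn2real (\<tau> (fst z) (snd z))) (snd z)
     * indicator {z\<in>space (borel \<Otimes>\<^sub>M Finf). fst z \<in> levels (snd z) t} z) \<in> borel_measurable (borel \<Otimes>\<^sub>M Finf)"
    .
  then show ?thesis
    by (rule measurable_cong[THEN iffD1, rotated]) (auto simp: indicator_def space_pair_measure)
qed

lemma measurable_Finf_Q2: "f \<in> borel_measurable (L \<Otimes>\<^sub>M Finf) \<Longrightarrow> f \<in> borel_measurable (L \<Otimes>\<^sub>M Q y)"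
proof -
  assume f: "f \<in> borel_measurable (L \<Otimes>\<^sub>M Finf)"
  have id: "(\<lambda>\<omega>. \<omega>) \<in> Q y \<rightarrow>\<^sub>M Finf"
    using aug_le_Q[of \<infinity> y] by (auto simp: measurable_def Finf_def)
  have "(\<lambda>z. (fst z, snd z)) \<in> L \<Otimes>\<^sub>M Q y \<rightarrow>\<^sub>M L \<Otimes>\<^sub>M Finf"
    by (rule measurable_Pair[OF measurable_fst measurable_compose[OF measurable_snd id]])
  from measurable_compose[OF this f] show ?thesis by simp
qed

lemma measurable_Finf_Q: "f \<in> borel_measurable Finf \<Longrightarrow> f \<in> borel_measurable (Q y)"
  unfolding Finf_def by (rule measurable_aug_Q)

lemma measurable_dA_integral:
  assumes "(\<lambda>(s, \<omega>). g s \<omega>) \<in> borel_measurable (borel \<Otimes>\<^sub>M Finf)"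
  shows "(\<lambda>\<omega>. dA_integral X A \<omega> t (\<lambda>s. g s \<omega>)) \<in> borel_measurable Finf"
proof -
  have "(\<lambda>(\<omega>, u). g (enn2real (\<tau> u \<omega>)) \<omega> * indicator (levels \<omega> t) u) \<in> borel_measurable (Finf \<Otimes>\<^sub>M lborel)"
    using measurable_compose[OF measurable_pair_swap' measurable_time_changed[OF assms, of t]]
    by (simp add: split_beta' cong: measurable_cong_sets)
  then show ?thesis
    unfolding dA_integral_joint[OF assms]
    by (intro lborel.borel_measurable_nn_integral) simp
qed

lemma integral_dA_Fubini:
  assumes g: "(\<lambda>(s, \<omega>). g s \<omega>) \<in> borel_measurable (borel \<Otimes>\<^sub>M Finf)"
  shows "(\<integral>\<^sup>+\<omega>. dA_integral X A \<omega> t (\<lambda>s. g s \<omega>) \<partial>Q y) =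
    (\<integral>\<^sup>+u. (\<integral>\<^sup>+\<omega>. g (enn2real (\<tau> u \<omega>)) \<omega> * indicator (levels \<omega> t) u \<partial>Q y) \<partial>lborel)"
proof -
  interpret Q: prob_space "Q y" by (rule prob_Q)
  interpret pair_sigma_finite lborel "Q y" ..
  have "(\<lambda>(u, \<omega>). g (enn2real (\<tau> u \<omega>)) \<omega> * indicator (levels \<omega> t) u) \<in> borel_measurable (lborel \<Otimes>\<^sub>M Q y)"
    using measurable_Finf_Q2[OF measurable_time_changed[OF g, of t], of y] by (simp cong: measurable_cong_sets)
  from Fubini[OF this] show ?thesis
    by (simp add: dA_integral_joint[OF g])
qed

text \<open>Each level of the clock is passed at a stopping time, so the strong Markov property, applied
  level by level, projects a functional of the future on the present state.\<close>

theorem dA_projection: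
  assumes F: "(\<lambda>(s, \<omega>). F s \<omega>) \<in> borel_measurable (borel \<Otimes>\<^sub>M Finf)"
    and \<Gamma>: "\<Gamma> \<in> sets Finf" "AE \<omega> in Q (Some x). \<omega> \<in> \<Gamma>"
    and F\<theta>: "(\<lambda>(s, \<omega>). indicator \<Gamma> \<omega> * F s (\<theta> (ennreal s) \<omega>)) \<in> borel_measurable (borel \<Otimes>\<^sub>M Finf)"
    and EF: "(\<lambda>(s, y). \<integral>\<^sup>+\<omega>. F s \<omega> \<partial>Q (Some y)) \<in> borel_measurable (borel \<Otimes>\<^sub>M borel)"
  shows "(\<integral>\<^sup>+\<omega>. dA_integral X A \<omega> t (\<lambda>s. F s (\<theta> (ennreal s) \<omega>)) \<partial>Q (Some x)) =
    (\<integral>\<^sup>+\<omega>. dA_integral X A \<omega> t (\<lambda>s. lift (\<lambda>y. \<integral>\<^sup>+\<omega>. F s \<omega> \<partial>Q (Some y)) (X (ennreal s) \<omega>)) \<partial>Q (Some x))"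
proof -
  let ?\<psi> = "\<lambda>s. lift (\<lambda>y. \<integral>\<^sup>+\<omega>. F s \<omega> \<partial>Q (Some y))"
  have \<psi>: "(\<lambda>(s, \<omega>). ?\<psi> s (X (ennreal s) \<omega>)) \<in> borel_measurable (borel \<Otimes>\<^sub>M Finf)"
  proof -
    have "(\<lambda>z. (fst z, X (ennreal (fst z)) (snd z))) \<in> borel \<Otimes>\<^sub>M Finf \<rightarrow>\<^sub>M borel \<Otimes>\<^sub>M borel_pt"
      by measurable
    from measurable_compose[OF this measurable_lift2[OF EF]] show ?thesis by (simp add: split_beta')
  qed
  have "(\<integral>\<^sup>+\<omega>. dA_integral X A \<omega> t (\<lambda>s. F s (\<theta> (ennreal s) \<omega>)) \<partial>Q (Some x)) =
    (\<integral>\<^sup>+\<omega>. dA_integral X A \<omega> t (\<lambda>s. indicator \<Gamma> \<omega> * F s (\<theta> (ennreal s) \<omega>)) \<partial>Q (Some x))"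
    by (rule nn_integral_cong_AE, use \<Gamma>(2) in eventually_elim) simp
  also have "\<dots> = (\<integral>\<^sup>+u. (\<integral>\<^sup>+\<omega>. (indicator \<Gamma> \<omega> * F (enn2real (\<tau> u \<omega>)) (\<theta> (ennreal (enn2real (\<tau> u \<omega>))) \<omega>))
      * indicator (levels \<omega> t) u \<partial>Q (Some x)) \<partial>lborel)"
    by (rule integral_dA_Fubini[OF F\<theta>])
  also have "\<dots> = (\<integral>\<^sup>+u. (\<integral>\<^sup>+\<omega>. ?\<psi> (enn2real (\<tau> u \<omega>)) (X (ennreal (enn2real (\<tau> u \<omega>))) \<omega>)
      * indicator (levels \<omega> t) u \<partial>Q (Some x)) \<partial>lborel)"
  proof (rule nn_integral_cong)
    fix u :: real
    show "(\<integral>\<^sup>+\<omega>. (indicator \<Gamma> \<omega> * F (enn2real (\<tau> u \<omega>)) (\<theta> (ennreal (enn2real (\<tau> u \<omega>))) \<omega>))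
        * indicator (levels \<omega> t) u \<partial>Q (Some x)) =
      (\<integral>\<^sup>+\<omega>. ?\<psi> (enn2real (\<tau> u \<omega>)) (X (ennreal (enn2real (\<tau> u \<omega>))) \<omega>) * indicator (levels \<omega> t) u \<partial>Q (Some x))"
    proof (cases "0 \<le> u")
      case False
      then show ?thesis by (simp add: levels_def)
    next
      case True
      define J where "J = {s. 0 < s \<and> ennreal s \<le> t}"
      have "{s\<in>space borel. 0 < s \<and> ennreal s \<le> t} \<in> sets borel" by measurable
      then have J: "J \<in> sets borel" by (simp add: J_def)
      define F' where "F' s \<omega> = indicator J s * F s \<omega>" for s \<omega>
      have F': "(\<lambda>(s, \<omega>). F' s \<omega>) \<in> borel_measurable (borel \<Otimes>\<^sub>M Finf)"
      proof -
        have "(\<lambda>z. indicator J (fst z) * (\<lambda>(s, \<omega>). F s \<omega>) z) \<in> borel_measurable (borel \<Otimes>\<^sub>M Finf)"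
          using J F by measurable
        then show ?thesis by (simp add: F'_def split_beta')
      qed
      have lev: "u \<in> levels \<omega> t \<longleftrightarrow> \<tau> u \<omega> < \<infinity> \<and> enn2real (\<tau> u \<omega>) \<in> J" for \<omega>
        using True by (auto simp: levels_def J_def enn2real_positive_iff less_top)
      have "(\<integral>\<^sup>+\<omega>. (indicator \<Gamma> \<omega> * F (enn2real (\<tau> u \<omega>)) (\<theta> (ennreal (enn2real (\<tau> u \<omega>))) \<omega>))
          * indicator (levels \<omega> t) u \<partial>Q (Some x)) =
        (\<integral>\<^sup>+\<omega>. F' (enn2real (\<tau> u \<omega>)) (\<theta> (\<tau> u \<omega>) \<omega>) * indicator {\<omega>. \<tau> u \<omega> < \<infinity>} \<omega> \<partial>Q (Some x))"
        by (rule nn_integral_cong_AE, use \<Gamma>(2) in eventually_elim)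
           (auto simp: F'_def indicator_def lev)
      also have "\<dots> = (\<integral>\<^sup>+\<omega>. (\<integral>\<^sup>+\<omega>'. F' (enn2real (\<tau> u \<omega>)) \<omega>' \<partial>Q (X (\<tau> u \<omega>) \<omega>)) * indicator {\<omega>. \<tau> u \<omega> < \<infinity>} \<omega> \<partial>Q (Some x))"
        by (rule strong_markov_path[OF stopping_\<tau> F'])
      also have "\<dots> = (\<integral>\<^sup>+\<omega>. ?\<psi> (enn2real (\<tau> u \<omega>)) (X (ennreal (enn2real (\<tau> u \<omega>))) \<omega>) * indicator (levels \<omega> t) u \<partial>Q (Some x))"
      proof (rule nn_integral_cong)
        fix \<omega>
        show "(\<integral>\<^sup>+\<omega>'. F' (enn2real (\<tau> u \<omega>)) \<omega>' \<partial>Q (X (\<tau> u \<omega>) \<omega>)) * indicator {\<omega>. \<tau> u \<omega> < \<infinity>} \<omega> =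
          ?\<psi> (enn2real (\<tau> u \<omega>)) (X (ennreal (enn2real (\<tau> u \<omega>))) \<omega>) * indicator (levels \<omega> t) u"
          using X_\<tau>_Some[of u \<omega>]
          by (cases "X (\<tau> u \<omega>) \<omega>") (auto simp: F'_def indicator_def lev)
      qed
      finally show ?thesis .
    qed
  qed
  also have "\<dots> = (\<integral>\<^sup>+\<omega>. dA_integral X A \<omega> t (\<lambda>s. ?\<psi> s (X (ennreal s) \<omega>)) \<partial>Q (Some x))"
    by (rule integral_dA_Fubini[OF \<psi>, symmetric])
  finally show ?thesis .
qed

lemma life_time_theta: "\<zeta> \<omega> \<le> ennreal r \<Longrightarrow> \<zeta> (\<theta> (ennreal r) \<omega>) = 0"
  using absorbed[of 0 "\<theta> (ennreal r) \<omega>"] absorbed[of "ennreal r" \<omega>] by (simp add: shift_X)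

lemma ennreal_eqI_less:
  assumes "\<And>s. 0 \<le> s \<Longrightarrow> (x :: ennreal) < ennreal s \<longleftrightarrow> y < ennreal s"
  shows "x = y"
proof (rule ccontr)
  have False if xy: "x < y" and iff: "\<And>s. 0 \<le> s \<Longrightarrow> x < ennreal s \<longleftrightarrow> y < ennreal s" for x y :: ennreal
  proof -
    obtain z where z: "x < z" "z < y" using dense[OF xy] by blast
    then have "z < top" using less_top order_less_trans by fastforce
    then have "ennreal (enn2real z) = z" by simp
    then show False using z iff[of "enn2real z"] by auto
  qed
  moreover assume "x \<noteq> y"
  ultimately show False using assms by (metis linorder_neq_iff)
qed

text \<open>By additivity, the level \<open>u\<close> of the shifted clock is the level \<open>u + A\<^sub>r\<close> of the original one.\<close>

lemma \<tau>_theta: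
  assumes \<omega>: "\<omega> \<in> \<Lambda>" and r: "0 \<le> r" "ennreal r < \<zeta> \<omega>" and u: "0 \<le> u"
  shows "\<tau> u (\<theta> (ennreal r) \<omega>) + ennreal r = \<tau> (u + enn2real (A r \<omega>)) \<omega>"
proof (rule ennreal_eqI_less)
  fix s :: real assume s: "0 \<le> s"
  let ?c = "enn2real (A r \<omega>)"
  have c: "ennreal ?c = A r \<omega>" "0 \<le> ?c" using A_finite[OF r] by auto
  show "\<tau> u (\<theta> (ennreal r) \<omega>) + ennreal r < ennreal s \<longleftrightarrow> \<tau> (u + ?c) \<omega> < ennreal s"
  proof (cases "r \<le> s")
    case True
    define q where "q = s - r"
    have q: "0 \<le> q" "s = r + q" using True by (auto simp: q_def)
    have "\<tau> u (\<theta> (ennreal r) \<omega>) + ennreal r < ennreal s \<longleftrightarrow>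
        ennreal r + \<tau> u (\<theta> (ennreal r) \<omega>) < ennreal r + ennreal q"
      using q r by (simp add: ennreal_plus add.commute)
    also have "\<dots> \<longleftrightarrow> \<tau> u (\<theta> (ennreal r) \<omega>) < ennreal q"
      by (subst ennreal_add_left_cancel_less) simp
    also have "\<dots> \<longleftrightarrow> A r \<omega> + ennreal u < A r \<omega> + A q (\<theta> (ennreal r) \<omega>)"
      using A_finite[OF r] by (subst ennreal_add_left_cancel_less) (auto simp: \<tau>_less_iff q)
    also have "\<dots> \<longleftrightarrow> ennreal (u + ?c) < A s \<omega>"
      using A_add[OF \<omega> q(1) r(1)] q(2) u c by (simp add: ennreal_plus add.commute)
    finally show ?thesis by (simp add: \<tau>_less_iff s)
  next
    case False
    have "\<not> ennreal (u + ?c) < A s \<omega>"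
    proof -
      have "A s \<omega> \<le> A r \<omega>" using False s by (intro A_mono) auto
      also have "\<dots> \<le> ennreal (u + ?c)" using u c by (metis add_increasing ennreal_leI order_refl)
      finally show ?thesis by simp
    qed
    moreover have "\<not> \<tau> u (\<theta> (ennreal r) \<omega>) + ennreal r < ennreal s"
    proof
      assume "\<tau> u (\<theta> (ennreal r) \<omega>) + ennreal r < ennreal s"
      moreover have "ennreal r \<le> \<tau> u (\<theta> (ennreal r) \<omega>) + ennreal r" by simp
      ultimately have "ennreal r < ennreal s" by (rule le_less_trans[rotated])
      then show False using False s r by (simp add: ennreal_less_iff)
    qed
    ultimately show ?thesis by (simp add: \<tau>_less_iff s)
  qed
qed

text \<open>In terms of levels, \<open>\<tau>_theta\<close> reduces the claim to the translation invariance of Lebesgue measure.\<close>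

lemma dA_shift:
  assumes \<omega>: "\<omega> \<in> \<Lambda>" and r: "0 \<le> r" and g[measurable]: "g \<in> borel_measurable borel"
  shows "dA_integral X A (\<theta> (ennreal r) \<omega>) t g =
    dA_integral X A \<omega> \<infinity> (\<lambda>s. g (s - r) * indicator {s. r < s \<and> ennreal (s - r) \<le> t} s)"
    (is "?l = ?r")
proof -
  let ?\<omega>' = "\<theta> (ennreal r) \<omega>"
  have meas: "(\<lambda>s. g s * indicator {s. 0 < s \<and> ennreal s \<le> t} s) \<in> borel_measurable borel"
    "(\<lambda>s. g (s - r) * indicator {s. r < s \<and> ennreal (s - r) \<le> t} s) \<in> borel_measurable borel"
    "(\<lambda>s. g (s - r) * indicator {s. r < s \<and> ennreal (s - r) \<le> t} s * indicator {s. 0 < s \<and> ennreal s \<le> \<infinity>} s) \<in> borel_measurable borel"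
    by measurable
  have l: "?l = (\<integral>\<^sup>+u. g (enn2real (\<tau> u ?\<omega>')) * indicator (levels ?\<omega>' t) u \<partial>lborel)"
    by (rule dA_integral_eq[OF meas(1)])
  have rr: "?r = (\<integral>\<^sup>+u. g (enn2real (\<tau> u \<omega>) - r) * indicator {s. r < s \<and> ennreal (s - r) \<le> t} (enn2real (\<tau> u \<omega>))
      * indicator (levels \<omega> \<infinity>) u \<partial>lborel)" (is "_ = (\<integral>\<^sup>+u. ?G u \<partial>lborel)")
    by (rule dA_integral_eq[OF meas(3)])
  show ?thesis
  proof (cases "ennreal r < \<zeta> \<omega>")
    case False
    then have le: "\<zeta> \<omega> \<le> ennreal r" by simp
    have "\<tau> u ?\<omega>' = \<infinity>" for u
      using \<tau>_less_life[of u ?\<omega>'] life_time_theta[OF le]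
      by (metis infinity_ennreal_def less_top not_less_zero)
    then have "?l = 0" unfolding l by (simp add: levels_def)
    moreover have z: "?G u = 0" for u
    proof (cases "\<tau> u \<omega> < \<infinity>")
      case True
      then have "\<tau> u \<omega> < ennreal r" using \<tau>_less_life[OF True] le by simp
      then have "enn2real (\<tau> u \<omega>) < r" using True by simp
      then show ?thesis by (simp add: indicator_def)
    qed (simp add: levels_def)
    have "?r = 0" unfolding rr z by simp
    ultimately show ?thesis by simp
  next
    case True
    let ?c = "enn2real (A r \<omega>)"
    have c: "ennreal ?c = A r \<omega>" "0 \<le> ?c" using A_finite[OF r True] by auto
    have G: "?G \<in> borel_measurable borel"
    proof -
      have \<tau>m[measurable]: "(\<lambda>u. \<tau> u \<omega>) \<in> borel_measurable borel"
        unfolding \<tau>_def by (rule clock.inv_clock_measurable[OF clock])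
      have "{u\<in>space borel. u \<in> levels \<omega> \<infinity>} \<in> sets borel" unfolding levels_def by measurable
      then have lev: "levels \<omega> \<infinity> \<in> sets borel" by simp
      have "(\<lambda>u. enn2real (\<tau> u \<omega>)) \<in> borel_measurable borel" by measurable
      from borel_measurable_times_ennreal[OF measurable_compose[OF this meas(2)] borel_measurable_indicator[OF lev]]
      show ?thesis .
    qed
    have "?r = (\<integral>\<^sup>+u. ?G (?c + 1 * u) \<partial>lborel)"
    proof -
      have "(\<integral>\<^sup>+u. ?G u \<partial>lborel) = ennreal \<bar>1\<bar> * (\<integral>\<^sup>+u. ?G (?c + 1 * u) \<partial>lborel)"
        by (rule nn_integral_real_affine[OF G]) simp
      then show ?thesis unfolding rr by (simp only: abs_one ennreal_1 mult_1)
    qed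
    also have "\<dots> = (\<integral>\<^sup>+u. g (enn2real (\<tau> u ?\<omega>')) * indicator (levels ?\<omega>' t) u \<partial>lborel)"
    proof (rule nn_integral_cong)
      fix u
      show "?G (?c + 1 * u) = g (enn2real (\<tau> u ?\<omega>')) * indicator (levels ?\<omega>' t) u"
      proof (cases "0 \<le> u")
        case u: True
        have eq: "\<tau> (?c + 1 * u) \<omega> = \<tau> u ?\<omega>' + ennreal r"
          using \<tau>_theta[OF \<omega> r True u] by (simp add: add.commute)
        show ?thesis
        proof (cases "\<tau> u ?\<omega>'")
          case (real q)
          have \<tau>v: "\<tau> (?c + 1 * u) \<omega> = ennreal (q + r)"
            unfolding eq real(2) using real(1) r by (rule ennreal_plus[symmetric])
          have T: "enn2real (\<tau> (?c + 1 * u) \<omega>) = q + r"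
            unfolding \<tau>v using real(1) r by (intro enn2real_ennreal) simp
          have "?c + 1 * u \<in> levels \<omega> \<infinity> \<longleftrightarrow> 0 < q + r"
            unfolding levels_def mem_Collect_eq \<tau>v using u c(2) by (simp del: ennreal_plus)
          moreover have "u \<in> levels ?\<omega>' t \<longleftrightarrow> 0 < q \<and> ennreal q \<le> t"
            unfolding levels_def mem_Collect_eq real(2) using u by simp
          moreover have "enn2real (\<tau> u ?\<omega>') = q" using real by simp
          ultimately show ?thesis
            unfolding T using r by (auto simp: indicator_def)
        next
          case top
          then have "\<tau> (?c + 1 * u) \<omega> = \<infinity>" using eq by simp
          then show ?thesis using top by (simp add: levels_def)
        qed
      next
        case False
        have "\<tau> (?c + 1 * u) \<omega> \<le> ennreal r" if "0 \<le> ?c + u"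
        proof -
          have "ennreal (?c + u) < A r \<omega>" using False that c by (metis add_less_same_cancel1 ennreal_less_iff not_le)
          then show ?thesis using r by (auto simp: \<tau>_less_iff[symmetric])
        qed
        then have "\<not> (r < enn2real (\<tau> (?c + 1 * u) \<omega>))" if "0 \<le> ?c + u"
          using that r enn2real_leI by (auto simp: not_less)
        then show ?thesis using False by (auto simp: levels_def indicator_def)
      qed
    qed
    finally show ?thesis using l by simp
  qed
qed

end

section \<open>Transition densities\<close>

locale revuz = pcaf M X P \<theta> A \<Lambda>
  for M :: "'w measure"
    and X :: "ennreal \<Rightarrow> 'w \<Rightarrow> 's::{metric_space, second_countable_topology} option"
    and P :: "'s option \<Rightarrow> 'w measure"
    and \<theta> :: "ennreal \<Rightarrow> 'w \<Rightarrow> 'w"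
    and A \<Lambda> +
  fixes m :: "'s measure" and p :: "real \<Rightarrow> 's \<Rightarrow> 's \<Rightarrow> ennreal" and \<mu> :: "'s measure"
  assumes radon: "radon_full_support m"
    and density: "transition_density m X P p"
    and Revuz: "revuz_measure m X P A \<mu>"
begin

lemma sets_m [simp, measurable_cong]: "sets m = sets borel"
  using radon by (simp add: radon_full_support_def)

lemma space_m [simp]: "space m = UNIV"
  using sets_eq_imp_space_eq[OF sets_m] by simp

lemma sets_\<mu> [simp, measurable_cong]: "sets \<mu> = sets borel"
  using Revuz by (simp add: revuz_measure_def)

lemma space_\<mu> [simp]: "space \<mu> = UNIV"
  using sets_eq_imp_space_eq[OF sets_\<mu>] by simp

sublocale m: sigma_finite_measure m
proof
  obtain \<V> :: "'s set set" where \<V>: "countable \<V>" "\<Union>\<V> = UNIV" "\<And>V. V \<in> \<V> \<Longrightarrow> open V \<and> compact (closure V)"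
    by (rule open_union_relatively_compact[OF open_UNIV]) blast
  have "emeasure m V \<noteq> \<infinity>" if "V \<in> \<V>" for V
  proof -
    have "emeasure m V \<le> emeasure m (closure V)"
      using closure_subset by (intro emeasure_mono) auto
    also have "\<dots> < \<infinity>" using \<V>(3)[OF that] radon by (simp add: radon_full_support_def)
    finally show ?thesis by simp
  qed
  then show "\<exists>A. countable A \<and> A \<subseteq> sets m \<and> \<Union>A = space m \<and> (\<forall>a\<in>A. emeasure m a \<noteq> \<infinity>)"
    using \<V> by (intro exI[of _ \<V>]) auto
qed

text \<open>The condition on \<open>t\<close> inside the function gives measurability on the whole time axis, from
  which all sections inherit it.\<close>

lemma p_joint: "(\<lambda>(t, x, y). if 0 < t then p t x y else 0) \<in> borel_measurable (borel \<Otimes>\<^sub>M borel \<Otimes>\<^sub>M borel)"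
  using measurable_extend_pos[of "\<lambda>t (x, y). p t x y" "borel \<Otimes>\<^sub>M borel"] density
  by (simp add: transition_density_def split_beta' split_beta cong: if_cong)

lemma measurable_p [measurable]: "0 < t \<Longrightarrow> (\<lambda>z. p t (fst z) (snd z)) \<in> borel_measurable (borel \<Otimes>\<^sub>M borel)"
  using measurable_compose[OF measurable_Pair1'[of t borel "borel \<Otimes>\<^sub>M borel"] p_joint] by (simp add: split_beta')

lemma measurable_p1: "0 < t \<Longrightarrow> p t x \<in> borel_measurable borel"
  using measurable_compose[OF measurable_Pair1'[of x borel borel] measurable_p] by simp

lemma p_sym: "0 < t \<Longrightarrow> p t x y = p t y x"
  using density by (simp add: transition_density_def)

lemma p_semigroup: "0 < s \<Longrightarrow> 0 < t \<Longrightarrow> p (t + s) x y = (\<integral>\<^sup>+z. p t x z * p s z y \<partial>m)"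
  using density by (simp add: transition_density_def)

lemma integral_X:
  assumes t: "0 < t" and f[measurable]: "f \<in> borel_measurable borel"
  shows "(\<integral>\<^sup>+\<omega>. lift f (X (ennreal t) \<omega>) \<partial>Q (Some x)) = (\<integral>\<^sup>+y. p t x y * f y \<partial>m)"
proof -
  let ?A = "{\<omega>. X (ennreal t) \<omega> \<noteq> None}"
  have N: "?A \<in> sets N"
  proof -
    have "?A = {\<omega>. X (ennreal t) \<omega> \<in> Some ` UNIV}" by auto
    then show ?thesis using measurable_X_ev[OF image_Some_borel_pt[of UNIV]] by simp
  qed
  then have A: "?A \<in> sets (P (Some x))" using subalgebra_N[of "Some x"] by (auto simp: subalgebra_def)
  have lf: "(\<lambda>\<omega>. lift f (X (ennreal t) \<omega>)) \<in> borel_measurable N"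
    by (rule measurable_compose[OF measurable_X measurable_lift[OF f]])
  have the: "(\<lambda>\<omega>. the (X (ennreal t) \<omega>)) \<in> restrict_space (P (Some x)) ?A \<rightarrow>\<^sub>M borel"
  proof -
    have "the \<in> borel_pt \<rightarrow>\<^sub>M (borel :: 's measure)" by (rule measurable_borel_ptI) simp_all
    then have "(\<lambda>\<omega>. the (X (ennreal t) \<omega>)) \<in> N \<rightarrow>\<^sub>M borel" by measurable
    then show ?thesis
      by (intro measurable_restrict_space1 measurable_from_subalg[OF subalgebra_N])
  qed
  have "(\<integral>\<^sup>+y. p t x y * f y \<partial>m) = (\<integral>\<^sup>+y. f y \<partial>density m (p t x))"
    using measurable_p1[OF t] by (subst nn_integral_density) auto
  also have "density m (p t x) = trans_law X P t x"
    using density t by (simp add: transition_density_def)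
  also have "(\<integral>\<^sup>+y. f y \<partial>trans_law X P t x) = (\<integral>\<^sup>+\<omega>. f (the (X (ennreal t) \<omega>)) \<partial>restrict_space (P (Some x)) ?A)"
    unfolding trans_law_def by (rule nn_integral_distr[OF the]) simp
  also have "\<dots> = (\<integral>\<^sup>+\<omega>. f (the (X (ennreal t) \<omega>)) * indicator ?A \<omega> \<partial>P (Some x))"
    using A by (intro nn_integral_restrict_space) (simp add: space_P)
  also have "\<dots> = (\<integral>\<^sup>+\<omega>. lift f (X (ennreal t) \<omega>) \<partial>P (Some x))"
    by (intro nn_integral_cong) (auto simp: lift_def split: option.splits)
  also have "\<dots> = (\<integral>\<^sup>+\<omega>. lift f (X (ennreal t) \<omega>) \<partial>Q (Some x))"
    unfolding nn_integral_Q P0_def by (rule nn_integral_subalgebra2[OF subalgebra_N lf, symmetric])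
  finally show ?thesis ..
qed

text \<open>An integrable weight stands in for \<open>m\<close>, which may have infinite mass, wherever a finite
  starting measure with the same null sets is needed.\<close>

lemma ex_weight:
  "\<exists>w. w \<in> borel_measurable borel \<and> (\<forall>x. 0 < w x \<and> w x \<le> (1 :: ennreal)) \<and> (\<integral>\<^sup>+x. w x \<partial>m) < \<infinity>"
proof -
  obtain h where h: "h \<in> borel_measurable m" "integral\<^sup>N m h \<noteq> \<infinity>" "\<And>x. 0 < h x \<and> h x < \<infinity>"
    using m.Ex_finite_integrable_function by auto
  have "(\<integral>\<^sup>+x. min 1 (h x) \<partial>m) \<le> integral\<^sup>N m h" by (intro nn_integral_mono) simp
  then have "(\<integral>\<^sup>+x. min 1 (h x) \<partial>m) < \<infinity>"
    by (rule le_less_trans) (use h(2) in \<open>simp add: less_top\<close>)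
  then show ?thesis using h by (intro exI[of _ "\<lambda>x. min 1 (h x)"]) auto
qed

definition w where
  "w = (SOME w. w \<in> borel_measurable borel \<and> (\<forall>x. 0 < w x \<and> w x \<le> (1 :: ennreal)) \<and> (\<integral>\<^sup>+x. w x \<partial>m) < \<infinity>)"

lemma w [measurable]: "w \<in> borel_measurable borel"
  and w_pos: "0 < w x" and w_le: "w x \<le> 1" and w_int: "(\<integral>\<^sup>+x. w x \<partial>m) < \<infinity>"
  using someI_ex[OF ex_weight] by (auto simp: w_def)

text \<open>The law at a positive time is absolutely continuous, so it does not see the exceptional
  starting points at which a completed path functional differs from a raw one.\<close>

lemma measurable_E_shift:
  assumes H: "H \<in> borel_measurable Finf" and t: "0 < t"
  shows "(\<lambda>x. \<integral>\<^sup>+\<omega>. H (\<theta> (ennreal t) \<omega>) \<partial>Q (Some x)) \<in> borel_measurable borel"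
proof -
  let ?W = "\<integral>\<^sup>+x. w x \<partial>m"
  have m0: "emeasure m UNIV \<noteq> 0"
    using radon by (auto simp: radon_full_support_def dest!: spec[of _ "UNIV :: 's set"])
  have W0: "?W \<noteq> 0"
  proof
    assume "?W = 0"
    then have "AE x in m. w x = 0" by (subst (asm) nn_integral_0_iff_AE) auto
    then have "AE x in m. False" using w_pos by (auto elim!: eventually_mono simp: less_le)
    then show False using m0 by (simp add: AE_iff_measurable[OF _ refl])
  qed
  have W1: "?W \<noteq> \<infinity>" using w_int by auto
  let ?n = "density m (\<lambda>x. w x / ?W)"
  have "emeasure ?n (space ?n) = (\<integral>\<^sup>+x. w x / ?W \<partial>m)"
    by (simp add: emeasure_density)
  also have "\<dots> = 1" using W0 w_int by (simp add: nn_integral_divide ennreal_divide_self)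
  finally have pn: "prob_space ?n" by (rule prob_spaceI)
  \<comment> \<open>the initial law with density proportional to \<open>w\<close>, equivalent to \<open>m\<close>\<close>
  define \<nu> where "\<nu> = distr ?n borel_pt Some"
  have Some: "Some \<in> ?n \<rightarrow>\<^sub>M borel_pt" using measurable_Some_borel_pt by (simp cong: measurable_cong_sets)
  have \<nu>: "\<nu> \<in> init_laws"
    unfolding init_laws_def \<nu>_def using prob_space.prob_space_distr[OF pn Some] by simp
  have \<nu>': "sets \<nu> = sets borel_pt" "space \<nu> \<noteq> {}" by (auto simp: \<nu>_def)
  have k: "P0 \<in> \<nu> \<rightarrow>\<^sub>M subprob_algebra N"
    using measurable_prob_algebraD[OF P0_kernel] \<nu>' by (simp cong: measurable_cong_sets)
  have sets_b: "sets (\<nu> \<bind> P0) = sets N"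
    using sets_bind[OF sets_kernel[OF k] \<nu>'(2)] by auto
  have "H \<in> borel_measurable (completion (\<nu> \<bind> P0))"
    using H aug_le_law_from[OF \<nu>, of \<infinity>] sets_eq_imp_space_eq[OF sets_b]
    by (auto simp: law_from_bind[OF \<nu>] Finf_def measurable_def)
  then obtain H1 where H1: "H1 \<in> borel_measurable (\<nu> \<bind> P0)" "AE \<omega> in \<nu> \<bind> P0. H \<omega> = H1 \<omega>"
    using completion_ex_borel_measurable by blast
  have H1N[measurable]: "H1 \<in> borel_measurable N" using H1(1) sets_b by (simp cong: measurable_cong_sets)
  obtain Z where Z: "Z \<in> null_sets (\<nu> \<bind> P0)" "{\<omega>\<in>space (\<nu> \<bind> P0). H \<omega> \<noteq> H1 \<omega>} \<subseteq> Z"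
    using H1(2) by (auto simp: eventually_ae_filter)
  have ZN[measurable]: "Z \<in> sets N" using Z(1) sets_b by auto
  have ZH: "H \<omega> = H1 \<omega>" if "\<omega> \<notin> Z" for \<omega> using Z(2) that sets_eq_imp_space_eq[OF sets_b] by auto
  have measZ: "(\<lambda>y. emeasure (P0 y) Z) \<in> borel_measurable borel_pt"
    by (rule measurable_compose[OF measurable_prob_algebraD[OF P0_kernel] measurable_emeasure_subprob_algebra[OF ZN]])
  \<comment> \<open>the exceptional starting points\<close>
  let ?D = "{x. emeasure (P0 (Some x)) Z \<noteq> 0}"
  have Dm: "?D \<in> sets borel"
  proof -
    have "(\<lambda>x. emeasure (P0 (Some x)) Z) \<in> borel_measurable borel"
      by (rule measurable_compose[OF measurable_Some_borel_pt measZ])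
    then have "{x\<in>space borel. emeasure (P0 (Some x)) Z \<noteq> 0} \<in> sets borel" by measurable
    then show ?thesis by simp
  qed
  have AEm: "AE x in m. emeasure (P0 (Some x)) Z = 0"
  proof -
    have "(\<integral>\<^sup>+y. emeasure (P0 y) Z \<partial>\<nu>) = emeasure (\<nu> \<bind> P0) Z"
      by (rule emeasure_bind[OF \<nu>'(2) k ZN, symmetric])
    then have "(\<integral>\<^sup>+y. emeasure (P0 y) Z \<partial>\<nu>) = 0" using Z(1) by auto
    then have "(\<integral>\<^sup>+x. w x / ?W * emeasure (P0 (Some x)) Z \<partial>m) = 0"
      using measurable_compose[OF measurable_Some_borel_pt measZ]
      by (simp add: \<nu>_def nn_integral_distr[OF Some] measZ nn_integral_density)
    then have "AE x in m. w x / ?W * emeasure (P0 (Some x)) Z = 0"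
      using measurable_compose[OF measurable_Some_borel_pt measZ] by (subst (asm) nn_integral_0_iff_AE) auto
    then show ?thesis
    proof eventually_elim
      fix x assume "w x / ?W * emeasure (P0 (Some x)) Z = 0"
      moreover have "w x / ?W \<noteq> 0" using w_pos[of x] W1 by (simp add: ennreal_divide_eq_0_iff less_le)
      ultimately show "emeasure (P0 (Some x)) Z = 0" by simp
    qed
  qed
  define v where "v y = (case y of None \<Rightarrow> \<integral>\<^sup>+\<omega>. H \<omega> \<partial>Q None | Some x \<Rightarrow> \<integral>\<^sup>+\<omega>. H1 \<omega> \<partial>P0 (Some x))" for y
  have v[measurable]: "v \<in> borel_measurable borel_pt"
  proof (rule measurable_borel_ptI)
    have "(\<lambda>x. \<integral>\<^sup>+\<omega>. H1 \<omega> \<partial>P0 (Some x)) \<in> borel_measurable borel"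
      by (rule measurable_compose[OF measurable_Some_borel_pt
            measurable_compose[OF measurable_prob_algebraD[OF P0_kernel] nn_integral_measurable_subprob_algebra[OF H1N]]])
    then show "(\<lambda>x. v (Some x)) \<in> borel_measurable borel" by (simp add: v_def)
  qed simp
  have v_eq: "v y = (\<integral>\<^sup>+\<omega>. H \<omega> \<partial>Q y)" if "y \<notin> Some ` ?D" for y
  proof (cases y)
    case (Some x)
    then have "emeasure (P0 (Some x)) Z = 0" using that by auto
    then have "AE \<omega> in P0 (Some x). \<omega> \<notin> Z" by (intro AE_not_in) (auto simp: null_sets_def)
    then have "(\<integral>\<^sup>+\<omega>. H1 \<omega> \<partial>P0 (Some x)) = (\<integral>\<^sup>+\<omega>. H \<omega> \<partial>P0 (Some x))"
      by (intro nn_integral_cong_AE) (auto elim!: eventually_mono simp: ZH)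
    then show ?thesis by (simp add: v_def Some nn_integral_Q)
  qed (simp add: v_def)
  have "(\<integral>\<^sup>+\<omega>. H (\<theta> (ennreal t) \<omega>) \<partial>Q (Some x)) = (\<integral>\<^sup>+y. v y \<partial>distr (P0 (Some x)) borel_pt (X (ennreal t)))" for x
  proof -
    have "(\<integral>\<^sup>+\<omega>. lift (indicator ?D) (X (ennreal t) \<omega>) \<partial>Q (Some x)) = (\<integral>\<^sup>+y. p t x y * indicator ?D y \<partial>m)"
      by (rule integral_X[OF t]) (use Dm in simp)
    also have "\<dots> = (\<integral>\<^sup>+y. 0 \<partial>m)"
      by (rule nn_integral_cong_AE, use AEm in eventually_elim) simp
    finally have "(\<integral>\<^sup>+\<omega>. lift (indicator ?D) (X (ennreal t) \<omega>) \<partial>Q (Some x)) = 0" by simp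
    then have "AE \<omega> in Q (Some x). lift (indicator ?D) (X (ennreal t) \<omega>) = (0 :: ennreal)"
      using measurable_compose[OF measurable_X_Q measurable_lift[OF borel_measurable_indicator[OF Dm]]]
      by (subst (asm) nn_integral_0_iff_AE) auto
    then have AEX: "AE \<omega> in Q (Some x). X (ennreal t) \<omega> \<notin> Some ` ?D"
      by (rule eventually_mono) (auto simp: indicator_def)
    have "(\<integral>\<^sup>+\<omega>. H (\<theta> (ennreal t) \<omega>) \<partial>Q (Some x)) = (\<integral>\<^sup>+\<omega>. (\<integral>\<^sup>+\<omega>'. H \<omega>' \<partial>Q (X (ennreal t) \<omega>)) \<partial>Q (Some x))"
      by (rule markov_path[OF H]) simp
    also have "\<dots> = (\<integral>\<^sup>+\<omega>. v (X (ennreal t) \<omega>) \<partial>Q (Some x))"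
      by (rule nn_integral_cong_AE, use AEX in eventually_elim) (simp add: v_eq)
    also have "\<dots> = (\<integral>\<^sup>+y. v y \<partial>distr (P0 (Some x)) borel_pt (X (ennreal t)))"
      by (simp add: nn_integral_Q nn_integral_distr)
    finally show ?thesis .
  qed
  moreover have "(\<lambda>x. \<integral>\<^sup>+y. v y \<partial>distr (P0 (Some x)) borel_pt (X (ennreal t))) \<in> borel_measurable borel"
    by (rule measurable_compose[OF measurable_Some_borel_pt
          measurable_compose[OF measurable_law_X[THEN measurable_prob_algebraD] nn_integral_measurable_subprob_algebra[OF v]]]) simp
  ultimately show ?thesis by simp
qed

section \<open>Potentials of an additive functional\<close>

abbreviation dA :: "'w \<Rightarrow> real measure" where "dA \<omega> \<equiv> dA_measure X A \<omega>"

lemma sets_dA [simp, measurable_cong]: "sets (dA \<omega>) = sets borel"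
  unfolding dA_measure_clock clock.D_def[OF clock, symmetric] clock.clock_measure_eq[OF clock] by simp

lemma space_dA [simp]: "space (dA \<omega>) = UNIV"
  using sets_eq_imp_space_eq[OF sets_dA] by simp

text \<open>\<open>Bi f 0 t\<close> is the additive functional \<open>f \<cdot> A\<close> at time \<open>t\<close>, and \<open>c f t\<close> below is its potential.  General windows
  \<open>(a, b]\<close> are carried along because measurability in the starting point is first available for \<open>a > 0\<close>, by
  \<open>measurable_E_shift\<close>, and has to be passed to \<open>a = 0\<close> in the limit.\<close>

definition Bi :: "('s \<Rightarrow> ennreal) \<Rightarrow> real \<Rightarrow> real \<Rightarrow> 'w \<Rightarrow> ennreal" where
  "Bi f a b \<omega> = (\<integral>\<^sup>+s. lift f (X (ennreal s) \<omega>) * indicator {a<..b} s \<partial>dA \<omega>)"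

definition EBi :: "('s \<Rightarrow> ennreal) \<Rightarrow> real \<Rightarrow> real \<Rightarrow> 's \<Rightarrow> ennreal" where
  "EBi f a b x = (\<integral>\<^sup>+\<omega>. Bi f a b \<omega> \<partial>Q (Some x))"

abbreviation c :: "('s \<Rightarrow> ennreal) \<Rightarrow> real \<Rightarrow> 's \<Rightarrow> ennreal" where
  "c f t \<equiv> EBi f 0 t"

definition Pt :: "real \<Rightarrow> ('s \<Rightarrow> ennreal) \<Rightarrow> 's \<Rightarrow> ennreal" where
  "Pt t f x = (\<integral>\<^sup>+y. p t x y * f y \<partial>m)"

lemma measurable_lift_X:
  assumes f: "f \<in> borel_measurable borel"
  shows "(\<lambda>(s, \<omega>). lift f (X (ennreal s) \<omega>)) \<in> borel_measurable (borel \<Otimes>\<^sub>M Finf)"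
  using measurable_compose[OF measurable_X2[OF measurable_fst measurable_snd] measurable_lift[OF f]]
  by (simp add: split_beta')

lemma measurable_lift_X_path:
  "f \<in> borel_measurable borel \<Longrightarrow> (\<lambda>s. lift f (X (ennreal s) \<omega>)) \<in> borel_measurable borel"
  by (rule borel_section[OF measurable_lift_X])

lemma Bi_dA_integral:
  "0 \<le> a \<Longrightarrow> Bi f a b \<omega> = dA_integral X A \<omega> \<infinity> (\<lambda>s. lift f (X (ennreal s) \<omega>) * indicator {a<..b} s)"
  unfolding Bi_def dA_integral_def by (intro nn_integral_cong) (auto simp: indicator_def)

lemma dA_integral_Bi:
  "0 \<le> t \<Longrightarrow> dA_integral X A \<omega> (ennreal t) (\<lambda>s. lift f (X (ennreal s) \<omega>)) = Bi f 0 t \<omega>"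
  unfolding Bi_def dA_integral_def by (intro nn_integral_cong) (auto simp: indicator_def)

lemma measurable_lift_X_ind:
  assumes f: "f \<in> borel_measurable borel"
  shows "(\<lambda>(s, \<omega>). lift f (X (ennreal s) \<omega>) * indicator {a<..b} s) \<in> borel_measurable (borel \<Otimes>\<^sub>M Finf)"
proof -
  have "(\<lambda>z. indicator {a<..b} (fst z) :: ennreal) \<in> borel_measurable (borel \<Otimes>\<^sub>M Finf)" by measurable
  from borel_measurable_times_ennreal[OF measurable_lift_X[OF f] this] show ?thesis by (simp add: split_beta')
qed

lemma measurable_Bi:
  "f \<in> borel_measurable borel \<Longrightarrow> 0 \<le> a \<Longrightarrow> Bi f a b \<in> borel_measurable Finf"
proof -
  assume "f \<in> borel_measurable borel" "0 \<le> a"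
  then have "Bi f a b = (\<lambda>\<omega>. dA_integral X A \<omega> \<infinity> (\<lambda>s. lift f (X (ennreal s) \<omega>) * indicator {a<..b} s))"
    by (intro ext Bi_dA_integral)
  moreover have "(\<lambda>(s, \<omega>). lift f (X (ennreal s) \<omega>) * indicator {a<..b} s) \<in> borel_measurable (borel \<Otimes>\<^sub>M Finf)"
    by (rule measurable_lift_X_ind) fact
  ultimately show ?thesis using measurable_dA_integral by simp
qed

lemma Bi_shift:
  assumes \<omega>: "\<omega> \<in> \<Lambda>" and f: "f \<in> borel_measurable borel" and r: "0 \<le> r" and t: "0 \<le> t"
  shows "Bi f 0 t (\<theta> (ennreal r) \<omega>) = Bi f r (r + t) \<omega>"
proof -
  have "Bi f 0 t (\<theta> (ennreal r) \<omega>) =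
    dA_integral X A (\<theta> (ennreal r) \<omega>) (ennreal t) (\<lambda>s. lift f (X (ennreal s) (\<theta> (ennreal r) \<omega>)))"
    by (rule dA_integral_Bi[OF t, symmetric])
  also have "\<dots> = dA_integral X A \<omega> \<infinity> (\<lambda>s. lift f (X (ennreal (s - r)) (\<theta> (ennreal r) \<omega>)) * indicator {s. r < s \<and> ennreal (s - r) \<le> ennreal t} s)"
    by (rule dA_shift[OF \<omega> r measurable_lift_X_path[OF f]])
  also have "(\<lambda>s. lift f (X (ennreal (s - r)) (\<theta> (ennreal r) \<omega>)) * indicator {s. r < s \<and> ennreal (s - r) \<le> ennreal t} s) =
    (\<lambda>s. lift f (X (ennreal s) \<omega>) * indicator {r<..r + t} s)"
  proof
    fix s
    have "ennreal r + ennreal (s - r) = ennreal s" if "r < s"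
      using that r by (simp flip: ennreal_plus)
    then show "lift f (X (ennreal (s - r)) (\<theta> (ennreal r) \<omega>)) * indicator {s. r < s \<and> ennreal (s - r) \<le> ennreal t} s =
      lift f (X (ennreal s) \<omega>) * indicator {r<..r + t} s"
      using t by (auto simp: indicator_def shift_X)
  qed
  also have "dA_integral X A \<omega> \<infinity> \<dots> = Bi f r (r + t) \<omega>" by (rule Bi_dA_integral[OF r, symmetric])
  finally show ?thesis .
qed

lemma Bi_None: "X 0 \<omega> = None \<Longrightarrow> Bi f a b \<omega> = 0"
proof -
  assume "X 0 \<omega> = None"
  then have "\<zeta> \<omega> = 0" using absorbed[of 0 \<omega>] by simp
  then have "X s \<omega> = None" for s using absorbed[of s \<omega>] by simp
  then show ?thesis by (simp add: Bi_def)
qed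

lemma AE_X_0: "AE \<omega> in Q y. X 0 \<omega> = y"
proof -
  have "{\<omega>. X 0 \<omega> \<in> {y}} \<in> sets N" by (rule measurable_X_ev[OF singleton_borel_pt])
  then have "AE \<omega> in restr_to_subalg (P y) N. X 0 \<omega> = y"
    by (intro AE_restr_to_subalg2[OF subalgebra_N X_0_AE]) (simp add: pred_def)
  then show ?thesis unfolding Q_def P0_def by (rule AE_completion)
qed

lemma E_Bi_None: "(\<integral>\<^sup>+\<omega>. Bi f a b \<omega> \<partial>Q None) = 0"
proof -
  have "(\<integral>\<^sup>+\<omega>. Bi f a b \<omega> \<partial>Q None) = (\<integral>\<^sup>+\<omega>. 0 \<partial>Q None)"
    by (rule nn_integral_cong_AE, use AE_X_0[of None] in eventually_elim) (simp add: Bi_None)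
  then show ?thesis by simp
qed

lemma Bi_split:
  assumes f: "f \<in> borel_measurable borel" and "a \<le> b" "b \<le> d"
  shows "Bi f a d \<omega> = Bi f a b \<omega> + Bi f b d \<omega>"
proof -
  note measurable_lift_X_path[OF f, measurable]
  have "Bi f a d \<omega> = (\<integral>\<^sup>+s. lift f (X (ennreal s) \<omega>) * indicator {a<..b} s + lift f (X (ennreal s) \<omega>) * indicator {b<..d} s \<partial>dA \<omega>)"
    unfolding Bi_def by (intro nn_integral_cong) (use assms in \<open>auto simp: indicator_def\<close>)
  also have "\<dots> = Bi f a b \<omega> + Bi f b d \<omega>"
    unfolding Bi_def by (intro nn_integral_add) measurable
  finally show ?thesis .
qed

lemma Bi_mono: "a' \<le> a \<Longrightarrow> b \<le> b' \<Longrightarrow> (\<And>x. f x \<le> g x) \<Longrightarrow> Bi f a b \<omega> \<le> Bi g a' b' \<omega>"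
  unfolding Bi_def by (intro nn_integral_mono mult_mono lift_mono) (auto simp: indicator_def)

lemma EBi_mono: "a' \<le> a \<Longrightarrow> b \<le> b' \<Longrightarrow> (\<And>x. f x \<le> g x) \<Longrightarrow> EBi f a b x \<le> EBi g a' b' x"
  unfolding EBi_def by (intro nn_integral_mono Bi_mono)

lemma EBi_split:
  assumes f: "f \<in> borel_measurable borel" and "0 \<le> a" "a \<le> b" "b \<le> d"
  shows "EBi f a d x = EBi f a b x + EBi f b d x"
  unfolding EBi_def Bi_split[OF f assms(3,4)] using assms
  by (intro nn_integral_add measurable_Finf_Q measurable_Bi) auto

lemma EBi_shift:
  assumes f: "f \<in> borel_measurable borel" and "0 \<le> r" "0 \<le> t"
  shows "EBi f r (r + t) x = (\<integral>\<^sup>+\<omega>. Bi f 0 t (\<theta> (ennreal r) \<omega>) \<partial>Q (Some x))"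
  unfolding EBi_def
  by (rule nn_integral_cong_AE, use AE_\<Lambda>[of x] in eventually_elim) (use assms in \<open>simp add: Bi_shift\<close>)

lemma measurable_EBi_pos:
  assumes f: "f \<in> borel_measurable borel" and "0 < a" "a \<le> b"
  shows "EBi f a b \<in> borel_measurable borel"
proof -
  have "EBi f a b = (\<lambda>x. \<integral>\<^sup>+\<omega>. Bi f 0 (b - a) (\<theta> (ennreal a) \<omega>) \<partial>Q (Some x))"
    using EBi_shift[OF f, of a "b - a"] assms by (intro ext) simp
  also have "\<dots> \<in> borel_measurable borel"
    by (rule measurable_E_shift) (use assms measurable_Bi in auto)
  finally show ?thesis .
qed

lemma Bi_SUP:
  assumes f: "f \<in> borel_measurable borel" and e: "\<And>n. a < e n" "decseq e" "e \<longlonglongrightarrow> a"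
  shows "Bi f a b \<omega> = (SUP n. Bi f (e n) b \<omega>)"
proof -
  note measurable_lift_X_path[OF f, measurable]
  have "(SUP n. Bi f (e n) b \<omega>) = (\<integral>\<^sup>+s. (SUP n. lift f (X (ennreal s) \<omega>) * indicator {e n<..b} s) \<partial>dA \<omega>)"
    unfolding Bi_def
  proof (rule nn_integral_monotone_convergence_SUP[symmetric])
    show "incseq (\<lambda>n s. lift f (X (ennreal s) \<omega>) * indicator {e n<..b} s)"
    proof (intro monoI le_funI mult_left_mono)
      fix i j :: nat and s :: real assume "i \<le> j"
      then have "e j \<le> e i" using e(2) by (auto simp: decseq_def)
      then show "indicator {e i<..b} s \<le> (indicator {e j<..b} s :: ennreal)" by (auto simp: indicator_def)
    qed simp
  qed measurable
  also have "\<dots> = Bi f a b \<omega>"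
    unfolding Bi_def
  proof (rule nn_integral_cong)
    fix s
    show "(SUP n. lift f (X (ennreal s) \<omega>) * indicator {e n<..b} s) = lift f (X (ennreal s) \<omega>) * indicator {a<..b} s"
    proof (cases "a < s \<and> s \<le> b")
      case True
      then have "\<forall>\<^sub>F n in sequentially. e n < s" using e(3) by (intro order_tendstoD) auto
      then obtain n where n: "e n < s" by (auto simp: eventually_sequentially)
      show ?thesis
      proof (rule antisym)
        show "(SUP n. lift f (X (ennreal s) \<omega>) * indicator {e n<..b} s) \<le> lift f (X (ennreal s) \<omega>) * indicator {a<..b} s"
          using e(1) by (intro SUP_least mult_left_mono) (auto simp: indicator_def True intro: order_less_trans)
        show "lift f (X (ennreal s) \<omega>) * indicator {a<..b} s \<le> (SUP n. lift f (X (ennreal s) \<omega>) * indicator {e n<..b} s)"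
          by (rule SUP_upper2[of n]) (use n True in \<open>auto simp: indicator_def\<close>)
      qed
    next
      case False
      then have "indicator {e n<..b} s = (0 :: ennreal)" for n
        using e(1)[of n] by (auto simp: indicator_def)
      moreover have "indicator {a<..b} s = (0 :: ennreal)" using False by (auto simp: indicator_def)
      ultimately show ?thesis by (simp only: mult_zero_right SUP_const UNIV_not_empty not_False_eq_True)
    qed
  qed
  finally show ?thesis ..
qed

lemma EBi_SUP:
  assumes f: "f \<in> borel_measurable borel" and "0 \<le> a" and e: "\<And>n. a < e n" "decseq e" "e \<longlonglongrightarrow> a"
  shows "EBi f a b x = (SUP n. EBi f (e n) b x)"
  unfolding EBi_def Bi_SUP[OF f e]
proof (rule nn_integral_monotone_convergence_SUP)
  show "incseq (\<lambda>n \<omega>. Bi f (e n) b \<omega>)"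
    using e(2) by (intro monoI le_funI Bi_mono) (auto simp: decseq_def)
  show "(\<lambda>\<omega>. Bi f (e n) b \<omega>) \<in> borel_measurable (Q (Some x))" for n
    using e(1)[of n] assms(2) by (intro measurable_Finf_Q measurable_Bi f) auto
qed

definition eps :: "real \<Rightarrow> real \<Rightarrow> nat \<Rightarrow> real" where
  "eps a b n = a + (b - a) * inverse (real (Suc n))"

lemma eps: "a < b \<Longrightarrow> a < eps a b n" "a \<le> b \<Longrightarrow> eps a b n \<le> b" "a \<le> b \<Longrightarrow> decseq (eps a b)" "eps a b \<longlonglongrightarrow> a"
proof -
  show "a < b \<Longrightarrow> a < eps a b n" by (simp add: eps_def)
  have "inverse (real (Suc n)) \<le> 1" by (simp add: field_simps)
  then show "a \<le> b \<Longrightarrow> eps a b n \<le> b"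
    using mult_left_mono[of "inverse (real (Suc n))" 1 "b - a"] by (simp add: eps_def)
  show "a \<le> b \<Longrightarrow> decseq (eps a b)"
    unfolding decseq_def eps_def by (auto intro!: mult_left_mono le_imp_inverse_le)
  have "eps a b \<longlonglongrightarrow> a + (b - a) * 0"
    unfolding eps_def[abs_def] by (intro tendsto_intros LIMSEQ_inverse_real_of_nat)
  then show "eps a b \<longlonglongrightarrow> a" by simp
qed

lemma Bi_empty: "b \<le> a \<Longrightarrow> Bi f a b \<omega> = 0"
  by (simp add: Bi_def)

lemma measurable_EBi:
  assumes f: "f \<in> borel_measurable borel" and "0 \<le> a"
  shows "EBi f a b \<in> borel_measurable borel"
proof (cases "a < b")
  case True
  have "EBi f a b = (\<lambda>x. SUP n. EBi f (eps a b n) b x)"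
    by (intro ext EBi_SUP[OF f] assms eps True less_imp_le[OF True])
  also have "\<dots> \<in> borel_measurable borel"
  proof (intro borel_measurable_SUP measurable_EBi_pos f)
    show "0 < eps a b n" for n using eps(1)[OF True, of n] assms(2) by linarith
    show "eps a b n \<le> b" for n using True by (intro eps) simp
  qed simp
  finally show ?thesis .
next
  case False
  then have "EBi f a b = (\<lambda>_. 0)" by (auto simp: EBi_def Bi_empty)
  then show ?thesis by simp
qed

text \<open>The Markov property at time \<open>a\<close>.\<close>

lemma EBi_Pt:
  assumes f: "f \<in> borel_measurable borel" and a: "0 < a" "a \<le> b"
  shows "EBi f a b x = Pt a (c f (b - a)) x"
proof -
  have "EBi f a b x = (\<integral>\<^sup>+\<omega>. Bi f 0 (b - a) (\<theta> (ennreal a) \<omega>) \<partial>Q (Some x))"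
    using EBi_shift[OF f, of a "b - a"] a by simp
  also have "\<dots> = (\<integral>\<^sup>+\<omega>. (\<integral>\<^sup>+\<omega>'. Bi f 0 (b - a) \<omega>' \<partial>Q (X (ennreal a) \<omega>)) \<partial>Q (Some x))"
    by (rule markov_path) (use f in \<open>auto intro: measurable_Bi\<close>)
  also have "\<dots> = (\<integral>\<^sup>+\<omega>. lift (c f (b - a)) (X (ennreal a) \<omega>) \<partial>Q (Some x))"
    by (intro nn_integral_cong) (auto simp: lift_def EBi_def E_Bi_None split: option.splits)
  also have "\<dots> = Pt a (c f (b - a)) x"
    unfolding Pt_def by (rule integral_X[OF a(1) measurable_EBi[OF f]]) simp
  finally show ?thesis .
qed

lemma p_mass_le: "0 < t \<Longrightarrow> (\<integral>\<^sup>+y. p t x y \<partial>m) \<le> 1"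
proof -
  assume t: "0 < t"
  interpret prob_space "Q (Some x)" by (rule prob_Q)
  have "(\<integral>\<^sup>+y. p t x y * 1 \<partial>m) = (\<integral>\<^sup>+\<omega>. lift (\<lambda>_. 1) (X (ennreal t) \<omega>) \<partial>Q (Some x))"
    by (rule integral_X[OF t, symmetric]) simp
  also have "\<dots> \<le> (\<integral>\<^sup>+\<omega>. 1 \<partial>Q (Some x))"
    by (intro nn_integral_mono) (auto simp: lift_def split: option.splits)
  also have "\<dots> = 1" using emeasure_space_1 by simp
  finally show ?thesis by simp
qed

lemma measurable_Pt:
  assumes "0 < t" and f[measurable]: "f \<in> borel_measurable borel"
  shows "Pt t f \<in> borel_measurable borel"
  unfolding Pt_def[abs_def]
proof (rule m.borel_measurable_nn_integral)
  note measurable_p[OF assms(1), measurable]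
  have "(\<lambda>z. p t (fst z) (snd z) * f (snd z)) \<in> borel_measurable (borel \<Otimes>\<^sub>M borel)" by measurable
  then show "(\<lambda>(x, y). p t x y * f y) \<in> borel_measurable (borel \<Otimes>\<^sub>M m)"
    by (simp add: split_beta' cong: measurable_cong_sets)
qed

text \<open>Symmetry of the semigroup on \<open>L\<^sup>2(m)\<close>, as Fubini for the symmetric density.\<close>

lemma Pt_symmetric:
  assumes t: "0 < t" and [measurable]: "f \<in> borel_measurable borel" "h \<in> borel_measurable borel"
  shows "(\<integral>\<^sup>+x. h x * Pt t f x \<partial>m) = (\<integral>\<^sup>+x. Pt t h x * f x \<partial>m)"
proof -
  interpret pair_sigma_finite m m ..
  note measurable_p[OF t, measurable] measurable_p1[OF t, measurable]
  have meas: "(\<lambda>(x, y). h x * (p t x y * f y)) \<in> borel_measurable (m \<Otimes>\<^sub>M m)"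
  proof -
    have "(\<lambda>z. h (fst z) * (p t (fst z) (snd z) * f (snd z))) \<in> borel_measurable (borel \<Otimes>\<^sub>M borel)" by measurable
    then show ?thesis by (simp add: split_beta' cong: measurable_cong_sets)
  qed
  have "(\<integral>\<^sup>+x. h x * Pt t f x \<partial>m) = (\<integral>\<^sup>+x. (\<integral>\<^sup>+y. h x * (p t x y * f y) \<partial>m) \<partial>m)"
    unfolding Pt_def by (intro nn_integral_cong nn_integral_cmult[symmetric]) simp
  also have "\<dots> = (\<integral>\<^sup>+y. (\<integral>\<^sup>+x. h x * (p t x y * f y) \<partial>m) \<partial>m)"
    using Fubini[OF meas] by simp
  also have "\<dots> = (\<integral>\<^sup>+y. (\<integral>\<^sup>+x. p t y x * h x * f y \<partial>m) \<partial>m)"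
    by (intro nn_integral_cong) (simp add: p_sym[OF t] mult_ac)
  also have "\<dots> = (\<integral>\<^sup>+y. Pt t h y * f y \<partial>m)"
    unfolding Pt_def by (intro nn_integral_cong nn_integral_multc) simp
  finally show ?thesis .
qed

lemma Pt_le_1: "0 < t \<Longrightarrow> (\<And>x. h x \<le> 1) \<Longrightarrow> Pt t h x \<le> 1"
proof -
  assume t: "0 < t" and h: "\<And>x. h x \<le> 1"
  have "Pt t h x \<le> (\<integral>\<^sup>+y. p t x y \<partial>m)"
    unfolding Pt_def by (intro nn_integral_mono) (use mult_left_mono[OF h] in \<open>simp add: le_fun_def\<close>)
  also have "\<dots> \<le> 1" by (rule p_mass_le[OF t])
  finally show ?thesis .
qed

lemma integral_Pt_le:
  assumes t: "0 < t" and f[measurable]: "f \<in> borel_measurable borel"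
  shows "(\<integral>\<^sup>+x. Pt t f x \<partial>m) \<le> (\<integral>\<^sup>+x. f x \<partial>m)"
proof -
  have "(\<integral>\<^sup>+x. 1 * Pt t f x \<partial>m) = (\<integral>\<^sup>+x. Pt t (\<lambda>_. 1) x * f x \<partial>m)"
    by (rule Pt_symmetric[OF t]) simp_all
  also have "\<dots> \<le> (\<integral>\<^sup>+x. 1 * f x \<partial>m)"
    by (intro nn_integral_mono mult_right_mono Pt_le_1[OF t]) simp_all
  finally show ?thesis by simp
qed

section \<open>The Revuz measure as a monotone limit\<close>

definition dy :: "nat \<Rightarrow> real" where "dy n = 1 / 2 ^ n"

lemma dy: "0 < dy n" "dy n = dy (Suc n) + dy (Suc n)" "dy n \<le> 1" "ennreal (1 / dy n) = 2 ^ n"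
  by (simp_all add: dy_def ennreal_power flip: ennreal_numeral)

lemma dy_tendsto: "dy \<longlonglongrightarrow> 0"
  unfolding dy_def[abs_def] using LIMSEQ_inverse_realpow_zero[of 2] by (simp add: inverse_eq_divide)

text \<open>The difference quotient of the definition of \<open>\<mu>\<close>, at dyadic times.  It increases in \<open>n\<close>, so the supremum is a monotone limit
  and additive in \<open>f\<close>.\<close>

definition q :: "('s \<Rightarrow> ennreal) \<Rightarrow> nat \<Rightarrow> ennreal" where
  "q f n = 2 ^ n * (\<integral>\<^sup>+x. c f (dy n) x \<partial>m)"

text \<open>\<open>P\<^sub>r\<close> contracts the integral with respect to \<open>m\<close>.\<close>

lemma integral_c_add_le:
  assumes f: "f \<in> borel_measurable borel" and "0 < r" "0 \<le> t"
  shows "(\<integral>\<^sup>+x. c f (r + t) x \<partial>m) \<le> (\<integral>\<^sup>+x. c f r x \<partial>m) + (\<integral>\<^sup>+x. c f t x \<partial>m)"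
proof -
  note measurable_EBi[OF f, measurable]
  have "c f (r + t) x = c f r x + Pt r (c f t) x" for x
    using EBi_split[OF f, of 0 r "r + t" x] EBi_Pt[OF f, of r "r + t" x] assms by simp
  then have "(\<integral>\<^sup>+x. c f (r + t) x \<partial>m) = (\<integral>\<^sup>+x. c f r x \<partial>m) + (\<integral>\<^sup>+x. Pt r (c f t) x \<partial>m)"
    using measurable_Pt[OF \<open>0 < r\<close>] by (simp add: nn_integral_add)
  also have "\<dots> \<le> (\<integral>\<^sup>+x. c f r x \<partial>m) + (\<integral>\<^sup>+x. c f t x \<partial>m)"
    using assms by (intro add_left_mono integral_Pt_le) auto
  finally show ?thesis .
qed

lemma q_incseq:
  assumes f: "f \<in> borel_measurable borel"
  shows "incseq (q f)"
proof (rule incseq_SucI)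
  fix n
  have "(\<integral>\<^sup>+x. c f (dy n) x \<partial>m) \<le> (\<integral>\<^sup>+x. c f (dy (Suc n)) x \<partial>m) + (\<integral>\<^sup>+x. c f (dy (Suc n)) x \<partial>m)"
    unfolding dy(2)[of n] by (rule integral_c_add_le[OF f dy(1) less_imp_le[OF dy(1)]])
  then have "2 ^ n * (\<integral>\<^sup>+x. c f (dy n) x \<partial>m) \<le> 2 ^ n * (2 * (\<integral>\<^sup>+x. c f (dy (Suc n)) x \<partial>m))"
    by (intro mult_left_mono) (simp_all add: mult_2)
  then show "q f n \<le> q f (Suc n)" by (simp add: q_def mult_ac)
qed

lemma integral_c_multiple_le:
  assumes f: "f \<in> borel_measurable borel" and "0 < r"
  shows "(\<integral>\<^sup>+x. c f (real k * r) x \<partial>m) \<le> ennreal (real k) * (\<integral>\<^sup>+x. c f r x \<partial>m)"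
proof (induction k)
  case 0
  then show ?case by (simp add: EBi_def Bi_def)
next
  case (Suc k)
  have "(\<integral>\<^sup>+x. c f (real (Suc k) * r) x \<partial>m) = (\<integral>\<^sup>+x. c f (r + real k * r) x \<partial>m)" by (simp add: algebra_simps)
  also have "\<dots> \<le> (\<integral>\<^sup>+x. c f r x \<partial>m) + (\<integral>\<^sup>+x. c f (real k * r) x \<partial>m)"
    using assms by (intro integral_c_add_le) auto
  also have "\<dots> \<le> (\<integral>\<^sup>+x. c f r x \<partial>m) + ennreal (real k) * (\<integral>\<^sup>+x. c f r x \<partial>m)"
    by (intro add_left_mono Suc.IH)
  also have "\<dots> = ennreal (real (Suc k)) * (\<integral>\<^sup>+x. c f r x \<partial>m)"
    by (simp add: distrib_right ennreal_plus[of 1, simplified] del: ennreal_plus)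
  finally show ?case .
qed

text \<open>Covering \<open>(0, t]\<close> by \<open>\<lceil>t / 2\<^sup>-\<^sup>n\<rceil>\<close> dyadic intervals loses a factor that tends to \<open>1\<close>.\<close>

lemma revuz_quotient_le:
  assumes f: "f \<in> borel_measurable borel" and t: "0 < t"
  shows "ennreal (1 / t) * (\<integral>\<^sup>+x. c f t x \<partial>m) \<le> (SUP n. q f n)"
proof -
  let ?S = "SUP n. q f n"
  have le: "ennreal (1 / t) * (\<integral>\<^sup>+x. c f t x \<partial>m) \<le> ennreal (1 + dy n / t) * ?S" for n
  proof -
    define k where "k = nat \<lceil>t / dy n\<rceil>"
    have k1: "t \<le> real k * dy n"
    proof -
      have "t / dy n \<le> real k" unfolding k_def by linarith
      then show ?thesis using dy(1)[of n] by (simp add: pos_divide_le_eq)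
    qed
    have k2: "real k * dy n \<le> t + dy n"
    proof -
      have "0 < t / dy n" using t dy(1)[of n] by simp
      then have "real k \<le> t / dy n + 1" unfolding k_def by linarith
      then have "real k * dy n \<le> (t / dy n + 1) * dy n" using dy(1)[of n] by (intro mult_right_mono) auto
      also have "\<dots> = t + dy n" using dy(1)[of n] by (simp add: field_simps)
      finally show ?thesis .
    qed
    have "(\<integral>\<^sup>+x. c f t x \<partial>m) \<le> (\<integral>\<^sup>+x. c f (real k * dy n) x \<partial>m)"
      using k1 by (intro nn_integral_mono EBi_mono) auto
    also have "\<dots> \<le> ennreal (real k) * (\<integral>\<^sup>+x. c f (dy n) x \<partial>m)"
      by (rule integral_c_multiple_le[OF f dy(1)])
    also have "\<dots> = ennreal (real k * dy n) * q f n"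
      using dy(1)[of n] by (simp add: q_def dy(4)[symmetric] mult.assoc[symmetric] flip: ennreal_mult')
    also have "\<dots> \<le> ennreal (t + dy n) * ?S"
      using k2 by (intro mult_mono ennreal_leI SUP_upper) auto
    finally have "ennreal (1 / t) * (\<integral>\<^sup>+x. c f t x \<partial>m) \<le> ennreal (1 / t) * (ennreal (t + dy n) * ?S)"
      by (intro mult_left_mono) simp_all
    also have "\<dots> = ennreal (1 + dy n / t) * ?S"
    proof -
      have "1 / t * (t + dy n) = 1 + dy n / t" using t by (simp add: field_simps)
      moreover have "ennreal (1 / t * (t + dy n)) = ennreal (1 / t) * ennreal (t + dy n)"
        using t dy(1)[of n] by (intro ennreal_mult) auto
      ultimately show ?thesis by (simp only: mult.assoc)
    qed
    finally show ?thesis .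
  qed
  have "(\<lambda>n. ennreal (1 + dy n / t)) \<longlonglongrightarrow> ennreal (1 + 0 / t)"
    using t by (intro tendsto_ennrealI tendsto_add tendsto_const tendsto_divide dy_tendsto) auto
  then have "(\<lambda>n. ?S * ennreal (1 + dy n / t)) \<longlonglongrightarrow> ?S * ennreal (1 + 0 / t)"
    by (intro tendsto_mult_ennreal tendsto_const) auto
  then have "(\<lambda>n. ennreal (1 + dy n / t) * ?S) \<longlonglongrightarrow> ?S" by (simp add: mult.commute)
  then show ?thesis by (rule tendsto_lowerbound) (use le in auto)
qed

lemma lift_indicator: "lift (indicator B) y = (indicator (Some ` B) y :: ennreal)"
  by (cases y) (auto simp: indicator_def)

lemma emeasure_\<mu>_SUP:
  assumes B: "B \<in> sets borel"
  shows "emeasure \<mu> B = (SUP n. q (indicator B) n)"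
proof -
  have ind: "indicator B \<in> borel_measurable borel" using B by simp
  have "emeasure \<mu> B = (SUP t\<in>{0<..}. ennreal (1 / t) * (\<integral>\<^sup>+x. c (indicator B) t x \<partial>m))"
  proof -
    have "expect X P x (\<lambda>\<omega>. dA_integral X A \<omega> (ennreal t) (\<lambda>s. indicator (Some ` B) (X (ennreal s) \<omega>))) = c (indicator B) t x"
      if "0 < t" for t x
      using dA_integral_Bi[of t _ "indicator B"] that by (simp add: expect_Q EBi_def lift_indicator)
    then show ?thesis
      using Revuz B unfolding revuz_measure_def by (auto intro!: SUP_cong)
  qed
  also have "\<dots> = (SUP n. q (indicator B) n)"
  proof (rule antisym)
    show "(SUP t\<in>{0<..}. ennreal (1 / t) * (\<integral>\<^sup>+x. c (indicator B) t x \<partial>m)) \<le> (SUP n. q (indicator B) n)"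
      by (intro SUP_least revuz_quotient_le ind) simp
    show "(SUP n. q (indicator B) n) \<le> (SUP t\<in>{0<..}. ennreal (1 / t) * (\<integral>\<^sup>+x. c (indicator B) t x \<partial>m))"
      by (intro SUP_least SUP_upper2[of "dy n" for n]) (auto simp: q_def dy(1) dy(4))
  qed
  finally show ?thesis .
qed

lemma lift_add: "lift (\<lambda>x. f x + g x) y = lift f y + lift g y"
  and lift_cmult: "lift (\<lambda>x. k * f x) y = k * lift f y"
  and lift_SUP: "lift (SUP i. U i) y = (SUP i. lift (U i) y)"
  by (cases y; simp add: image_comp)+

lemma EBi_add:
  assumes f: "f \<in> borel_measurable borel" and g: "g \<in> borel_measurable borel" and "0 \<le> a"
  shows "EBi (\<lambda>x. f x + g x) a b x = EBi f a b x + EBi g a b x"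
proof -
  note measurable_lift_X_path[OF f, measurable] measurable_lift_X_path[OF g, measurable]
  have "Bi (\<lambda>x. f x + g x) a b \<omega> = Bi f a b \<omega> + Bi g a b \<omega>" for \<omega>
    unfolding Bi_def lift_add distrib_right by (rule nn_integral_add) measurable
  then have "Bi (\<lambda>x. f x + g x) a b = (\<lambda>\<omega>. Bi f a b \<omega> + Bi g a b \<omega>)" by (rule ext)
  then show ?thesis
    unfolding EBi_def using assms by (simp add: nn_integral_add measurable_Finf_Q measurable_Bi)
qed

lemma EBi_cmult:
  assumes f: "f \<in> borel_measurable borel" and "0 \<le> a"
  shows "EBi (\<lambda>x. k * f x) a b x = k * EBi f a b x"
proof -
  note measurable_lift_X_path[OF f, measurable]
  have "Bi (\<lambda>x. k * f x) a b \<omega> = k * Bi f a b \<omega>" for \<omega>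
    unfolding Bi_def lift_cmult mult.assoc by (rule nn_integral_cmult) measurable
  then have "Bi (\<lambda>x. k * f x) a b = (\<lambda>\<omega>. k * Bi f a b \<omega>)" by (rule ext)
  then show ?thesis
    unfolding EBi_def using assms by (simp add: nn_integral_cmult measurable_Finf_Q measurable_Bi)
qed

lemma EBi_SUP_fun:
  assumes U: "\<And>i. U i \<in> borel_measurable borel" "incseq U" and "0 \<le> a"
  shows "EBi (SUP i. U i) a b x = (SUP i. EBi (U i) a b x)"
proof -
  note measurable_lift_X_path[OF U(1), measurable]
  have mono: "U i y \<le> U j y" if "i \<le> j" for i j y using U(2) that by (auto simp: incseq_def le_fun_def)
  have "Bi (SUP i. U i) a b \<omega> = (SUP i. Bi (U i) a b \<omega>)" for \<omega>
  proof -
    have "Bi (SUP i. U i) a b \<omega> = (\<integral>\<^sup>+s. (SUP i. lift (U i) (X (ennreal s) \<omega>) * indicator {a<..b} s) \<partial>dA \<omega>)"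
      unfolding Bi_def lift_SUP by (intro nn_integral_cong) (simp add: SUP_mult_right_ennreal)
    also have "\<dots> = (SUP i. Bi (U i) a b \<omega>)"
      unfolding Bi_def
      by (rule nn_integral_monotone_convergence_SUP)
         (auto intro!: monoI le_funI mult_right_mono lift_mono mono)
    finally show ?thesis .
  qed
  then have "Bi (SUP i. U i) a b = (\<lambda>\<omega>. SUP i. Bi (U i) a b \<omega>)" by (rule ext)
  then show ?thesis
    unfolding EBi_def
    by (subst nn_integral_monotone_convergence_SUP[symmetric])
       (auto intro!: monoI le_funI Bi_mono mono measurable_Finf_Q measurable_Bi U assms)
qed

lemma integral_\<mu>_SUP:
  assumes "f \<in> borel_measurable borel"
  shows "(\<integral>\<^sup>+y. f y \<partial>\<mu>) = (SUP n. q f n)"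
  using assms
proof (induction f rule: borel_measurable_induct)
  case (cong f g)
  then have "f = g" by auto
  then show ?case using cong by simp
next
  case (set B)
  then show ?case using emeasure_\<mu>_SUP[OF set] by simp
next
  case (mult u k)
  have "(SUP n. q (\<lambda>x. k * u x) n) = (SUP n. k * q u n)"
    using mult measurable_EBi[of u] by (simp add: q_def EBi_cmult nn_integral_cmult mult_ac)
  also have "\<dots> = k * (SUP n. q u n)" by (rule SUP_mult_left_ennreal[symmetric])
  finally show ?case using mult by (simp add: nn_integral_cmult)
next
  case (add u v)
  have "(SUP n. q (\<lambda>x. v x + u x) n) = (SUP n. q v n + q u n)"
    using add measurable_EBi[of u] measurable_EBi[of v] by (simp add: q_def EBi_add nn_integral_add distrib_left)
  also have "\<dots> = (SUP n. q v n) + (SUP n. q u n)"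
    by (rule ennreal_SUP_add) (use q_incseq add in auto)
  finally show ?case using add by (simp add: nn_integral_add)
next
  case (seq U)
  have qU: "q (SUP i. U i) n = (SUP i. q (U i) n)" for n
  proof -
    have "c (U i) (dy n) \<in> borel_measurable m" for i
      using measurable_EBi[OF seq.hyps(1) order_refl] by (simp cong: measurable_cong_sets)
    then have "(\<integral>\<^sup>+x. c (SUP i. U i) (dy n) x \<partial>m) = (SUP i. \<integral>\<^sup>+x. c (U i) (dy n) x \<partial>m)"
      unfolding EBi_SUP_fun[OF seq.hyps(1) seq.hyps(3) order_refl]
      using seq.hyps(3) by (intro nn_integral_monotone_convergence_SUP)
         (auto intro!: monoI le_funI EBi_mono simp: incseq_def le_fun_def)
    then show ?thesis by (simp add: q_def SUP_mult_left_ennreal)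
  qed
  have "(\<integral>\<^sup>+y. (SUP i. U i) y \<partial>\<mu>) = (SUP i. \<integral>\<^sup>+y. U i y \<partial>\<mu>)"
    unfolding SUP_apply using seq.hyps(1,3) by (intro nn_integral_monotone_convergence_SUP) simp_all
  also have "\<dots> = (SUP i. SUP n. q (U i) n)" using seq.IH by simp
  also have "\<dots> = (SUP n. SUP i. q (U i) n)" by (rule SUP_commute)
  finally show ?case by (simp only: qU)
qed

lemma integral_c_le:
  assumes f: "f \<in> borel_measurable borel"
  shows "(\<integral>\<^sup>+x. c f (dy n) x \<partial>m) \<le> ennreal (dy n) * (\<integral>\<^sup>+y. f y \<partial>\<mu>)"
proof -
  have "(\<integral>\<^sup>+x. c f (dy n) x \<partial>m) = ennreal (dy n) * q f n"
    using dy(1)[of n] by (simp add: q_def dy(4)[symmetric] mult.assoc[symmetric] flip: ennreal_mult')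
  also have "\<dots> \<le> ennreal (dy n) * (\<integral>\<^sup>+y. f y \<partial>\<mu>)"
    unfolding integral_\<mu>_SUP[OF f] by (intro mult_left_mono SUP_upper) auto
  finally show ?thesis .
qed

section \<open>A localizing function\<close>

text \<open>At the value \<open>\<infinity>\<close> this is \<open>1\<close>; it only matters before the life time, where the clock is finite.\<close>

definition e :: "ennreal \<Rightarrow> ennreal" where
  "e a = ennreal (exp (- enn2real a))"

lemma measurable_e [measurable]: "e \<in> borel_measurable borel"
  unfolding e_def[abs_def] by measurable

lemma e_le_1: "e a \<le> 1"
  by (simp add: e_def ennreal_le_1)

lemma e_pos: "0 < e a"
  by (simp add: e_def)

abbreviation W :: "real \<Rightarrow> 'w \<Rightarrow> ennreal" where
  "W r \<omega> \<equiv> lift w (X (ennreal r) \<omega>)"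

lemma W_le_1: "W r \<omega> \<le> 1"
  by (cases "X (ennreal r) \<omega>") (auto simp: w_le)

lemma w_nonzero: "w x \<noteq> 0"
  using w_pos[of x] by auto

lemma W_alive: "0 < W r \<omega> \<longleftrightarrow> ennreal r < \<zeta> \<omega>"
  using absorbed[of "ennreal r" \<omega>] by (cases "X (ennreal r) \<omega>") (auto simp: w_nonzero not_le[symmetric])

lemma W_eq_0: "\<not> ennreal r < \<zeta> \<omega> \<Longrightarrow> W r \<omega> = 0"
  using W_alive[of r \<omega>] by (simp add: not_gr_zero)

definition Fw :: "'w \<Rightarrow> ennreal" where
  "Fw \<omega> = (\<integral>\<^sup>+r. W r \<omega> * e (A (max 0 r) \<omega>) * indicator {0<..1} r \<partial>lborel)"

definition \<phi> :: "'s \<Rightarrow> ennreal" where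
  "\<phi> x = (\<integral>\<^sup>+\<omega>. Fw \<omega> \<partial>Q (Some x))"

text \<open>The integrand of \<open>Fw\<close> along the path shifted by \<open>s\<close>, written in terms of the original path.
  This version is jointly measurable in \<open>s\<close>, \<open>\<omega>\<close> and \<open>r\<close>.\<close>

definition Gw :: "real \<Rightarrow> 'w \<Rightarrow> real \<Rightarrow> ennreal" where
  "Gw s \<omega> r = W r \<omega> * e (A (max 0 r) \<omega> - A (max 0 s) \<omega>) * indicator {max 0 s<..max 0 s + 1} r"

lemma measurable_W2:
  "f \<in> borel_measurable L \<Longrightarrow> g \<in> L \<rightarrow>\<^sub>M Finf \<Longrightarrow> (\<lambda>z. W (f z) (g z)) \<in> borel_measurable L"
  by (rule measurable_compose[OF measurable_X2 measurable_lift[OF w]])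

lemma measurable_Gw: "(\<lambda>z. Gw (fst (fst z)) (snd (fst z)) (snd z)) \<in> borel_measurable ((borel \<Otimes>\<^sub>M Finf) \<Otimes>\<^sub>M lborel)"
proof -
  let ?L = "(borel \<Otimes>\<^sub>M Finf) \<Otimes>\<^sub>M lborel :: ((real \<times> 'w) \<times> real) measure"
  have s: "(\<lambda>z. fst (fst z)) \<in> borel_measurable ?L" and r: "snd \<in> borel_measurable ?L"
    and \<omega>: "(\<lambda>z. snd (fst z)) \<in> ?L \<rightarrow>\<^sub>M Finf" by measurable
  note measurable_W2[OF r \<omega>, measurable] measurable_A2[OF s \<omega>, measurable] measurable_A2[OF r \<omega>, measurable]
  have "{z\<in>space ?L. max 0 (fst (fst z)) < snd z \<and> snd z \<le> max 0 (fst (fst z)) + 1} \<in> sets ?L" by measurable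
  then have [measurable]: "(\<lambda>z. indicator {max 0 (fst (fst z))<..max 0 (fst (fst z)) + 1} (snd z) :: ennreal) \<in> borel_measurable ?L"
    by (rule measurable_cong[THEN iffD1, OF _ borel_measurable_indicator, rotated]) (auto simp: indicator_def)
  show ?thesis unfolding Gw_def by measurable
qed

lemma Fw_Gw: "Fw \<omega> = (\<integral>\<^sup>+r. Gw 0 \<omega> r \<partial>lborel)"
  by (simp add: Fw_def Gw_def A_0)

lemma measurable_Gw_path: "Gw s \<omega> \<in> borel_measurable lborel"
proof -
  have "(\<lambda>r. ((s, \<omega>), r)) \<in> lborel \<rightarrow>\<^sub>M (borel \<Otimes>\<^sub>M Finf) \<Otimes>\<^sub>M lborel" by (rule measurable_Pair1') (simp add: space_pair_measure)
  from measurable_compose[OF this measurable_Gw] show ?thesis by simp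
qed

lemma measurable_int_Gw: "(\<lambda>(s, \<omega>). \<integral>\<^sup>+r. Gw s \<omega> r \<partial>lborel) \<in> borel_measurable (borel \<Otimes>\<^sub>M Finf)"
  using lborel.borel_measurable_nn_integral[of "\<lambda>z r. Gw (fst z) (snd z) r" "borel \<Otimes>\<^sub>M Finf"] measurable_Gw
  by (simp add: split_beta')

lemma measurable_Fw: "Fw \<in> borel_measurable Finf"
proof -
  have "(\<lambda>\<omega>. (0 :: real, \<omega>)) \<in> Finf \<rightarrow>\<^sub>M borel \<Otimes>\<^sub>M Finf" by measurable
  from measurable_compose[OF this measurable_int_Gw] show ?thesis
    unfolding Fw_Gw[abs_def] by simp
qed

lemma Fw_theta:
  assumes \<omega>: "\<omega> \<in> \<Lambda>"
  shows "Fw (\<theta> (ennreal s) \<omega>) = (\<integral>\<^sup>+r. Gw s \<omega> r \<partial>lborel)"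
proof -
  define s' where "s' = max 0 s"
  have s': "0 \<le> s'" "ennreal s = ennreal s'" by (auto simp: s'_def max_def ennreal_neg)
  let ?\<omega> = "\<theta> (ennreal s') \<omega>"
  have "(\<integral>\<^sup>+r. Gw s \<omega> r \<partial>lborel) = ennreal \<bar>1\<bar> * (\<integral>\<^sup>+r. Gw s \<omega> (s' + 1 * r) \<partial>lborel)"
    by (rule nn_integral_real_affine) (use measurable_Gw_path[of s \<omega>] in simp_all)
  also have "\<dots> = (\<integral>\<^sup>+r. Gw s \<omega> (s' + 1 * r) \<partial>lborel)" by simp
  also have "\<dots> = (\<integral>\<^sup>+r. W r ?\<omega> * e (A (max 0 r) ?\<omega>) * indicator {0<..1} r \<partial>lborel)"
  proof (rule nn_integral_cong)
    fix r
    show "Gw s \<omega> (s' + 1 * r) = W r ?\<omega> * e (A (max 0 r) ?\<omega>) * indicator {0<..1} r"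
    proof (cases "0 < r \<and> r \<le> 1")
      case True
      have Xr: "X (ennreal r) ?\<omega> = X (ennreal (s' + r)) \<omega>"
        using s' True by (simp add: shift_X ennreal_plus)
      show ?thesis
      proof (cases "ennreal (s' + r) < \<zeta> \<omega>")
        case alive: True
        have "ennreal s' \<le> ennreal (s' + r)" using True by (intro ennreal_leI) simp
        then have fin: "A s' \<omega> < \<infinity>" using alive s' by (intro A_finite) (auto intro: le_less_trans)
        have "A (s' + r) \<omega> - A s' \<omega> = A r ?\<omega>"
          using fin A_add[OF \<omega>, of r s'] True s' by (simp add: ennreal_add_diff_cancel_left less_top)
        moreover have "max 0 (s' + 1 * r) = s' + r" "max 0 r = r" using True s' by auto
        ultimately show ?thesis
          unfolding Gw_def s'_def[symmetric] using True s' Xr by (simp add: indicator_def)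
      next
        case False
        then have "W r ?\<omega> = 0" "W (s' + 1 * r) \<omega> = 0" using W_eq_0[of "s' + r" \<omega>] Xr by simp_all
        then show ?thesis by (simp add: Gw_def)
      qed
    next
      case False
      then show ?thesis by (auto simp: Gw_def s'_def[symmetric] indicator_def)
    qed
  qed
  also have "\<dots> = Fw (\<theta> (ennreal s) \<omega>)" by (simp add: Fw_def s')
  finally show ?thesis ..
qed

lemma measurable_Fw_theta: "(\<lambda>(s, \<omega>). indicator \<Lambda> \<omega> * Fw (\<theta> (ennreal s) \<omega>)) \<in> borel_measurable (borel \<Otimes>\<^sub>M Finf)"
proof -
  have "(\<lambda>z. indicator \<Lambda> (snd z) :: ennreal) \<in> borel_measurable (borel \<Otimes>\<^sub>M Finf)"
    using \<Lambda>_Finf by measurable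
  from borel_measurable_times_ennreal[OF this measurable_int_Gw]
  show ?thesis
    by (rule measurable_cong[THEN iffD1, rotated]) (auto simp: Fw_theta indicator_def)
qed

lemma Fw_le_1: "Fw \<omega> \<le> 1"
proof -
  have "Fw \<omega> \<le> (\<integral>\<^sup>+r. indicator {0<..1 :: real} r \<partial>lborel)"
    unfolding Fw_def
  proof (rule nn_integral_mono)
    fix r
    have "W r \<omega> * e (A (max 0 r) \<omega>) \<le> 1 * 1" by (intro mult_mono W_le_1 e_le_1) auto
    then show "W r \<omega> * e (A (max 0 r) \<omega>) * indicator {0<..1} r \<le> indicator {0<..1} r"
      by (auto simp: indicator_def)
  qed
  also have "\<dots> = 1" by simp
  finally show ?thesis .
qed

lemma Fw_None: "X 0 \<omega> = None \<Longrightarrow> Fw \<omega> = 0"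
proof -
  assume "X 0 \<omega> = None"
  then have "\<zeta> \<omega> = 0" using absorbed[of 0 \<omega>] by simp
  then have "X s \<omega> = None" for s using absorbed[of s \<omega>] by simp
  then show ?thesis by (simp add: Fw_def)
qed

lemma E_Fw: "(\<integral>\<^sup>+\<omega>. Fw \<omega> \<partial>Q y) = lift \<phi> y"
proof (cases y)
  case None
  have "(\<integral>\<^sup>+\<omega>. Fw \<omega> \<partial>Q None) = (\<integral>\<^sup>+\<omega>. 0 \<partial>Q None)"
    by (rule nn_integral_cong_AE, use AE_X_0[of None] in eventually_elim) (simp add: Fw_None)
  then show ?thesis by (simp add: None)
qed (simp add: \<phi>_def)

lemma \<phi>_le_1: "\<phi> x \<le> 1"
proof -
  interpret prob_space "Q (Some x)" by (rule prob_Q)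
  have "\<phi> x \<le> (\<integral>\<^sup>+\<omega>. 1 \<partial>Q (Some x))" unfolding \<phi>_def by (intro nn_integral_mono Fw_le_1)
  then show ?thesis using emeasure_space_1 by simp
qed

lemma Fw_pos: "X 0 \<omega> \<noteq> None \<Longrightarrow> 0 < Fw \<omega>"
proof -
  assume "X 0 \<omega> \<noteq> None"
  then have z: "0 < \<zeta> \<omega>" using absorbed[of 0 \<omega>] by (simp add: zero_less_iff_neq_zero)
  obtain d where d: "0 < d" "d \<le> 1" "ennreal d \<le> \<zeta> \<omega>"
  proof (cases "\<zeta> \<omega>")
    case (real r)
    then have "0 < r" using z by simp
    then show ?thesis using that[of "min 1 r"] real by (auto intro: ennreal_leI)
  next
    case top
    then show ?thesis using that[of 1] by simp
  qed
  have "Fw \<omega> \<noteq> 0"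
  proof
    assume "Fw \<omega> = 0"
    then have "AE r in lborel. Gw 0 \<omega> r = 0"
      unfolding Fw_Gw using measurable_Gw_path by (subst (asm) nn_integral_0_iff_AE) auto
    then have "AE r in lborel. r \<notin> {0<..<d}"
    proof eventually_elim
      fix r assume G: "Gw 0 \<omega> r = 0"
      show "r \<notin> {0<..<d}"
      proof
        assume r: "r \<in> {0<..<d}"
        then have "ennreal r < ennreal d" by (intro ennreal_lessI) auto
        then have "0 < W r \<omega>" using d(3) by (simp add: W_alive)
        moreover have "0 < e (A (max 0 r) \<omega> - A (max 0 0) \<omega>)" by (rule e_pos)
        moreover have "indicator {max 0 0<..max 0 0 + 1} r = (1 :: ennreal)" using r d by simp
        ultimately show False using G unfolding Gw_def by (metis mult.right_neutral mult_eq_0_iff not_gr_zero)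
      qed
    qed
    moreover have "{r \<in> space lborel. \<not> r \<notin> {0<..<d}} = {0<..<d}" by auto
    ultimately have "emeasure lborel {0<..<d} = 0"
      using AE_iff_measurable[of "{0<..<d}" lborel "\<lambda>r. r \<notin> {0<..<d}"] by simp
    then show False using d by simp
  qed
  then show ?thesis by (simp add: zero_less_iff_neq_zero)
qed

text \<open>A path that starts in the state space has a positive life time, and until then the integrand of \<open>Fw\<close> is strictly positive on \<open>(0, 1]\<close>.\<close>

lemma \<phi>_pos: "0 < \<phi> x"
proof -
  interpret prob_space "Q (Some x)" by (rule prob_Q)
  have "\<phi> x \<noteq> 0"
  proof
    assume "\<phi> x = 0"
    then have "AE \<omega> in Q (Some x). Fw \<omega> = 0"
      unfolding \<phi>_def using measurable_Finf_Q[OF measurable_Fw] by (subst (asm) nn_integral_0_iff_AE) auto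
    moreover have "AE \<omega> in Q (Some x). 0 < Fw \<omega>"
      using AE_X_0[of "Some x"] by eventually_elim (simp add: Fw_pos)
    ultimately have "AE \<omega> in Q (Some x). False" by eventually_elim simp
    then show False by simp
  qed
  then show ?thesis by (simp add: zero_less_iff_neq_zero)
qed

text \<open>The expectations of \<open>Fw \<circ> \<theta>\<^sub>\<epsilon>\<close> are Borel in the starting point by \<open>measurable_E_shift\<close>; right
  continuity transfers this to \<open>\<phi>\<close>.\<close>

lemma Fw_right_continuous:
  assumes \<omega>: "\<omega> \<in> \<Lambda>"
  shows "(\<lambda>n. Fw (\<theta> (ennreal (eps 0 1 n)) \<omega>)) \<longlonglongrightarrow> Fw \<omega>"
  unfolding Fw_theta[OF \<omega>] unfolding Fw_Gw
proof (rule nn_integral_dominated_convergence[where w = "indicator {0<..2}"])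
  have d: "0 < eps 0 1 n" "eps 0 1 n \<le> 1" for n using eps(1,2)[of 0 1 n] by auto
  show "AE r in lborel. Gw (eps 0 1 n) \<omega> r \<le> indicator {0<..2} r" for n
  proof (rule AE_I2)
    fix r
    have "W r \<omega> * e (A (max 0 r) \<omega> - A (max 0 (eps 0 1 n)) \<omega>) \<le> 1 * 1" by (intro mult_mono W_le_1 e_le_1) auto
    then show "Gw (eps 0 1 n) \<omega> r \<le> indicator {0<..2} r"
      unfolding Gw_def using d[of n] by (auto simp: indicator_def max_def)
  qed
  have A0: "(\<lambda>n. A (eps 0 1 n) \<omega>) \<longlonglongrightarrow> 0"
    using continuous_on_tendsto_compose[OF clock.cont[OF clock, of \<omega>] eps(4)[of 0 1]] d(1)
    by (simp add: A_0 less_imp_le)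
  have "AE r in lborel. r \<noteq> (0 :: real) \<and> r \<noteq> 1"
    using AE_lborel_singleton[of "0 :: real"] AE_lborel_singleton[of "1 :: real"] by eventually_elim simp
  then show "AE r in lborel. (\<lambda>n. Gw (eps 0 1 n) \<omega> r) \<longlonglongrightarrow> Gw 0 \<omega> r"
  proof eventually_elim
    fix r :: real assume r: "r \<noteq> 0 \<and> r \<noteq> 1"
    have lim: "eps 0 1 \<longlonglongrightarrow> 0" by (rule eps(4))
    have lim1: "(\<lambda>n. eps 0 1 n + 1) \<longlonglongrightarrow> 1" using tendsto_add[OF lim tendsto_const, of 1] by simp
    show "(\<lambda>n. Gw (eps 0 1 n) \<omega> r) \<longlonglongrightarrow> Gw 0 \<omega> r"
    proof (cases "0 < r \<and> r < 1 \<and> ennreal r < \<zeta> \<omega>")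
      case True
      have Ar: "A r \<omega> < \<infinity>" using A_finite[of r \<omega>] True by simp
      have ev: "\<forall>\<^sub>F n in sequentially. eps 0 1 n < r" using lim True by (intro order_tendstoD(2)) auto
      have "(\<lambda>n. enn2real (A (eps 0 1 n) \<omega>)) \<longlonglongrightarrow> 0"
        by (rule tendsto_enn2real) (use A0 in simp_all)
      then have "(\<lambda>n. enn2real (A r \<omega>) - enn2real (A (eps 0 1 n) \<omega>)) \<longlonglongrightarrow> enn2real (A r \<omega>) - 0"
        by (intro tendsto_diff tendsto_const)
      then have "(\<lambda>n. ennreal (exp (- (enn2real (A r \<omega>) - enn2real (A (eps 0 1 n) \<omega>))))) \<longlonglongrightarrow> e (A r \<omega>)"
        unfolding e_def by (intro tendsto_ennrealI tendsto_exp tendsto_minus) simp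
      moreover have "\<forall>\<^sub>F n in sequentially. ennreal (exp (- (enn2real (A r \<omega>) - enn2real (A (eps 0 1 n) \<omega>)))) = e (A r \<omega> - A (eps 0 1 n) \<omega>)"
        using ev
      proof eventually_elim
        fix n assume "eps 0 1 n < r"
        then have le: "A (eps 0 1 n) \<omega> \<le> A r \<omega>" using d(1)[of n] by (intro A_mono) auto
        obtain a b where ab: "A r \<omega> = ennreal a" "A (eps 0 1 n) \<omega> = ennreal b" "0 \<le> a" "0 \<le> b"
          using Ar le by (cases "A r \<omega>"; cases "A (eps 0 1 n) \<omega>") (auto simp: top_unique)
        then have "b \<le> a" using le by simp
        then show "ennreal (exp (- (enn2real (A r \<omega>) - enn2real (A (eps 0 1 n) \<omega>)))) = e (A r \<omega> - A (eps 0 1 n) \<omega>)"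
          using ab by (simp add: e_def ennreal_minus)
      qed
      ultimately have "(\<lambda>n. e (A r \<omega> - A (eps 0 1 n) \<omega>)) \<longlonglongrightarrow> e (A r \<omega>)"
        by (rule Lim_transform_eventually)
      then have "(\<lambda>n. W r \<omega> * e (A r \<omega> - A (eps 0 1 n) \<omega>)) \<longlonglongrightarrow> W r \<omega> * e (A r \<omega>)"
        by (intro tendsto_mult_ennreal tendsto_const) (use W_le_1[of r \<omega>] e_le_1[of "A r \<omega>"] in \<open>auto simp: top_unique\<close>)
      moreover have "\<forall>\<^sub>F n in sequentially. W r \<omega> * e (A r \<omega> - A (eps 0 1 n) \<omega>) = Gw (eps 0 1 n) \<omega> r"
        using ev
      proof eventually_elim
        fix n assume "eps 0 1 n < r"
        then show "W r \<omega> * e (A r \<omega> - A (eps 0 1 n) \<omega>) = Gw (eps 0 1 n) \<omega> r"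
          unfolding Gw_def using True d[of n] by (auto simp: indicator_def max_def)
      qed
      ultimately have "(\<lambda>n. Gw (eps 0 1 n) \<omega> r) \<longlonglongrightarrow> W r \<omega> * e (A r \<omega>)"
        by (rule Lim_transform_eventually)
      then show ?thesis using True by (simp add: Gw_def A_0 max_def)
    next
      case False
      then consider "r < 0" | "1 < r" | "\<not> ennreal r < \<zeta> \<omega>" using r by linarith
      then have "\<forall>\<^sub>F n in sequentially. Gw (eps 0 1 n) \<omega> r = 0"
      proof cases
        case 1
        have "Gw (eps 0 1 n) \<omega> r = 0" for n
          using 1 d(1)[of n] by (simp add: Gw_def indicator_def max_def)
        then show ?thesis by simp
      next
        case 2
        then have "\<forall>\<^sub>F n in sequentially. eps 0 1 n + 1 < r" using lim1 by (intro order_tendstoD(2)) auto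
        then show ?thesis by (rule eventually_mono) (simp add: Gw_def indicator_def max_absorb2 less_imp_le[OF d(1)])
      qed (simp add: Gw_def W_eq_0)
      moreover have "Gw 0 \<omega> r = 0" using False r by (auto simp: Gw_def W_eq_0 indicator_def)
      ultimately show ?thesis by (simp add: tendsto_eventually)
    qed
  qed
qed (use measurable_Gw_path in auto)

lemma measurable_\<phi> [measurable]: "\<phi> \<in> borel_measurable borel"
proof (rule borel_measurable_LIMSEQ_order)
  show "(\<lambda>x. \<integral>\<^sup>+\<omega>. Fw (\<theta> (ennreal (eps 0 1 n)) \<omega>) \<partial>Q (Some x)) \<in> borel_measurable borel" for n
    by (rule measurable_E_shift[OF measurable_Fw]) (use eps(1)[of 0 1 n] in simp)
  fix x
  interpret prob_space "Q (Some x)" by (rule prob_Q)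
  have [measurable]: "(\<lambda>\<omega>. indicator \<Lambda> \<omega> * Fw (\<theta> (ennreal s) \<omega>)) \<in> borel_measurable (Q (Some x))" for s
  proof (rule measurable_Finf_Q)
    have "(\<lambda>\<omega>. (s, \<omega>)) \<in> Finf \<rightarrow>\<^sub>M borel \<Otimes>\<^sub>M Finf" by measurable
    from measurable_compose[OF this measurable_Fw_theta]
    show "(\<lambda>\<omega>. indicator \<Lambda> \<omega> * Fw (\<theta> (ennreal s) \<omega>)) \<in> borel_measurable Finf" by simp
  qed
  have "(\<lambda>n. \<integral>\<^sup>+\<omega>. indicator \<Lambda> \<omega> * Fw (\<theta> (ennreal (eps 0 1 n)) \<omega>) \<partial>Q (Some x)) \<longlonglongrightarrow> \<phi> x"
    unfolding \<phi>_def
  proof (rule nn_integral_dominated_convergence[where w = "\<lambda>_. 1"])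
    show "AE \<omega> in Q (Some x). indicator \<Lambda> \<omega> * Fw (\<theta> (ennreal (eps 0 1 n)) \<omega>) \<le> 1" for n
      using Fw_le_1 by (auto simp: indicator_def)
    show "AE \<omega> in Q (Some x). (\<lambda>n. indicator \<Lambda> \<omega> * Fw (\<theta> (ennreal (eps 0 1 n)) \<omega>)) \<longlonglongrightarrow> Fw \<omega>"
      using AE_\<Lambda>[of x] by eventually_elim (simp add: Fw_right_continuous)
  qed (use measurable_Finf_Q[OF measurable_Fw] emeasure_space_1 in auto)
  moreover have "(\<integral>\<^sup>+\<omega>. indicator \<Lambda> \<omega> * Fw (\<theta> (ennreal (eps 0 1 n)) \<omega>) \<partial>Q (Some x)) =
      (\<integral>\<^sup>+\<omega>. Fw (\<theta> (ennreal (eps 0 1 n)) \<omega>) \<partial>Q (Some x))" for n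
    by (rule nn_integral_cong_AE, use AE_\<Lambda>[of x] in eventually_elim) simp
  ultimately show "(\<lambda>n. \<integral>\<^sup>+\<omega>. Fw (\<theta> (ennreal (eps 0 1 n)) \<omega>) \<partial>Q (Some x)) \<longlonglongrightarrow> \<phi> x" by simp
qed

lemma integral_exp:
  assumes "0 \<le> b"
  shows "(\<integral>\<^sup>+u. ennreal (exp (u - a)) * indicator {0..b} u \<partial>lborel) = ennreal (exp (b - a) - exp (- a))"
proof -
  have "(\<integral>\<^sup>+u. ennreal (exp (u - a)) * indicator {0..b} u \<partial>lborel) = ennreal (exp (b - a) - exp (0 - a))"
    by (rule nn_integral_FTC_Icc) (use assms in \<open>auto intro!: derivative_eq_intros\<close>)
  then show ?thesis by simp
qed

lemma measurable_\<tau>_path: "(\<lambda>u. \<tau> u \<omega>) \<in> borel_measurable borel"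
  unfolding \<tau>_def by (rule clock.inv_clock_measurable[OF clock])

lemma measurable_levels: "levels \<omega> t \<in> sets borel"
proof -
  note measurable_\<tau>_path[of \<omega>, measurable]
  have "{u\<in>space borel. u \<in> levels \<omega> t} \<in> sets borel" unfolding levels_def by measurable
  then show ?thesis by simp
qed

text \<open>By Fubini, the time \<open>r\<close> contributes to the first summand at most the weight \<open>w(X\<^sub>r)\<close> times
  \<open>\<integral> exp(-(A\<^sub>r - A\<^sub>s)) dA\<^sub>s\<close> over \<open>s \<le> min r t\<close>.  In levels, this is
  \<open>\<integral> exp(u - A\<^sub>r) du\<close>, which telescopes to \<open>exp(A\<^sub>s - A\<^sub>r) - exp(-A\<^sub>r)\<close> at \<open>s = min r t\<close>.  The subtracted term is
  compensated by \<open>Fw \<omega>\<close>.  The remaining one is at most \<open>1\<close> for \<open>r \<le> t\<close>, and for \<open>r > t\<close> it is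
  the integrand of \<open>Fw \<circ> \<theta>\<^sub>t\<close>.\<close>

lemma localizer_inequality:
  assumes \<omega>: "\<omega> \<in> \<Lambda>" and t: "0 \<le> t"
  shows "dA_integral X A \<omega> (ennreal t) (\<lambda>s. indicator \<Lambda> \<omega> * Fw (\<theta> (ennreal s) \<omega>)) + Fw \<omega>
    \<le> Fw (\<theta> (ennreal t) \<omega>) + (\<integral>\<^sup>+r. W r \<omega> * indicator {0<..t} r \<partial>lborel)"
proof -
  define H where "H u r = indicator (levels \<omega> (ennreal t)) u * Gw (enn2real (\<tau> u \<omega>)) \<omega> r" for u r
  have Hm: "(\<lambda>z. H (fst z) (snd z)) \<in> borel_measurable (lborel \<Otimes>\<^sub>M lborel)"
  proof -
    note measurable_\<tau>_path[of \<omega>, measurable] measurable_levels[of \<omega> "ennreal t", measurable]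
    have "(\<lambda>z. ((enn2real (\<tau> (fst z) \<omega>), \<omega>), snd z)) \<in> lborel \<Otimes>\<^sub>M lborel \<rightarrow>\<^sub>M (borel \<Otimes>\<^sub>M Finf) \<Otimes>\<^sub>M lborel"
      by (intro measurable_Pair measurable_const) (simp_all cong: measurable_cong_sets)
    from measurable_compose[OF this measurable_Gw]
    have "(\<lambda>z. Gw (enn2real (\<tau> (fst z) \<omega>)) \<omega> (snd z)) \<in> borel_measurable (lborel \<Otimes>\<^sub>M lborel)" by simp
    moreover have "(\<lambda>z. indicator (levels \<omega> (ennreal t)) (fst z) :: ennreal) \<in> borel_measurable (lborel \<Otimes>\<^sub>M lborel)"
      by (rule measurable_compose[OF measurable_fst]) (simp cong: measurable_cong_sets)
    ultimately show ?thesis unfolding H_def by (rule borel_measurable_times_ennreal[rotated])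
  qed
  have "dA_integral X A \<omega> (ennreal t) (\<lambda>s. indicator \<Lambda> \<omega> * Fw (\<theta> (ennreal s) \<omega>)) =
    (\<integral>\<^sup>+u. (indicator \<Lambda> \<omega> * Fw (\<theta> (ennreal (enn2real (\<tau> u \<omega>))) \<omega>)) * indicator (levels \<omega> (ennreal t)) u \<partial>lborel)"
    by (rule dA_integral_joint[OF measurable_Fw_theta])
  also have "\<dots> = (\<integral>\<^sup>+u. (\<integral>\<^sup>+r. H u r \<partial>lborel) \<partial>lborel)"
    unfolding H_def using \<omega>
    by (intro nn_integral_cong) (simp add: Fw_theta nn_integral_cmult[OF measurable_Gw_path] mult.commute)
  also have "\<dots> = (\<integral>\<^sup>+r. (\<integral>\<^sup>+u. H u r \<partial>lborel) \<partial>lborel)"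
    using lborel_pair.Fubini[of "\<lambda>z. H (fst z) (snd z)"] Hm by (simp add: split_beta')
  finally have J: "dA_integral X A \<omega> (ennreal t) (\<lambda>s. indicator \<Lambda> \<omega> * Fw (\<theta> (ennreal s) \<omega>)) =
    (\<integral>\<^sup>+r. (\<integral>\<^sup>+u. H u r \<partial>lborel) \<partial>lborel)" .
  have Lm: "(\<lambda>r. \<integral>\<^sup>+u. H u r \<partial>lborel) \<in> borel_measurable lborel"
  proof (rule lborel.borel_measurable_nn_integral)
    show "(\<lambda>(r, u). H u r) \<in> borel_measurable (lborel \<Otimes>\<^sub>M lborel)"
      using measurable_compose[OF measurable_pair_swap' Hm] by (simp add: split_beta')
  qed
  have Wm: "(\<lambda>r. W r \<omega> * indicator {0<..t} r) \<in> borel_measurable lborel"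
    using measurable_lift_X_path[OF w, of \<omega>] by simp
  have point: "(\<integral>\<^sup>+u. H u r \<partial>lborel) + Gw 0 \<omega> r \<le> Gw t \<omega> r + W r \<omega> * indicator {0<..t} r" for r
  proof (cases "ennreal r < \<zeta> \<omega> \<and> 0 < r \<and> r \<le> t + 1")
    case False
    have "H u r = 0" for u
    proof (cases "u \<in> levels \<omega> (ennreal t)")
      case True
      then have "0 < enn2real (\<tau> u \<omega>)" "enn2real (\<tau> u \<omega>) \<le> t"
        using t enn2real_leI by (auto simp: levels_def enn2real_positive_iff less_top)
      then show ?thesis using False by (auto simp: H_def Gw_def indicator_def W_eq_0)
    qed (simp add: H_def)
    moreover have "Gw 0 \<omega> r = 0" using False t by (auto simp: Gw_def indicator_def W_eq_0)
    ultimately show ?thesis by simp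
  next
    case True
    then have r: "0 < r" "r \<le> t + 1" "ennreal r < \<zeta> \<omega>" by auto
    define \<alpha> where "\<alpha> = enn2real (A r \<omega>)"
    have \<alpha>: "A r \<omega> = ennreal \<alpha>" "0 \<le> \<alpha>" using A_finite[of r \<omega>] r by (auto simp: \<alpha>_def)
    define \<beta> where "\<beta> = enn2real (A (min r t) \<omega>)"
    have le: "A (min r t) \<omega> \<le> A r \<omega>" using r t by (intro A_mono) auto
    then have "A (min r t) \<omega> < \<infinity>" using \<alpha> by (auto intro: le_less_trans)
    then have \<beta>: "A (min r t) \<omega> = ennreal \<beta>" "0 \<le> \<beta>" by (auto simp: \<beta>_def)
    have \<beta>\<alpha>: "\<beta> \<le> \<alpha>" using le \<alpha> \<beta> by simp
    have "(\<integral>\<^sup>+u. H u r \<partial>lborel) \<le> (\<integral>\<^sup>+u. W r \<omega> * (ennreal (exp (u - \<alpha>)) * indicator {0..\<beta>} u) \<partial>lborel)"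
    proof (rule nn_integral_mono)
      fix u
      show "H u r \<le> W r \<omega> * (ennreal (exp (u - \<alpha>)) * indicator {0..\<beta>} u)"
      proof (cases "u \<in> levels \<omega> (ennreal t) \<and> enn2real (\<tau> u \<omega>) < r")
        case True
        then have fin: "\<tau> u \<omega> < \<infinity>" and u: "0 \<le> u" and T: "enn2real (\<tau> u \<omega>) \<le> t"
          using t enn2real_leI by (auto simp: levels_def)
        have Au: "A (enn2real (\<tau> u \<omega>)) \<omega> = ennreal u" by (rule A_\<tau>[OF fin])
        have "ennreal u \<le> A (min r t) \<omega>"
          unfolding Au[symmetric] using True T by (intro A_mono) auto
        then have "u \<le> \<beta>" using \<beta> by simp
        moreover have "e (A r \<omega> - ennreal u) = ennreal (exp (u - \<alpha>))"
          using u \<open>u \<le> \<beta>\<close> \<beta>\<alpha> by (simp add: e_def \<alpha> ennreal_minus)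
        ultimately show ?thesis
          using u r Au by (auto simp: H_def Gw_def indicator_def max_def)
      next
        case False
        then show ?thesis by (auto simp: H_def Gw_def indicator_def)
      qed
    qed
    also have "\<dots> = W r \<omega> * ennreal (exp (\<beta> - \<alpha>) - exp (- \<alpha>))"
      by (subst nn_integral_cmult) (simp_all add: integral_exp[OF \<beta>(2)])
    finally have HI: "(\<integral>\<^sup>+u. H u r \<partial>lborel) \<le> W r \<omega> * ennreal (exp (\<beta> - \<alpha>) - exp (- \<alpha>))" .
    have G0: "Gw 0 \<omega> r \<le> W r \<omega> * ennreal (exp (- \<alpha>))"
      using r by (auto simp: Gw_def A_0 max_def \<alpha> e_def indicator_def)
    have "(\<integral>\<^sup>+u. H u r \<partial>lborel) + Gw 0 \<omega> r \<le> W r \<omega> * ennreal (exp (\<beta> - \<alpha>) - exp (- \<alpha>)) + W r \<omega> * ennreal (exp (- \<alpha>))"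
      by (rule add_mono[OF HI G0])
    also have "\<dots> = W r \<omega> * ennreal (exp (\<beta> - \<alpha>))"
      using \<beta>(2) by (simp add: distrib_left[symmetric] flip: ennreal_plus)
    also have "\<dots> \<le> Gw t \<omega> r + W r \<omega> * indicator {0<..t} r"
    proof (cases "r \<le> t")
      case True
      have "W r \<omega> * ennreal (exp (\<beta> - \<alpha>)) \<le> W r \<omega> * 1"
        using \<beta>\<alpha> by (intro mult_left_mono) (simp_all add: ennreal_le_1)
      then show ?thesis using True r by (simp add: add_increasing)
    next
      case False
      then have "min r t = t" "max 0 r = r" "max 0 t = t" using t r by auto
      moreover have "e (A r \<omega> - ennreal \<beta>) = ennreal (exp (\<beta> - \<alpha>))"
        using \<beta>\<alpha> \<beta>(2) by (simp add: e_def \<alpha> ennreal_minus)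
      ultimately have "Gw t \<omega> r = W r \<omega> * ennreal (exp (\<beta> - \<alpha>))"
        unfolding Gw_def using \<beta>(1) r False by simp
      then show ?thesis by simp
    qed
    finally show ?thesis .
  qed
  have "dA_integral X A \<omega> (ennreal t) (\<lambda>s. indicator \<Lambda> \<omega> * Fw (\<theta> (ennreal s) \<omega>)) + Fw \<omega> =
    (\<integral>\<^sup>+r. (\<integral>\<^sup>+u. H u r \<partial>lborel) + Gw 0 \<omega> r \<partial>lborel)"
    unfolding J Fw_Gw[of \<omega>] by (rule nn_integral_add[OF Lm measurable_Gw_path, symmetric])
  also have "\<dots> \<le> (\<integral>\<^sup>+r. Gw t \<omega> r + W r \<omega> * indicator {0<..t} r \<partial>lborel)"
    by (intro nn_integral_mono point)
  also have "\<dots> = Fw (\<theta> (ennreal t) \<omega>) + (\<integral>\<^sup>+r. W r \<omega> * indicator {0<..t} r \<partial>lborel)"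
    unfolding Fw_theta[OF \<omega>] by (rule nn_integral_add[OF measurable_Gw_path Wm])
  finally show ?thesis .
qed

text \<open>The function \<open>R\<^sub>t h = \<integral>\<^sub>0\<^sup>t P\<^sub>r h dr\<close> is the expected time integral of \<open>h\<close> along the path.\<close>

definition Rt :: "real \<Rightarrow> ('s \<Rightarrow> ennreal) \<Rightarrow> 's \<Rightarrow> ennreal" where
  "Rt t h x = (\<integral>\<^sup>+r. Pt r h x * indicator {0<..t} r \<partial>lborel)"

lemma measurable_Pt_joint:
  assumes h: "h \<in> borel_measurable borel"
  shows "(\<lambda>(r, x). if 0 < r then Pt r h x else 0) \<in> borel_measurable (borel \<Otimes>\<^sub>M borel)"
proof -
  have "(\<lambda>z. (fst (fst z), snd (fst z), snd z)) \<in> (borel \<Otimes>\<^sub>M borel) \<Otimes>\<^sub>M borel \<rightarrow>\<^sub>M (borel :: real measure) \<Otimes>\<^sub>M (borel :: 's measure) \<Otimes>\<^sub>M (borel :: 's measure)"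
    by measurable
  from measurable_compose[OF this p_joint]
  have [measurable]: "(\<lambda>z. if 0 < fst (fst z) then p (fst (fst z)) (snd (fst z)) (snd z) else 0)
    \<in> borel_measurable ((borel \<Otimes>\<^sub>M borel) \<Otimes>\<^sub>M (borel :: 's measure))" by simp
  note h[measurable]
  have "(\<lambda>z. (if 0 < fst (fst z) then p (fst (fst z)) (snd (fst z)) (snd z) else 0) * h (snd z))
    \<in> borel_measurable ((borel \<Otimes>\<^sub>M borel) \<Otimes>\<^sub>M (borel :: 's measure))" by measurable
  then have "(\<lambda>(z, y). (if 0 < fst z then p (fst z) (snd z) y else 0) * h y)
    \<in> borel_measurable ((borel \<Otimes>\<^sub>M borel) \<Otimes>\<^sub>M m)" by (simp add: split_beta' cong: measurable_cong_sets)
  from m.borel_measurable_nn_integral[OF this]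
  show ?thesis
    by (rule measurable_cong[THEN iffD1, rotated]) (auto simp: Pt_def)
qed

lemma measurable_Rt_integrand:
  assumes h: "h \<in> borel_measurable borel"
  shows "(\<lambda>(x, r). Pt r h x * indicator {0<..t} r) \<in> borel_measurable (borel \<Otimes>\<^sub>M lborel)"
proof -
  have "(\<lambda>z. indicator {0<..t} (fst z) :: ennreal) \<in> borel_measurable (borel \<Otimes>\<^sub>M (borel :: 's measure))" by measurable
  from borel_measurable_times_ennreal[OF measurable_Pt_joint[OF h] this]
  have "(\<lambda>z. Pt (fst z) h (snd z) * indicator {0<..t} (fst z)) \<in> borel_measurable (borel \<Otimes>\<^sub>M borel)"
    by (rule measurable_cong[THEN iffD1, rotated]) (auto simp: indicator_def)
  from measurable_compose[OF measurable_pair_swap' this] show ?thesis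
    by (simp add: split_beta' cong: measurable_cong_sets)
qed

lemma measurable_Rt: "h \<in> borel_measurable borel \<Longrightarrow> Rt t h \<in> borel_measurable borel"
  unfolding Rt_def[abs_def] by (rule lborel.borel_measurable_nn_integral[OF measurable_Rt_integrand])

lemma measurable_Pt_time: "h \<in> borel_measurable borel \<Longrightarrow> (\<lambda>r. Pt r h x * indicator {0<..t} r) \<in> borel_measurable borel"
proof -
  assume h: "h \<in> borel_measurable borel"
  have "Pair x \<in> lborel \<rightarrow>\<^sub>M (borel :: 's measure) \<Otimes>\<^sub>M lborel" by (rule measurable_Pair1') simp
  from measurable_compose[OF this measurable_Rt_integrand[OF h, of t]]
  show ?thesis by (simp cong: measurable_cong_sets)
qed

lemma integral_Rt:
  assumes h: "h \<in> borel_measurable borel" and v[measurable]: "v \<in> borel_measurable borel"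
  shows "(\<integral>\<^sup>+x. v x * Rt t h x \<partial>m) = (\<integral>\<^sup>+r. (\<integral>\<^sup>+x. v x * Pt r h x \<partial>m) * indicator {0<..t} r \<partial>lborel)"
proof -
  interpret pair_sigma_finite m lborel ..
  have meas: "(\<lambda>(x, r). v x * (Pt r h x * indicator {0<..t} r)) \<in> borel_measurable (m \<Otimes>\<^sub>M lborel)"
  proof -
    have "(\<lambda>z. v (fst z)) \<in> borel_measurable (borel \<Otimes>\<^sub>M lborel)" by measurable
    from borel_measurable_times_ennreal[OF this measurable_Rt_integrand[OF h, of t]]
    show ?thesis by (simp add: split_beta' cong: measurable_cong_sets)
  qed
  have "(\<integral>\<^sup>+x. v x * Rt t h x \<partial>m) = (\<integral>\<^sup>+x. (\<integral>\<^sup>+r. v x * (Pt r h x * indicator {0<..t} r) \<partial>lborel) \<partial>m)"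
    unfolding Rt_def using measurable_Pt_time[OF h]
    by (intro nn_integral_cong nn_integral_cmult[symmetric]) (simp cong: measurable_cong_sets)
  also have "\<dots> = (\<integral>\<^sup>+r. (\<integral>\<^sup>+x. v x * (Pt r h x * indicator {0<..t} r) \<partial>m) \<partial>lborel)"
    using Fubini[OF meas] by simp
  also have "\<dots> = (\<integral>\<^sup>+r. (\<integral>\<^sup>+x. v x * Pt r h x \<partial>m) * indicator {0<..t} r \<partial>lborel)"
    by (intro nn_integral_cong) (auto simp: indicator_def)
  finally show ?thesis .
qed

lemma Rt_le:
  assumes "\<And>x. h x \<le> 1" "0 \<le> t" shows "Rt t h x \<le> ennreal t"
proof -
  have "Rt t h x \<le> (\<integral>\<^sup>+r. indicator {0<..t} r \<partial>lborel)"
    unfolding Rt_def by (intro nn_integral_mono) (use Pt_le_1 assms in \<open>auto simp: indicator_def\<close>)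
  then show ?thesis using assms(2) by simp
qed

lemma integral_Rt_le:
  assumes h: "h \<in> borel_measurable borel" and t: "0 \<le> t"
  shows "(\<integral>\<^sup>+x. Rt t h x \<partial>m) \<le> ennreal t * (\<integral>\<^sup>+x. h x \<partial>m)"
proof -
  have "(\<integral>\<^sup>+x. Rt t h x \<partial>m) = (\<integral>\<^sup>+r. (\<integral>\<^sup>+x. Pt r h x \<partial>m) * indicator {0<..t} r \<partial>lborel)"
    using integral_Rt[OF h, of "\<lambda>_. 1" t] by simp
  also have "\<dots> \<le> (\<integral>\<^sup>+r. (\<integral>\<^sup>+x. h x \<partial>m) * indicator {0<..t} r \<partial>lborel)"
    by (intro nn_integral_mono) (use integral_Pt_le[OF _ h] in \<open>auto simp: indicator_def\<close>)
  also have "\<dots> = ennreal t * (\<integral>\<^sup>+x. h x \<partial>m)"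
    using t by (simp add: nn_integral_cmult mult.commute)
  finally show ?thesis .
qed

lemma E_Rt:
  assumes h: "h \<in> borel_measurable borel"
  shows "(\<integral>\<^sup>+\<omega>. (\<integral>\<^sup>+r. lift h (X (ennreal r) \<omega>) * indicator {0<..t} r \<partial>lborel) \<partial>Q (Some x)) = Rt t h x"
proof -
  interpret Q: prob_space "Q (Some x)" by (rule prob_Q)
  interpret pair_sigma_finite lborel "Q (Some x)" ..
  have "(\<lambda>(r, \<omega>). lift h (X (ennreal r) \<omega>) * indicator {0<..t} r) \<in> borel_measurable (lborel \<Otimes>\<^sub>M Q (Some x))"
    using measurable_Finf_Q2[OF measurable_lift_X_ind[OF h]] by (simp cong: measurable_cong_sets)
  from Fubini[OF this]
  have "(\<integral>\<^sup>+\<omega>. (\<integral>\<^sup>+r. lift h (X (ennreal r) \<omega>) * indicator {0<..t} r \<partial>lborel) \<partial>Q (Some x)) =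
    (\<integral>\<^sup>+r. (\<integral>\<^sup>+\<omega>. lift h (X (ennreal r) \<omega>) * indicator {0<..t} r \<partial>Q (Some x)) \<partial>lborel)" by simp
  also have "\<dots> = Rt t h x"
    unfolding Rt_def
    by (intro nn_integral_cong) (auto simp: indicator_def Pt_def integral_X[OF _ h])
  finally show ?thesis .
qed

lemma \<phi>_le_Rt: "\<phi> x \<le> Rt 1 w x"
  unfolding \<phi>_def E_Rt[OF w, symmetric] Fw_def
  by (intro nn_integral_mono mult_right_mono)
     (use mult_left_mono[OF e_le_1] in \<open>simp_all add: le_fun_def\<close>)

lemma integral_\<phi>_finite: "(\<integral>\<^sup>+x. \<phi> x \<partial>m) < \<infinity>"
proof -
  have "(\<integral>\<^sup>+x. \<phi> x \<partial>m) \<le> (\<integral>\<^sup>+x. Rt 1 w x \<partial>m)" by (intro nn_integral_mono \<phi>_le_Rt)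
  also have "\<dots> \<le> ennreal 1 * (\<integral>\<^sup>+x. w x \<partial>m)" by (rule integral_Rt_le[OF w]) simp
  also have "\<dots> < \<infinity>" using w_int by simp
  finally show ?thesis .
qed

lemma c_\<phi>_eq:
  assumes t: "0 \<le> t"
  shows "c \<phi> t x = (\<integral>\<^sup>+\<omega>. dA_integral X A \<omega> (ennreal t) (\<lambda>s. indicator \<Lambda> \<omega> * Fw (\<theta> (ennreal s) \<omega>)) \<partial>Q (Some x))"
proof -
  have "(\<integral>\<^sup>+\<omega>. dA_integral X A \<omega> (ennreal t) (\<lambda>s. indicator \<Lambda> \<omega> * Fw (\<theta> (ennreal s) \<omega>)) \<partial>Q (Some x)) =
    (\<integral>\<^sup>+\<omega>. dA_integral X A \<omega> (ennreal t) (\<lambda>s. Fw (\<theta> (ennreal s) \<omega>)) \<partial>Q (Some x))"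
    by (rule nn_integral_cong_AE, use AE_\<Lambda>[of x] in eventually_elim) simp
  also have "\<dots> = (\<integral>\<^sup>+\<omega>. dA_integral X A \<omega> (ennreal t) (\<lambda>s. lift (\<lambda>y. \<integral>\<^sup>+\<omega>. Fw \<omega> \<partial>Q (Some y)) (X (ennreal s) \<omega>)) \<partial>Q (Some x))"
  proof (rule dA_projection[OF _ \<Lambda>_Finf AE_\<Lambda> measurable_Fw_theta])
    show "(\<lambda>(s :: real, \<omega>). Fw \<omega>) \<in> borel_measurable (borel \<Otimes>\<^sub>M Finf)"
      using measurable_compose[OF measurable_snd measurable_Fw] by (simp add: split_beta')
    show "(\<lambda>(s :: real, y). \<integral>\<^sup>+\<omega>. Fw \<omega> \<partial>Q (Some y)) \<in> borel_measurable (borel \<Otimes>\<^sub>M borel)"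
      using measurable_compose[OF measurable_snd measurable_\<phi>] by (simp add: split_beta' \<phi>_def)
  qed
  also have "\<dots> = c \<phi> t x"
    by (simp only: EBi_def dA_integral_Bi[OF t, symmetric] \<phi>_def[abs_def])
  finally show ?thesis ..
qed

text \<open>The expectation of \<open>localizer_inequality\<close>, with projection on the left and the Markov property on the right.\<close>

lemma c_\<phi>_le:
  assumes t: "0 < t"
  shows "c \<phi> t x + \<phi> x \<le> Pt t \<phi> x + Rt t w x"
proof -
  let ?J = "\<lambda>\<omega>. dA_integral X A \<omega> (ennreal t) (\<lambda>s. indicator \<Lambda> \<omega> * Fw (\<theta> (ennreal s) \<omega>))"
  have J: "?J \<in> borel_measurable (Q (Some x))"
    by (rule measurable_Finf_Q[OF measurable_dA_integral[OF measurable_Fw_theta]])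
  have Fm: "Fw \<in> borel_measurable (Q (Some x))" by (rule measurable_Finf_Q[OF measurable_Fw])
  have R: "(\<lambda>\<omega>. \<integral>\<^sup>+r. W r \<omega> * indicator {0<..t} r \<partial>lborel) \<in> borel_measurable (Q (Some x))"
  proof (rule measurable_Finf_Q, rule lborel.borel_measurable_nn_integral)
    show "(\<lambda>(\<omega>, r). W r \<omega> * indicator {0<..t} r) \<in> borel_measurable (Finf \<Otimes>\<^sub>M lborel)"
      using measurable_compose[OF measurable_pair_swap' measurable_lift_X_ind[OF w, of 0 t]]
      by (simp add: split_beta' cong: measurable_cong_sets)
  qed
  have F\<theta>: "(\<lambda>\<omega>. indicator \<Lambda> \<omega> * Fw (\<theta> (ennreal t) \<omega>)) \<in> borel_measurable (Q (Some x))"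
  proof (rule measurable_Finf_Q)
    have "(\<lambda>\<omega>. (t, \<omega>)) \<in> Finf \<rightarrow>\<^sub>M borel \<Otimes>\<^sub>M Finf" by measurable
    from measurable_compose[OF this measurable_Fw_theta]
    show "(\<lambda>\<omega>. indicator \<Lambda> \<omega> * Fw (\<theta> (ennreal t) \<omega>)) \<in> borel_measurable Finf" by simp
  qed
  have "c \<phi> t x + \<phi> x = (\<integral>\<^sup>+\<omega>. ?J \<omega> + Fw \<omega> \<partial>Q (Some x))"
    using t by (simp add: c_\<phi>_eq \<phi>_def nn_integral_add[OF J Fm])
  also have "\<dots> \<le> (\<integral>\<^sup>+\<omega>. indicator \<Lambda> \<omega> * Fw (\<theta> (ennreal t) \<omega>) + (\<integral>\<^sup>+r. W r \<omega> * indicator {0<..t} r \<partial>lborel) \<partial>Q (Some x))"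
    by (rule nn_integral_mono_AE, use AE_\<Lambda>[of x] in eventually_elim)
       (use localizer_inequality t in simp)
  also have "\<dots> = (\<integral>\<^sup>+\<omega>. indicator \<Lambda> \<omega> * Fw (\<theta> (ennreal t) \<omega>) \<partial>Q (Some x)) + Rt t w x"
    by (simp add: nn_integral_add[OF F\<theta> R] E_Rt)
  also have "(\<integral>\<^sup>+\<omega>. indicator \<Lambda> \<omega> * Fw (\<theta> (ennreal t) \<omega>) \<partial>Q (Some x)) = (\<integral>\<^sup>+\<omega>. Fw (\<theta> (ennreal t) \<omega>) \<partial>Q (Some x))"
    by (rule nn_integral_cong_AE, use AE_\<Lambda>[of x] in eventually_elim) simp
  also have "\<dots> = (\<integral>\<^sup>+\<omega>. lift \<phi> (X (ennreal t) \<omega>) \<partial>Q (Some x))"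
    by (subst markov_path[OF measurable_Fw]) (simp_all add: E_Fw)
  also have "\<dots> = Pt t \<phi> x"
    unfolding Pt_def by (rule integral_X[OF t measurable_\<phi>])
  finally show ?thesis .
qed

lemma c_\<phi>_bound: "0 < t \<Longrightarrow> c \<phi> t x \<le> 1 + ennreal t"
proof -
  assume t: "0 < t"
  have "c \<phi> t x \<le> c \<phi> t x + \<phi> x" by simp
  also have "\<dots> \<le> Pt t \<phi> x + Rt t w x" by (rule c_\<phi>_le[OF t])
  also have "\<dots> \<le> 1 + ennreal t"
    using t by (intro add_mono Pt_le_1 Rt_le \<phi>_le_1 w_le) auto
  finally show ?thesis .
qed

text \<open>The terms \<open>\<integral> \<phi> dm\<close> and \<open>\<integral> P\<^sub>t \<phi> dm\<close> of \<open>c_\<phi>_le\<close> cancel because \<open>P\<^sub>t\<close> contracts and \<open>\<phi>\<close> is integrable.\<close>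

lemma integral_c_\<phi>_le:
  assumes t: "0 < t"
  shows "(\<integral>\<^sup>+x. c \<phi> t x \<partial>m) \<le> ennreal t * (\<integral>\<^sup>+x. w x \<partial>m)"
proof -
  note measurable_EBi[OF measurable_\<phi>, measurable] measurable_Pt[OF t measurable_\<phi>, measurable] measurable_Rt[OF w, measurable]
  let ?I = "\<integral>\<^sup>+x. \<phi> x \<partial>m"
  have "?I + (\<integral>\<^sup>+x. c \<phi> t x \<partial>m) = (\<integral>\<^sup>+x. c \<phi> t x + \<phi> x \<partial>m)"
    by (subst nn_integral_add) (simp_all add: add.commute)
  also have "\<dots> \<le> (\<integral>\<^sup>+x. Pt t \<phi> x + Rt t w x \<partial>m)" by (intro nn_integral_mono c_\<phi>_le[OF t])
  also have "\<dots> = (\<integral>\<^sup>+x. Pt t \<phi> x \<partial>m) + (\<integral>\<^sup>+x. Rt t w x \<partial>m)" by (rule nn_integral_add) simp_all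
  also have "\<dots> \<le> ?I + ennreal t * (\<integral>\<^sup>+x. w x \<partial>m)"
    using t by (intro add_mono integral_Pt_le integral_Rt_le) auto
  finally show ?thesis
    using integral_\<phi>_finite by (subst (asm) ennreal_add_left_cancel_le) auto
qed

lemma \<mu>_\<phi>_finite: "(\<integral>\<^sup>+y. \<phi> y \<partial>\<mu>) < \<infinity>"
proof -
  have "q \<phi> n \<le> (\<integral>\<^sup>+x. w x \<partial>m)" for n
  proof -
    have "q \<phi> n \<le> 2 ^ n * (ennreal (dy n) * (\<integral>\<^sup>+x. w x \<partial>m))"
      unfolding q_def by (intro mult_left_mono integral_c_\<phi>_le dy) simp
    also have "\<dots> = (\<integral>\<^sup>+x. w x \<partial>m)"
      using dy(1)[of n] by (simp add: dy(4)[symmetric] mult.assoc[symmetric] flip: ennreal_mult')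
    finally show ?thesis .
  qed
  then have "(\<integral>\<^sup>+y. \<phi> y \<partial>\<mu>) \<le> (\<integral>\<^sup>+x. w x \<partial>m)"
    unfolding integral_\<mu>_SUP[OF measurable_\<phi>] by (intro SUP_least)
  then show ?thesis using w_int by (rule le_less_trans)
qed

section \<open>Second moments of an additive functional\<close>

text \<open>For \<open>r > 0\<close> this is \<open>P\<^sub>r g\<close>.  Expressed through the path it also makes sense at \<open>r = 0\<close>, the end point of the
  time integrals below.\<close>

definition PP :: "real \<Rightarrow> ('s \<Rightarrow> ennreal) \<Rightarrow> 's \<Rightarrow> ennreal" where
  "PP r g y = (\<integral>\<^sup>+\<omega>. lift g (X (ennreal r) \<omega>) \<partial>Q (Some y))"

lemma PP_pos: "0 < r \<Longrightarrow> g \<in> borel_measurable borel \<Longrightarrow> PP r g y = Pt r g y"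
  by (simp add: PP_def Pt_def integral_X)

lemma E_at_start:
  "(\<integral>\<^sup>+\<omega>. lift f (X 0 \<omega>) * H \<omega> \<partial>Q (Some y)) = (\<integral>\<^sup>+\<omega>. f y * H \<omega> \<partial>Q (Some y))"
  by (rule nn_integral_cong_AE, use AE_X_0[of "Some y"] in eventually_elim) simp

lemma PP_0: "PP 0 g y = g y"
proof -
  interpret prob_space "Q (Some y)" by (rule prob_Q)
  show ?thesis using E_at_start[where f = g and H = "\<lambda>_. 1" and y = y] emeasure_space_1 by (simp add: PP_def)
qed

lemma measurable_E_joint:
  fixes H :: "'l \<Rightarrow> 'w \<Rightarrow> ennreal"
  assumes H: "(\<lambda>(l, \<omega>). H l \<omega>) \<in> borel_measurable (L \<Otimes>\<^sub>M N)"
  shows "(\<lambda>(l, y). \<integral>\<^sup>+\<omega>. H l \<omega> \<partial>Q (Some y)) \<in> borel_measurable (L \<Otimes>\<^sub>M borel)"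
proof -
  have "(\<lambda>(z :: 'l \<times> 's, \<omega>). H (fst z) \<omega>) \<in> borel_measurable ((L \<Otimes>\<^sub>M borel) \<Otimes>\<^sub>M N)"
  proof -
    have "(\<lambda>z. (fst (fst z), snd z)) \<in> (L \<Otimes>\<^sub>M (borel :: 's measure)) \<Otimes>\<^sub>M N \<rightarrow>\<^sub>M L \<Otimes>\<^sub>M N" by measurable
    from measurable_compose[OF this H] show ?thesis by (simp add: split_beta')
  qed
  moreover have "(\<lambda>z :: 'l \<times> 's. P0 (Some (snd z))) \<in> L \<Otimes>\<^sub>M borel \<rightarrow>\<^sub>M subprob_algebra N"
    by (rule measurable_compose[OF measurable_compose[OF measurable_snd measurable_Some_borel_pt] measurable_prob_algebraD[OF P0_kernel]])
  ultimately have "(\<lambda>z. \<integral>\<^sup>+\<omega>. H (fst z) \<omega> \<partial>P0 (Some (snd z))) \<in> borel_measurable (L \<Otimes>\<^sub>M borel)"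
    by (rule nn_integral_measurable_subprob_algebra2)
  then show ?thesis by (simp add: split_beta' nn_integral_Q)
qed

lemma Pt_semigroup:
  assumes s: "0 < s" and r: "0 < r" and h[measurable]: "h \<in> borel_measurable borel"
  shows "Pt s (Pt r h) x = Pt (s + r) h x"
proof -
  interpret pair_sigma_finite m m ..
  note measurable_p[OF s, measurable] measurable_p[OF r, measurable] measurable_p1[OF s, measurable] measurable_p1[OF r, measurable]
  have meas: "(\<lambda>(y, z). p s x y * (p r y z * h z)) \<in> borel_measurable (m \<Otimes>\<^sub>M m)"
  proof -
    have "(\<lambda>u. p s x (fst u) * (p r (fst u) (snd u) * h (snd u))) \<in> borel_measurable (borel \<Otimes>\<^sub>M borel)"
      by measurable
    then show ?thesis by (simp add: split_beta' cong: measurable_cong_sets)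
  qed
  have pr: "(\<lambda>y. p r y z) \<in> borel_measurable borel" for z
    using measurable_p1[OF r, of z] by (simp add: p_sym[OF r, of _ z])
  have "Pt s (Pt r h) x = (\<integral>\<^sup>+y. (\<integral>\<^sup>+z. p s x y * (p r y z * h z) \<partial>m) \<partial>m)"
    unfolding Pt_def by (intro nn_integral_cong nn_integral_cmult[symmetric]) simp
  also have "\<dots> = (\<integral>\<^sup>+z. (\<integral>\<^sup>+y. p s x y * (p r y z * h z) \<partial>m) \<partial>m)"
    using Fubini[OF meas] by simp
  also have "\<dots> = (\<integral>\<^sup>+z. (\<integral>\<^sup>+y. p s x y * p r y z \<partial>m) * h z \<partial>m)"
    using pr by (intro nn_integral_cong) (simp add: nn_integral_multc mult.assoc[symmetric])
  also have "\<dots> = Pt (s + r) h x"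
    unfolding Pt_def by (simp add: p_semigroup[OF r s])
  finally show ?thesis .
qed

lemma nn_integral_shift:
  fixes v :: "real \<Rightarrow> ennreal"
  assumes "v \<in> borel_measurable borel"
  shows "(\<integral>\<^sup>+q. v q \<partial>lborel) = (\<integral>\<^sup>+r. v (s + r) \<partial>lborel)"
proof -
  have "(\<integral>\<^sup>+q. v q \<partial>lborel) = ennreal \<bar>1\<bar> * (\<integral>\<^sup>+r. v (s + 1 * r) \<partial>lborel)"
    by (rule nn_integral_real_affine[OF assms]) simp
  then show ?thesis by simp
qed

lemma measurable_Pt_window:
  assumes h: "h \<in> borel_measurable borel" and "0 \<le> a"
  shows "(\<lambda>r. Pt r h x * indicator {a<..b} r) \<in> borel_measurable borel"
proof -
  have "(\<lambda>r. indicator {a<..b} r :: ennreal) \<in> borel_measurable borel" by simp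
  from borel_measurable_times_ennreal[OF measurable_Pt_time[OF h, of x b] this]
  show ?thesis by (rule measurable_cong[THEN iffD1, rotated]) (use assms(2) in \<open>auto simp: indicator_def\<close>)
qed

lemma Pt_Rt:
  assumes s: "0 < s" and h: "h \<in> borel_measurable borel"
  shows "Pt s (Rt a h) x = (\<integral>\<^sup>+q. Pt q h x * indicator {s<..s + a} q \<partial>lborel)"
proof -
  have "Pt s (Rt a h) x = (\<integral>\<^sup>+r. (\<integral>\<^sup>+y. p s x y * Pt r h y \<partial>m) * indicator {0<..a} r \<partial>lborel)"
    unfolding Pt_def[of s "Rt a h"] by (rule integral_Rt[OF h measurable_p1[OF s]])
  also have "\<dots> = (\<integral>\<^sup>+r. Pt (s + r) h x * indicator {s<..s + a} (s + r) \<partial>lborel)"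
    by (intro nn_integral_cong) (auto simp: indicator_def Pt_semigroup[OF s _ h, unfolded Pt_def[of s]])
  also have "\<dots> = (\<integral>\<^sup>+q. Pt q h x * indicator {s<..s + a} q \<partial>lborel)"
    by (rule nn_integral_shift[symmetric, OF measurable_Pt_window[OF h]]) (use s in simp)
  finally show ?thesis .
qed

lemma Pt_window_le:
  assumes h: "\<And>x. h x \<le> 1" and "0 \<le> a" "a \<le> b"
  shows "(\<integral>\<^sup>+q. Pt q h x * indicator {a<..b} q \<partial>lborel) \<le> ennreal (b - a)"
proof -
  have "(\<integral>\<^sup>+q. Pt q h x * indicator {a<..b} q \<partial>lborel) \<le> (\<integral>\<^sup>+q. indicator {a<..b} q \<partial>lborel)"
    by (intro nn_integral_mono) (use Pt_le_1[of _ h] assms in \<open>auto simp: indicator_def\<close>)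
  then show ?thesis using assms by simp
qed

text \<open>The time windows \<open>(0, a]\<close> and \<open>(s, s + a]\<close> differ by pieces of length at most \<open>s\<close>, on which \<open>P\<^sub>q h \<le> 1\<close>.\<close>

lemma Pt_Rt_le:
  assumes s: "0 < s" and h: "h \<in> borel_measurable borel" "\<And>x. h x \<le> 1" and a: "0 < a"
  shows "Pt s (Rt a h) x \<le> Rt a h x + ennreal s" "Rt a h x \<le> Pt s (Rt a h) x + ennreal s"
proof -
  note mw = measurable_Pt_window[OF h(1)]
  have "Pt s (Rt a h) x \<le> (\<integral>\<^sup>+q. Pt q h x * indicator {0<..a} q + Pt q h x * indicator {a<..a + s} q \<partial>lborel)"
    unfolding Pt_Rt[OF s h(1)] by (intro nn_integral_mono) (use s a in \<open>auto simp: indicator_def\<close>)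
  also have "\<dots> = Rt a h x + (\<integral>\<^sup>+q. Pt q h x * indicator {a<..a + s} q \<partial>lborel)"
    unfolding Rt_def using mw[of 0 x a] mw[of a x "a + s"] a by (subst nn_integral_add) simp_all
  also have "\<dots> \<le> Rt a h x + ennreal s"
    using Pt_window_le[where h = h and a = a and b = "a + s" and x = x, OF h(2)] s a by (intro add_left_mono) simp
  finally show "Pt s (Rt a h) x \<le> Rt a h x + ennreal s" .
  have "Rt a h x \<le> (\<integral>\<^sup>+q. Pt q h x * indicator {s<..s + a} q + Pt q h x * indicator {0<..s} q \<partial>lborel)"
    unfolding Rt_def by (intro nn_integral_mono) (use s a in \<open>auto simp: indicator_def\<close>)
  also have "\<dots> = Pt s (Rt a h) x + (\<integral>\<^sup>+q. Pt q h x * indicator {0<..s} q \<partial>lborel)"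
    unfolding Pt_Rt[OF s h(1)] using mw[of s x "s + a"] mw[of 0 x s] s by (subst nn_integral_add) simp_all
  also have "\<dots> \<le> Pt s (Rt a h) x + ennreal s"
    using Pt_window_le[where h = h and a = 0 and b = s and x = x, OF h(2)] s by (intro add_left_mono) simp
  finally show "Rt a h x \<le> Pt s (Rt a h) x + ennreal s" .
qed

lemma PP_Rt_le:
  assumes s: "0 \<le> r" "r \<le> s" and h: "h \<in> borel_measurable borel" "\<And>x. h x \<le> 1" and a: "0 < a"
  shows "PP r (Rt a h) x \<le> Rt a h x + ennreal s" "Rt a h x \<le> PP r (Rt a h) x + ennreal s"
proof -
  have "PP r (Rt a h) x \<le> Rt a h x + ennreal r \<and> Rt a h x \<le> PP r (Rt a h) x + ennreal r"
    using Pt_Rt_le[of r h a x] PP_pos[OF _ measurable_Rt[OF h(1)], of r a x] assms by (cases "r = 0") (auto simp: PP_0)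
  moreover have "ennreal r \<le> ennreal s" using s by (simp add: ennreal_leI)
  ultimately show "PP r (Rt a h) x \<le> Rt a h x + ennreal s" "Rt a h x \<le> PP r (Rt a h) x + ennreal s"
    by (meson add_left_mono order_trans)+
qed

lemma measurable_Bi_joint:
  assumes f: "f \<in> borel_measurable borel"
  shows "(\<lambda>(r, \<omega>). Bi f (max 0 r) (max 0 r + s) \<omega>) \<in> borel_measurable (borel \<Otimes>\<^sub>M Finf)"
proof -
  let ?L = "(borel \<Otimes>\<^sub>M Finf) \<Otimes>\<^sub>M lborel :: ((real \<times> 'w) \<times> real) measure"
  have "(\<lambda>z. fst (fst z)) \<in> borel_measurable ?L" and u: "snd \<in> borel_measurable ?L"
    and \<omega>: "(\<lambda>z. snd (fst z)) \<in> ?L \<rightarrow>\<^sub>M Finf" by measurable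
  then have [measurable]: "(\<lambda>z. max 0 (fst (fst z))) \<in> borel_measurable ?L" by measurable
  have T[measurable]: "(\<lambda>z. enn2real (\<tau> (snd z) (snd (fst z)))) \<in> borel_measurable ?L"
    using measurable_\<tau>2[OF u \<omega>] by measurable
  have 1: "(\<lambda>z. lift f (X (ennreal (enn2real (\<tau> (snd z) (snd (fst z))))) (snd (fst z)))) \<in> borel_measurable ?L"
    by (rule measurable_compose[OF measurable_X2[OF T \<omega>] measurable_lift[OF f]])
  have "{z\<in>space ?L. max 0 (fst (fst z)) < enn2real (\<tau> (snd z) (snd (fst z))) \<and> enn2real (\<tau> (snd z) (snd (fst z))) \<le> max 0 (fst (fst z)) + s} \<in> sets ?L"
    by measurable
  then have 2: "(\<lambda>z. indicator {max 0 (fst (fst z))<..max 0 (fst (fst z)) + s} (enn2real (\<tau> (snd z) (snd (fst z)))) :: ennreal) \<in> borel_measurable ?L"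
    by (rule measurable_cong[THEN iffD1, OF _ borel_measurable_indicator, rotated]) (auto simp: indicator_def)
  have "(\<lambda>z. (snd z, snd (fst z))) \<in> ?L \<rightarrow>\<^sub>M borel \<Otimes>\<^sub>M Finf" using u \<omega> by measurable
  from measurable_sets[OF this sets_levels[of \<infinity>]]
  have 3: "(\<lambda>z. indicator (levels (snd (fst z)) \<infinity>) (snd z) :: ennreal) \<in> borel_measurable ?L"
    by (rule measurable_cong[THEN iffD1, OF _ borel_measurable_indicator, rotated]) (auto simp: indicator_def space_pair_measure)
  have "(\<lambda>(z, u). (lift f (X (ennreal (enn2real (\<tau> u (snd z)))) (snd z)) * indicator {max 0 (fst z)<..max 0 (fst z) + s} (enn2real (\<tau> u (snd z))))
      * indicator (levels (snd z) \<infinity>) u) \<in> borel_measurable ?L"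
    using borel_measurable_times_ennreal[OF borel_measurable_times_ennreal[OF 1 2] 3] by (simp add: split_beta')
  from lborel.borel_measurable_nn_integral[OF this]
  show ?thesis
    by (rule measurable_cong[THEN iffD1, rotated])
       (auto simp: Bi_dA_integral dA_integral_joint[OF measurable_lift_X_ind[OF f]])
qed

text \<open>The square is twice the double integral over pairs of levels \<open>u < v\<close>.  For fixed \<open>u\<close>, the inner integral is at
  most \<open>Bi f 0 s\<close> of the path shifted by \<open>\<tau>\<^sub>u\<close>, whose projection on the state at that time is \<open>c f s\<close>.\<close>

lemma E_Bi_square:
  assumes f: "f \<in> borel_measurable borel" and s: "0 \<le> s"
  shows "(\<integral>\<^sup>+\<omega>. Bi f 0 s \<omega> * Bi f 0 s \<omega> \<partial>Q (Some x)) \<le> 2 * c (\<lambda>y. f y * c f s y) s x"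
proof -
  define F where "F = (\<lambda>(r :: real) \<omega>. lift f (X 0 \<omega>) * Bi f 0 s \<omega>)"
  have F\<theta>: "F r (\<theta> (ennreal r') \<omega>) = lift f (X (ennreal r') \<omega>) * Bi f 0 s (\<theta> (ennreal r') \<omega>)" for r r' \<omega>
    by (simp add: F_def shift_X)
  have m1: "(\<lambda>(r, \<omega>). F r \<omega>) \<in> borel_measurable (borel \<Otimes>\<^sub>M Finf)"
  proof -
    have "(\<lambda>\<omega>. lift f (X 0 \<omega>)) \<in> borel_measurable Finf"
      using measurable_compose[OF measurable_X measurable_lift[OF f]] N_le_Finf by (auto simp: measurable_def)
    from measurable_compose[OF measurable_snd borel_measurable_times_ennreal[OF this measurable_Bi[OF f order_refl, of s]]]
    show ?thesis by (simp add: F_def split_beta')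
  qed
  have m2: "(\<lambda>(r, \<omega>). indicator \<Lambda> \<omega> * F r (\<theta> (ennreal r) \<omega>)) \<in> borel_measurable (borel \<Otimes>\<^sub>M Finf)"
  proof -
    have "(\<lambda>z. indicator \<Lambda> (snd z) :: ennreal) \<in> borel_measurable (borel \<Otimes>\<^sub>M Finf)"
      using \<Lambda>_Finf by measurable
    from borel_measurable_times_ennreal[OF this borel_measurable_times_ennreal[OF measurable_lift_X[OF f] measurable_Bi_joint[OF f, of s]]]
    show ?thesis
    proof (rule measurable_cong[THEN iffD1, rotated])
      fix z :: "real \<times> 'w"
      have "Bi f 0 s (\<theta> (ennreal r) \<omega>) = Bi f (max 0 r) (max 0 r + s) \<omega>" if "\<omega> \<in> \<Lambda>" for r \<omega>
        using Bi_shift[OF that f, of "max 0 r" s] s by simp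
      then show "indicator \<Lambda> (snd z) * ((case z of (s, \<omega>) \<Rightarrow> lift f (X (ennreal s) \<omega>)) *
          (case z of (r, \<omega>) \<Rightarrow> Bi f (max 0 r) (max 0 r + s) \<omega>)) =
        (case z of (r, \<omega>) \<Rightarrow> indicator \<Lambda> \<omega> * F r (\<theta> (ennreal r) \<omega>))"
        by (cases z) (auto simp: F\<theta> indicator_def)
    qed
  qed
  have EF: "(\<integral>\<^sup>+\<omega>. F r \<omega> \<partial>Q (Some y)) = f y * c f s y" for r y
    unfolding F_def E_at_start EBi_def
    using measurable_Finf_Q[OF measurable_Bi[OF f order_refl]] by (simp add: nn_integral_cmult)
  have m3: "(\<lambda>(r, y). \<integral>\<^sup>+\<omega>. F r \<omega> \<partial>Q (Some y)) \<in> borel_measurable (borel \<Otimes>\<^sub>M borel)"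
    unfolding EF using measurable_compose[OF measurable_snd borel_measurable_times_ennreal[OF f measurable_EBi[OF f order_refl, of s]]]
    by (simp add: split_beta')
  have path: "Bi f 0 s \<omega> * Bi f 0 s \<omega> \<le> 2 * dA_integral X A \<omega> (ennreal s) (\<lambda>r. indicator \<Lambda> \<omega> * F r (\<theta> (ennreal r) \<omega>))"
    if \<omega>: "\<omega> \<in> \<Lambda>" for \<omega>
  proof -
    define T where "T u = enn2real (\<tau> u \<omega>)" for u
    define \<psi> where "\<psi> u = lift f (X (ennreal (T u)) \<omega>) * indicator (levels \<omega> (ennreal s)) u" for u
    note measurable_\<tau>_path[of \<omega>, measurable] measurable_levels[measurable]
    have Tm[measurable]: "T \<in> borel_measurable borel" unfolding T_def[abs_def] by measurable
    have fT[measurable]: "(\<lambda>u. lift f (X (ennreal (T u)) \<omega>)) \<in> borel_measurable borel"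
      by (rule measurable_compose[OF Tm measurable_lift_X_path[OF f]])
    have \<psi>m[measurable]: "\<psi> \<in> borel_measurable borel" unfolding \<psi>_def[abs_def] by measurable
    have B: "Bi f 0 s \<omega> = (\<integral>\<^sup>+u. \<psi> u \<partial>lborel)"
      unfolding dA_integral_Bi[OF s, symmetric] dA_integral_joint[OF measurable_lift_X[OF f]] \<psi>_def T_def ..
    define K where "K u = (\<integral>\<^sup>+v. \<psi> v * indicator {u<..} v \<partial>lborel)" for u
    have Dm: "(\<lambda>z. \<psi> (fst z) * (\<psi> (snd z) * indicator {fst z<..} (snd z))) \<in> borel_measurable (lborel \<Otimes>\<^sub>M lborel)"
    proof -
      have "{z\<in>space (borel \<Otimes>\<^sub>M borel). fst z < (snd z :: real)} \<in> sets (borel \<Otimes>\<^sub>M borel)" by measurable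
      then have [measurable]: "(\<lambda>z. indicator {fst z<..} (snd z :: real) :: ennreal) \<in> borel_measurable (borel \<Otimes>\<^sub>M borel)"
        by (rule measurable_cong[THEN iffD1, OF _ borel_measurable_indicator, rotated]) (auto simp: indicator_def space_pair_measure)
      have "(\<lambda>z. \<psi> (fst z) * (\<psi> (snd z) * indicator {fst z<..} (snd z))) \<in> borel_measurable (borel \<Otimes>\<^sub>M borel)" by measurable
      then show ?thesis by (simp cong: measurable_cong_sets)
    qed
    have Km: "K \<in> borel_measurable lborel"
      unfolding K_def[abs_def]
    proof (rule lborel.borel_measurable_nn_integral)
      have "{z\<in>space (borel \<Otimes>\<^sub>M borel). fst z < (snd z :: real)} \<in> sets (borel \<Otimes>\<^sub>M borel)" by measurable
      then have [measurable]: "(\<lambda>z. indicator {fst z<..} (snd z :: real) :: ennreal) \<in> borel_measurable (borel \<Otimes>\<^sub>M borel)"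
        by (rule measurable_cong[THEN iffD1, OF _ borel_measurable_indicator, rotated]) (auto simp: indicator_def space_pair_measure)
      have "(\<lambda>z. \<psi> (snd z) * indicator {fst z<..} (snd z)) \<in> borel_measurable (borel \<Otimes>\<^sub>M borel)" by measurable
      then show "(\<lambda>(u, v). \<psi> v * indicator {u<..} v) \<in> borel_measurable (lborel \<Otimes>\<^sub>M lborel)"
        by (simp add: split_beta' cong: measurable_cong_sets)
    qed
    have "Bi f 0 s \<omega> * Bi f 0 s \<omega> = (\<integral>\<^sup>+u. \<psi> u * (\<integral>\<^sup>+v. \<psi> v \<partial>lborel) \<partial>lborel)"
      unfolding B by (rule nn_integral_multc[symmetric]) simp
    also have "\<dots> = (\<integral>\<^sup>+u. \<psi> u * K u + (\<integral>\<^sup>+v. \<psi> v * (\<psi> u * indicator {v<..} u) \<partial>lborel) \<partial>lborel)"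
    proof (rule nn_integral_cong)
      fix u
      have "(\<integral>\<^sup>+v. \<psi> v \<partial>lborel) = (\<integral>\<^sup>+v. \<psi> v * indicator {u<..} v + \<psi> v * indicator {v<..} u \<partial>lborel)"
        by (rule nn_integral_cong_AE, use AE_lborel_singleton[of u] in eventually_elim) (auto simp: indicator_def)
      also have "\<dots> = K u + (\<integral>\<^sup>+v. \<psi> v * indicator {v<..} u \<partial>lborel)"
      proof -
        have "(\<lambda>v. indicator {v<..} u :: ennreal) = indicator {..<u}" by (auto simp: indicator_def)
        then have [measurable]: "(\<lambda>v. indicator {v<..} u :: ennreal) \<in> borel_measurable borel" by simp
        show ?thesis unfolding K_def by (rule nn_integral_add) simp_all
      qed
      also have "\<psi> u * \<dots> = \<psi> u * K u + (\<integral>\<^sup>+v. \<psi> v * (\<psi> u * indicator {v<..} u) \<partial>lborel)"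
      proof -
        have "(\<lambda>v. indicator {v<..} u :: ennreal) = indicator {..<u}" by (auto simp: indicator_def)
        then have [measurable]: "(\<lambda>v. indicator {v<..} u :: ennreal) \<in> borel_measurable borel" by simp
        have "(\<integral>\<^sup>+v. \<psi> v * (\<psi> u * indicator {v<..} u) \<partial>lborel) = (\<integral>\<^sup>+v. \<psi> u * (\<psi> v * indicator {v<..} u) \<partial>lborel)"
          by (intro nn_integral_cong) (simp add: mult_ac)
        also have "\<dots> = \<psi> u * (\<integral>\<^sup>+v. \<psi> v * indicator {v<..} u \<partial>lborel)" by (rule nn_integral_cmult) simp
        finally show ?thesis by (simp add: distrib_left)
      qed
      finally show "\<psi> u * (\<integral>\<^sup>+v. \<psi> v \<partial>lborel) = \<psi> u * K u + (\<integral>\<^sup>+v. \<psi> v * (\<psi> u * indicator {v<..} u) \<partial>lborel)" .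
    qed
    also have "\<dots> = (\<integral>\<^sup>+u. \<psi> u * K u \<partial>lborel) + (\<integral>\<^sup>+u. (\<integral>\<^sup>+v. \<psi> v * (\<psi> u * indicator {v<..} u) \<partial>lborel) \<partial>lborel)"
    proof (rule nn_integral_add)
      show "(\<lambda>u. \<psi> u * K u) \<in> borel_measurable lborel" using Km by simp
      show "(\<lambda>u. \<integral>\<^sup>+v. \<psi> v * (\<psi> u * indicator {v<..} u) \<partial>lborel) \<in> borel_measurable lborel"
      proof (rule lborel.borel_measurable_nn_integral)
        show "(\<lambda>(u, v). \<psi> v * (\<psi> u * indicator {v<..} u)) \<in> borel_measurable (lborel \<Otimes>\<^sub>M lborel)"
          using measurable_compose[OF measurable_pair_swap' Dm] by (simp add: split_beta')
      qed
    qed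
    also have "(\<integral>\<^sup>+u. (\<integral>\<^sup>+v. \<psi> v * (\<psi> u * indicator {v<..} u) \<partial>lborel) \<partial>lborel) = (\<integral>\<^sup>+v. (\<integral>\<^sup>+u. \<psi> v * (\<psi> u * indicator {v<..} u) \<partial>lborel) \<partial>lborel)"
      using lborel_pair.Fubini[OF Dm] by simp
    also have "\<dots> = (\<integral>\<^sup>+v. \<psi> v * K v \<partial>lborel)"
      unfolding K_def by (intro nn_integral_cong nn_integral_cmult) simp
    also have "(\<integral>\<^sup>+u. \<psi> u * K u \<partial>lborel) + (\<integral>\<^sup>+v. \<psi> v * K v \<partial>lborel) = 2 * (\<integral>\<^sup>+u. \<psi> u * K u \<partial>lborel)"
      by (simp add: mult_2)
    also have "\<dots> \<le> 2 * (\<integral>\<^sup>+u. (indicator \<Lambda> \<omega> * F (T u) (\<theta> (ennreal (T u)) \<omega>)) * indicator (levels \<omega> (ennreal s)) u \<partial>lborel)"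
    proof (intro mult_left_mono nn_integral_mono)
      fix u
      show "\<psi> u * K u \<le> (indicator \<Lambda> \<omega> * F (T u) (\<theta> (ennreal (T u)) \<omega>)) * indicator (levels \<omega> (ennreal s)) u"
      proof (cases "u \<in> levels \<omega> (ennreal s)")
        case u: True
        have Tu: "0 \<le> T u" by (simp add: T_def)
        have "K u \<le> (\<integral>\<^sup>+v. (lift f (X (ennreal (T v)) \<omega>) * indicator {T u<..T u + s} (T v)) * indicator (levels \<omega> \<infinity>) v \<partial>lborel)"
          unfolding K_def
        proof (rule nn_integral_mono)
          fix v
          show "\<psi> v * indicator {u<..} v \<le> (lift f (X (ennreal (T v)) \<omega>) * indicator {T u<..T u + s} (T v)) * indicator (levels \<omega> \<infinity>) v"
          proof (cases "v \<in> levels \<omega> (ennreal s) \<and> u < v")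
            case True
            then have v: "v \<in> levels \<omega> (ennreal s)" "u < v" by auto
            have u0: "0 \<le> u" using u by (simp add: levels_def)
            have Au: "A (T u) \<omega> = ennreal u" and Av: "A (T v) \<omega> = ennreal v"
              using u v A_\<tau> by (auto simp: levels_def T_def)
            have "\<not> T v \<le> T u"
            proof
              assume "T v \<le> T u"
              then have "A (T v) \<omega> \<le> A (T u) \<omega>" by (intro A_mono) (simp add: T_def)
              then show False using Au Av v(2) u0 by simp
            qed
            moreover have "T v \<le> s" using v(1) s enn2real_leI by (auto simp: levels_def T_def)
            moreover have "v \<in> levels \<omega> \<infinity>" using v(1) by (auto simp: levels_def)
            ultimately show ?thesis using Tu by (simp add: \<psi>_def indicator_def)
          qed (auto simp: \<psi>_def indicator_def)
        qed
        also have "\<dots> = Bi f (T u) (T u + s) \<omega>"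
          unfolding Bi_dA_integral[OF Tu] dA_integral_joint[OF measurable_lift_X_ind[OF f]] by (simp only: T_def)
        also have "\<dots> = Bi f 0 s (\<theta> (ennreal (T u)) \<omega>)" by (rule Bi_shift[OF \<omega> f Tu s, symmetric])
        finally show ?thesis
          using \<omega> by (simp add: \<psi>_def F\<theta> u mult_left_mono)
      qed (simp add: \<psi>_def)
    qed simp
    also have "\<dots> = 2 * dA_integral X A \<omega> (ennreal s) (\<lambda>r. indicator \<Lambda> \<omega> * F r (\<theta> (ennreal r) \<omega>))"
      unfolding dA_integral_joint[OF m2] T_def ..
    finally show ?thesis .
  qed
  have "(\<integral>\<^sup>+\<omega>. Bi f 0 s \<omega> * Bi f 0 s \<omega> \<partial>Q (Some x)) \<le>
    (\<integral>\<^sup>+\<omega>. 2 * dA_integral X A \<omega> (ennreal s) (\<lambda>r. indicator \<Lambda> \<omega> * F r (\<theta> (ennreal r) \<omega>)) \<partial>Q (Some x))"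
    by (rule nn_integral_mono_AE, use AE_\<Lambda>[of x] in eventually_elim) (rule path)
  also have "\<dots> = 2 * (\<integral>\<^sup>+\<omega>. dA_integral X A \<omega> (ennreal s) (\<lambda>r. indicator \<Lambda> \<omega> * F r (\<theta> (ennreal r) \<omega>)) \<partial>Q (Some x))"
    by (rule nn_integral_cmult[OF measurable_Finf_Q[OF measurable_dA_integral[OF m2]]])
  also have "(\<integral>\<^sup>+\<omega>. dA_integral X A \<omega> (ennreal s) (\<lambda>r. indicator \<Lambda> \<omega> * F r (\<theta> (ennreal r) \<omega>)) \<partial>Q (Some x)) =
    (\<integral>\<^sup>+\<omega>. dA_integral X A \<omega> (ennreal s) (\<lambda>r. F r (\<theta> (ennreal r) \<omega>)) \<partial>Q (Some x))"
    by (rule nn_integral_cong_AE, use AE_\<Lambda>[of x] in eventually_elim) simp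
  also have "\<dots> = (\<integral>\<^sup>+\<omega>. dA_integral X A \<omega> (ennreal s) (\<lambda>r. lift (\<lambda>y. \<integral>\<^sup>+\<omega>. F r \<omega> \<partial>Q (Some y)) (X (ennreal r) \<omega>)) \<partial>Q (Some x))"
    by (rule dA_projection[OF m1 \<Lambda>_Finf AE_\<Lambda> m2 m3])
  also have "\<dots> = c (\<lambda>y. f y * c f s y) s x"
    unfolding EF EBi_def[of "\<lambda>y. f y * c f s y"] dA_integral_Bi[OF s] ..
  finally show ?thesis .
qed

text \<open>Put the factor \<open>g(X\<^sub>s)\<close> under the integral \<open>\<integral>\<^sub>0\<^sup>s f(X\<^sub>r) dA\<^sub>r\<close>.  Projection at time \<open>r\<close>
  turns it into \<open>P\<^bsub>s-r\<^esub> g\<close>, which differs from \<open>g\<close> by at most \<open>s\<close>.\<close>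

lemma E_Bi_end:
  assumes f: "f \<in> borel_measurable borel" and s: "0 \<le> s"
    and h: "h \<in> borel_measurable borel" "\<And>x. h x \<le> 1" and a: "0 < a"
  defines "g \<equiv> Rt a h"
  defines "V \<equiv> \<lambda>x. \<integral>\<^sup>+\<omega>. Bi f 0 s \<omega> * lift g (X (ennreal s) \<omega>) \<partial>Q (Some x)"
  shows "V x \<le> c (\<lambda>y. f y * g y) s x + ennreal s * c f s x"
    and "c (\<lambda>y. f y * g y) s x \<le> V x + ennreal s * c f s x"
proof -
  have g: "g \<in> borel_measurable borel" unfolding g_def by (rule measurable_Rt[OF h(1)])
  define F where "F = (\<lambda>r \<omega>. lift f (X 0 \<omega>) * (indicator {..s} r * lift g (X (ennreal (s - r)) \<omega>)))"
  have m0: "(\<lambda>(r, \<omega>). F r \<omega>) \<in> borel_measurable (borel \<Otimes>\<^sub>M N)"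
  proof -
    have "(\<lambda>z. (s - fst z, snd z)) \<in> borel \<Otimes>\<^sub>M N \<rightarrow>\<^sub>M borel \<Otimes>\<^sub>M N" by measurable
    from measurable_compose[OF measurable_compose[OF this measurable_X_joint] measurable_lift[OF g]]
    have 1: "(\<lambda>z. lift g (X (ennreal (s - fst z)) (snd z))) \<in> borel_measurable (borel \<Otimes>\<^sub>M N)" by simp
    have 2: "(\<lambda>z. indicator {..s} (fst z) :: ennreal) \<in> borel_measurable (borel \<Otimes>\<^sub>M N)" by measurable
    have 3: "(\<lambda>z. lift f (X 0 (snd z))) \<in> borel_measurable (borel \<Otimes>\<^sub>M N)"
      by (rule measurable_compose[OF measurable_compose[OF measurable_snd measurable_X] measurable_lift[OF f]])
    show ?thesis
      using borel_measurable_times_ennreal[OF 3 borel_measurable_times_ennreal[OF 2 1]] by (simp add: F_def split_beta')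
  qed
  have m1: "(\<lambda>(r, \<omega>). F r \<omega>) \<in> borel_measurable (borel \<Otimes>\<^sub>M Finf)"
  proof -
    have "(\<lambda>\<omega>. \<omega>) \<in> Finf \<rightarrow>\<^sub>M N" using N_le_Finf by (auto simp: measurable_def)
    then have "(\<lambda>z. (fst z, snd z)) \<in> borel \<Otimes>\<^sub>M Finf \<rightarrow>\<^sub>M borel \<Otimes>\<^sub>M N"
      by (intro measurable_Pair measurable_fst measurable_compose[OF measurable_snd])
    from measurable_compose[OF this m0] show ?thesis by simp
  qed
  have F\<theta>: "F r (\<theta> (ennreal r) \<omega>) = lift f (X (ennreal r) \<omega>) * (indicator {..s} r * lift g (X (ennreal (max 0 r) + ennreal (s - r)) \<omega>))" for r \<omega>
    by (simp add: F_def shift_X)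
  have m2: "(\<lambda>(r, \<omega>). indicator UNIV \<omega> * F r (\<theta> (ennreal r) \<omega>)) \<in> borel_measurable (borel \<Otimes>\<^sub>M Finf)"
  proof -
    have "(\<lambda>z. max 0 (fst z) + max 0 (s - fst z)) \<in> borel_measurable (borel \<Otimes>\<^sub>M Finf)" by measurable
    from measurable_compose[OF measurable_X2[OF this measurable_snd] measurable_lift[OF g]]
    have 1: "(\<lambda>z. lift g (X (ennreal (max 0 (fst z)) + ennreal (s - fst z)) (snd z))) \<in> borel_measurable (borel \<Otimes>\<^sub>M Finf)"
      by (simp add: ennreal_plus)
    have 2: "(\<lambda>z. indicator {..s} (fst z) :: ennreal) \<in> borel_measurable (borel \<Otimes>\<^sub>M Finf)" by measurable
    show ?thesis
      using borel_measurable_times_ennreal[OF measurable_lift_X[OF f] borel_measurable_times_ennreal[OF 2 1]]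
      by (simp add: F\<theta> split_beta')
  qed
  have EF: "(\<integral>\<^sup>+\<omega>. F r \<omega> \<partial>Q (Some y)) = f y * (indicator {..s} r * PP (s - r) g y)" for r y
  proof -
    have "(\<lambda>\<omega>. lift g (X (ennreal (s - r)) \<omega>)) \<in> borel_measurable (Q (Some y))"
      by (rule measurable_compose[OF measurable_X_Q measurable_lift[OF g]])
    then show ?thesis unfolding F_def E_at_start PP_def by (simp add: nn_integral_cmult)
  qed
  have V_eq: "V x = (\<integral>\<^sup>+\<omega>. dA_integral X A \<omega> (ennreal s) (\<lambda>r. lift (\<lambda>y. f y * (indicator {..s} r * PP (s - r) g y)) (X (ennreal r) \<omega>)) \<partial>Q (Some x))"
  proof -
    have "V x = (\<integral>\<^sup>+\<omega>. dA_integral X A \<omega> (ennreal s) (\<lambda>r. F r (\<theta> (ennreal r) \<omega>)) \<partial>Q (Some x))"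
      unfolding V_def
    proof (rule nn_integral_cong)
      fix \<omega>
      note measurable_lift_X_path[OF f, of \<omega>, measurable]
      have "dA_integral X A \<omega> (ennreal s) (\<lambda>r. F r (\<theta> (ennreal r) \<omega>)) =
        (\<integral>\<^sup>+r. lift f (X (ennreal r) \<omega>) * indicator {0<..s} r * lift g (X (ennreal s) \<omega>) \<partial>dA \<omega>)"
        unfolding dA_integral_def
      proof (rule nn_integral_cong)
        fix r
        have "ennreal r + ennreal (s - r) = ennreal s" if "0 < r" "r \<le> s" using that by (simp flip: ennreal_plus)
        then show "F r (\<theta> (ennreal r) \<omega>) * indicator {r. 0 < r \<and> ennreal r \<le> ennreal s} r =
          lift f (X (ennreal r) \<omega>) * indicator {0<..s} r * lift g (X (ennreal s) \<omega>)"
          using s by (auto simp: F\<theta> indicator_def max_def)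
      qed
      also have "\<dots> = Bi f 0 s \<omega> * lift g (X (ennreal s) \<omega>)"
        unfolding Bi_def by (rule nn_integral_multc) measurable
      finally show "Bi f 0 s \<omega> * lift g (X (ennreal s) \<omega>) = dA_integral X A \<omega> (ennreal s) (\<lambda>r. F r (\<theta> (ennreal r) \<omega>))" ..
    qed
    also have "\<dots> = (\<integral>\<^sup>+\<omega>. dA_integral X A \<omega> (ennreal s) (\<lambda>r. lift (\<lambda>y. \<integral>\<^sup>+\<omega>. F r \<omega> \<partial>Q (Some y)) (X (ennreal r) \<omega>)) \<partial>Q (Some x))"
      by (rule dA_projection[OF m1 _ _ m2 measurable_E_joint[OF m0]]) (use sets.top[of Finf] in auto)
    finally show ?thesis unfolding EF .
  qed
  have G: "(\<lambda>y. f y * g y + ennreal s * f y) \<in> borel_measurable borel" using f g by measurable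
  have Gsum: "c (\<lambda>y. f y * g y + ennreal s * f y) s x = c (\<lambda>y. f y * g y) s x + ennreal s * c f s x"
    using f g by (simp add: EBi_add EBi_cmult)
  have "V x \<le> (\<integral>\<^sup>+\<omega>. dA_integral X A \<omega> (ennreal s) (\<lambda>r. lift (\<lambda>y. f y * g y + ennreal s * f y) (X (ennreal r) \<omega>)) \<partial>Q (Some x))"
    unfolding V_eq dA_integral_def
  proof (intro nn_integral_mono)
    fix \<omega> r
    show "lift (\<lambda>y. f y * (indicator {..s} r * PP (s - r) g y)) (X (ennreal r) \<omega>) * indicator {r. 0 < r \<and> ennreal r \<le> ennreal s} r
      \<le> lift (\<lambda>y. f y * g y + ennreal s * f y) (X (ennreal r) \<omega>) * indicator {r. 0 < r \<and> ennreal r \<le> ennreal s} r"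
    proof (cases "0 < r \<and> r \<le> s")
      case True
      have "f y * PP (s - r) g y \<le> f y * (g y + ennreal s)" for y
        unfolding g_def using True by (intro mult_left_mono PP_Rt_le h a) auto
      then have "lift (\<lambda>y. f y * (indicator {..s} r * PP (s - r) g y)) (X (ennreal r) \<omega>) \<le> lift (\<lambda>y. f y * g y + ennreal s * f y) (X (ennreal r) \<omega>)"
        using True by (intro lift_mono) (simp add: distrib_left mult.commute)
      then show ?thesis by (rule mult_right_mono) simp
    qed (use s in \<open>auto simp: indicator_def\<close>)
  qed
  also have "\<dots> = c (\<lambda>y. f y * g y) s x + ennreal s * c f s x"
    by (simp only: Gsum[symmetric] EBi_def[of "\<lambda>y. f y * g y + ennreal s * f y"] dA_integral_Bi[OF s])
  finally show "V x \<le> c (\<lambda>y. f y * g y) s x + ennreal s * c f s x" .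
  have meas_k: "(\<lambda>(r, \<omega>). lift (\<lambda>y. f y * (indicator {..s} r * PP (s - r) g y)) (X (ennreal r) \<omega>)) \<in> borel_measurable (borel \<Otimes>\<^sub>M Finf)"
  proof -
    have "(\<lambda>z. (fst z, X (ennreal (fst z)) (snd z))) \<in> borel \<Otimes>\<^sub>M Finf \<rightarrow>\<^sub>M borel \<Otimes>\<^sub>M borel_pt" by measurable
    from measurable_compose[OF this measurable_lift2[OF measurable_E_joint[OF m0]]]
    show ?thesis by (simp add: split_beta' EF)
  qed
  have "c (\<lambda>y. f y * g y) s x = (\<integral>\<^sup>+\<omega>. dA_integral X A \<omega> (ennreal s) (\<lambda>r. lift (\<lambda>y. f y * g y) (X (ennreal r) \<omega>)) \<partial>Q (Some x))"
    by (simp only: EBi_def dA_integral_Bi[OF s])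
  also have "\<dots> \<le> (\<integral>\<^sup>+\<omega>. dA_integral X A \<omega> (ennreal s) (\<lambda>r. lift (\<lambda>y. f y * (indicator {..s} r * PP (s - r) g y)) (X (ennreal r) \<omega>)) +
      ennreal s * Bi f 0 s \<omega> \<partial>Q (Some x))"
  proof (rule nn_integral_mono)
    fix \<omega>
    note measurable_lift_X_path[OF f, of \<omega>, measurable] borel_section[OF meas_k, of \<omega>, measurable]
    have "{r\<in>space borel. 0 < r \<and> ennreal r \<le> ennreal s} \<in> sets borel" by measurable
    then have [measurable]: "{r. 0 < r \<and> ennreal r \<le> ennreal s} \<in> sets borel" by simp
    have "dA_integral X A \<omega> (ennreal s) (\<lambda>r. lift (\<lambda>y. f y * g y) (X (ennreal r) \<omega>)) \<le>
      (\<integral>\<^sup>+r. lift (\<lambda>y. f y * (indicator {..s} r * PP (s - r) g y)) (X (ennreal r) \<omega>) * indicator {r. 0 < r \<and> ennreal r \<le> ennreal s} r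
        + ennreal s * (lift f (X (ennreal r) \<omega>) * indicator {0<..s} r) \<partial>dA \<omega>)"
      unfolding dA_integral_def
    proof (rule nn_integral_mono)
      fix r
      show "lift (\<lambda>y. f y * g y) (X (ennreal r) \<omega>) * indicator {r. 0 < r \<and> ennreal r \<le> ennreal s} r \<le>
        lift (\<lambda>y. f y * (indicator {..s} r * PP (s - r) g y)) (X (ennreal r) \<omega>) * indicator {r. 0 < r \<and> ennreal r \<le> ennreal s} r
        + ennreal s * (lift f (X (ennreal r) \<omega>) * indicator {0<..s} r)"
      proof (cases "0 < r \<and> r \<le> s")
        case True
        have "f y * g y \<le> f y * (PP (s - r) g y + ennreal s)" for y
          unfolding g_def using True by (intro mult_left_mono PP_Rt_le h a) auto
        then have "lift (\<lambda>y. f y * g y) (X (ennreal r) \<omega>) \<le> lift (\<lambda>y. f y * (indicator {..s} r * PP (s - r) g y) + ennreal s * f y) (X (ennreal r) \<omega>)"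
          using True by (intro lift_mono) (simp add: distrib_left mult.commute)
        then show ?thesis using True s by (simp add: lift_add lift_cmult)
      qed (use s in \<open>auto simp: indicator_def\<close>)
    qed
    also have "\<dots> = dA_integral X A \<omega> (ennreal s) (\<lambda>r. lift (\<lambda>y. f y * (indicator {..s} r * PP (s - r) g y)) (X (ennreal r) \<omega>)) +
      (\<integral>\<^sup>+r. ennreal s * (lift f (X (ennreal r) \<omega>) * indicator {0<..s} r) \<partial>dA \<omega>)"
      unfolding dA_integral_def by (rule nn_integral_add) measurable
    also have "(\<integral>\<^sup>+r. ennreal s * (lift f (X (ennreal r) \<omega>) * indicator {0<..s} r) \<partial>dA \<omega>) = ennreal s * Bi f 0 s \<omega>"
      unfolding Bi_def by (rule nn_integral_cmult) measurable
    finally show "dA_integral X A \<omega> (ennreal s) (\<lambda>r. lift (\<lambda>y. f y * g y) (X (ennreal r) \<omega>)) \<le>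
      dA_integral X A \<omega> (ennreal s) (\<lambda>r. lift (\<lambda>y. f y * (indicator {..s} r * PP (s - r) g y)) (X (ennreal r) \<omega>)) + ennreal s * Bi f 0 s \<omega>" .
  qed
  also have "\<dots> = V x + ennreal s * c f s x"
  proof -
    note B = measurable_Finf_Q[OF measurable_Bi[OF f order_refl]]
    have "(\<lambda>\<omega>. ennreal s * Bi f 0 s \<omega>) \<in> borel_measurable (Q (Some x))" using B by measurable
    then show ?thesis
      unfolding V_eq EBi_def
      by (subst nn_integral_add[OF measurable_Finf_Q[OF measurable_dA_integral[OF meas_k]]])
         (simp_all add: nn_integral_cmult B)
  qed
  finally show "c (\<lambda>y. f y * g y) s x \<le> V x + ennreal s * c f s x" .
qed

section \<open>The energy identity\<close>

lemma dy_decseq: "decseq dy"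
  unfolding decseq_def dy_def by (auto intro!: divide_left_mono power_increasing)

lemma le_of_le_add_null:
  fixes x y :: ennreal
  assumes "\<And>n. x \<le> y + z n" "z \<longlonglongrightarrow> 0"
  shows "x \<le> y"
proof -
  have "(\<lambda>n. y + z n) \<longlonglongrightarrow> y + 0" by (intro tendsto_add tendsto_const assms(2))
  then have "x \<le> y + 0" by (rule tendsto_lowerbound) (use assms(1) in auto)
  then show ?thesis by simp
qed

text \<open>The parameter \<open>\<delta>\<close> balances a factor \<open>(G - L)\<^sup>2\<close> of order \<open>s\<close> against a factor \<open>B\<^sup>2\<close> of smaller
  order, without a square root.\<close>

lemma weighted_AM_GM:
  fixes G L \<delta> :: real and B :: ennreal
  assumes "0 \<le> G" "0 \<le> L" "0 < \<delta>"
  shows "ennreal G * B \<le> ennreal L * B + ennreal \<delta> * ennreal ((G - L)\<^sup>2) + ennreal (1 / \<delta>) * (B * B)"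
proof (cases B)
  case (real b)
  have "(G - L) * b \<le> \<delta> * (G - L)\<^sup>2 + 1 / \<delta> * (b * b)"
  proof -
    define d where "d = G - L"
    have "0 \<le> (\<delta> * d - b)\<^sup>2" by simp
    then have *: "2 * (\<delta> * d * b) \<le> \<delta>\<^sup>2 * d\<^sup>2 + b\<^sup>2" by (simp add: power2_eq_square algebra_simps)
    have "0 \<le> \<delta>\<^sup>2 * d\<^sup>2 + b\<^sup>2" by simp
    then have "\<delta> * d * b \<le> \<delta>\<^sup>2 * d\<^sup>2 + b\<^sup>2" using * by linarith
    then have "\<delta> * (d * b) \<le> \<delta> * (\<delta> * d\<^sup>2 + 1 / \<delta> * (b * b))"
      using assms(3) by (simp add: power2_eq_square algebra_simps)
    then show ?thesis using assms(3) by (simp add: d_def mult_le_cancel_left_pos)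
  qed
  then have le: "G * b \<le> L * b + \<delta> * (G - L)\<^sup>2 + 1 / \<delta> * (b * b)" by (simp add: algebra_simps)
  have "ennreal (G * b) \<le> ennreal (L * b + \<delta> * (G - L)\<^sup>2 + 1 / \<delta> * (b * b))" by (rule ennreal_leI[OF le])
  also have "\<dots> = ennreal (L * b) + ennreal (\<delta> * (G - L)\<^sup>2) + ennreal (1 / \<delta> * (b * b))"
    using real assms by (subst ennreal_plus; simp)+
  also have "ennreal (G * b) = ennreal G * ennreal b" using real assms by (simp add: ennreal_mult)
  also have "ennreal (L * b) = ennreal L * ennreal b" using real assms by (simp add: ennreal_mult)
  also have "ennreal (\<delta> * (G - L)\<^sup>2) = ennreal \<delta> * ennreal ((G - L)\<^sup>2)"
    using assms by (intro ennreal_mult) auto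
  also have "ennreal (1 / \<delta> * (b * b)) = ennreal (1 / \<delta>) * (ennreal b * ennreal b)"
    using real assms by (simp add: ennreal_mult[symmetric])
  finally show ?thesis by (simp only: real)
next
  case top
  then show ?thesis using assms(3) by (simp add: ennreal_mult_top)
qed

text \<open>Continuity of the additive functional at time \<open>0\<close>, in expectation.\<close>

lemma c_tendsto_0:
  assumes f: "f \<in> borel_measurable borel" "\<And>x. f x \<le> \<phi> x"
  shows "(\<lambda>n. c f (dy n) x) \<longlonglongrightarrow> 0"
proof -
  have fin: "c f 1 x \<noteq> top"
  proof -
    have "c f 1 x \<le> c \<phi> 1 x" by (intro EBi_mono f order_refl)
    also have "\<dots> \<le> 1 + ennreal 1" by (rule c_\<phi>_bound) simp
    finally show ?thesis by (auto simp: top_unique)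
  qed
  have split: "c f 1 x = c f (dy n) x + EBi f (dy n) 1 x" for n
    using dy(1,3)[of n] by (intro EBi_split f) auto
  have fin2: "EBi f (dy n) 1 x \<noteq> top" for n using fin split[of n] by (auto simp: top_add)
  have "incseq (\<lambda>n. EBi f (dy n) 1 x)"
    using dy_decseq by (intro incseq_SucI EBi_mono) (auto simp: decseq_Suc_iff)
  then have "(\<lambda>n. EBi f (dy n) 1 x) \<longlonglongrightarrow> (SUP n. EBi f (dy n) 1 x)" by (rule LIMSEQ_SUP)
  also have "(SUP n. EBi f (dy n) 1 x) = c f 1 x"
    by (rule EBi_SUP[symmetric]) (use f dy(1) dy_decseq dy_tendsto in auto)
  finally have "(\<lambda>n. c f 1 x - EBi f (dy n) 1 x) \<longlonglongrightarrow> c f 1 x - c f 1 x"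
    by (intro tendsto_diff_ennreal tendsto_const fin)
  moreover have "c f 1 x - EBi f (dy n) 1 x = c f (dy n) x" for n
    unfolding split[of n] using fin2[of n] by (simp add: ennreal_add_diff_cancel_right)
  ultimately show ?thesis using fin by (simp add: ennreal_minus_eq_0)
qed

lemma c_le_2:
  assumes f: "\<And>x. f x \<le> \<phi> x"
  shows "c f (dy n) x \<le> 2"
proof -
  have "c f (dy n) x \<le> c \<phi> 1 x" by (intro EBi_mono f order_refl dy)
  also have "\<dots> \<le> 1 + ennreal 1" by (rule c_\<phi>_bound) simp
  finally show ?thesis by simp
qed

lemma integral_c_tendsto_0:
  assumes f: "f \<in> borel_measurable borel" "\<And>x. f x \<le> \<phi> x"
    and L: "sets L = sets borel" and v: "v \<in> borel_measurable borel" "(\<integral>\<^sup>+x. v x \<partial>L) < \<infinity>"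
  shows "(\<lambda>n. \<integral>\<^sup>+x. v x * c f (dy n) x \<partial>L) \<longlonglongrightarrow> 0"
proof -
  have vL[measurable]: "v \<in> borel_measurable L" using v(1) L by (simp cong: measurable_cong_sets)
  have cL[measurable]: "c f t \<in> borel_measurable L" for t
    using measurable_EBi[OF f(1) order_refl] L by (simp cong: measurable_cong_sets)
  have vfin: "AE x in L. v x \<noteq> \<infinity>" using v(2) by (intro nn_integral_PInf_AE) auto
  have "(\<lambda>n. \<integral>\<^sup>+x. v x * c f (dy n) x \<partial>L) \<longlonglongrightarrow> (\<integral>\<^sup>+x. 0 \<partial>L)"
  proof (rule nn_integral_dominated_convergence[where w = "\<lambda>x. v x * 2"])
    show "AE x in L. v x * c f (dy n) x \<le> v x * 2" for n
      by (intro AE_I2 mult_left_mono c_le_2 f) simp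
    show "(\<integral>\<^sup>+x. v x * 2 \<partial>L) < \<infinity>"
      using v(2) by (simp add: nn_integral_multc ennreal_mult_less_top)
    show "AE x in L. (\<lambda>n. v x * c f (dy n) x) \<longlonglongrightarrow> 0"
      using vfin
    proof eventually_elim
      fix x assume "v x \<noteq> \<infinity>"
      then have "(\<lambda>n. v x * c f (dy n) x) \<longlonglongrightarrow> v x * 0"
        by (intro tendsto_mult_ennreal tendsto_const c_tendsto_0 f) auto
      then show "(\<lambda>n. v x * c f (dy n) x) \<longlonglongrightarrow> 0" by simp
    qed
  qed auto
  then show ?thesis by simp
qed

text \<open>Expand the square: \<open>E\<^sub>x[(g(X\<^sub>0) - g(X\<^sub>s))\<^sup>2] = g\<^sup>2 - 2 g P\<^sub>s g + P\<^sub>s(g\<^sup>2)\<close> at \<open>x\<close>.  Integrated against \<open>m\<close>, the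
  last term is at most the first one because \<open>P\<^sub>s\<close> contracts.  So the integral is at most \<open>2 \<langle>g, g - P\<^sub>s g\<rangle>\<close>, and
  \<open>g - P\<^sub>s g \<le> s\<close>.\<close>

lemma quadratic_variation_bound:
  assumes h: "h \<in> borel_measurable borel" "\<And>x. h x \<le> 1" and a: "0 < a" and s: "0 < s"
    and h_int: "(\<integral>\<^sup>+x. h x \<partial>m) < \<infinity>"
  defines "g \<equiv> Rt a h"
  defines "DD \<equiv> \<lambda>x. \<integral>\<^sup>+\<omega>. ennreal ((enn2real (g x) - enn2real (lift g (X (ennreal s) \<omega>)))\<^sup>2) \<partial>Q (Some x)"
  shows "DD \<in> borel_measurable borel" "(\<integral>\<^sup>+x. DD x \<partial>m) \<le> ennreal (2 * s) * (\<integral>\<^sup>+x. g x \<partial>m)"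
proof -
  have g[measurable]: "g \<in> borel_measurable borel" unfolding g_def by (rule measurable_Rt[OF h(1)])
  have g_le: "g x \<le> ennreal a" for x unfolding g_def using a by (intro Rt_le h) simp
  have g_fin: "g x < \<infinity>" for x using g_le[of x] by (rule le_less_trans) simp
  have lg_fin: "lift g z < \<infinity>" for z using g_fin by (cases z) auto
  have gr: "ennreal (enn2real (g x)) = g x" "ennreal (enn2real (lift g z)) = lift g z" for x z
    using g_fin lg_fin by auto
  note measurable_Pt[OF s, measurable]
  have eq: "DD x + 2 * (g x * Pt s g x) = g x * g x + Pt s (\<lambda>y. g y * g y) x" for x
  proof -
    interpret prob_space "Q (Some x)" by (rule prob_Q)
    have lg[measurable]: "(\<lambda>\<omega>. lift g (X (ennreal s) \<omega>)) \<in> borel_measurable (Q (Some x))"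
      by (rule measurable_compose[OF measurable_X_Q measurable_lift[OF g]])
    have "(\<integral>\<^sup>+\<omega>. ennreal ((enn2real (g x) - enn2real (lift g (X (ennreal s) \<omega>)))\<^sup>2) + 2 * (g x * lift g (X (ennreal s) \<omega>)) \<partial>Q (Some x)) =
      (\<integral>\<^sup>+\<omega>. g x * g x + lift (\<lambda>y. g y * g y) (X (ennreal s) \<omega>) \<partial>Q (Some x))"
    proof (rule nn_integral_cong)
      fix \<omega>
      define G L where "G = enn2real (g x)" and "L = enn2real (lift g (X (ennreal s) \<omega>))"
      have nn: "0 \<le> G" "0 \<le> L" by (simp_all add: G_def L_def)
      have "lift (\<lambda>y. g y * g y) (X (ennreal s) \<omega>) = ennreal L * ennreal L"
        unfolding L_def gr by (cases "X (ennreal s) \<omega>") auto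
      moreover have "ennreal ((G - L)\<^sup>2) + 2 * (ennreal G * ennreal L) = ennreal G * ennreal G + ennreal L * ennreal L"
      proof -
        have "ennreal ((G - L)\<^sup>2) + 2 * (ennreal G * ennreal L) = ennreal ((G - L)\<^sup>2 + 2 * (G * L))"
          using nn by (simp add: ennreal_mult)
        also have "(G - L)\<^sup>2 + 2 * (G * L) = G * G + L * L" by (simp add: power2_eq_square algebra_simps)
        finally show ?thesis using nn by (simp add: ennreal_mult)
      qed
      ultimately show "ennreal ((enn2real (g x) - enn2real (lift g (X (ennreal s) \<omega>)))\<^sup>2) + 2 * (g x * lift g (X (ennreal s) \<omega>)) =
        g x * g x + lift (\<lambda>y. g y * g y) (X (ennreal s) \<omega>)"
        by (simp add: G_def L_def gr)
    qed
    moreover have "(\<integral>\<^sup>+\<omega>. ennreal ((enn2real (g x) - enn2real (lift g (X (ennreal s) \<omega>)))\<^sup>2) + 2 * (g x * lift g (X (ennreal s) \<omega>)) \<partial>Q (Some x)) =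
      DD x + 2 * (g x * Pt s g x)"
    proof -
      have "(\<integral>\<^sup>+\<omega>. 2 * (g x * lift g (X (ennreal s) \<omega>)) \<partial>Q (Some x)) = 2 * (g x * Pt s g x)"
        unfolding Pt_def integral_X[OF s g, symmetric] by (simp add: nn_integral_cmult)
      then show ?thesis unfolding DD_def by (subst nn_integral_add) simp_all
    qed
    moreover have "(\<integral>\<^sup>+\<omega>. g x * g x + lift (\<lambda>y. g y * g y) (X (ennreal s) \<omega>) \<partial>Q (Some x)) = g x * g x + Pt s (\<lambda>y. g y * g y) x"
    proof -
      have gg: "(\<lambda>y. g y * g y) \<in> borel_measurable borel" by measurable
      have "(\<lambda>\<omega>. lift (\<lambda>y. g y * g y) (X (ennreal s) \<omega>)) \<in> borel_measurable (Q (Some x))"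
        by (rule measurable_compose[OF measurable_X_Q measurable_lift[OF gg]])
      then show ?thesis
        unfolding Pt_def integral_X[OF s gg, symmetric]
        by (subst nn_integral_add) (simp_all add: emeasure_space_1[simplified])
    qed
    ultimately show ?thesis by simp
  qed
  have gP_fin: "2 * (g x * Pt s g x) \<noteq> top" for x
  proof -
    have "Pt s g x \<le> g x + ennreal s" unfolding g_def by (rule Pt_Rt_le[OF s h a])
    also have "\<dots> < \<infinity>" using g_fin by simp
    finally show ?thesis using g_fin[of x] by (auto simp: ennreal_mult_eq_top_iff)
  qed
  have "DD = (\<lambda>x. (g x * g x + Pt s (\<lambda>y. g y * g y) x) - 2 * (g x * Pt s g x))"
    unfolding eq[symmetric] using gP_fin by (simp add: ennreal_add_diff_cancel_right)
  also have "\<dots> \<in> borel_measurable borel" by measurable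
  finally show DD[measurable]: "DD \<in> borel_measurable borel" .
  let ?G = "\<integral>\<^sup>+x. g x \<partial>m" and ?C = "\<integral>\<^sup>+x. g x * Pt s g x \<partial>m"
  have G_fin: "?G < \<infinity>"
  proof -
    have "?G \<le> ennreal a * (\<integral>\<^sup>+x. h x \<partial>m)" unfolding g_def using a by (intro integral_Rt_le h) simp
    also have "\<dots> < \<infinity>" using h_int by (simp add: ennreal_mult_less_top)
    finally show ?thesis .
  qed
  have C_fin: "2 * ?C \<noteq> top"
  proof -
    have "?C \<le> (\<integral>\<^sup>+x. g x * ennreal (a + s) \<partial>m)"
    proof (intro nn_integral_mono mult_left_mono)
      fix x
      have "Pt s g x \<le> g x + ennreal s" unfolding g_def by (rule Pt_Rt_le[OF s h a])
      also have "\<dots> \<le> ennreal a + ennreal s" by (intro add_right_mono g_le)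
      finally show "Pt s g x \<le> ennreal (a + s)" using a s by simp
    qed simp
    also have "\<dots> < \<infinity>" using G_fin by (simp add: nn_integral_multc ennreal_mult_less_top)
    finally show ?thesis by (simp add: ennreal_mult_eq_top_iff)
  qed
  have "2 * ?C + (\<integral>\<^sup>+x. DD x \<partial>m) = (\<integral>\<^sup>+x. DD x + 2 * (g x * Pt s g x) \<partial>m)"
    by (subst nn_integral_add) (simp_all add: nn_integral_cmult add.commute)
  also have "\<dots> = (\<integral>\<^sup>+x. g x * g x \<partial>m) + (\<integral>\<^sup>+x. Pt s (\<lambda>y. g y * g y) x \<partial>m)"
    unfolding eq by (rule nn_integral_add) simp_all
  also have "\<dots> \<le> (\<integral>\<^sup>+x. g x * g x \<partial>m) + (\<integral>\<^sup>+x. g x * g x \<partial>m)"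
    by (intro add_left_mono integral_Pt_le[OF s]) simp
  also have "\<dots> = 2 * (\<integral>\<^sup>+x. g x * g x \<partial>m)" by (simp add: mult_2)
  also have "\<dots> \<le> 2 * (\<integral>\<^sup>+x. g x * Pt s g x + ennreal s * g x \<partial>m)"
  proof (intro mult_left_mono nn_integral_mono)
    fix x
    have "g x \<le> Pt s g x + ennreal s" unfolding g_def by (rule Pt_Rt_le[OF s h a])
    then have "g x * g x \<le> g x * (Pt s g x + ennreal s)" by (rule mult_left_mono) simp
    then show "g x * g x \<le> g x * Pt s g x + ennreal s * g x" by (simp add: distrib_left mult.commute)
  qed simp
  also have "\<dots> = 2 * ?C + ennreal (2 * s) * ?G"
    using s by (subst nn_integral_add) (simp_all add: nn_integral_cmult distrib_left ennreal_mult mult.assoc)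
  finally show "(\<integral>\<^sup>+x. DD x \<partial>m) \<le> ennreal (2 * s) * ?G"
    using C_fin by (subst (asm) ennreal_add_left_cancel_le) auto
qed

text \<open>The Markov property and symmetry give \<open>\<gamma>(s + r) = \<gamma>(r) + \<langle>P\<^sub>r h, c\<^sub>s\<rangle>\<close>.  Integrated over \<open>r \<in> (0, a]\<close>, this says
  \<open>\<langle>R\<^sub>a h, c\<^sub>s\<rangle> = \<integral>\<^sub>a\<^bsup>a+s\<^esup> \<gamma> - \<integral>\<^sub>0\<^sup>s \<gamma>\<close>, and \<open>\<gamma>\<close> is monotone.\<close>

lemma energy_sandwich:
  assumes f: "f \<in> borel_measurable borel" "\<And>x. f x \<le> \<phi> x"
    and h: "h \<in> borel_measurable borel" "\<And>x. h x \<le> 1" and h_int: "(\<integral>\<^sup>+x. h x \<partial>m) < \<infinity>"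
    and a: "0 < a" and s: "0 < s"
  defines "\<gamma> \<equiv> \<lambda>r. \<integral>\<^sup>+x. h x * c f r x \<partial>m"
  defines "I \<equiv> \<integral>\<^sup>+x. Rt a h x * c f s x \<partial>m"
  shows "ennreal s * \<gamma> a \<le> I + ennreal s * \<gamma> s" "I \<le> ennreal s * \<gamma> (a + s)"
proof -
  note h(1)[measurable] measurable_EBi[OF f(1) order_refl, measurable]
  have \<gamma>_mono: "\<gamma> r \<le> \<gamma> r'" if "r \<le> r'" for r r'
    unfolding \<gamma>_def using that by (intro nn_integral_mono mult_left_mono EBi_mono) auto
  have \<gamma>_fin: "\<gamma> r < \<infinity>" for r
  proof -
    have "\<gamma> r \<le> (\<integral>\<^sup>+x. h x * ennreal (2 + \<bar>r\<bar>) \<partial>m)"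
      unfolding \<gamma>_def
    proof (intro nn_integral_mono mult_left_mono)
      fix x
      have "c f r x \<le> c \<phi> (1 + \<bar>r\<bar>) x" by (intro EBi_mono f) auto
      also have "\<dots> \<le> 1 + ennreal (1 + \<bar>r\<bar>)" by (rule c_\<phi>_bound) simp
      finally show "c f r x \<le> ennreal (2 + \<bar>r\<bar>)" by (simp flip: ennreal_plus ennreal_1)
    qed simp
    also have "\<dots> < \<infinity>" using h_int by (simp add: nn_integral_multc ennreal_mult_less_top)
    finally show ?thesis .
  qed
  have \<gamma>_meas[measurable]: "\<gamma> \<in> borel_measurable borel"
  proof -
    have "mono (\<lambda>r. enn2real (\<gamma> r))" using \<gamma>_fin by (intro monoI enn2real_mono \<gamma>_mono) auto
    then have "(\<lambda>r. ennreal (enn2real (\<gamma> r))) \<in> borel_measurable borel"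
      by (intro measurable_compose[OF borel_measurable_mono measurable_ennreal])
    also have "(\<lambda>r. ennreal (enn2real (\<gamma> r))) = \<gamma>" using \<gamma>_fin by (intro ext ennreal_enn2real) auto
    finally show ?thesis .
  qed
  define \<kappa> where "\<kappa> r = (\<integral>\<^sup>+x. c f s x * Pt r h x \<partial>m)" for r
  have \<kappa>_meas: "(\<lambda>r. \<kappa> r * indicator {0<..a} r) \<in> borel_measurable lborel"
  proof -
    have "(\<lambda>z. c f s (fst z)) \<in> borel_measurable (borel \<Otimes>\<^sub>M lborel)" by measurable
    from borel_measurable_times_ennreal[OF this measurable_Rt_integrand[OF h(1), of a]]
    have "(\<lambda>z. c f s (fst z) * (Pt (snd z) h (fst z) * indicator {0<..a} (snd z))) \<in> borel_measurable (borel \<Otimes>\<^sub>M lborel)"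
      by (simp add: split_beta')
    from measurable_compose[OF measurable_pair_swap' this]
    have "(\<lambda>(r, x). c f s x * (Pt r h x * indicator {0<..a} r)) \<in> borel_measurable (lborel \<Otimes>\<^sub>M m)"
      by (simp add: split_beta' cong: measurable_cong_sets)
    from m.borel_measurable_nn_integral[OF this]
    show ?thesis
      by (rule measurable_cong[THEN iffD1, rotated]) (auto simp: \<kappa>_def indicator_def)
  qed
  have step: "\<gamma> (s + r) = \<gamma> r + \<kappa> r" if r: "0 < r" for r
  proof -
    have "c f (s + r) x = c f r x + Pt r (c f s) x" for x
      using EBi_split[OF f(1), of 0 r "s + r" x] EBi_Pt[OF f(1) r, of "s + r" x] r s by simp
    then have "\<gamma> (s + r) = (\<integral>\<^sup>+x. h x * c f r x \<partial>m) + (\<integral>\<^sup>+x. h x * Pt r (c f s) x \<partial>m)"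
      unfolding \<gamma>_def using measurable_Pt[OF r] by (simp add: distrib_left nn_integral_add)
    then show ?thesis
      unfolding \<gamma>_def \<kappa>_def by (simp add: Pt_symmetric[OF r] mult.commute)
  qed
  have I_eq: "I = (\<integral>\<^sup>+r. \<kappa> r * indicator {0<..a} r \<partial>lborel)"
    unfolding I_def \<kappa>_def using integral_Rt[OF h(1), of "c f s" a] by (simp add: mult.commute)
  let ?J = "\<lambda>b d. \<integral>\<^sup>+r. \<gamma> r * indicator {b<..d} r \<partial>lborel"
  have J_le: "?J b d \<le> \<gamma> d * ennreal (d - b)" if "b \<le> d" for b d
  proof -
    have "?J b d \<le> (\<integral>\<^sup>+r. \<gamma> d * indicator {b<..d} r \<partial>lborel)"
      by (intro nn_integral_mono) (auto simp: indicator_def intro: \<gamma>_mono)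
    then show ?thesis using that by (simp add: nn_integral_cmult)
  qed
  have J_ge: "\<gamma> b * ennreal (d - b) \<le> ?J b d" if "b \<le> d" for b d
  proof -
    have "(\<integral>\<^sup>+r. \<gamma> b * indicator {b<..d} r \<partial>lborel) \<le> ?J b d"
      by (intro nn_integral_mono) (auto simp: indicator_def intro: \<gamma>_mono)
    then show ?thesis using that by (simp add: nn_integral_cmult)
  qed
  have J_split: "?J b e = ?J b d + ?J d e" if "b \<le> d" "d \<le> e" for b d e
  proof -
    have "?J b e = (\<integral>\<^sup>+r. \<gamma> r * indicator {b<..d} r + \<gamma> r * indicator {d<..e} r \<partial>lborel)"
      by (intro nn_integral_cong) (use that in \<open>auto simp: indicator_def\<close>)
    then show ?thesis by (simp add: nn_integral_add)
  qed
  have "?J s (s + a) = (\<integral>\<^sup>+r. \<gamma> (s + r) * indicator {s<..s + a} (s + r) \<partial>lborel)"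
    by (rule nn_integral_shift) simp
  also have "\<dots> = (\<integral>\<^sup>+r. \<gamma> r * indicator {0<..a} r + \<kappa> r * indicator {0<..a} r \<partial>lborel)"
    by (intro nn_integral_cong) (auto simp: indicator_def step)
  also have "\<dots> = ?J 0 a + I"
    unfolding I_eq by (rule nn_integral_add[OF _ \<kappa>_meas]) simp
  finally have shift: "?J s (s + a) = ?J 0 a + I" .
  have "?J 0 s + ?J s (s + a) = ?J 0 a + ?J a (s + a)"
    using J_split[of 0 s "s + a"] J_split[of 0 a "s + a"] a s by simp
  then have "?J 0 a + (?J 0 s + I) = ?J 0 a + ?J a (s + a)"
    unfolding shift by (simp add: add_ac)
  moreover have "?J 0 a \<noteq> top"
  proof -
    have "?J 0 a \<le> \<gamma> a * ennreal a" using J_le[of 0 a] a by simp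
    also have "\<dots> < \<infinity>" using \<gamma>_fin[of a] by (simp add: ennreal_mult_less_top)
    finally show ?thesis by simp
  qed
  ultimately have key: "?J 0 s + I = ?J a (s + a)"
    by (simp add: ennreal_add_left_cancel)
  have "ennreal s * \<gamma> a \<le> ?J a (s + a)" using J_ge[of a "s + a"] s by (simp add: mult.commute)
  also have "\<dots> \<le> I + ennreal s * \<gamma> s"
    unfolding key[symmetric] using J_le[of 0 s] s by (simp add: add.commute mult.commute add_left_mono)
  finally show "ennreal s * \<gamma> a \<le> I + ennreal s * \<gamma> s" .
  have "I \<le> ?J 0 s + I" by simp
  also have "\<dots> \<le> ennreal s * \<gamma> (a + s)"
    unfolding key using J_le[of a "s + a"] s by (simp add: mult.commute add.commute)
  finally show "I \<le> ennreal s * \<gamma> (a + s)" .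
qed

text \<open>Replace \<open>g(X\<^sub>0)\<close> by \<open>g(X\<^sub>s)\<close> with \<open>weighted_AM_GM\<close>, then \<open>g(X\<^sub>s)\<close> by the running value inside the integral with
  \<open>E_Bi_end\<close>.  The integral of \<open>err\<close> over \<open>m\<close>, divided by \<open>s\<close>, becomes small when first \<open>s\<close> and then \<open>\<delta>\<close> tends to \<open>0\<close>.\<close>

lemma energy_error:
  assumes f: "f \<in> borel_measurable borel"
    and h: "h \<in> borel_measurable borel" "\<And>x. h x \<le> 1" and a: "0 < a" and s: "0 < s" and \<delta>: "0 < \<delta>"
  defines "g \<equiv> Rt a h"
  defines "DD \<equiv> \<lambda>x. \<integral>\<^sup>+\<omega>. ennreal ((enn2real (g x) - enn2real (lift g (X (ennreal s) \<omega>)))\<^sup>2) \<partial>Q (Some x)"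
  defines "err \<equiv> \<lambda>x. ennreal s * c f s x + ennreal \<delta> * DD x + ennreal (2 / \<delta>) * c (\<lambda>y. f y * c f s y) s x"
  shows "g x * c f s x \<le> c (\<lambda>y. f y * g y) s x + err x"
    and "c (\<lambda>y. f y * g y) s x \<le> g x * c f s x + err x"
proof -
  define V where "V = (\<integral>\<^sup>+\<omega>. Bi f 0 s \<omega> * lift g (X (ennreal s) \<omega>) \<partial>Q (Some x))"
  have g: "g \<in> borel_measurable borel" unfolding g_def by (rule measurable_Rt[OF h(1)])
  have g_fin: "g y < \<infinity>" for y
    using Rt_le[where h = h and t = a and x = y, OF h(2)] a by (auto simp: g_def intro: le_less_trans)
  have lg_fin: "lift g z < \<infinity>" for z using g_fin by (cases z) auto
  define G L where "G = enn2real (g x)" and "L = (\<lambda>\<omega>. enn2real (lift g (X (ennreal s) \<omega>)))"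
  have Gg: "ennreal G = g x" and Lg: "ennreal (L \<omega>) = lift g (X (ennreal s) \<omega>)" for \<omega>
    using g_fin lg_fin by (auto simp: G_def L_def)
  have nn: "0 \<le> G" "0 \<le> L \<omega>" for \<omega> by (simp_all add: G_def L_def)
  have B[measurable]: "Bi f 0 s \<in> borel_measurable (Q (Some x))"
    by (rule measurable_Finf_Q[OF measurable_Bi[OF f order_refl]])
  have lg[measurable]: "(\<lambda>\<omega>. lift g (X (ennreal s) \<omega>)) \<in> borel_measurable (Q (Some x))"
    by (rule measurable_compose[OF measurable_X_Q measurable_lift[OF g]])
  have Lm[measurable]: "L \<in> borel_measurable (Q (Some x))" unfolding L_def by measurable
  have gc: "g x * c f s x = (\<integral>\<^sup>+\<omega>. ennreal G * Bi f 0 s \<omega> \<partial>Q (Some x))"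
    unfolding EBi_def Gg by (rule nn_integral_cmult[symmetric]) simp
  have V_eq: "V = (\<integral>\<^sup>+\<omega>. ennreal (L \<omega>) * Bi f 0 s \<omega> \<partial>Q (Some x))"
    unfolding V_def Lg by (simp add: mult.commute)
  let ?sq = "\<integral>\<^sup>+\<omega>. Bi f 0 s \<omega> * Bi f 0 s \<omega> \<partial>Q (Some x)"
  have sq: "ennreal (1 / \<delta>) * ?sq \<le> ennreal (2 / \<delta>) * c (\<lambda>y. f y * c f s y) s x"
  proof -
    have "ennreal (1 / \<delta>) * ?sq \<le> ennreal (1 / \<delta>) * (2 * c (\<lambda>y. f y * c f s y) s x)"
      using s by (intro mult_left_mono E_Bi_square f) auto
    also have "\<dots> = (ennreal (1 / \<delta>) * ennreal 2) * c (\<lambda>y. f y * c f s y) s x" by (simp add: mult.assoc)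
    also have "ennreal (1 / \<delta>) * ennreal 2 = ennreal (2 / \<delta>)"
      using \<delta> by (subst ennreal_mult[symmetric]) auto
    finally show ?thesis .
  qed
  have DD: "DD x = (\<integral>\<^sup>+\<omega>. ennreal ((G - L \<omega>)\<^sup>2) \<partial>Q (Some x))" by (simp add: DD_def G_def L_def)
  have DD': "DD x = (\<integral>\<^sup>+\<omega>. ennreal ((L \<omega> - G)\<^sup>2) \<partial>Q (Some x))" unfolding DD by (simp add: power2_commute)
  have sum: "(\<integral>\<^sup>+\<omega>. ennreal (K \<omega>) * Bi f 0 s \<omega> + ennreal \<delta> * ennreal ((K' \<omega> - K \<omega>)\<^sup>2) + ennreal (1 / \<delta>) * (Bi f 0 s \<omega> * Bi f 0 s \<omega>) \<partial>Q (Some x)) =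
    (\<integral>\<^sup>+\<omega>. ennreal (K \<omega>) * Bi f 0 s \<omega> \<partial>Q (Some x)) + ennreal \<delta> * (\<integral>\<^sup>+\<omega>. ennreal ((K' \<omega> - K \<omega>)\<^sup>2) \<partial>Q (Some x)) + ennreal (1 / \<delta>) * ?sq"
    if [measurable]: "K \<in> borel_measurable (Q (Some x))" "K' \<in> borel_measurable (Q (Some x))" for K K' :: "'w \<Rightarrow> real"
    by (simp add: nn_integral_add nn_integral_cmult)
  have "g x * c f s x \<le> (\<integral>\<^sup>+\<omega>. ennreal (L \<omega>) * Bi f 0 s \<omega> + ennreal \<delta> * ennreal ((G - L \<omega>)\<^sup>2) + ennreal (1 / \<delta>) * (Bi f 0 s \<omega> * Bi f 0 s \<omega>) \<partial>Q (Some x))"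
    unfolding gc by (intro nn_integral_mono weighted_AM_GM nn \<delta>)
  also have "\<dots> = V + ennreal \<delta> * DD x + ennreal (1 / \<delta>) * ?sq"
    using sum[of L "\<lambda>_. G"] by (simp add: V_eq DD)
  also have "\<dots> \<le> (c (\<lambda>y. f y * g y) s x + ennreal s * c f s x) + ennreal \<delta> * DD x + ennreal (2 / \<delta>) * c (\<lambda>y. f y * c f s y) s x"
    using E_Bi_end(1)[OF f less_imp_le[OF s] h a, of x] sq
    by (intro add_mono order_refl) (simp_all add: V_def g_def)
  finally show "g x * c f s x \<le> c (\<lambda>y. f y * g y) s x + err x"
    by (simp add: err_def add_ac)
  have "V \<le> (\<integral>\<^sup>+\<omega>. ennreal G * Bi f 0 s \<omega> + ennreal \<delta> * ennreal ((L \<omega> - G)\<^sup>2) + ennreal (1 / \<delta>) * (Bi f 0 s \<omega> * Bi f 0 s \<omega>) \<partial>Q (Some x))"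
    unfolding V_eq by (intro nn_integral_mono weighted_AM_GM nn \<delta>)
  also have "\<dots> = g x * c f s x + ennreal \<delta> * DD x + ennreal (1 / \<delta>) * ?sq"
    using sum[of "\<lambda>_. G" L] by (simp add: gc DD')
  finally have V_le: "V \<le> g x * c f s x + ennreal \<delta> * DD x + ennreal (2 / \<delta>) * c (\<lambda>y. f y * c f s y) s x"
    using sq by (meson add_left_mono order_trans)
  have "c (\<lambda>y. f y * g y) s x \<le> V + ennreal s * c f s x"
    using E_Bi_end(2)[OF f less_imp_le[OF s] h a, of x] by (simp add: V_def g_def)
  also have "\<dots> \<le> (g x * c f s x + ennreal \<delta> * DD x + ennreal (2 / \<delta>) * c (\<lambda>y. f y * c f s y) s x) + ennreal s * c f s x"
    by (intro add_right_mono V_le)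
  finally show "c (\<lambda>y. f y * g y) s x \<le> g x * c f s x + err x"
    by (simp add: err_def add_ac)
qed

text \<open>Here \<open>\<langle>g, c\<^sub>s\<rangle> / s\<close>, for \<open>s = 2\<^sup>-\<^sup>n\<close>, is compared with the energy on the left by \<open>energy_sandwich\<close> and
  with the quotient \<open>q (f g) n\<close> for the right-hand side by \<open>energy_error\<close>.\<close>

lemma energy_identity_bounded:
  assumes f: "f \<in> borel_measurable borel" "\<And>x. f x \<le> \<phi> x"
    and h: "h \<in> borel_measurable borel" "\<And>x. h x \<le> 1" and h_int: "(\<integral>\<^sup>+x. h x \<partial>m) < \<infinity>" and a: "0 < a"
  shows "(\<integral>\<^sup>+x. h x * c f a x \<partial>m) = (\<integral>\<^sup>+y. f y * Rt a h y \<partial>\<mu>)"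
proof -
  define g where "g = Rt a h"
  define \<gamma> where "\<gamma> r = (\<integral>\<^sup>+x. h x * c f r x \<partial>m)" for r
  have g[measurable]: "g \<in> borel_measurable borel" unfolding g_def by (rule measurable_Rt[OF h(1)])
  note f(1)[measurable] h(1)[measurable] measurable_EBi[OF f(1) order_refl, measurable]
  have fg: "(\<lambda>y. f y * g y) \<in> borel_measurable borel" by measurable
  let ?K = "\<integral>\<^sup>+x. g x \<partial>m" and ?F = "\<integral>\<^sup>+y. f y \<partial>\<mu>" and ?T = "\<integral>\<^sup>+y. f y * g y \<partial>\<mu>"
  have K_fin: "?K < \<infinity>"
  proof -
    have "?K \<le> ennreal a * (\<integral>\<^sup>+x. h x \<partial>m)" unfolding g_def using a by (intro integral_Rt_le h) simp
    also have "\<dots> < \<infinity>" using h_int by (simp add: ennreal_mult_less_top)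
    finally show ?thesis .
  qed
  have F_fin: "?F < \<infinity>" by (rule le_less_trans[OF nn_integral_mono[OF f(2)] \<mu>_\<phi>_finite])
  \<comment> \<open>bounds the integral of the error over \<open>m\<close>, divided by the time step\<close>
  define E where "E \<delta> n = ennreal (dy n) * ?F + ennreal (2 * \<delta>) * ?K + ennreal (2 / \<delta>) * (\<integral>\<^sup>+y. f y * c f (dy n) y \<partial>\<mu>)" for \<delta> n
  define I where "I n = (\<integral>\<^sup>+x. g x * c f (dy n) x \<partial>m)" for n
  have err: "I n \<le> (\<integral>\<^sup>+x. c (\<lambda>y. f y * g y) (dy n) x \<partial>m) + ennreal (dy n) * E \<delta> n"
    "(\<integral>\<^sup>+x. c (\<lambda>y. f y * g y) (dy n) x \<partial>m) \<le> I n + ennreal (dy n) * E \<delta> n" if \<delta>: "0 < \<delta>" for \<delta> n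
  proof -
    let ?s = "dy n"
    define DD where "DD = (\<lambda>x. \<integral>\<^sup>+\<omega>. ennreal ((enn2real (g x) - enn2real (lift g (X (ennreal ?s) \<omega>)))\<^sup>2) \<partial>Q (Some x))"
    define r where "r = (\<lambda>x. ennreal ?s * c f ?s x + ennreal \<delta> * DD x + ennreal (2 / \<delta>) * c (\<lambda>y. f y * c f ?s y) ?s x)"
    have DD[measurable]: "DD \<in> borel_measurable borel" and DD_le: "(\<integral>\<^sup>+x. DD x \<partial>m) \<le> ennreal (2 * ?s) * ?K"
      unfolding DD_def g_def by (rule quadratic_variation_bound[OF h a dy(1) h_int])+
    have fc: "(\<lambda>y. f y * c f ?s y) \<in> borel_measurable borel" by measurable
    note measurable_EBi[OF fc order_refl, measurable] measurable_EBi[OF fg order_refl, measurable]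
    have r[measurable]: "r \<in> borel_measurable borel" unfolding r_def by measurable
    have "(\<integral>\<^sup>+x. r x \<partial>m) = ennreal ?s * (\<integral>\<^sup>+x. c f ?s x \<partial>m) + ennreal \<delta> * (\<integral>\<^sup>+x. DD x \<partial>m)
        + ennreal (2 / \<delta>) * (\<integral>\<^sup>+x. c (\<lambda>y. f y * c f ?s y) ?s x \<partial>m)"
      unfolding r_def by (simp add: nn_integral_add nn_integral_cmult)
    also have "\<dots> \<le> ennreal ?s * (ennreal ?s * ?F) + ennreal \<delta> * (ennreal (2 * ?s) * ?K)
        + ennreal (2 / \<delta>) * (ennreal ?s * (\<integral>\<^sup>+y. f y * c f ?s y \<partial>\<mu>))"
      by (intro add_mono mult_left_mono integral_c_le f fc DD_le) simp_all
    also have "\<dots> = ennreal ?s * E \<delta> n"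
    proof -
      have "ennreal \<delta> * ennreal (2 * ?s) = ennreal ?s * ennreal (2 * \<delta>)"
        using \<delta> dy(1)[of n] by (simp flip: ennreal_mult)
      then have "ennreal \<delta> * (ennreal (2 * ?s) * ?K) = ennreal ?s * (ennreal (2 * \<delta>) * ?K)"
        by (simp only: mult.assoc[symmetric])
      then show ?thesis unfolding E_def distrib_left by (simp only: mult_ac)
    qed
    finally have r_int: "(\<integral>\<^sup>+x. r x \<partial>m) \<le> ennreal ?s * E \<delta> n" .
    have pt: "g x * c f ?s x \<le> c (\<lambda>y. f y * g y) ?s x + r x" "c (\<lambda>y. f y * g y) ?s x \<le> g x * c f ?s x + r x" for x
      unfolding r_def DD_def g_def by (rule energy_error[OF f(1) h a dy(1) \<delta>])+
    have "I n \<le> (\<integral>\<^sup>+x. c (\<lambda>y. f y * g y) ?s x + r x \<partial>m)" unfolding I_def by (intro nn_integral_mono pt)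
    also have "\<dots> = (\<integral>\<^sup>+x. c (\<lambda>y. f y * g y) ?s x \<partial>m) + (\<integral>\<^sup>+x. r x \<partial>m)" by (rule nn_integral_add) simp_all
    finally show "I n \<le> (\<integral>\<^sup>+x. c (\<lambda>y. f y * g y) ?s x \<partial>m) + ennreal ?s * E \<delta> n"
      using r_int by (meson add_left_mono order_trans)
    have "(\<integral>\<^sup>+x. c (\<lambda>y. f y * g y) ?s x \<partial>m) \<le> (\<integral>\<^sup>+x. g x * c f ?s x + r x \<partial>m)" by (intro nn_integral_mono pt)
    also have "\<dots> = I n + (\<integral>\<^sup>+x. r x \<partial>m)" unfolding I_def by (rule nn_integral_add) simp_all
    finally show "(\<integral>\<^sup>+x. c (\<lambda>y. f y * g y) ?s x \<partial>m) \<le> I n + ennreal ?s * E \<delta> n"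
      using r_int by (meson add_left_mono order_trans)
  qed
  have cancel: "2 ^ n * (ennreal (dy n) * z) = z" for n z
    using dy(1)[of n] by (simp add: dy(4)[symmetric] mult.assoc[symmetric] flip: ennreal_mult')
  have lower: "\<gamma> a \<le> ?T + (E \<delta> n + \<gamma> (dy n))" if \<delta>: "0 < \<delta>" for \<delta> n
  proof -
    have "ennreal (dy n) * \<gamma> a \<le> I n + ennreal (dy n) * \<gamma> (dy n)"
      unfolding I_def g_def \<gamma>_def by (rule energy_sandwich(1)[OF f h h_int a dy(1)])
    also have "\<dots> \<le> ((\<integral>\<^sup>+x. c (\<lambda>y. f y * g y) (dy n) x \<partial>m) + ennreal (dy n) * E \<delta> n) + ennreal (dy n) * \<gamma> (dy n)"
      by (intro add_right_mono err \<delta>)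
    also have "\<dots> \<le> (ennreal (dy n) * ?T + ennreal (dy n) * E \<delta> n) + ennreal (dy n) * \<gamma> (dy n)"
      by (intro add_right_mono integral_c_le fg)
    finally have "ennreal (dy n) * \<gamma> a \<le> ennreal (dy n) * (?T + (E \<delta> n + \<gamma> (dy n)))"
      by (simp only: distrib_left add.assoc)
    then have "2 ^ n * (ennreal (dy n) * \<gamma> a) \<le> 2 ^ n * (ennreal (dy n) * (?T + (E \<delta> n + \<gamma> (dy n))))"
      by (rule mult_left_mono) (rule zero_le)
    then show ?thesis by (simp only: cancel)
  qed
  have upper: "q (\<lambda>y. f y * g y) n \<le> \<gamma> (a + dy n) + E \<delta> n" if \<delta>: "0 < \<delta>" for \<delta> n
  proof -
    have "(\<integral>\<^sup>+x. c (\<lambda>y. f y * g y) (dy n) x \<partial>m) \<le> I n + ennreal (dy n) * E \<delta> n" by (rule err[OF \<delta>])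
    also have "\<dots> \<le> ennreal (dy n) * \<gamma> (a + dy n) + ennreal (dy n) * E \<delta> n"
      unfolding I_def g_def \<gamma>_def by (intro add_right_mono energy_sandwich(2)[OF f h h_int a dy(1)])
    finally have "q (\<lambda>y. f y * g y) n \<le> 2 ^ n * (ennreal (dy n) * (\<gamma> (a + dy n) + E \<delta> n))"
      unfolding q_def by (intro mult_left_mono) (simp_all add: distrib_left)
    then show ?thesis by (simp only: cancel)
  qed
  have E_lim: "E \<delta> \<longlonglongrightarrow> ennreal (2 * \<delta>) * ?K" if \<delta>: "0 < \<delta>" for \<delta>
  proof -
    have "(\<lambda>n. ennreal (dy n) * ?F) \<longlonglongrightarrow> ennreal 0 * ?F"
      using F_fin by (intro tendsto_mult_ennreal tendsto_const tendsto_ennrealI dy_tendsto) auto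
    moreover have "(\<lambda>n. ennreal (2 / \<delta>) * (\<integral>\<^sup>+y. f y * c f (dy n) y \<partial>\<mu>)) \<longlonglongrightarrow> ennreal (2 / \<delta>) * 0"
      by (intro tendsto_mult_ennreal tendsto_const integral_c_tendsto_0 f sets_\<mu> F_fin) auto
    ultimately have "(\<lambda>n. ennreal (dy n) * ?F + ennreal (2 * \<delta>) * ?K + ennreal (2 / \<delta>) * (\<integral>\<^sup>+y. f y * c f (dy n) y \<partial>\<mu>))
      \<longlonglongrightarrow> ennreal 0 * ?F + ennreal (2 * \<delta>) * ?K + ennreal (2 / \<delta>) * 0"
      by (intro tendsto_add tendsto_const)
    then show ?thesis unfolding E_def[abs_def] by simp
  qed
  have \<gamma>0: "(\<lambda>n. \<gamma> (dy n)) \<longlonglongrightarrow> 0"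
    unfolding \<gamma>_def by (rule integral_c_tendsto_0[OF f sets_m h(1) h_int])
  have \<gamma>a: "(\<lambda>n. \<gamma> (a + dy n)) \<longlonglongrightarrow> \<gamma> a"
  proof -
    note measurable_Pt[OF a, measurable]
    have "\<gamma> (a + dy n) = \<gamma> a + (\<integral>\<^sup>+x. Pt a h x * c f (dy n) x \<partial>m)" for n
    proof -
      have "c f (a + dy n) x = c f a x + Pt a (c f (dy n)) x" for x
        using EBi_split[OF f(1), of 0 a "a + dy n" x] EBi_Pt[OF f(1) a, of "a + dy n" x] a dy(1)[of n] by simp
      then have "\<gamma> (a + dy n) = \<gamma> a + (\<integral>\<^sup>+x. h x * Pt a (c f (dy n)) x \<partial>m)"
        unfolding \<gamma>_def by (simp add: distrib_left nn_integral_add)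
      then show ?thesis by (simp add: Pt_symmetric[OF a])
    qed
    moreover have "(\<lambda>n. \<integral>\<^sup>+x. Pt a h x * c f (dy n) x \<partial>m) \<longlonglongrightarrow> 0"
      by (rule integral_c_tendsto_0[OF f sets_m])
         (use le_less_trans[OF integral_Pt_le[OF a h(1)] h_int] in auto)
    then have "(\<lambda>n. \<gamma> a + (\<integral>\<^sup>+x. Pt a h x * c f (dy n) x \<partial>m)) \<longlonglongrightarrow> \<gamma> a + 0"
      by (intro tendsto_add tendsto_const)
    ultimately show ?thesis by simp
  qed
  have null: "(\<lambda>k. ennreal (2 * dy k) * ?K) \<longlonglongrightarrow> 0"
  proof -
    have "(\<lambda>k. ennreal (2 * dy k) * ?K) \<longlonglongrightarrow> ennreal (2 * 0) * ?K"
      using K_fin by (intro tendsto_mult_ennreal tendsto_const tendsto_ennrealI tendsto_mult dy_tendsto) auto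
    then show ?thesis by simp
  qed
  have "\<gamma> a \<le> ?T"
  proof (rule le_of_le_add_null[OF _ null])
    fix k
    have "(\<lambda>n. ?T + (E (dy k) n + \<gamma> (dy n))) \<longlonglongrightarrow> ?T + (ennreal (2 * dy k) * ?K + 0)"
      by (intro tendsto_add tendsto_const E_lim dy \<gamma>0)
    then have "\<gamma> a \<le> ?T + (ennreal (2 * dy k) * ?K + 0)"
      by (rule tendsto_lowerbound) (use lower[OF dy(1)] in auto)
    then show "\<gamma> a \<le> ?T + ennreal (2 * dy k) * ?K" by simp
  qed
  moreover have "?T \<le> \<gamma> a"
  proof (rule le_of_le_add_null[OF _ null])
    fix k
    have "q (\<lambda>y. f y * g y) \<longlonglongrightarrow> ?T"
      unfolding integral_\<mu>_SUP[OF fg] by (rule LIMSEQ_SUP[OF q_incseq[OF fg]])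
    moreover have "(\<lambda>n. \<gamma> (a + dy n) + E (dy k) n) \<longlonglongrightarrow> \<gamma> a + ennreal (2 * dy k) * ?K"
      by (intro tendsto_add \<gamma>a E_lim dy)
    ultimately show "?T \<le> \<gamma> a + ennreal (2 * dy k) * ?K"
      by (rule LIMSEQ_le) (use upper[OF dy(1)] in auto)
  qed
  ultimately show ?thesis by (simp add: \<gamma>_def g_def)
qed

section \<open>The potential at a single starting point\<close>

lemma Rt_cmult:
  assumes h: "h \<in> borel_measurable borel"
  shows "Rt t (\<lambda>x. k * h x) x = k * Rt t h x"
proof -
  have "Pt r (\<lambda>x. k * h x) x * indicator {0<..t} r = k * (Pt r h x * indicator {0<..t} r)" for r
  proof (cases "0 < r")
    case True
    note measurable_p1[OF True, measurable] h[measurable]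
    have "Pt r (\<lambda>x. k * h x) x = (\<integral>\<^sup>+y. k * (p r x y * h y) \<partial>m)"
      unfolding Pt_def by (simp add: mult.left_commute)
    also have "\<dots> = k * Pt r h x" unfolding Pt_def by (rule nn_integral_cmult) simp
    finally show ?thesis by (simp add: mult.assoc)
  qed simp
  then show ?thesis
    unfolding Rt_def using measurable_Pt_time[OF h, of x t] by (simp add: nn_integral_cmult cong: measurable_cong_sets)
qed

lemma Rt_SUP:
  assumes U: "\<And>i. U i \<in> borel_measurable borel" "incseq U"
  shows "Rt t (SUP i. U i) x = (SUP i. Rt t (U i) x)"
proof -
  have inc: "incseq (\<lambda>i r. Pt r (U i) x * indicator {0<..t} r)"
    using U(2) by (intro incseq_SucI le_funI mult_right_mono) (auto simp: Pt_def incseq_Suc_iff le_fun_def intro!: nn_integral_mono mult_left_mono)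
  have "Pt r (SUP i. U i) x * indicator {0<..t} r = (SUP i. Pt r (U i) x * indicator {0<..t} r)" for r
  proof (cases "0 < r")
    case True
    note measurable_p1[OF True, measurable] U(1)[measurable]
    have "Pt r (SUP i. U i) x = (\<integral>\<^sup>+y. (SUP i. p r x y * U i y) \<partial>m)"
      unfolding Pt_def by (simp add: SUP_mult_left_ennreal image_comp)
    also have "\<dots> = (SUP i. Pt r (U i) x)"
      unfolding Pt_def using U(2)
      by (intro nn_integral_monotone_convergence_SUP) (auto simp: incseq_def le_fun_def intro!: mult_left_mono)
    finally show ?thesis by (simp add: SUP_mult_right_ennreal)
  qed (simp add: indicator_def)
  then have "Rt t (SUP i. U i) x = (\<integral>\<^sup>+r. (SUP i. Pt r (U i) x * indicator {0<..t} r) \<partial>lborel)"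
    by (simp only: Rt_def)
  also have "\<dots> = (SUP i. Rt t (U i) x)"
    unfolding Rt_def using inc measurable_Pt_time[OF U(1)]
    by (intro nn_integral_monotone_convergence_SUP) (auto cong: measurable_cong_sets)
  finally show ?thesis .
qed

text \<open>A Borel function \<open>h \<ge> 0\<close> is the increasing limit of \<open>min h (n w)\<close>, multiples of functions that
  are bounded by \<open>1\<close> and integrable.\<close>

lemma energy_identity:
  assumes f: "f \<in> borel_measurable borel" "\<And>x. f x \<le> \<phi> x"
    and h: "h \<in> borel_measurable borel" and a: "0 < a"
  shows "(\<integral>\<^sup>+x. h x * c f a x \<partial>m) = (\<integral>\<^sup>+y. f y * Rt a h y \<partial>\<mu>)"
proof -
  define k where "k n x = min (h x / of_nat n) (w x)" for n x
  define H where "H n = (\<lambda>x. of_nat n * k n x)" for n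
  note f(1)[measurable] h[measurable] measurable_EBi[OF f(1) order_refl, measurable]
  have k[measurable]: "k n \<in> borel_measurable borel" for n unfolding k_def by measurable
  have H_meas[measurable]: "H n \<in> borel_measurable borel" for n unfolding H_def by measurable
  note measurable_Rt[OF H_meas, measurable] measurable_Rt[OF k, measurable]
  have H_min: "H n x = min (h x) (of_nat n * w x)" for n x
  proof (cases "n = 0")
    case False
    then have hn: "of_nat n * (h x / of_nat n) = h x"
      by (simp add: ennreal_times_divide mult.commute[of "of_nat n"] ennreal_mult_divide_eq)
    show ?thesis
    proof (cases "h x / of_nat n \<le> w x")
      case True
      then have "of_nat n * (h x / of_nat n) \<le> of_nat n * w x" by (rule mult_left_mono) simp
      then show ?thesis using True hn by (simp add: H_def k_def min_def)
    next
      case False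
      then have "of_nat n * w x \<le> of_nat n * (h x / of_nat n)" by (intro mult_left_mono) auto
      then show ?thesis using False hn by (auto simp: H_def k_def min_def)
    qed
  qed (simp add: H_def)
  have H_inc: "incseq H"
    unfolding incseq_def le_fun_def H_min by (intro allI impI min.mono mult_right_mono) auto
  have H_sup: "(SUP n. H n) = h"
  proof (rule ext)
    fix x
    have "(SUP n. H n) x = (SUP n. inf (h x) (of_nat n * w x))" by (simp add: image_comp H_min inf_min)
    also have "\<dots> = inf (h x) (SUP n. of_nat n * w x)" by (rule inf_SUP[symmetric])
    also have "(SUP n. of_nat n * w x) = top"
      by (simp add: SUP_mult_right_ennreal[symmetric] ennreal_SUP_of_nat_eq_top ennreal_top_mult w_nonzero)
    finally show "(SUP n. H n) x = h x" by simp
  qed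
  have id: "(\<integral>\<^sup>+x. H n x * c f a x \<partial>m) = (\<integral>\<^sup>+y. f y * Rt a (H n) y \<partial>\<mu>)" for n
  proof -
    have k_le: "k n x \<le> w x" for x by (simp add: k_def)
    have "(\<integral>\<^sup>+x. k n x * c f a x \<partial>m) = (\<integral>\<^sup>+y. f y * Rt a (k n) y \<partial>\<mu>)"
    proof (rule energy_identity_bounded[OF f k _ _ a])
      show "k n x \<le> 1" for x using k_le w_le by (rule order_trans)
      show "(\<integral>\<^sup>+x. k n x \<partial>m) < \<infinity>" by (rule le_less_trans[OF nn_integral_mono[OF k_le] w_int])
    qed
    then show ?thesis
      unfolding H_def Rt_cmult[OF k] by (simp add: mult.assoc mult.left_commute[of "f _"] nn_integral_cmult)
  qed
  have "(\<integral>\<^sup>+x. h x * c f a x \<partial>m) = (\<integral>\<^sup>+x. (SUP n. H n x * c f a x) \<partial>m)"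
    by (subst H_sup[symmetric]) (simp add: SUP_mult_right_ennreal image_comp)
  also have "\<dots> = (SUP n. \<integral>\<^sup>+x. H n x * c f a x \<partial>m)"
    using H_inc by (intro nn_integral_monotone_convergence_SUP) (auto simp: incseq_def le_fun_def intro!: mult_right_mono)
  also have "\<dots> = (SUP n. \<integral>\<^sup>+y. f y * Rt a (H n) y \<partial>\<mu>)" by (simp only: id)
  also have "\<dots> = (\<integral>\<^sup>+y. (SUP n. f y * Rt a (H n) y) \<partial>\<mu>)"
  proof (rule nn_integral_monotone_convergence_SUP[symmetric])
    have "Rt a (H n) y \<le> Rt a (H n') y" if "n \<le> n'" for n n' y
      unfolding Rt_def Pt_def using H_inc that
      by (intro nn_integral_mono mult_right_mono mult_left_mono) (auto simp: incseq_def le_fun_def)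
    then show "incseq (\<lambda>n y. f y * Rt a (H n) y)"
      by (auto simp: incseq_def le_fun_def intro!: mult_left_mono)
  qed (simp cong: measurable_cong_sets)
  also have "\<dots> = (\<integral>\<^sup>+y. f y * Rt a (SUP n. H n) y \<partial>\<mu>)"
    by (simp only: SUP_mult_left_ennreal[symmetric] Rt_SUP[OF H_meas H_inc])
  finally show ?thesis by (simp only: H_sup)
qed

lemma measurable_p_time_space:
  assumes "0 \<le> a"
  shows "(\<lambda>(r, y). p r x y * indicator {a<..b} r) \<in> borel_measurable (borel \<Otimes>\<^sub>M borel)"
proof -
  have "(\<lambda>z. (fst z, x, snd z)) \<in> borel \<Otimes>\<^sub>M borel \<rightarrow>\<^sub>M (borel :: real measure) \<Otimes>\<^sub>M (borel :: 's measure) \<Otimes>\<^sub>M (borel :: 's measure)"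
    by measurable
  from measurable_compose[OF this p_joint]
  have "(\<lambda>z. if 0 < fst z then p (fst z) x (snd z) else 0) \<in> borel_measurable (borel \<Otimes>\<^sub>M (borel :: 's measure))"
    by simp
  moreover have "(\<lambda>z. indicator {a<..b} (fst z) :: ennreal) \<in> borel_measurable (borel \<Otimes>\<^sub>M (borel :: 's measure))"
    by measurable
  ultimately have "(\<lambda>z. (if 0 < fst z then p (fst z) x (snd z) else 0) * indicator {a<..b} (fst z))
    \<in> borel_measurable (borel \<Otimes>\<^sub>M (borel :: 's measure))" by (rule borel_measurable_times_ennreal)
  then show ?thesis
    by (rule measurable_cong[THEN iffD1, rotated]) (use assms in \<open>auto simp: indicator_def\<close>)
qed

text \<open>The kernel \<open>p\<^sub>a(x, \<cdot>)\<close> is the test function \<open>h\<close> that localizes the energy identity at \<open>x\<close>.\<close>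

lemma EBi_window:
  assumes f: "f \<in> borel_measurable borel" "\<And>x. f x \<le> \<phi> x" and a: "0 < a"
  shows "EBi f a b x = (\<integral>\<^sup>+y. f y * (\<integral>\<^sup>+r. p r x y * indicator {a<..b} r \<partial>lborel) \<partial>\<mu>)"
proof (cases "a < b")
  case True
  have [measurable]: "p a x \<in> borel_measurable borel" by (rule measurable_p1[OF a])
  have "EBi f a b x = (\<integral>\<^sup>+y. p a x y * c f (b - a) y \<partial>m)"
    using EBi_Pt[OF f(1) a] True by (simp add: Pt_def)
  also have "\<dots> = (\<integral>\<^sup>+y. f y * Rt (b - a) (p a x) y \<partial>\<mu>)"
    by (rule energy_identity[OF f]) (use True in auto)
  also have "\<dots> = (\<integral>\<^sup>+y. f y * (\<integral>\<^sup>+r. p r x y * indicator {a<..b} r \<partial>lborel) \<partial>\<mu>)"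
  proof (intro nn_integral_cong arg_cong2[where f = "(*)"] refl)
    fix y
    have "Pt r (p a x) y * indicator {0<..b - a} r = p (a + r) x y * indicator {a<..b} (a + r)" for r
    proof (cases "0 < r")
      case True
      have "Pt r (p a x) y = (\<integral>\<^sup>+z. p r y z * p a z x \<partial>m)"
        unfolding Pt_def by (simp add: p_sym[OF a, of x])
      also have "\<dots> = p (a + r) x y"
        using p_semigroup[OF a True, of y x] p_sym[of "r + a" y x] a True by (simp add: add.commute)
      finally show ?thesis using True by (auto simp: indicator_def)
    qed auto
    then have "Rt (b - a) (p a x) y = (\<integral>\<^sup>+r. p (a + r) x y * indicator {a<..b} (a + r) \<partial>lborel)"
      by (simp only: Rt_def)
    also have "\<dots> = (\<integral>\<^sup>+r. p r x y * indicator {a<..b} r \<partial>lborel)"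
    proof (rule nn_integral_shift[symmetric])
      show "(\<lambda>r. p r x y * indicator {a<..b} r) \<in> borel_measurable borel"
        using measurable_compose[OF measurable_Pair2'[of y borel borel] measurable_p_time_space[of a x b]] a by simp
    qed
    finally show "Rt (b - a) (p a x) y = (\<integral>\<^sup>+r. p r x y * indicator {a<..b} r \<partial>lborel)" .
  qed
  finally show ?thesis .
next
  case False
  then show ?thesis by (simp add: EBi_def Bi_empty)
qed

text \<open>The sets \<open>{1 \<le> n \<phi>}\<close> have finite measure by Markov's inequality and exhaust the space since \<open>\<phi> > 0\<close>.\<close>

lemma sigma_finite_\<mu>: "sigma_finite_measure \<mu>"
proof
  let ?A = "\<lambda>n. {y. 1 \<le> of_nat n * \<phi> y}"
  have sets: "?A n \<in> sets borel" for n by measurable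
  have "emeasure \<mu> (?A n) \<noteq> \<infinity>" for n
  proof -
    have "emeasure \<mu> (?A n) \<le> of_nat n * (\<integral>\<^sup>+y. \<phi> y \<partial>\<mu>)"
      using nn_integral_Markov_inequality[of \<phi> UNIV \<mu> "of_nat n"] by (simp cong: measurable_cong_sets)
    also have "\<dots> < \<infinity>" using \<mu>_\<phi>_finite by (simp add: ennreal_mult_less_top of_nat_less_top)
    finally show ?thesis by simp
  qed
  moreover have "(\<Union>n. ?A n) = UNIV"
  proof (intro set_eqI iffI UNIV_I)
    fix y
    have "(SUP n. of_nat n * \<phi> y) = top"
      using \<phi>_pos[of y] by (simp add: SUP_mult_right_ennreal[symmetric] ennreal_SUP_of_nat_eq_top ennreal_top_mult)
    then have "1 < (SUP n. of_nat n * \<phi> y)" by (simp only: ennreal_one_less_top)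
    then show "y \<in> (\<Union>n. ?A n)" unfolding less_SUP_iff by (auto intro: less_imp_le)
  qed
  ultimately show "\<exists>\<A>. countable \<A> \<and> \<A> \<subseteq> sets \<mu> \<and> \<Union>\<A> = space \<mu> \<and> (\<forall>a\<in>\<A>. emeasure \<mu> a \<noteq> \<infinity>)"
    using sets by (intro exI[of _ "range ?A"]) auto
qed

sublocale \<mu>: sigma_finite_measure \<mu> by (rule sigma_finite_\<mu>)

lemma measurable_p_weighted:
  assumes f: "f \<in> borel_measurable borel" and "0 \<le> a"
  shows "(\<lambda>(r, y). f y * (p r x y * indicator {a<..b} r)) \<in> borel_measurable (lborel \<Otimes>\<^sub>M \<mu>)"
proof -
  have "(\<lambda>z. f (snd z)) \<in> borel_measurable (borel \<Otimes>\<^sub>M borel)" using f by measurable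
  from borel_measurable_times_ennreal[OF this measurable_p_time_space[of a x b]] show ?thesis
    using assms(2) by (simp add: split_beta' cong: measurable_cong_sets)
qed

text \<open>Start the window at \<open>a > 0\<close> and let \<open>a\<close> decrease to \<open>0\<close>.\<close>

lemma c_density:
  assumes f: "f \<in> borel_measurable borel" "\<And>x. f x \<le> \<phi> x"
  shows "c f t x = (\<integral>\<^sup>+r. (\<integral>\<^sup>+y. p r x y * f y \<partial>\<mu>) * indicator {0<..t} r \<partial>lborel)"
proof (cases "0 < t")
  case True
  interpret pair_sigma_finite lborel \<mu> ..
  define a where "a = eps 0 t"
  have a: "0 < a n" "decseq a" "a \<longlonglongrightarrow> 0" for n using eps[of 0 t] True by (auto simp: a_def)
  have F: "EBi f (a n) t x = (\<integral>\<^sup>+r. (\<integral>\<^sup>+y. f y * (p r x y * indicator {a n<..t} r) \<partial>\<mu>) \<partial>lborel)" for n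
  proof -
    have "(\<lambda>r. p r x y * indicator {a n<..t} r) \<in> borel_measurable lborel" for y
      using measurable_compose[OF measurable_Pair2'[of y borel borel] measurable_p_time_space[of "a n" x t]] a(1)[of n]
      by (simp cong: measurable_cong_sets)
    then have "EBi f (a n) t x = (\<integral>\<^sup>+y. (\<integral>\<^sup>+r. f y * (p r x y * indicator {a n<..t} r) \<partial>lborel) \<partial>\<mu>)"
      unfolding EBi_window[OF f a(1)] by (intro nn_integral_cong nn_integral_cmult[symmetric])
    also have "\<dots> = (\<integral>\<^sup>+r. (\<integral>\<^sup>+y. f y * (p r x y * indicator {a n<..t} r) \<partial>\<mu>) \<partial>lborel)"
      using Fubini[OF measurable_p_weighted[OF f(1), of "a n" x t]] a(1)[of n] by simp
    finally show ?thesis .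
  qed
  have ind: "(\<integral>\<^sup>+y. f y * (p r x y * indicator {b<..t} r) \<partial>\<mu>) = (\<integral>\<^sup>+y. p r x y * f y \<partial>\<mu>) * indicator {b<..t} r" for r b
    by (auto simp: indicator_def mult.commute)
  have meas: "(\<lambda>r. (\<integral>\<^sup>+y. p r x y * f y \<partial>\<mu>) * indicator {a n<..t} r) \<in> borel_measurable lborel" for n
    using \<mu>.borel_measurable_nn_integral[OF measurable_p_weighted[OF f(1), of "a n" x t]] a(1)[of n] by (simp add: ind)
  have "c f t x = (SUP n. EBi f (a n) t x)" by (rule EBi_SUP[OF f(1) order_refl a])
  also have "\<dots> = (\<integral>\<^sup>+r. (SUP n. (\<integral>\<^sup>+y. p r x y * f y \<partial>\<mu>) * indicator {a n<..t} r) \<partial>lborel)"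
    unfolding F ind
  proof (rule nn_integral_monotone_convergence_SUP[symmetric, OF _ meas])
    have "indicator {a n<..t} r \<le> (indicator {a n'<..t} r :: ennreal)" if "n \<le> n'" for n n' r
      using decseqD[OF a(2) that] by (auto simp: indicator_def)
    then show "incseq (\<lambda>n r. (\<integral>\<^sup>+y. p r x y * f y \<partial>\<mu>) * indicator {a n<..t} r)"
      unfolding incseq_def le_fun_def by (intro allI impI mult_left_mono) auto
  qed
  also have "\<dots> = (\<integral>\<^sup>+r. (\<integral>\<^sup>+y. p r x y * f y \<partial>\<mu>) * indicator {0<..t} r \<partial>lborel)"
  proof (intro nn_integral_cong)
    fix r
    have "(SUP n. indicator {a n<..t} r) = (indicator {0<..t} r :: ennreal)"
    proof (rule antisym)
      show "(SUP n. indicator {a n<..t} r) \<le> (indicator {0<..t} r :: ennreal)"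
        using a(1) by (intro SUP_least) (auto simp: indicator_def intro: less_trans)
      show "(indicator {0<..t} r :: ennreal) \<le> (SUP n. indicator {a n<..t} r)"
      proof (cases "r \<in> {0<..t}")
        case True
        then have "\<forall>\<^sub>F n in sequentially. a n < r" using a(3) by (auto intro: order_tendstoD)
        then obtain n where "a n < r" by (auto dest: eventually_happens)
        then show ?thesis using True by (intro SUP_upper2[of n]) auto
      qed simp
    qed
    then show "(SUP n. (\<integral>\<^sup>+y. p r x y * f y \<partial>\<mu>) * indicator {a n<..t} r) = (\<integral>\<^sup>+y. p r x y * f y \<partial>\<mu>) * indicator {0<..t} r"
      by (simp add: SUP_mult_left_ennreal[symmetric])
  qed
  finally show ?thesis .
qed (simp add: EBi_def Bi_empty)

section \<open>The occupation formula\<close>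

text \<open>Time and state at the level \<open>u\<close>.  The default value is taken only where the density \<open>occ_dens\<close> vanishes.\<close>

definition Z :: "real \<times> 'w \<Rightarrow> real \<times> 's" where
  "Z z = (enn2real (\<tau> (fst z) (snd z)),
     case X (ennreal (enn2real (\<tau> (fst z) (snd z)))) (snd z) of None \<Rightarrow> undefined | Some y \<Rightarrow> y)"

definition occ_dens :: "real \<times> 'w \<Rightarrow> ennreal" where
  "occ_dens z = lift \<phi> (X (ennreal (enn2real (\<tau> (fst z) (snd z)))) (snd z)) * indicator (levels (snd z) \<infinity>) (fst z)"

text \<open>Integration against \<open>occ x\<close> is \<open>E\<^sub>x[\<integral> \<phi>(X\<^sub>s) g(s, X\<^sub>s) dA\<^sub>s]\<close>.  Having a measure on time and state space at hand allows a
  uniqueness argument on rectangles.\<close>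

definition occ :: "'s \<Rightarrow> (real \<times> 's) measure" where
  "occ x = distr (density (lborel \<Otimes>\<^sub>M Q (Some x)) occ_dens) (borel \<Otimes>\<^sub>M borel) Z"

lemma measurable_lift_X2:
  assumes g: "(\<lambda>(s, y). g s y) \<in> borel_measurable (borel \<Otimes>\<^sub>M borel)"
  shows "(\<lambda>(s, \<omega>). lift (g s) (X (ennreal s) \<omega>)) \<in> borel_measurable (borel \<Otimes>\<^sub>M Finf)"
proof -
  have "(\<lambda>z. (fst z, X (ennreal (fst z)) (snd z))) \<in> borel \<Otimes>\<^sub>M Finf \<rightarrow>\<^sub>M borel \<Otimes>\<^sub>M borel_pt"
    by measurable
  from measurable_compose[OF this measurable_lift2[OF g]] show ?thesis by (simp add: split_beta')
qed

lemma measurable_lborel_Q: "f \<in> borel \<Otimes>\<^sub>M Finf \<rightarrow>\<^sub>M L \<Longrightarrow> f \<in> lborel \<Otimes>\<^sub>M Q y \<rightarrow>\<^sub>M L"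
proof -
  assume f: "f \<in> borel \<Otimes>\<^sub>M Finf \<rightarrow>\<^sub>M L"
  have "(\<lambda>z. (fst z, snd z)) \<in> lborel \<Otimes>\<^sub>M Q y \<rightarrow>\<^sub>M borel \<Otimes>\<^sub>M Finf"
  proof (rule measurable_Pair)
    show "fst \<in> lborel \<Otimes>\<^sub>M Q y \<rightarrow>\<^sub>M borel" by measurable
    have "id \<in> Q y \<rightarrow>\<^sub>M Finf" using aug_le_Q[of \<infinity> y] by (auto simp: measurable_def Finf_def)
    from measurable_compose[OF measurable_snd this] show "snd \<in> lborel \<Otimes>\<^sub>M Q y \<rightarrow>\<^sub>M Finf" by simp
  qed
  from measurable_compose[OF this f] show ?thesis by simp
qed

lemma measurable_Z: "Z \<in> borel \<Otimes>\<^sub>M Finf \<rightarrow>\<^sub>M borel \<Otimes>\<^sub>M borel"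
proof -
  have "(\<lambda>y. case y of None \<Rightarrow> undefined | Some y \<Rightarrow> y) \<in> borel_pt \<rightarrow>\<^sub>M (borel :: 's measure)"
    by (rule measurable_borel_ptI) simp_all
  from measurable_compose[OF measurable_X2 this]
  have [measurable]: "(\<lambda>z. case X (ennreal (enn2real (\<tau> (fst z) (snd z)))) (snd z) of None \<Rightarrow> undefined | Some y \<Rightarrow> y)
    \<in> borel \<Otimes>\<^sub>M Finf \<rightarrow>\<^sub>M borel" by measurable
  show ?thesis unfolding Z_def[abs_def] by measurable
qed

lemma measurable_occ_dens: "occ_dens \<in> borel_measurable (borel \<Otimes>\<^sub>M Finf)"
  using measurable_time_changed[OF measurable_lift_X[OF measurable_\<phi>], of \<infinity>]
  by (simp add: occ_dens_def[abs_def] split_beta')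

lemma sets_occ [simp, measurable_cong]: "sets (occ x) = sets (borel \<Otimes>\<^sub>M borel)"
  by (simp add: occ_def)

lemma integral_occ:
  assumes g: "(\<lambda>(s, y). g s y) \<in> borel_measurable (borel \<Otimes>\<^sub>M borel)"
  shows "(\<integral>\<^sup>+(s, y). g s y \<partial>occ x) =
    (\<integral>\<^sup>+\<omega>. dA_integral X A \<omega> \<infinity> (\<lambda>s. lift (\<lambda>y. \<phi> y * g s y) (X (ennreal s) \<omega>)) \<partial>Q (Some x))"
proof -
  interpret Q: prob_space "Q (Some x)" by (rule prob_Q)
  interpret pair_sigma_finite lborel "Q (Some x)" ..
  note d = measurable_lborel_Q[OF measurable_occ_dens, of "Some x"] and Z = measurable_lborel_Q[OF measurable_Z, of "Some x"]
  note gZ = measurable_compose[OF Z g]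
  have \<phi>g: "(\<lambda>(s, y). \<phi> y * g s y) \<in> borel_measurable (borel \<Otimes>\<^sub>M borel)"
  proof -
    have "(\<lambda>z. \<phi> (snd z)) \<in> borel_measurable (borel \<Otimes>\<^sub>M borel)" by measurable
    from borel_measurable_times_ennreal[OF this g] show ?thesis by (simp add: split_beta')
  qed
  have "(\<integral>\<^sup>+(s, y). g s y \<partial>occ x) = (\<integral>\<^sup>+z. (case Z z of (s, y) \<Rightarrow> g s y) \<partial>density (lborel \<Otimes>\<^sub>M Q (Some x)) occ_dens)"
    unfolding occ_def using Z g by (intro nn_integral_distr) (simp_all cong: measurable_cong_sets)
  also have "\<dots> = (\<integral>\<^sup>+z. occ_dens z * (case Z z of (s, y) \<Rightarrow> g s y) \<partial>(lborel \<Otimes>\<^sub>M Q (Some x)))"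
    by (rule nn_integral_density[OF d gZ])
  also have "\<dots> = (\<integral>\<^sup>+u. (\<integral>\<^sup>+\<omega>. occ_dens (u, \<omega>) * (case Z (u, \<omega>) of (s, y) \<Rightarrow> g s y) \<partial>Q (Some x)) \<partial>lborel)"
    by (rule Q.nn_integral_fst[symmetric]) (rule borel_measurable_times_ennreal[OF d gZ])
  also have "\<dots> = (\<integral>\<^sup>+u. (\<integral>\<^sup>+\<omega>. lift (\<lambda>y. \<phi> y * g (enn2real (\<tau> u \<omega>)) y) (X (ennreal (enn2real (\<tau> u \<omega>))) \<omega>)
      * indicator (levels \<omega> \<infinity>) u \<partial>Q (Some x)) \<partial>lborel)"
  proof (intro nn_integral_cong)
    fix u \<omega>
    show "occ_dens (u, \<omega>) * (case Z (u, \<omega>) of (s, y) \<Rightarrow> g s y) =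
      lift (\<lambda>y. \<phi> y * g (enn2real (\<tau> u \<omega>)) y) (X (ennreal (enn2real (\<tau> u \<omega>))) \<omega>) * indicator (levels \<omega> \<infinity>) u"
      by (cases "X (ennreal (enn2real (\<tau> u \<omega>))) \<omega>") (simp_all add: occ_dens_def Z_def mult_ac)
  qed
  also have "\<dots> = (\<integral>\<^sup>+\<omega>. dA_integral X A \<omega> \<infinity> (\<lambda>s. lift (\<lambda>y. \<phi> y * g s y) (X (ennreal s) \<omega>)) \<partial>Q (Some x))"
    by (rule integral_dA_Fubini[OF measurable_lift_X2[OF \<phi>g], symmetric])
  finally show ?thesis .
qed

definition occ_density :: "'s \<Rightarrow> real \<times> 's \<Rightarrow> ennreal" where
  "occ_density x z = (if 0 < fst z then p (fst z) x (snd z) else 0) * \<phi> (snd z)"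

lemma measurable_occ_density: "occ_density x \<in> borel_measurable (borel \<Otimes>\<^sub>M borel)"
proof -
  have "(\<lambda>z. (fst z, x, snd z)) \<in> borel \<Otimes>\<^sub>M borel \<rightarrow>\<^sub>M (borel :: real measure) \<Otimes>\<^sub>M (borel :: 's measure) \<Otimes>\<^sub>M (borel :: 's measure)"
    by measurable
  from measurable_compose[OF this p_joint]
  have [measurable]: "(\<lambda>z. if 0 < fst z then p (fst z) x (snd z) else 0) \<in> borel_measurable (borel \<Otimes>\<^sub>M (borel :: 's measure))"
    by simp
  show ?thesis unfolding occ_density_def[abs_def] by measurable
qed

lemma integral_occ_density:
  assumes g: "(\<lambda>(s, y). g s y) \<in> borel_measurable (borel \<Otimes>\<^sub>M borel)"
  shows "(\<integral>\<^sup>+(s, y). g s y \<partial>density (lborel \<Otimes>\<^sub>M \<mu>) (occ_density x)) =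
    (\<integral>\<^sup>+s. (\<integral>\<^sup>+y. p s x y * (\<phi> y * g s y) \<partial>\<mu>) * indicator {0<..} s \<partial>lborel)"
proof -
  interpret pair_sigma_finite lborel \<mu> ..
  have d: "occ_density x \<in> borel_measurable (lborel \<Otimes>\<^sub>M \<mu>)" and g': "(\<lambda>(s, y). g s y) \<in> borel_measurable (lborel \<Otimes>\<^sub>M \<mu>)"
    using measurable_occ_density g by (simp_all cong: measurable_cong_sets)
  have "(\<integral>\<^sup>+(s, y). g s y \<partial>density (lborel \<Otimes>\<^sub>M \<mu>) (occ_density x)) =
    (\<integral>\<^sup>+z. occ_density x z * (case z of (s, y) \<Rightarrow> g s y) \<partial>(lborel \<Otimes>\<^sub>M \<mu>))"
    by (rule nn_integral_density[OF d g'])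
  also have "\<dots> = (\<integral>\<^sup>+s. (\<integral>\<^sup>+y. occ_density x (s, y) * (case (s, y) of (s, y) \<Rightarrow> g s y) \<partial>\<mu>) \<partial>lborel)"
    by (rule \<mu>.nn_integral_fst[symmetric]) (rule borel_measurable_times_ennreal[OF d g'])
  also have "\<dots> = (\<integral>\<^sup>+s. (\<integral>\<^sup>+y. p s x y * (\<phi> y * g s y) \<partial>\<mu>) * indicator {0<..} s \<partial>lborel)"
    by (intro nn_integral_cong) (auto simp: occ_density_def indicator_def mult.assoc)
  finally show ?thesis .
qed

text \<open>Weighted by \<open>\<phi>\<close>, both sides of the occupation formula are measures on time and space that are finite on bounded time
  intervals, and they agree on the rectangles \<open>(-\<infinity>, t] \<times> B\<close>.\<close>

lemma occ_eq: "occ x = density (lborel \<Otimes>\<^sub>M \<mu>) (occ_density x)"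
proof -
  define E where "E = {{..t} \<times> B | (t :: real) (B :: 's set). B \<in> sets borel}"
  have rect: "emeasure (occ x) ({..t} \<times> B) = c (\<lambda>y. \<phi> y * indicator B y) t x"
      "emeasure (density (lborel \<Otimes>\<^sub>M \<mu>) (occ_density x)) ({..t} \<times> B) = c (\<lambda>y. \<phi> y * indicator B y) t x"
    if B: "B \<in> sets borel" for t B
  proof -
    let ?f = "\<lambda>y. \<phi> y * indicator B y"
    have f: "?f \<in> borel_measurable borel" "?f y \<le> \<phi> y" for y
      using B by (auto simp: indicator_def)
    have meas: "(\<lambda>(s, y). indicator {..t} s * indicator B y :: ennreal) \<in> borel_measurable (borel \<Otimes>\<^sub>M borel)"
      using B by measurable
    have ind: "indicator ({..t} \<times> B) = (\<lambda>(s, y). indicator {..t} s * indicator B y :: ennreal)"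
      by (auto simp: indicator_def fun_eq_iff)
    have "emeasure (occ x) ({..t} \<times> B) = (\<integral>\<^sup>+(s, y). indicator {..t} s * indicator B y \<partial>occ x)"
      unfolding ind[symmetric] using B by (intro nn_integral_indicator[symmetric]) (simp add: pair_measureI)
    also have "\<dots> = (\<integral>\<^sup>+\<omega>. Bi ?f 0 t \<omega> \<partial>Q (Some x))"
      unfolding integral_occ[OF meas]
    proof (intro nn_integral_cong)
      fix \<omega>
      have "lift (\<lambda>y. \<phi> y * (indicator {..t} s * indicator B y)) z * indicator {s. 0 < s \<and> ennreal s \<le> \<infinity>} s = lift ?f z * indicator {0<..t} s" for s z
        by (cases z) (auto simp: indicator_def)
      then show "dA_integral X A \<omega> \<infinity> (\<lambda>s. lift (\<lambda>y. \<phi> y * (indicator {..t} s * indicator B y)) (X (ennreal s) \<omega>)) = Bi ?f 0 t \<omega>"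
        unfolding dA_integral_def Bi_def by (simp only:)
    qed
    finally show "emeasure (occ x) ({..t} \<times> B) = c ?f t x" by (simp add: EBi_def)
    have "emeasure (density (lborel \<Otimes>\<^sub>M \<mu>) (occ_density x)) ({..t} \<times> B) =
      (\<integral>\<^sup>+(s, y). indicator {..t} s * indicator B y \<partial>density (lborel \<Otimes>\<^sub>M \<mu>) (occ_density x))"
      unfolding ind[symmetric] using B by (intro nn_integral_indicator[symmetric]) (simp add: pair_measureI)
    also have "\<dots> = (\<integral>\<^sup>+r. (\<integral>\<^sup>+y. p r x y * ?f y \<partial>\<mu>) * indicator {0<..t} r \<partial>lborel)"
      unfolding integral_occ_density[OF meas] by (intro nn_integral_cong) (auto simp: indicator_def)
    also have "\<dots> = c ?f t x" by (rule c_density[OF f, symmetric])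
    finally show "emeasure (density (lborel \<Otimes>\<^sub>M \<mu>) (occ_density x)) ({..t} \<times> B) = c ?f t x" .
  qed
  have sets_E: "sets (borel \<Otimes>\<^sub>M (borel :: 's measure)) = sigma_sets UNIV E"
  proof -
    have "sets (borel \<Otimes>\<^sub>M (borel :: 's measure)) =
      sets (sigma (space borel \<times> space (borel :: 's measure)) {a \<times> b | a b. a \<in> range (atMost :: real \<Rightarrow> _) \<and> b \<in> sets borel})"
    proof (rule sets_pair_eq[where Ca = "range (\<lambda>n. {..real n})" and Cb = "{UNIV}"])
      show "sets (borel :: real measure) = sigma_sets (space borel) (range atMost)"
        by (subst borel_eq_atMost) simp
      show "sets (borel :: 's measure) = sigma_sets (space borel) (sets borel)"
        by (simp add: sets.sigma_sets_eq[of borel, simplified])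
      show "\<Union>(range (\<lambda>n. {..real n})) = space borel" by (auto simp: real_arch_simple)
    qed auto
    also have "{a \<times> b | a b. a \<in> range (atMost :: real \<Rightarrow> _) \<and> b \<in> sets (borel :: 's measure)} = E"
      by (auto simp: E_def)
    finally show ?thesis by (simp add: sets_measure_of_conv)
  qed
  show ?thesis
  proof (rule measure_eqI_generator_eq[where E = E and \<Omega> = UNIV and A = "\<lambda>i. {..real i} \<times> UNIV"])
    show "Int_stable E"
    proof (rule Int_stableI)
      fix a b assume "a \<in> E" "b \<in> E"
      then obtain t B t' B' where "a = {..t} \<times> B" "b = {..t'} \<times> B'" "B \<in> sets borel" "B' \<in> sets borel"
        unfolding E_def by blast
      then have "a \<inter> b = {..min t t'} \<times> (B \<inter> B')" "B \<inter> B' \<in> sets borel" by auto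
      then show "a \<inter> b \<in> E" unfolding E_def by blast
    qed
    show "emeasure (occ x) a = emeasure (density (lborel \<Otimes>\<^sub>M \<mu>) (occ_density x)) a" if "a \<in> E" for a
      using that rect by (auto simp: E_def)
    show "sets (density (lborel \<Otimes>\<^sub>M \<mu>) (occ_density x)) = sigma_sets UNIV E"
      unfolding sets_E[symmetric] by (simp cong: sets_pair_measure_cong)
    show "emeasure (occ x) ({..real i} \<times> UNIV) \<noteq> \<infinity>" for i
    proof -
      have "c (\<lambda>y. \<phi> y * indicator UNIV y) (real i) x \<le> c \<phi> (real i + 1) x" by (intro EBi_mono) auto
      also have "\<dots> \<le> 1 + ennreal (real i + 1)" by (rule c_\<phi>_bound) simp
      also have "\<dots> < \<infinity>" by simp
      finally show ?thesis using rect(1)[of UNIV "real i"] by simp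
    qed
    show "(\<Union>i. {..real i} \<times> UNIV) = UNIV" by (auto simp: real_arch_simple)
    show "range (\<lambda>i. {..real i} \<times> UNIV) \<subseteq> E"
      unfolding E_def using sets.top[of "borel :: 's measure"] by (simp only: space_borel) blast
  qed (simp_all add: sets_E)
qed

text \<open>Divide by \<open>\<phi>\<close>, which is positive and finite, and use that the two weighted measures agree.\<close>

theorem occupation_formula:
  assumes \<psi>: "(\<lambda>(s, y). \<psi> s y) \<in> borel_measurable (borel \<Otimes>\<^sub>M borel)"
  shows "(\<integral>\<^sup>+\<omega>. dA_integral X A \<omega> t (\<lambda>s. lift (\<psi> s) (X (ennreal s) \<omega>)) \<partial>Q (Some x)) =
    (\<integral>\<^sup>+s\<in>{s. 0 < s \<and> ennreal s \<le> t}. (\<integral>\<^sup>+y. p s x y * \<psi> s y \<partial>\<mu>) \<partial>lborel)"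
proof -
  define g where "g s y = \<psi> s y * indicator {s. 0 < s \<and> ennreal s \<le> t} s / \<phi> y" for s y
  have g: "(\<lambda>(s, y). g s y) \<in> borel_measurable (borel \<Otimes>\<^sub>M borel)"
  proof -
    note \<psi>[measurable]
    have "(\<lambda>z. (case z of (s, y) \<Rightarrow> \<psi> s y) * indicator {s. 0 < s \<and> ennreal s \<le> t} (fst z) / \<phi> (snd z)) \<in> borel_measurable (borel \<Otimes>\<^sub>M borel)"
      by measurable
    then show ?thesis by (simp add: g_def split_beta')
  qed
  have \<phi>g: "\<phi> y * g s y = \<psi> s y * indicator {s. 0 < s \<and> ennreal s \<le> t} s" for s y
  proof -
    have "\<phi> y \<noteq> 0" "\<phi> y \<noteq> top" using \<phi>_pos[of y] \<phi>_le_1[of y] by (auto simp: top_unique)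
    then show ?thesis
      by (simp add: g_def ennreal_times_divide mult.commute[of "\<phi> y"] ennreal_mult_divide_eq)
  qed
  have "(\<integral>\<^sup>+\<omega>. dA_integral X A \<omega> t (\<lambda>s. lift (\<psi> s) (X (ennreal s) \<omega>)) \<partial>Q (Some x)) =
    (\<integral>\<^sup>+\<omega>. dA_integral X A \<omega> \<infinity> (\<lambda>s. lift (\<lambda>y. \<phi> y * g s y) (X (ennreal s) \<omega>)) \<partial>Q (Some x))"
  proof (intro nn_integral_cong)
    fix \<omega>
    have "lift (\<psi> s) z * indicator {s. 0 < s \<and> ennreal s \<le> t} s =
      lift (\<lambda>y. \<phi> y * g s y) z * indicator {s. 0 < s \<and> ennreal s \<le> \<infinity>} s" for s z
      unfolding \<phi>g by (cases z) (auto simp: indicator_def)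
    then show "dA_integral X A \<omega> t (\<lambda>s. lift (\<psi> s) (X (ennreal s) \<omega>)) =
      dA_integral X A \<omega> \<infinity> (\<lambda>s. lift (\<lambda>y. \<phi> y * g s y) (X (ennreal s) \<omega>))"
      unfolding dA_integral_def by (simp only:)
  qed
  also have "\<dots> = (\<integral>\<^sup>+s. (\<integral>\<^sup>+y. p s x y * (\<phi> y * g s y) \<partial>\<mu>) * indicator {0<..} s \<partial>lborel)"
    unfolding integral_occ[OF g, symmetric] occ_eq by (rule integral_occ_density[OF g])
  also have "\<dots> = (\<integral>\<^sup>+s\<in>{s. 0 < s \<and> ennreal s \<le> t}. (\<integral>\<^sup>+y. p s x y * \<psi> s y \<partial>\<mu>) \<partial>lborel)"
    unfolding \<phi>g by (intro nn_integral_cong) (auto simp: indicator_def)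
  finally show ?thesis .
qed

end

section \<open>Functionals of the shifted path\<close>

theorem theorem2p7:
  fixes m :: "'s::{metric_space, second_countable_topology} measure"
    and D :: "('s \<Rightarrow> real) set"
    and \<E> :: "('s \<Rightarrow> real) \<Rightarrow> ('s \<Rightarrow> real) \<Rightarrow> real"
    and M :: "'w measure"
    and X :: "ennreal \<Rightarrow> 'w \<Rightarrow> 's option"
    and P :: "'s option \<Rightarrow> 'w measure"
    and \<theta> :: "ennreal \<Rightarrow> 'w \<Rightarrow> 'w"
    and p :: "real \<Rightarrow> 's \<Rightarrow> 's \<Rightarrow> ennreal"
    and A :: "real \<Rightarrow> 'w \<Rightarrow> ennreal"
    and \<mu> :: "'s measure"
    and F :: "real \<Rightarrow> 'w \<Rightarrow> ennreal"
    and t :: ennreal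
    and x :: 's
  assumes "locally_compact_space (euclidean :: 's topology)"
    and "radon_full_support m"
    and "regular_dirichlet_form m D \<E>"
    and "hunt_process M X P \<theta>"
    and "m_symmetric m X P"
    and "has_dirichlet_form m X P D \<E>"
    and "AC_cond m X P"
    and "transition_density m X P p"
    and "pcaf_strict X P \<theta> A"
    and "revuz_measure m X P A \<mu>"
    and "(\<lambda>(s, \<omega>). F s \<omega>) \<in>
           borel_measurable (restrict_space borel {0<..} \<Otimes>\<^sub>M aug_filt X P \<infinity>)"
    and "\<exists>\<Lambda>\<in>sets (aug_filt X P \<infinity>).
           (\<forall>y. emeasure (Pc X P y) \<Lambda> = 1) \<and>
           (\<lambda>(s, \<omega>). indicator \<Lambda> \<omega> * F s (\<theta> (ennreal s) \<omega>)) \<in>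
             borel_measurable (restrict_space borel {0<..} \<Otimes>\<^sub>M aug_filt X P \<infinity>)"
    and "(\<lambda>(s, y). expect X P y (F s)) \<in>
           borel_measurable (restrict_space borel {0<..} \<Otimes>\<^sub>M borel)"
    and "0 < t"
  shows "expect X P x (\<lambda>\<omega>. dA_integral X A \<omega> t (\<lambda>s. F s (\<theta> (ennreal s) \<omega>))) =
         (\<integral>\<^sup>+s\<in>{s. 0 < s \<and> ennreal s \<le> t}. (\<integral>\<^sup>+y. p s x y * expect X P y (F s) \<partial>\<mu>) \<partial>lborel)"
proof -
  obtain \<Lambda> where "defining_set X P \<theta> A \<Lambda>" "\<And>t \<omega>. 0 \<le> t \<Longrightarrow> \<omega> \<notin> \<Lambda> \<Longrightarrow> A t \<omega> = 0"
    using assms(9) unfolding pcaf_strict_def by blast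
  then interpret revuz M X P \<theta> A \<Lambda> m p \<mu>
    using assms
    by (intro revuz.intro revuz_axioms.intro pcaf.intro pcaf_axioms.intro hunt.intro hunt_axioms.intro)
       (auto simp: pcaf_strict_def)
  obtain \<Gamma> where \<Gamma>: "\<Gamma> \<in> sets Finf" "\<And>y. emeasure (Q (Some y)) \<Gamma> = 1"
    and F\<theta>: "(\<lambda>(s, \<omega>). indicator \<Gamma> \<omega> * F s (\<theta> (ennreal s) \<omega>)) \<in> borel_measurable (restrict_space borel {0<..} \<Otimes>\<^sub>M Finf)"
    using assms(12) by (auto simp: Q_Some Finf_def)
  define G where "G s \<omega> = (if 0 < s then F s \<omega> else 0)" for s \<omega>
  have EG: "(\<integral>\<^sup>+\<omega>. G s \<omega> \<partial>Q (Some y)) = (if 0 < s then expect X P y (F s) else 0)" for s y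
    by (simp add: G_def expect_Q)
  have G_meas: "(\<lambda>(s, \<omega>). G s \<omega>) \<in> borel_measurable (borel \<Otimes>\<^sub>M Finf)"
    unfolding G_def Finf_def by (rule measurable_extend_pos[OF assms(11)])
  have EG_meas: "(\<lambda>(s, y). \<integral>\<^sup>+\<omega>. G s \<omega> \<partial>Q (Some y)) \<in> borel_measurable (borel \<Otimes>\<^sub>M borel)"
    unfolding EG by (rule measurable_extend_pos[OF assms(13)])
  have G\<theta>_meas: "(\<lambda>(s, \<omega>). indicator \<Gamma> \<omega> * G s (\<theta> (ennreal s) \<omega>)) \<in> borel_measurable (borel \<Otimes>\<^sub>M Finf)"
    using measurable_extend_pos[OF F\<theta>] by (simp add: G_def if_distrib cong: if_cong)
  have "expect X P x (\<lambda>\<omega>. dA_integral X A \<omega> t (\<lambda>s. F s (\<theta> (ennreal s) \<omega>))) =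
    (\<integral>\<^sup>+\<omega>. dA_integral X A \<omega> t (\<lambda>s. G s (\<theta> (ennreal s) \<omega>)) \<partial>Q (Some x))"
    unfolding expect_Q dA_integral_def by (intro nn_integral_cong) (auto simp: G_def indicator_def)
  also have "\<dots> = (\<integral>\<^sup>+\<omega>. dA_integral X A \<omega> t (\<lambda>s. lift (\<lambda>y. \<integral>\<^sup>+\<omega>. G s \<omega> \<partial>Q (Some y)) (X (ennreal s) \<omega>)) \<partial>Q (Some x))"
  proof (rule dA_projection[OF G_meas \<Gamma>(1) _ G\<theta>_meas EG_meas])
    show "AE \<omega> in Q (Some x). \<omega> \<in> \<Gamma>"
      using AE_Q_iff[of "\<lambda>\<omega>. \<omega> \<in> \<Gamma>" "Some x"] \<Gamma> by simp
  qed
  also have "\<dots> = (\<integral>\<^sup>+s\<in>{s. 0 < s \<and> ennreal s \<le> t}. (\<integral>\<^sup>+y. p s x y * (\<integral>\<^sup>+\<omega>. G s \<omega> \<partial>Q (Some y)) \<partial>\<mu>) \<partial>lborel)"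
    by (rule occupation_formula[OF EG_meas])
  also have "\<dots> = (\<integral>\<^sup>+s\<in>{s. 0 < s \<and> ennreal s \<le> t}. (\<integral>\<^sup>+y. p s x y * expect X P y (F s) \<partial>\<mu>) \<partial>lborel)"
    unfolding EG by (intro nn_integral_cong) (auto simp: indicator_def)
  finally show ?thesis .
qed

end
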